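(* Let $\mathbb{F}=\mathbb{R}$ or $\mathbb{C}$. Suppose that $A_1$ (respectively $A_2$) is a positive (finite) dimensional simple unital $\mathbb{F}$-algebra and $\pi_{\mathcal{A}_1,V}:\mathcal{A}_1\to V$ (respectively $\pi_{\mathcal{A}_2,W}:\mathcal{A}_2\to W$) is a $C^\infty$ $\mathbb{F}$-algebra bundle with typical fiber $A_1$ (respectively $A_2$). Let $f$ be an $\mathbb{F}$-algebra isomorphism $\mathcal{F}_c(\pi_{\mathcal{A}_1,V})\to\mathcal{F}_c(\pi_{\mathcal{A}_2,W})$ (respectively $\mathcal{F}(\pi_{\mathcal{A}_1,V})\to\mathcal{F}(\pi_{\mathcal{A}_2,W})$). Then there exist a bi-$\mathcal{F}$ map $\phi:W\to V$ and an $\mathcal{F}$ isomorphism of algebra bundles $\gamma:\phi^*\mathcal{A}_1\to\mathcal{A}_2$ covering the identity map on $W$ such that $f(x)=\gamma\circ(\phi^*x)$ for each $x\in\mathcal{F}_c(\pi_{\mathcal{A}_1,V})$ (respectively for each $x\in\mathcal{F}(\pi_{\mathcal{A}_1,V})$).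
   Context: All manifolds are Hausdorff. $V$ and $W$ are finite dimensional $C^\infty$ manifolds, possibly with boundary, not necessarily paracompact or connected. All algebras are associative. Smoothness class: $\mathcal{F}$ is a fixed class among $C^k$, $k=0,1,\dots,\infty$ (in the Michal–Bastiani or the Fréchet sense), locally Hölder $C^{k,\alpha}$, $k=0,1,\dots$, $0\le\alpha\le1$ ($C^{k,0}=C^k$), or locally Sobolev $W^{k,p}$, $k=1,2,\dots$, $1\le p<\infty$, where for $n=\dim_{\mathbb{R}}V$ and for $n=\dim_{\mathbb{R}}W$ one has $kp>n$, or $k=n$ and $p=1$. A $C^\infty$ $\mathbb{F}$-algebra bundle $\pi_{\mathcal{A},V}:\mathcal{A}\to V$ with typical fiber $A$ is a $C^\infty$ vector bundle such that each fiber $\mathcal{A}_v$ carries an $\mathbb{F}$-algebra structure and each $v\in V$ has an open neighborhood $O$ with a diffeomorphism $O\times A\to\pi_{\mathcal{A},V}^{-1}(O)$ preserving the algebra structure fiberwise. $\mathcal{F}(\pi_{\mathcal{A},V})$ (resp. $\mathcal{F}_c(\pi_{\mathcal{A},V})$) is the algebra of $\mathcal{F}$ sections (resp. with compact support) under pointwise operations. A bijection $\phi:W\to V$ is a bi-$\mathcal{F}$ map if both $\phi$ and $\phi^{-1}$ are $\mathcal{F}$ maps. A real vector bundle over $W$ is an $\mathcal{F}$ bundle if its transition functions are $\mathcal{F}$ maps into the general linear group; if $\phi:W\to V$ is an $\mathcal{F}$ map then the pullback $\phi^*\mathcal{A}_1$ is such a bundle. An $\mathcal{F}$ isomorphism of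 algebra bundles covering the identity is a bundle map that is an algebra isomorphism on each fiber and is represented in local trivializations by $\mathcal{F}$ matrix valued maps. $\phi^*x$ is the pullback of the section $x$. *)

theory Defs
  imports "HOL-Analysis.Analysis" "HOL-Algebra.Ideal" "HOL-Algebra.Module" "HOL-Library.Extended_Nat"
begin

section \<open>Regularity classes\<close>

text \<open>
  Functions are considered on a set \<open>S\<close> that is relatively open in a Euclidean space or in a
  half-space, so derivatives at boundary points are derivatives within \<open>S\<close>.
  \<open>iter_diff P k S f\<close> says that \<open>f\<close> is \<open>k\<close> times Frechet differentiable on \<open>S\<close> and that all
  its \<open>k\<close>-th order derivatives satisfy \<open>P\<close>. Evaluating the derivative at each fixed vector
  avoids iterated spaces of linear maps; the domain being finite dimensional, continuity
  (or local Hoelder continuity) of all these evaluations is the same as that of the derivative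
  in operator norm.
\<close>

primrec iter_diff ::
  "('e::euclidean_space set \<Rightarrow> ('e \<Rightarrow> 'b::real_normed_vector) \<Rightarrow> bool) \<Rightarrow> nat \<Rightarrow>
   'e set \<Rightarrow> ('e \<Rightarrow> 'b) \<Rightarrow> bool" where
  "iter_diff P 0 S f \<longleftrightarrow> P S f"
| "iter_diff P (Suc k) S f \<longleftrightarrow>
     (\<exists>f'. (\<forall>x\<in>S. (f has_derivative f' x) (at x within S)) \<and>
           (\<forall>h. iter_diff P k S (\<lambda>x. f' x h)))"

definition Ck_Frechet :: "enat \<Rightarrow> 'e::euclidean_space set \<Rightarrow> ('e \<Rightarrow> 'b::real_normed_vector) \<Rightarrow> bool" where
  "Ck_Frechet k S f \<longleftrightarrow> (\<forall>j::nat. enat j \<le> k \<longrightarrow> iter_diff continuous_on j S f)"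

text \<open>
  Michal--Bastiani sense: the iterated directional derivatives
  \<open>d j x v = D\<^sub>v\<^sub>(\<^sub>j\<^sub>-\<^sub>1\<^sub>) \<dots> D\<^sub>v\<^sub>(\<^sub>0\<^sub>) f (x)\<close> exist in the interior of \<open>S\<close> and extend
  to jointly continuous functions of the point of \<open>S\<close> and the directions. Directions
  are given as a sequence \<open>v\<close>, of which \<open>d j\<close> uses only the first \<open>j\<close> entries.
\<close>

definition Ck_MB :: "enat \<Rightarrow> 'e::euclidean_space set \<Rightarrow> ('e \<Rightarrow> 'b::real_normed_vector) \<Rightarrow> bool" where
  "Ck_MB k S f \<longleftrightarrow>
     (\<exists>d :: nat \<Rightarrow> 'e \<Rightarrow> (nat \<Rightarrow> 'e) \<Rightarrow> 'b.
        (\<forall>x\<in>S. \<forall>v. d 0 x v = f x) \<and>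
        (\<forall>j. enat j \<le> k \<longrightarrow> continuous_on (S \<times> UNIV) (\<lambda>(x, v). d j x v)) \<and>
        (\<forall>j. enat (Suc j) \<le> k \<longrightarrow>
           (\<forall>x\<in>interior S. \<forall>v.
              ((\<lambda>t. d j (x + t *\<^sub>R v j) v) has_vector_derivative d (Suc j) x v) (at 0))))"

text \<open>
  For \<open>\<alpha> = 0\<close> the estimate is local boundedness, which continuity implies; so the class
  \<open>C\<^sup>k\<^sup>,\<^sup>0\<close> is \<open>C\<^sup>k\<close>.
\<close>

definition loc_holder :: "real \<Rightarrow> 'e::euclidean_space set \<Rightarrow> ('e \<Rightarrow> 'b::real_normed_vector) \<Rightarrow> bool" where
  "loc_holder \<alpha> S f \<longleftrightarrow> continuous_on S f \<and>
     (\<forall>x\<in>S. \<exists>e>0. \<exists>C. \<forall>y\<in>S \<inter> ball x e. \<forall>z\<in>S \<inter> ball x e.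
        norm (f y - f z) \<le> C * dist y z powr \<alpha>)"

definition test_function :: "'e::euclidean_space set \<Rightarrow> ('e \<Rightarrow> real) \<Rightarrow> bool" where
  "test_function \<Omega> \<psi> \<longleftrightarrow>
     Ck_Frechet \<infinity> UNIV \<psi> \<and> (\<exists>K. compact K \<and> K \<subseteq> \<Omega> \<and> (\<forall>x. x \<notin> K \<longrightarrow> \<psi> x = 0))"

definition iter_partial :: "'e::euclidean_space list \<Rightarrow> ('e \<Rightarrow> real) \<Rightarrow> 'e \<Rightarrow> real" where
  "iter_partial bs \<psi> = foldr (\<lambda>b h x. frechet_derivative h (at x) b) bs \<psi>"

definition weak_partial ::
  "'e::euclidean_space set \<Rightarrow> 'e list \<Rightarrow> ('e \<Rightarrow> 'b::euclidean_space) \<Rightarrow> ('e \<Rightarrow> 'b) \<Rightarrow> bool" where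
  "weak_partial \<Omega> bs u g \<longleftrightarrow>
     (\<forall>\<psi>. test_function \<Omega> \<psi> \<longrightarrow>
        (LINT x:\<Omega>|lborel. iter_partial bs \<psi> x *\<^sub>R u x) =
        (-1) ^ length bs *\<^sub>R (LINT x:\<Omega>|lborel. \<psi> x *\<^sub>R g x))"

definition in_Lp :: "real \<Rightarrow> 'e::euclidean_space set \<Rightarrow> ('e \<Rightarrow> 'b::euclidean_space) \<Rightarrow> bool" where
  "in_Lp p \<Omega> g \<longleftrightarrow>
     set_borel_measurable lborel \<Omega> g \<and> set_integrable lborel \<Omega> (\<lambda>x. norm (g x) powr p)"

text \<open>A multi-index of order at most \<open>k\<close> is a list of at most \<open>k\<close> coordinate directions.\<close>

definition in_sobolev :: "nat \<Rightarrow> real \<Rightarrow> 'e::euclidean_space set \<Rightarrow> ('e \<Rightarrow> 'b::euclidean_space) \<Rightarrow> bool" where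
  "in_sobolev k p \<Omega> u \<longleftrightarrow>
     (\<forall>bs. set bs \<subseteq> Basis \<and> length bs \<le> k \<longrightarrow> (\<exists>g. in_Lp p \<Omega> g \<and> weak_partial \<Omega> bs u g))"

text \<open>
  In the range of exponents considered, elements of \<open>W\<^sup>k\<^sup>,\<^sup>p\<close> have a (unique) continuous
  representative, up to the boundary; functions of this class are identified with it.
\<close>

definition loc_sobolev :: "nat \<Rightarrow> real \<Rightarrow> 'e::euclidean_space set \<Rightarrow> ('e \<Rightarrow> 'b::euclidean_space) \<Rightarrow> bool" where
  "loc_sobolev k p S u \<longleftrightarrow> continuous_on S u \<and>
     (\<forall>x\<in>S. \<exists>N. open N \<and> x \<in> N \<and> in_sobolev k p (N \<inter> interior S) u)"

datatype regularity =
    MB enat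
  | Frechet enat
  | Holder nat real
  | Sobolev nat real

fun in_class :: "regularity \<Rightarrow> 'e::euclidean_space set \<Rightarrow> ('e \<Rightarrow> 'b::euclidean_space) \<Rightarrow> bool" where
  "in_class (MB k) S f = Ck_MB k S f"
| "in_class (Frechet k) S f = Ck_Frechet k S f"
| "in_class (Holder k \<alpha>) S f = iter_diff (loc_holder \<alpha>) k S f"
| "in_class (Sobolev k p) S f = loc_sobolev k p S f"

fun admissible :: "regularity \<Rightarrow> nat \<Rightarrow> bool" where
  "admissible (MB k) n = True"
| "admissible (Frechet k) n = True"
| "admissible (Holder k \<alpha>) n = (0 \<le> \<alpha> \<and> \<alpha> \<le> 1)"
| "admissible (Sobolev k p) n =
     (1 \<le> k \<and> 1 \<le> p \<and> (real k * p > real n \<or> k = n \<and> p = 1))"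

abbreviation smooth :: regularity where
  "smooth \<equiv> Frechet \<infinity>"


section \<open>Manifolds with boundary\<close>

text \<open>
  The atlas is not required to be maximal. Euclidean types have positive dimension; to include
  manifolds of dimension \<open>0\<close> (discrete spaces), charts may take their values in the
  one-point subspace of the model type. So \<open>n\<close> is either \<open>0\<close> or the dimension of the
  model type, and every \<open>n\<close> occurs for a suitable type. All the classes above contain every
  function on \<open>{0}\<close>.
\<close>

record ('v, 'e) manifold =
  mtop :: "'v topology"
  charts :: "('v set \<times> ('v \<Rightarrow> 'e)) set"

definition local_models :: "nat \<Rightarrow> 'e::euclidean_space set set" where
  "local_models n =
     (if n = 0 then {{0}} else insert UNIV ((\<lambda>b. {x. 0 \<le> x \<bullet> b}) ` Basis))"

definition smooth_manifold :: "nat \<Rightarrow> ('v, 'e::euclidean_space) manifold \<Rightarrow> bool" where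
  "smooth_manifold n V \<longleftrightarrow>
     Hausdorff_space (mtop V) \<and>
     (n = 0 \<or> n = DIM('e)) \<and>
     (\<Union>(U, c)\<in>charts V. U) = topspace (mtop V) \<and>
     (\<forall>(U, c)\<in>charts V. openin (mtop V) U \<and>
        (\<exists>M\<in>local_models n. openin (top_of_set M) (c ` U)) \<and>
        homeomorphic_map (subtopology (mtop V) U) (top_of_set (c ` U)) c) \<and>
     (\<forall>(U, c)\<in>charts V. \<forall>(U', c')\<in>charts V.
        in_class smooth (c ` (U \<inter> U')) (\<lambda>y. c' (inv_into U c y)))"

definition class_fun ::
  "regularity \<Rightarrow> ('v, 'e::euclidean_space) manifold \<Rightarrow> 'v set \<Rightarrow> ('v \<Rightarrow> 'b::euclidean_space) \<Rightarrow> bool" where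
  "class_fun \<F> V S g \<longleftrightarrow>
     (\<forall>(U, c)\<in>charts V. in_class \<F> (c ` (U \<inter> S)) (\<lambda>y. g (inv_into U c y)))"

definition class_matrix ::
  "regularity \<Rightarrow> ('v, 'e::euclidean_space) manifold \<Rightarrow> 'v set \<Rightarrow>
   ('v \<Rightarrow> 'a::euclidean_space \<Rightarrow> 'b::euclidean_space) \<Rightarrow> bool" where
  "class_matrix \<F> V S L \<longleftrightarrow> (\<forall>i\<in>Basis. \<forall>j\<in>Basis. class_fun \<F> V S (\<lambda>v. L v i \<bullet> j))"

definition class_map ::
  "regularity \<Rightarrow> ('w, 'd::euclidean_space) manifold \<Rightarrow> ('v, 'e::euclidean_space) manifold \<Rightarrow>
   ('w \<Rightarrow> 'v) \<Rightarrow> bool" where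
  "class_map \<F> W V \<phi> \<longleftrightarrow>
     continuous_map (mtop W) (mtop V) \<phi> \<and>
     (\<forall>(U, c)\<in>charts V. class_fun \<F> W {w \<in> topspace (mtop W). \<phi> w \<in> U} (\<lambda>w. c (\<phi> w)))"

definition bi_class_map ::
  "regularity \<Rightarrow> ('w, 'd::euclidean_space) manifold \<Rightarrow> ('v, 'e::euclidean_space) manifold \<Rightarrow>
   ('w \<Rightarrow> 'v) \<Rightarrow> bool" where
  "bi_class_map \<F> W V \<phi> \<longleftrightarrow>
     bij_betw \<phi> (topspace (mtop W)) (topspace (mtop V)) \<and>
     class_map \<F> W V \<phi> \<and>
     class_map \<F> V W (inv_into (topspace (mtop W)) \<phi>)"


section \<open>Algebras\<close>

text \<open>
  The ground field is a set \<open>K\<close> of complex numbers, to be \<open>\<real>\<close> or all of \<open>\<complex>\<close>. Algebras over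
  it are records of the module type of HOL-Algebra; scalar multiplication by
  complex numbers outside \<open>K\<close> is irrelevant.
\<close>

definition scalar_ring :: "complex set \<Rightarrow> complex ring" where
  "scalar_ring K = \<lparr>carrier = K, mult = (*), one = 1, zero = 0, add = (+)\<rparr>"

definition unital_algebra :: "complex set \<Rightarrow> (complex, 'x) module \<Rightarrow> bool" where
  "unital_algebra K R \<longleftrightarrow>
     ring R \<and> Module.module (scalar_ring K) R \<and>
     (\<forall>c\<in>K. \<forall>x\<in>carrier R. \<forall>y\<in>carrier R.
        (c \<odot>\<^bsub>R\<^esub> x) \<otimes>\<^bsub>R\<^esub> y = c \<odot>\<^bsub>R\<^esub> (x \<otimes>\<^bsub>R\<^esub> y) \<and>
        x \<otimes>\<^bsub>R\<^esub> (c \<odot>\<^bsub>R\<^esub> y) = c \<odot>\<^bsub>R\<^esub> (x \<otimes>\<^bsub>R\<^esub> y))"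

definition simple_algebra :: "complex set \<Rightarrow> (complex, 'x) module \<Rightarrow> bool" where
  "simple_algebra K R \<longleftrightarrow>
     unital_algebra K R \<and> carrier R \<noteq> {\<zero>\<^bsub>R\<^esub>} \<and>
     (\<forall>I. ideal I R \<longrightarrow> I = {\<zero>\<^bsub>R\<^esub>} \<or> I = carrier R)"

text \<open>
  The underlying real vector space of a typical fiber is a Euclidean space (any real vector
  space of positive finite dimension is isomorphic to one); its norm only serves to
  express regularity of matrix valued functions.
\<close>

definition on_euclidean_space :: "(complex, 'a::euclidean_space) module \<Rightarrow> bool" where
  "on_euclidean_space A \<longleftrightarrow>
     carrier A = UNIV \<and> \<zero>\<^bsub>A\<^esub> = 0 \<and> (\<forall>x y. x \<oplus>\<^bsub>A\<^esub> y = x + y) \<and>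
     (\<forall>r x. complex_of_real r \<odot>\<^bsub>A\<^esub> x = r *\<^sub>R x)"

text \<open>Units are not mentioned, because algebras of compactly supported sections may lack them.\<close>

definition algebra_iso ::
  "complex set \<Rightarrow> (complex, 'x) module \<Rightarrow> (complex, 'y) module \<Rightarrow> ('x \<Rightarrow> 'y) \<Rightarrow> bool" where
  "algebra_iso K R R' h \<longleftrightarrow>
     bij_betw h (carrier R) (carrier R') \<and>
     (\<forall>x\<in>carrier R. \<forall>y\<in>carrier R.
        h (x \<oplus>\<^bsub>R\<^esub> y) = h x \<oplus>\<^bsub>R'\<^esub> h y \<and> h (x \<otimes>\<^bsub>R\<^esub> y) = h x \<otimes>\<^bsub>R'\<^esub> h y) \<and>
     (\<forall>c\<in>K. \<forall>x\<in>carrier R. h (c \<odot>\<^bsub>R\<^esub> x) = c \<odot>\<^bsub>R'\<^esub> h x)"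


section \<open>Algebra bundles\<close>

text \<open>
  The topology and differentiable structure of the total space are those given by a vector
  bundle atlas: a set of local trivializations \<open>(O, \<tau>)\<close>, where \<open>(v, a) \<mapsto> \<tau> v a\<close> is a
  fiberwise linear bijection from \<open>O \<times> A\<close> to the part of the total space over \<open>O\<close>, with
  transition functions of the given class into the general linear group of the Euclidean
  space \<open>'a\<close> underlying \<open>A\<close>.
\<close>

record ('v, 'x, 'a) fibre_bundle =
  total :: "'x set"
  proj :: "'x \<Rightarrow> 'v"
  fibre :: "'v \<Rightarrow> (complex, 'x) module"
  trivs :: "('v set \<times> ('v \<Rightarrow> 'a \<Rightarrow> 'x)) set"

definition linear_iso :: "(complex, 'x) module \<Rightarrow> ('a::euclidean_space \<Rightarrow> 'x) \<Rightarrow> bool" where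
  "linear_iso R h \<longleftrightarrow>
     bij_betw h UNIV (carrier R) \<and>
     (\<forall>a b. h (a + b) = h a \<oplus>\<^bsub>R\<^esub> h b) \<and>
     (\<forall>r a. h (r *\<^sub>R a) = complex_of_real r \<odot>\<^bsub>R\<^esub> h a)"

definition vector_bundle ::
  "regularity \<Rightarrow> ('v, 'e::euclidean_space) manifold \<Rightarrow> ('v, 'x, 'a::euclidean_space) fibre_bundle \<Rightarrow> bool" where
  "vector_bundle \<F> V B \<longleftrightarrow>
     proj B ` total B \<subseteq> topspace (mtop V) \<and>
     (\<forall>v\<in>topspace (mtop V). carrier (fibre B v) = {e \<in> total B. proj B e = v}) \<and>
     (\<Union>(O', \<tau>)\<in>trivs B. O') = topspace (mtop V) \<and>
     (\<forall>(O', \<tau>)\<in>trivs B. openin (mtop V) O' \<and> (\<forall>v\<in>O'. linear_iso (fibre B v) (\<tau> v))) \<and>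
     (\<forall>(O', \<tau>)\<in>trivs B. \<forall>(O'', \<sigma>)\<in>trivs B.
        class_matrix \<F> V (O' \<inter> O'') (\<lambda>v. inv_into UNIV (\<sigma> v) \<circ> \<tau> v))"

text \<open>
  A fiberwise linear bijection \<open>\<tau>\<close> from \<open>O \<times> A\<close> to the part of the total space over \<open>O\<close> is
  a diffeomorphism if and only if it can be added to the vector bundle atlas.
\<close>

definition algebra_bundle ::
  "complex set \<Rightarrow> ('v, 'e::euclidean_space) manifold \<Rightarrow> (complex, 'a::euclidean_space) module \<Rightarrow>
   ('v, 'x, 'a) fibre_bundle \<Rightarrow> bool" where
  "algebra_bundle K V A B \<longleftrightarrow>
     vector_bundle smooth V B \<and>
     (\<forall>v\<in>topspace (mtop V). unital_algebra K (fibre B v)) \<and>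
     (\<forall>v\<in>topspace (mtop V). \<exists>O' \<tau>. openin (mtop V) O' \<and> v \<in> O' \<and>
        vector_bundle smooth V (B\<lparr>trivs := insert (O', \<tau>) (trivs B)\<rparr>) \<and>
        (\<forall>u\<in>O'. algebra_iso K A (fibre B u) (\<tau> u)))"

text \<open>Sections are \<open>undefined\<close> off the base, so that equal sections are equal as functions.\<close>

definition sections ::
  "regularity \<Rightarrow> ('v, 'e::euclidean_space) manifold \<Rightarrow> ('v, 'x, 'a::euclidean_space) fibre_bundle \<Rightarrow>
   ('v \<Rightarrow> 'x) set" where
  "sections \<F> V B =
     {s \<in> extensional (topspace (mtop V)).
        (\<forall>v\<in>topspace (mtop V). s v \<in> total B \<and> proj B (s v) = v) \<and>
        (\<forall>(O', \<tau>)\<in>trivs B. class_fun \<F> V O' (\<lambda>v. inv_into UNIV (\<tau> v) (s v)))}"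

definition sections_c ::
  "regularity \<Rightarrow> ('v, 'e::euclidean_space) manifold \<Rightarrow> ('v, 'x, 'a::euclidean_space) fibre_bundle \<Rightarrow>
   ('v \<Rightarrow> 'x) set" where
  "sections_c \<F> V B =
     {s \<in> sections \<F> V B.
        compactin (mtop V)
          (mtop V closure_of {v \<in> topspace (mtop V). s v \<noteq> \<zero>\<^bsub>fibre B v\<^esub>})}"

definition pointwise_algebra ::
  "('v, 'e) manifold \<Rightarrow> ('v, 'x, 'a) fibre_bundle \<Rightarrow> ('v \<Rightarrow> 'x) set \<Rightarrow> (complex, 'v \<Rightarrow> 'x) module" where
  "pointwise_algebra V B S =
     \<lparr>carrier = S,
      mult = (\<lambda>s t. \<lambda>v\<in>topspace (mtop V). s v \<otimes>\<^bsub>fibre B v\<^esub> t v),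
      one = (\<lambda>v\<in>topspace (mtop V). \<one>\<^bsub>fibre B v\<^esub>),
      zero = (\<lambda>v\<in>topspace (mtop V). \<zero>\<^bsub>fibre B v\<^esub>),
      add = (\<lambda>s t. \<lambda>v\<in>topspace (mtop V). s v \<oplus>\<^bsub>fibre B v\<^esub> t v),
      smult = (\<lambda>c s. \<lambda>v\<in>topspace (mtop V). c \<odot>\<^bsub>fibre B v\<^esub> s v)\<rparr>"

definition section_algebra ::
  "regularity \<Rightarrow> ('v, 'e::euclidean_space) manifold \<Rightarrow> ('v, 'x, 'a::euclidean_space) fibre_bundle \<Rightarrow>
   (complex, 'v \<Rightarrow> 'x) module" where
  "section_algebra \<F> V B = pointwise_algebra V B (sections \<F> V B)"

definition section_algebra_c ::
  "regularity \<Rightarrow> ('v, 'e::euclidean_space) manifold \<Rightarrow> ('v, 'x, 'a::euclidean_space) fibre_bundle \<Rightarrow>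
   (complex, 'v \<Rightarrow> 'x) module" where
  "section_algebra_c \<F> V B = pointwise_algebra V B (sections_c \<F> V B)"

definition pullback_fibre :: "'w \<Rightarrow> (complex, 'x) module \<Rightarrow> (complex, 'w \<times> 'x) module" where
  "pullback_fibre w R =
     \<lparr>carrier = {w} \<times> carrier R,
      mult = (\<lambda>p q. (w, snd p \<otimes>\<^bsub>R\<^esub> snd q)),
      one = (w, \<one>\<^bsub>R\<^esub>),
      zero = (w, \<zero>\<^bsub>R\<^esub>),
      add = (\<lambda>p q. (w, snd p \<oplus>\<^bsub>R\<^esub> snd q)),
      smult = (\<lambda>c p. (w, c \<odot>\<^bsub>R\<^esub> snd p))\<rparr>"

definition pullback_bundle ::
  "('w, 'd) manifold \<Rightarrow> ('w \<Rightarrow> 'v) \<Rightarrow> ('v, 'x, 'a) fibre_bundle \<Rightarrow> ('w, 'w \<times> 'x, 'a) fibre_bundle" where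
  "pullback_bundle W \<phi> B =
     \<lparr>total = {(w, e). w \<in> topspace (mtop W) \<and> e \<in> total B \<and> proj B e = \<phi> w},
      proj = fst,
      fibre = (\<lambda>w. pullback_fibre w (fibre B (\<phi> w))),
      trivs = (\<lambda>(O', \<tau>). ({w \<in> topspace (mtop W). \<phi> w \<in> O'}, \<lambda>w a. (w, \<tau> (\<phi> w) a))) ` trivs B\<rparr>"

definition pullback_section ::
  "('w, 'd) manifold \<Rightarrow> ('w \<Rightarrow> 'v) \<Rightarrow> ('v \<Rightarrow> 'x) \<Rightarrow> 'w \<Rightarrow> 'w \<times> 'x" where
  "pullback_section W \<phi> s = (\<lambda>w\<in>topspace (mtop W). (w, s (\<phi> w)))"

text \<open>
  Isomorphisms of algebra bundles over the same base, covering the identity. Bijectivity of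
  \<open>\<gamma>\<close> on total spaces follows from bijectivity on fibers.
\<close>

definition algebra_bundle_iso ::
  "regularity \<Rightarrow> complex set \<Rightarrow> ('w, 'd::euclidean_space) manifold \<Rightarrow>
   ('w, 'x, 'a::euclidean_space) fibre_bundle \<Rightarrow> ('w, 'y, 'b::euclidean_space) fibre_bundle \<Rightarrow>
   ('x \<Rightarrow> 'y) \<Rightarrow> bool" where
  "algebra_bundle_iso \<F> K W B B' \<gamma> \<longleftrightarrow>
     (\<forall>w\<in>topspace (mtop W). algebra_iso K (fibre B w) (fibre B' w) \<gamma>) \<and>
     (\<forall>(O', \<tau>)\<in>trivs B. \<forall>(O'', \<sigma>)\<in>trivs B'.
        class_matrix \<F> W (O' \<inter> O'') (\<lambda>w. inv_into UNIV (\<sigma> w) \<circ> \<gamma> \<circ> \<tau> w))"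

end

(*
Every point w of W has a point phi(w) of V such that f(y)(w) = 0 whenever the section y vanishes near
phi(w): otherwise pull back sections supported in shrinking neighbourhoods of w and use the compactness of
supports or, without compact supports, a function growing along a locally finite sequence of bumps. A scalar
function h acts on the fibre at w by a central element Xi(h), which depends linearly on h. If h(phi(w)) = 0 but
Xi(h) is nonzero, hence a nonzerodivisor, then by finite dimension some k with k(phi(w)) = 0 acts as 1, although
1 - k is invertible near phi(w). So f(y)(w) depends only on y(phi(w)).

For Sobolev classes only smooth functions are known to multiply sections, so f could a priori see more of y
than y(phi(w)). It would then do so at all points near w, and a gliding hump along a sequence phi(w_j)
produces a Sobolev section whose image is unbounded.

Simplicity of the fibres makes y(phi(w)) -> f(y)(w) injective. Hence products are preserved backwards as well,
the same construction applies to the inverse of f, and it yields the inverse of phi.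
*)
theory Submission
 imports Defs
begin

text \<open>The scalar k that acts as 1 is refuted by p = e / (1 - k) for a bump e at phi(w): the
  identity p = e + p k becomes c = 1 + c in the fibre. This works even if nonzero constants lack
  compact support.

  The gliding hump gives z = h u - s with h and s smooth off one point v, z continuous, z(v) = 0 and
  h(phi(w_j)) = j. Let delta = f(u i) - u(phi) f(e i) be what point evaluation misses in f(u i).
  Then f(z i) = h(phi) delta + z(phi) f(e i), which is unbounded unless delta tends to 0. The costly
  point is that z must be Sobolev near v in every chart: mollifiers, approximation in L^p, measure
  bounds for Lipschitz images and the weak chain rule serve this. Staying over interior points of
  charts keeps the boundary out of it.

  The remaining classes are intersections of C^{k,alpha} conditions and share one treatment. Closure
  of Sobolev sections under products is not established, so f is assumed multiplicative only where
  the product is a section; density of the image of phi carries this over to the inverse of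
  f.\<close>

section \<open>Locally Hoelder functions\<close>

text \<open>Makes C^k the exponent 0 case of the Hoelder classes, so that closure properties are
  proved once for both.\<close>

lemma loc_holder_zero: "loc_holder 0 = continuous_on"
proof (intro ext iffI)
 fix S :: "'e::euclidean_space set" and f :: "'e => 'b::real_normed_vector"
 assume f: "continuous_on S f"
 show "loc_holder 0 S f" unfolding loc_holder_def
 proof (intro conjI ballI f)
  fix x assume x: "x \<in> S"
  from f x obtain e where e: "e > 0" "!!y. y \<in> S ==> dist y x < e ==> dist (f y) (f x) < 1"
   unfolding continuous_on_iff by (metis zero_less_one)
  \<comment> \<open>In HOL \<open>0 powr 0 = 0\<close>, so y = z is a case of its own; otherwise the
    right side is 2.\<close>
  have "norm (f y - f z) <= 2 * dist y z powr 0" if "y \<in> S \<inter> ball x e" "z \<in> S \<inter> ball x e" for y z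
  proof (cases "y = z")
   case False
   have "dist (f y) (f z) <= dist (f y) (f x) + dist (f z) (f x)" by (rule dist_triangle2)
   also have "\<dots> <= 2" using e(2)[of y] e(2)[of z] that by (simp add: dist_commute)
   finally show ?thesis using False by (simp add: dist_norm)
  qed simp
  thus "\<exists>e>0. \<exists>C. \<forall>y\<in>S \<inter> ball x e. \<forall>z\<in>S \<inter> ball x e. norm (f y - f z) <= C * dist y z powr 0"
   using e(1) by blast
 qed
qed (simp add: loc_holder_def)

lemma loc_holder_continuous: "loc_holder \<alpha> S f ==> continuous_on S f"
 by (simp add: loc_holder_def)

text \<open>The same constant bounds increments and values, since the estimate for products needs
  both.\<close>

lemma loc_holderE:
 assumes "loc_holder \<alpha> S f" "x \<in> S"
 obtains e C where "e > 0" "C >= 0"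
  "!!y z. y \<in> S ==> z \<in> S ==> dist x y < e ==> dist x z < e ==> norm (f y - f z) <= C * dist y z powr \<alpha>"
  "!!y. y \<in> S ==> dist x y < e ==> norm (f y) <= C"
proof -
 from assms obtain e C where e: "e > 0"
  and C: "!!y z. y \<in> S \<inter> ball x e ==> z \<in> S \<inter> ball x e ==> norm (f y - f z) <= C * dist y z powr \<alpha>"
  unfolding loc_holder_def by blast
 from assms have "continuous_on S f" by (simp add: loc_holder_def)
 with assms(2) obtain d where d: "d > 0" "!!y. y \<in> S ==> dist y x < d ==> dist (f y) (f x) < 1"
  unfolding continuous_on_iff by (metis zero_less_one)
 define D where "D = \<bar>C\<bar> + norm (f x) + 1"
 have D: "C <= D" "0 <= D" "norm (f x) + 1 <= D"
  using abs_ge_self[of C] norm_ge_zero[of "f x"] unfolding D_def by linarith+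
 show ?thesis
 proof (rule that[of "min e d" D])
  fix y z assume yz: "y \<in> S" "z \<in> S" "dist x y < min e d" "dist x z < min e d"
  have "norm (f y - f z) <= C * dist y z powr \<alpha>" using yz by (intro C) auto
  also have "\<dots> <= D * dist y z powr \<alpha>" using D by (intro mult_right_mono) simp_all
  finally show "norm (f y - f z) <= D * dist y z powr \<alpha>" .
 next
  fix y assume y: "y \<in> S" "dist x y < min e d"
  have "norm (f y) <= norm (f x) + dist (f y) (f x)"
   by (metis dist_norm norm_triangle_sub)
  with d(2)[of y] y D show "norm (f y) <= D" by (simp add: dist_commute)
 qed (use e d D in auto)
qed

lemma loc_holderI:
 assumes "continuous_on S f"
  and "!!x. x \<in> S ==> \<exists>e>0. \<exists>C. \<forall>y\<in>S. \<forall>z\<in>S. dist x y < e --> dist x z < e --> norm (f y - f z) <= C * dist y z powr \<alpha>"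
 shows "loc_holder \<alpha> S f"
 unfolding loc_holder_def
proof (intro conjI assms(1) ballI)
 fix x assume "x \<in> S"
 from assms(2)[OF this] obtain e C where "e > 0" "\<forall>y\<in>S. \<forall>z\<in>S. dist x y < e --> dist x z < e --> norm (f y - f z) <= C * dist y z powr \<alpha>"
  by blast
 thus "\<exists>e>0. \<exists>C. \<forall>y\<in>S \<inter> ball x e. \<forall>z\<in>S \<inter> ball x e. norm (f y - f z) <= C * dist y z powr \<alpha>"
  by (intro exI[of _ e] conjI exI[of _ C] ballI) auto
qed

abbreviation dominated_near where
 "dominated_near S x u f g \<equiv> \<exists>e>0. \<exists>K\<ge>0. \<forall>y\<in>S. \<forall>z\<in>S. dist x y < e --> dist x z < e -->
   norm (u y - u z) <= K * (norm (f y - f z) + norm (g y - g z))"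

text \<open>Sums, products, linear images, reciprocals and restrictions all reduce to this
  criterion; they differ only in the local bound on increments.\<close>

lemma loc_holder_dominated:
 assumes f: "loc_holder \<alpha> S f" and g: "loc_holder \<alpha> S g" and T: "T \<subseteq> S" and u: "continuous_on T u"
  and le: "!!x. x \<in> T ==> dominated_near T x u f g"
 shows "loc_holder \<alpha> T u"
proof (rule loc_holderI[OF u])
 fix x assume x: "x \<in> T"
 with T have xS: "x \<in> S" by blast
 from loc_holderE[OF f xS] obtain d C where d: "d > 0" and
  C: "!!y z. y \<in> S ==> z \<in> S ==> dist x y < d ==> dist x z < d ==> norm (f y - f z) <= C * dist y z powr \<alpha>" by metis
 from loc_holderE[OF g xS] obtain d' D where d': "d' > 0" and
  D: "!!y z. y \<in> S ==> z \<in> S ==> dist x y < d' ==> dist x z < d' ==> norm (g y - g z) <= D * dist y z powr \<alpha>" by metis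
 from le[OF x] obtain e K where e: "e > 0" and K: "K >= 0" "!!y z. y \<in> T ==> z \<in> T ==> dist x y < e ==> dist x z < e ==>
   norm (u y - u z) <= K * (norm (f y - f z) + norm (g y - g z))" by metis
 have "norm (u y - u z) <= (K * (C + D)) * dist y z powr \<alpha>"
  if "y \<in> T" "z \<in> T" "dist x y < min e (min d d')" "dist x z < min e (min d d')" for y z
 proof -
  have "norm (u y - u z) <= K * (norm (f y - f z) + norm (g y - g z))" using that by (intro K(2)) auto
  also have "\<dots> <= K * (C * dist y z powr \<alpha> + D * dist y z powr \<alpha>)"
   using that T by (intro mult_left_mono add_mono C D K(1)) auto
  finally show ?thesis by (simp add: algebra_simps)
 qed
 thus "\<exists>e>0. \<exists>C. \<forall>y\<in>T. \<forall>z\<in>T. dist x y < e --> dist x z < e --> norm (u y - u z) <= C * dist y z powr \<alpha>"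
  using e d d' by (intro exI[of _ "min e (min d d')"] conjI exI[of _ "K * (C + D)"]) auto
qed

lemma loc_holder_subset: "loc_holder \<alpha> S f ==> T \<subseteq> S ==> loc_holder \<alpha> T f"
 by (rule loc_holder_dominated[of \<alpha> S f f])
  (auto intro!: exI[of _ "1::real"] intro: continuous_on_subset dest: loc_holder_continuous)

lemma loc_holder_cong:
 assumes "!!x. x \<in> S ==> f x = g x"
 shows "loc_holder \<alpha> S f \<longleftrightarrow> loc_holder \<alpha> S g"
 using assms continuous_on_cong[OF refl assms] unfolding loc_holder_def by auto

lemma loc_holder_glue:
 assumes "!!x. x \<in> S ==> \<exists>N. open N & x \<in> N & loc_holder \<alpha> (S \<inter> N) f"
 shows "loc_holder \<alpha> S f"
proof (rule loc_holderI)
 show "continuous_on S f"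
  unfolding continuous_on_eq_continuous_within
 proof
  fix x assume x: "x \<in> S"
  with assms obtain N where N: "open N" "x \<in> N" "loc_holder \<alpha> (S \<inter> N) f" by blast
  hence "continuous (at x within S \<inter> N) f"
   using x by (auto simp: continuous_on_eq_continuous_within dest: loc_holder_continuous)
  thus "continuous (at x within S) f"
   using N at_within_nhd[of x N S "S \<inter> N"] by auto
 qed
 fix x assume x: "x \<in> S"
 with assms obtain N where N: "open N" "x \<in> N" "loc_holder \<alpha> (S \<inter> N) f" by blast
 then obtain d where d: "d > 0" "ball x d \<subseteq> N" by (meson openE)
 from x N have "x \<in> S \<inter> N" by blast
 from loc_holderE[OF N(3) this] obtain e C where e: "e > 0" and 
  C: "!!y z. y \<in> S \<inter> N ==> z \<in> S \<inter> N ==> dist x y < e ==> dist x z < e ==> norm (f y - f z) <= C * dist y z powr \<alpha>"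
  by metis
 show "\<exists>e>0. \<exists>C. \<forall>y\<in>S. \<forall>z\<in>S. dist x y < e --> dist x z < e --> norm (f y - f z) <= C * dist y z powr \<alpha>"
  by (rule exI[of _ "min e d"], intro conjI exI[of _ C] ballI impI C)
    (use e d in \<open>auto simp: subset_iff\<close>)
qed

lemma loc_holder_add:
 assumes "loc_holder \<alpha> S f" "loc_holder \<alpha> S g"
 shows "loc_holder \<alpha> S (%x. f x + g x)"
proof (rule loc_holder_dominated[OF assms order_refl])
 show "continuous_on S (%x. f x + g x)" using assms by (intro continuous_intros loc_holder_continuous)
 have "norm ((f y + g y) - (f z + g z)) <= 1 * (norm (f y - f z) + norm (g y - g z))" for y z
  by (metis add_diff_add norm_triangle_ineq mult_1)
 thus "dominated_near S x (%x. f x + g x) f g" for x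
  using zero_less_one zero_le_one by blast
qed

lemma loc_holder_linear:
 assumes "loc_holder \<alpha> S f" "bounded_linear L"
 shows "loc_holder \<alpha> S (%x. L (f x))"
proof (rule loc_holder_dominated[OF assms(1,1) order_refl])
 interpret L: bounded_linear L by fact
 show "continuous_on S (%x. L (f x))" using assms by (intro L.continuous_on loc_holder_continuous)
 obtain B where B: "B >= 0" "!!x. norm (L x) <= norm x * B" using L.nonneg_bounded by blast
 have "norm (L (f y) - L (f z)) <= B * (norm (f y - f z) + norm (f y - f z))" for y z
  using B(2)[of "f y - f z"] mult_nonneg_nonneg[OF B(1) norm_ge_zero, of "f y - f z"] by (simp only: L.diff distrib_left mult.commute)
 thus "dominated_near S x (%x. L (f x)) f f" for x
  using zero_less_one B(1) by blast
qed

lemma loc_holder_mult: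
 fixes h :: "'e::euclidean_space => real"
 assumes "loc_holder \<alpha> S h" "loc_holder \<alpha> S f"
 shows "loc_holder \<alpha> S (%x. h x *\<^sub>R f x)"
proof (rule loc_holder_dominated[OF assms order_refl])
 show "continuous_on S (%x. h x *\<^sub>R f x)" using assms by (intro continuous_intros loc_holder_continuous)
 fix x assume x: "x \<in> S"
 from loc_holderE[OF assms(1) x] obtain e C where e: "e > 0" "C >= 0" "!!y. y \<in> S ==> dist x y < e ==> norm (h y) <= C" by metis
 from loc_holderE[OF assms(2) x] obtain d D where d: "d > 0" "D >= 0" "!!y. y \<in> S ==> dist x y < d ==> norm (f y) <= D" by metis
 have "norm (h y *\<^sub>R f y - h z *\<^sub>R f z) <= (C + D) * (norm (h y - h z) + norm (f y - f z))"
  if "y \<in> S" "z \<in> S" "dist x y < min e d" "dist x z < min e d" for y z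
 proof -
  have "h y *\<^sub>R f y - h z *\<^sub>R f z = h y *\<^sub>R (f y - f z) + (h y - h z) *\<^sub>R f z" by (simp add: algebra_simps)
  hence "norm (h y *\<^sub>R f y - h z *\<^sub>R f z) <= norm (h y) * norm (f y - f z) + norm (h y - h z) * norm (f z)"
   by (metis norm_scaleR norm_triangle_ineq real_norm_def)
  also have "\<dots> <= (C + D) * norm (f y - f z) + norm (h y - h z) * (C + D)"
   using that e(2) e(3)[of y] d(2) d(3)[of z] by (intro add_mono mult_mono) (auto intro: add_increasing add_increasing2)
  finally show ?thesis by (simp add: algebra_simps)
 qed
 thus "dominated_near S x (%x. h x *\<^sub>R f x) h f"
  using e d by (intro exI[of _ "min e d"] conjI exI[of _ "C + D"]) auto
qed

lemma loc_holder_inverse: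
 fixes h :: "'e::euclidean_space => real"
 assumes "loc_holder \<alpha> S h" and nz: "!!x. x \<in> S ==> h x ~= 0"
 shows "loc_holder \<alpha> S (%x. inverse (h x))"
proof (rule loc_holder_dominated[OF assms(1,1) order_refl])
 show cont: "continuous_on S (%x. inverse (h x))" using assms
  by (intro continuous_intros loc_holder_continuous) auto
 fix x assume x: "x \<in> S"
 \<comment> \<open>Continuity read as exponent 0 supplies the local bound on 1/h.\<close>
 have "loc_holder 0 S (%x. inverse (h x))" using cont by (simp add: loc_holder_zero)
 from loc_holderE[OF this x] obtain d D where d: "d > 0" "D >= 0" "!!y. y \<in> S ==> dist x y < d ==> norm (inverse (h y)) <= D"
  by metis
 have "norm (inverse (h y) - inverse (h z)) <= (D * D) * (norm (h y - h z) + norm (h y - h z))"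
  if "y \<in> S" "z \<in> S" "dist x y < d" "dist x z < d" for y z
 proof -
  have "norm (inverse (h y) - inverse (h z)) = (norm (inverse (h y)) * norm (inverse (h z))) * norm (h y - h z)"
   using nz that by (simp add: inverse_diff_inverse abs_mult mult.commute)
  also have "\<dots> <= (D * D) * (norm (h y - h z) + norm (h y - h z))"
   using that d by (intro mult_mono d(3)) auto
  finally show ?thesis .
 qed
 thus "dominated_near S x (%x. inverse (h x)) h h"
  using d by (intro exI[of _ d] conjI exI[of _ "D * D"]) auto
qed

lemma loc_holder_const: "0 <= \<alpha> ==> loc_holder \<alpha> S (%x. c)"
 by (rule loc_holderI) (simp, rule exI[of _ "1::real"], simp, rule exI[of _ "0::real"], simp)

section \<open>Relatively open subsets of half-spaces\<close>

text \<open>In positive dimension the images of charts are of this kind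
  (\<open>model_open_cases\<close>).\<close>

definition half_open :: "'e::euclidean_space set => bool" where
 "half_open S \<longleftrightarrow> (\<exists>M\<in>insert UNIV ((%b. {x. 0 <= x \<bullet> b}) ` Basis). openin (top_of_set M) S)"

lemma half_openE:
 assumes "half_open S" "x \<in> S"
 obtains r M where "r > 0" "convex M" "closed M" "M \<inter> ball x r \<subseteq> S" "S \<subseteq> M"
  "!!i d. i \<in> Basis ==> d >= 0 ==> x + d *\<^sub>R i \<in> M"
  "M = UNIV \<or> (\<exists>b\<in>Basis. M = {x. 0 <= x \<bullet> b})"
proof -
 from assms(1) obtain M where M: "M = UNIV \<or> (\<exists>b\<in>Basis. M = {x. 0 <= x \<bullet> b})" "openin (top_of_set M) S"
  unfolding half_open_def by blast
 from M(2) assms(2) obtain r where r: "r > 0" "ball x r \<inter> M \<subseteq> S" and SM: "S \<subseteq> M"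
  by (meson openin_contains_ball)
 show ?thesis
 proof (rule that[of r M])
  show "convex M" using M(1) convex_halfspace_ge[of 0] by (auto simp: inner_commute)
  show "closed M" using M(1) closed_halfspace_ge[of 0] by (auto simp: inner_commute)
  show "x + d *\<^sub>R i \<in> M" if "i \<in> Basis" "d >= 0" for i d
   using M(1) SM assms(2) that by (auto simp: inner_add_left inner_Basis)
 qed (use r SM M in auto)
qed

lemma half_open_openin: "half_open S ==> openin (top_of_set S) T ==> half_open T"
 unfolding half_open_def by (meson openin_trans)

lemma half_open_Int: "half_open S ==> open N ==> half_open (S \<inter> N)"
 by (metis half_open_openin openin_open_Int)

lemma open_half_open: "open S ==> half_open S"
 unfolding half_open_def by auto

text \<open>Even at a boundary point the nonnegative multiples of all basis vectors stay in the
  half-space, and these determine the derivative within S.\<close>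

lemma half_open_derivative_unique:
 fixes f :: "'e::euclidean_space => 'b::real_normed_vector"
 assumes "half_open S" "x \<in> S" "(f has_derivative f') (at x within S)" "(f has_derivative f'') (at x within S)"
 shows "f' = f''"
proof (rule frechet_derivative_unique_within[OF assms(3,4)])
 fix i :: 'e and e :: real assume ie: "i \<in> Basis" "0 < e"
 from half_openE[OF assms(1,2)] obtain r M where r: "r > 0" "M \<inter> ball x r \<subseteq> S"
  "!!d. d >= 0 ==> x + d *\<^sub>R i \<in> M" using ie by metis
 define d where "d = min e r / 2"
 have "d > 0" "d < e" "d < r" using r ie by (auto simp: d_def)
 moreover have "x + d *\<^sub>R i \<in> S" using r \<open>d > 0\<close> \<open>d < r\<close> ie by (auto simp: dist_norm subset_iff)
 ultimately show "\<exists>d. 0 < \<bar>d\<bar> & \<bar>d\<bar> < e & x + d *\<^sub>R i \<in> S" by (intro exI[of _ d]) auto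
qed

text \<open>A small step along the inner normal b leads from the boundary into the interior.\<close>

lemma half_open_interior_near:
 assumes "half_open S" "x \<in> S" "r > 0"
 shows "\<exists>y\<in>interior S. dist x y < r"
proof -
 from half_openE[OF assms(1,2)] obtain r' M where r': "r' > 0" "M \<inter> ball x r' \<subseteq> S" "S \<subseteq> M"
  "M = UNIV \<or> (\<exists>b\<in>Basis. M = {x. 0 <= x \<bullet> b})" by metis
 show ?thesis
 proof (cases "M = UNIV")
  case True
  with r' have "x \<in> interior S" by (meson Int_iff UNIV_I centre_in_ball interiorI open_ball subset_iff)
  with assms show ?thesis by (intro bexI[of _ x]) auto
 next
  case False
  with r' obtain b where b: "b \<in> Basis" "M = {x. 0 <= x \<bullet> b}" by blast
  define d where "d = min r r' / 2"
  have d: "d > 0" "d < r" "d < r'" using r' assms by (auto simp: d_def)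
  let ?T = "{x. 0 < x \<bullet> b} \<inter> ball x r'"
  have T: "open ?T" "?T \<subseteq> S" using r' b open_halfspace_gt[of 0 b] by (auto simp: inner_commute)
  have "0 <= x \<bullet> b" using assms r' b by auto
  hence "x + d *\<^sub>R b \<in> ?T" using d b by (auto simp: inner_add_left dist_norm)
  hence "x + d *\<^sub>R b \<in> interior S" using T by (meson interiorI)
  thus ?thesis using d b by (intro bexI[of _ "x + d *\<^sub>R b"]) (auto simp: dist_norm)
 qed
qed

subsection \<open>Iterated differentiability\<close>

abbreviation Hd where "Hd \<alpha> \<equiv> iter_diff (loc_holder \<alpha>)"

lemma iter_diff_cong:
 assumes "!!f g. (!!x. x \<in> S ==> f x = g x) ==> P S f ==> P S g"
  and "!!x. x \<in> S ==> f x = g x" "iter_diff P k S f"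
 shows "iter_diff P k S g"
 using assms(2,3)
proof (induction k arbitrary: f g)
 case (Suc k)
 from Suc.prems(2) obtain f' where f': "\<forall>x\<in>S. (f has_derivative f' x) (at x within S)" "\<forall>h. iter_diff P k S (%x. f' x h)"
  by auto
 have "\<forall>x\<in>S. (g has_derivative f' x) (at x within S)"
  using f'(1) Suc.prems(1) by (metis has_derivative_transform)
 with f'(2) show ?case by auto
qed (use assms(1) in auto)

lemma H_cong:
 assumes "!!x. x \<in> S ==> f x = g x"
 shows "Hd \<alpha> k S f \<longleftrightarrow> Hd \<alpha> k S g"
proof -
 have *: "Hd \<alpha> k S v" if "!!x. x \<in> S ==> u x = v x" "Hd \<alpha> k S u"
  for u v :: "'a => 'b"
  by (rule iter_diff_cong[OF _ that(1) that(2)]) (use loc_holder_cong in \<open>blast dest: iffD1\<close>)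
 show ?thesis using *[of f g] *[of g f] assms by (intro iffI) simp_all
qed

lemma H_subset: "Hd \<alpha> k S f ==> T \<subseteq> S ==> Hd \<alpha> k T f"
proof (induction k arbitrary: f)
 case (Suc k)
 then obtain f' where "\<forall>x\<in>S. (f has_derivative f' x) (at x within S)" "\<forall>h. Hd \<alpha> k S (%x. f' x h)"
  by auto
 with Suc show ?case unfolding iter_diff.simps
  by (intro exI[of _ f'] conjI) (meson has_derivative_subset subset_iff, blast)
qed (simp add: loc_holder_subset)

lemma H_add:
 "Hd \<alpha> k S f ==> Hd \<alpha> k S g ==> Hd \<alpha> k S (%x. f x + g x)"
proof (induction k arbitrary: f g)
 case (Suc k)
 from Suc.prems obtain f' g' where "\<forall>x\<in>S. (f has_derivative f' x) (at x within S)" "\<forall>h. Hd \<alpha> k S (%x. f' x h)"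
  "\<forall>x\<in>S. (g has_derivative g' x) (at x within S)" "\<forall>h. Hd \<alpha> k S (%x. g' x h)"
  by auto
 with Suc.IH show ?case unfolding iter_diff.simps
  by (intro exI[of _ "%x h. f' x h + g' x h"] conjI ballI allI has_derivative_add) simp_all
qed (simp add: loc_holder_add)

lemma H_linear:
 assumes "bounded_linear L"
 shows "Hd \<alpha> k S f ==> Hd \<alpha> k S (%x. L (f x))"
proof (induction k arbitrary: f)
 case (Suc k)
 from Suc.prems obtain f' where "\<forall>x\<in>S. (f has_derivative f' x) (at x within S)" "\<forall>h. Hd \<alpha> k S (%x. f' x h)"
  by auto
 with Suc.IH show ?case unfolding iter_diff.simps
  by (intro exI[of _ "%x h. L (f' x h)"] conjI ballI allI bounded_linear.has_derivative[OF assms]) simp_all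
qed (simp add: loc_holder_linear assms)

lemma H_const: "0 <= \<alpha> ==> Hd \<alpha> k S (%x. c)"
proof (induction k arbitrary: c)
 case (Suc k)
 thus ?case by (auto intro!: exI[of _ "%x h. 0"])
qed (simp add: loc_holder_const)

lemma H_sum:
 assumes "0 <= \<alpha>" "!!i. i \<in> I ==> Hd \<alpha> k S (f i)"
 shows "Hd \<alpha> k S (%x. \<Sum>i\<in>I. f i x)"
 using assms(2)
proof (induction I rule: infinite_finite_induct)
 case (insert i I)
 thus ?case using H_add[of \<alpha> k S "f i" "%x. \<Sum>i\<in>I. f i x"] by simp
qed (simp_all add: H_const assms(1))

lemma linear_basis_expansion:
 fixes L :: "'e::euclidean_space => 'b::real_vector"
 assumes "linear L"
 shows "L h = (\<Sum>i\<in>Basis. (h \<bullet> i) *\<^sub>R L i)"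
proof -
 have "L (\<Sum>i\<in>Basis. (h \<bullet> i) *\<^sub>R i) = (\<Sum>i\<in>Basis. (h \<bullet> i) *\<^sub>R L i)"
  by (simp add: linear_sum[OF assms] linear_scale[OF assms])
 thus ?thesis by (simp add: euclidean_representation)
qed

lemma onorm_basis_bound:
 fixes L :: "'e::euclidean_space => 'b::real_normed_vector"
 assumes L: "linear L" and B: "!!i. i \<in> Basis ==> norm (L i) <= B i"
 shows "onorm L <= (\<Sum>i\<in>Basis. \<bar>B i\<bar>)"
proof (rule onorm_le)
 fix h
 have "norm (L h) <= (\<Sum>i\<in>Basis. norm ((h \<bullet> i) *\<^sub>R L i))"
  unfolding linear_basis_expansion[OF L, of h] by (rule norm_sum)
 also have "\<dots> <= (\<Sum>i\<in>Basis. norm h * \<bar>B i\<bar>)"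
 proof (rule sum_mono)
  fix i :: 'e assume i: "i \<in> Basis"
  show "norm ((h \<bullet> i) *\<^sub>R L i) <= norm h * \<bar>B i\<bar>"
   using Basis_le_norm[OF i, of h] B[OF i] by (auto intro: mult_mono)
 qed
 finally show "norm (L h) <= (\<Sum>i\<in>Basis. \<bar>B i\<bar>) * norm h" by (simp add: sum_distrib_left mult.commute)
qed

text \<open>Half-spaces are convex, so the mean value inequality holds up to the boundary and gives
  a local Lipschitz bound. On sets of diameter at most 1 this is a Hoelder bound for every exponent
  up to 1.\<close>

lemma loc_holder_differentiable:
 assumes S: "half_open S" and \<alpha>: "0 <= \<alpha>" "\<alpha> <= 1"
  and f': "!!x. x \<in> S ==> (f has_derivative f' x) (at x within S)"
  and cont: "!!h. continuous_on S (%x. f' x h)"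
 shows "loc_holder \<alpha> S f"
proof (rule loc_holderI)
 show "continuous_on S f" using f' by (meson continuous_on_eq_continuous_within has_derivative_continuous)
 fix x assume x: "x \<in> S"
 from half_openE[OF S x] obtain r M where r: "r > 0" "convex M" "M \<inter> ball x r \<subseteq> S" "S \<subseteq> M" by metis
 have "\<exists>d>0. \<exists>B. \<forall>y\<in>S. dist x y < d --> norm (f' y i) <= B" for i
 proof -
  have "loc_holder 0 S (%x. f' x i)" using cont by (simp add: loc_holder_zero)
  from loc_holderE[OF this x] show ?thesis by metis
 qed
 then obtain d B where d: "!!i. d i > 0" and B: "!!i y. y \<in> S ==> dist x y < d i ==> norm (f' y i) <= B i" by metis
 \<comment> \<open>The half makes e strictly smaller than every radius in the minimum and the
   distance of two points of T at most 1.\<close>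
 define e where "e = min 1 (min r (Min (d ` Basis))) / 2"
 have e: "e > 0" "e < r" "2 * e <= 1" "!!i. i \<in> Basis ==> e < d i" 
 proof -
  have "Min (d ` Basis) > 0" using d by (subst Min_gr_iff) auto
  thus "e > 0" using r by (auto simp: e_def)
  show "e < r" "2 * e <= 1" using r by (auto simp: e_def)
  fix i :: 'a assume "i \<in> Basis"
  hence "Min (d ` Basis) <= d i" by (intro Min_le) auto
  thus "e < d i" using d[of i] by (auto simp: e_def)
 qed
 define T where "T = M \<inter> ball x e"
 have T: "convex T" "T \<subseteq> S" unfolding T_def using r e by (auto intro: convex_Int)
 define C where "C = (\<Sum>i\<in>Basis. \<bar>B i\<bar>)"
 have on: "onorm (f' y) <= C" if "y \<in> T" for y
  unfolding C_def
 proof (rule onorm_basis_bound)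
  show "linear (f' y)" using f'[of y] that T has_derivative_linear by blast
  show "norm (f' y i) <= B i" if "i \<in> Basis" for i using \<open>y \<in> T\<close> T e(4)[OF that] by (intro B) (auto simp: T_def)
 qed
 have "norm (f y - f z) <= C * dist y z powr \<alpha>" if "y \<in> T" "z \<in> T" for y z
 proof (cases "y = z")
  case False
  have "dist y z <= dist x y + dist x z" by (rule dist_triangle3)
  also have "\<dots> <= 1" using that e by (auto simp: T_def)
  finally have le1: "dist y z <= 1" .
  have C0: "C >= 0" by (auto simp: C_def intro: sum_nonneg)
  have "norm (f y - f z) <= C * norm (y - z)"
   by (rule differentiable_bound[OF T(1) _ on that]) (use f' T in \<open>blast intro: has_derivative_subset\<close>)
  also have "norm (y - z) = dist y z powr 1" using False by (simp add: dist_norm)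
  also have "C * dist y z powr 1 <= C * dist y z powr \<alpha>" using le1 \<alpha> C0 False
   by (intro mult_left_mono powr_mono') auto
  finally show ?thesis .
 qed simp
 moreover have "y \<in> T" if "y \<in> S" "dist x y < e" for y
  using that r by (auto simp: T_def)
 ultimately show "\<exists>e>0. \<exists>C. \<forall>y\<in>S. \<forall>z\<in>S. dist x y < e --> dist x z < e --> norm (f y - f z) <= C * dist y z powr \<alpha>"
  using e(1) by (intro exI[of _ e] conjI exI[of _ C]) auto
qed

lemma H_continuous:
 assumes "half_open S" "Hd \<alpha> k S f"
 shows "continuous_on S f"
proof (cases k)
 case 0
 with assms show ?thesis by (simp add: loc_holder_continuous)
next
 case (Suc j)
 with assms show ?thesis
  by (auto simp: continuous_on_eq_continuous_within intro: has_derivative_continuous)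
qed

text \<open>The inclusion of C^{k+1,beta} in C^{k,alpha}. In the Leibniz rule one factor remains
  undifferentiated and has to be used at the lower order.\<close>

lemma H_Suc_D:
 assumes S: "half_open S" and \<alpha>: "0 <= \<alpha>" "\<alpha> <= 1"
 shows "Hd \<beta> (Suc k) S f ==> Hd \<alpha> k S f"
proof (induction k arbitrary: f)
 case 0
 then obtain f' where f': "!!x. x \<in> S ==> (f has_derivative f' x) (at x within S)" "!!h. loc_holder \<beta> S (%x. f' x h)"
  by auto
 show ?case using loc_holder_differentiable[OF S \<alpha> f'(1)] f'(2) loc_holder_continuous by auto
next
 case (Suc k)
 then obtain f' where f': "\<forall>x\<in>S. (f has_derivative f' x) (at x within S)" "!!h. Hd \<beta> (Suc k) S (%x. f' x h)"
  by (metis iter_diff.simps(2))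
 show ?case unfolding iter_diff.simps(2)[of _ k] using f' Suc.IH by blast
qed

lemma H_mult:
 fixes h :: "'e::euclidean_space => real"
 assumes S: "half_open S" and \<alpha>: "0 <= \<alpha>" "\<alpha> <= 1"
 shows "Hd \<alpha> k S h ==> Hd \<alpha> k S f ==>
  Hd \<alpha> k S (%x. h x *\<^sub>R f x)"
proof (induction k arbitrary: h f)
 case (Suc k)
 from Suc.prems obtain h' f' where
  h': "!!x. x \<in> S ==> (h has_derivative h' x) (at x within S)" "!!v. Hd \<alpha> k S (%x. h' x v)" and
  f': "!!x. x \<in> S ==> (f has_derivative f' x) (at x within S)" "!!v. Hd \<alpha> k S (%x. f' x v)"
  by (metis iter_diff.simps(2))
 have "Hd \<alpha> k S h" "Hd \<alpha> k S f"
  using Suc.prems H_Suc_D[OF S \<alpha>] by auto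
 hence "Hd \<alpha> k S (%x. h x *\<^sub>R f' x v + h' x v *\<^sub>R f x)" for v
  by (intro H_add Suc.IH h' f')
 thus ?case unfolding iter_diff.simps
  by (intro exI[of _ "%x v. h x *\<^sub>R f' x v + h' x v *\<^sub>R f x"] conjI ballI allI has_derivative_scaleR h' f')
qed (simp add: loc_holder_mult)

lemma H_inverse:
 fixes h :: "'e::euclidean_space => real"
 assumes S: "half_open S" and \<alpha>: "0 <= \<alpha>" "\<alpha> <= 1"
  and nz: "!!x. x \<in> S ==> h x ~= 0"
 shows "Hd \<alpha> k S h ==> Hd \<alpha> k S (%x. inverse (h x))"
proof (induction k)
 case (Suc k)
 from Suc.prems obtain h' where
  h': "!!x. x \<in> S ==> (h has_derivative h' x) (at x within S)" "!!v. Hd \<alpha> k S (%x. h' x v)"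
  by (metis iter_diff.simps(2))
 have "Hd \<alpha> k S (%x. inverse (h x))"
  using Suc.prems H_Suc_D[OF S \<alpha>] Suc.IH by auto
 hence "Hd \<alpha> k S (%x. - (inverse (h x) *\<^sub>R (h' x v *\<^sub>R inverse (h x))))" for v
  by (intro H_linear[OF bounded_linear_minus[OF bounded_linear_ident]] H_mult[OF S \<alpha>] h')
 thus ?case unfolding iter_diff.simps
  by (intro exI[of _ "%x v. - (inverse (h x) *\<^sub>R (h' x v *\<^sub>R inverse (h x)))"] conjI ballI allI)
   (auto intro!: has_derivative_eq_rhs[OF Deriv.has_derivative_inverse[OF _ h'(1)]] nz)
qed (simp add: loc_holder_inverse nz)

text \<open>Only evaluations of f' at fixed vectors are known to be regular. Therefore
  \<open>f' (\<tau> x) (\<tau>' x v)\<close> is expanded in the basis, after which the induction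
  hypothesis and the product rule apply.\<close>

lemma H_compose:
 fixes f :: "'d::euclidean_space => 'b::real_normed_vector" and \<tau> :: "'e::euclidean_space => 'd"
 assumes S: "half_open S" and T: "half_open T" and sub: "\<tau> ` S \<subseteq> T"
  and \<tau>: "!!j. Hd 0 j S \<tau>"
 shows "Hd 0 k T f ==> Hd 0 k S (%x. f (\<tau> x))"
proof (induction k arbitrary: f)
 case 0
 have "continuous_on S \<tau>" using \<tau>[of 0] by (simp add: loc_holder_zero)
 with 0 show ?case unfolding iter_diff.simps loc_holder_zero 
  by (rule continuous_on_compose2) (use sub in auto)
next
 case (Suc k)
 from Suc.prems obtain f' where
  f': "!!x. x \<in> T ==> (f has_derivative f' x) (at x within T)" "!!v. Hd 0 k T (%x. f' x v)"
  by (metis iter_diff.simps(2))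
 from \<tau>[of "Suc k"] obtain \<tau>' where
  \<tau>': "!!x. x \<in> S ==> (\<tau> has_derivative \<tau>' x) (at x within S)" "!!v. Hd 0 k S (%x. \<tau>' x v)"
  by (metis iter_diff.simps(2))
 have der: "((%x. f (\<tau> x)) has_derivative (%v. f' (\<tau> x) (\<tau>' x v))) (at x within S)" if "x \<in> S" for x
 proof -
  have "(f has_derivative f' (\<tau> x)) (at (\<tau> x) within \<tau> ` S)"
   using f'(1)[of "\<tau> x"] sub that by (meson has_derivative_subset image_subset_iff)
  from has_derivative_in_compose[OF \<tau>'(1)[OF that] this] show ?thesis .
 qed
 have "Hd 0 k S (%x. f' (\<tau> x) (\<tau>' x v))" for v
 proof -
  have "Hd 0 k S (%x. \<Sum>i\<in>Basis. (\<tau>' x v \<bullet> i) *\<^sub>R f' (\<tau> x) i)"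
   by (intro H_sum H_mult[OF S] Suc.IH f' H_linear[OF bounded_linear_inner_left] \<tau>') auto
  also have "?this \<longleftrightarrow> ?thesis"
   by (intro H_cong linear_basis_expansion[symmetric] has_derivative_linear[OF f'(1)]) (use sub in auto)
  finally show ?thesis .
 qed
 with der show ?case unfolding iter_diff.simps by (intro exI conjI ballI allI) auto
qed

text \<open>The derivatives chosen on the various neighbourhoods agree by uniqueness within S, so
  the diagonal choice \<open>F y y\<close> is a derivative on all of S.\<close>

lemma H_glue:
 assumes S: "half_open S"
 shows "(!!x. x \<in> S ==> \<exists>N. open N & x \<in> N & Hd \<alpha> k (S \<inter> N) f) ==> Hd \<alpha> k S f"
proof (induction k arbitrary: f)
 case 0
 thus ?case by (auto intro: loc_holder_glue)
next
 case (Suc k)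
 then obtain N where N: "!!x. x \<in> S ==> open (N x)" "!!x. x \<in> S ==> x \<in> N x"
   and D: "!!x. x \<in> S ==> Hd \<alpha> (Suc k) (S \<inter> N x) f" by metis
 hence "\<forall>x\<in>S. \<exists>f'. (\<forall>y\<in>S \<inter> N x. (f has_derivative f' y) (at y within S \<inter> N x)) & (\<forall>h. Hd \<alpha> k (S \<inter> N x) (%y. f' y h))"
  by simp
 then obtain F where F: "!!x y. x \<in> S ==> y \<in> S \<inter> N x ==> (f has_derivative F x y) (at y within S \<inter> N x)"
  "!!x h. x \<in> S ==> Hd \<alpha> k (S \<inter> N x) (%y. F x y h)" by metis
 have F1: "(f has_derivative F x y) (at y within S)" if "x \<in> S" "y \<in> S \<inter> N x" for x y
 proof -
  have "at y within S = at y within S \<inter> N x" by (rule at_within_nhd[of y "N x"]) (use N that in auto)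
  with F(1)[OF that] show ?thesis by simp
 qed
 have eq: "F x y = F y y" if "x \<in> S" "y \<in> S \<inter> N x" for x y
  using half_open_derivative_unique[OF S _ F1[OF that] F1[of y y]] that N by auto
 have "Hd \<alpha> k S (%y. F y y h)" for h
 proof (rule Suc.IH)
  fix x assume x: "x \<in> S"
  have "Hd \<alpha> k (S \<inter> N x) (%y. F y y h)"
   using F(2)[OF x] eq[OF x] H_cong[of "S \<inter> N x" "%y. F x y h" "%y. F y y h"] by metis
  with N x show "\<exists>N. open N & x \<in> N & Hd \<alpha> k (S \<inter> N) (%y. F y y h)" by blast
 qed
 with F1 N show ?case unfolding iter_diff.simps by (intro exI[of _ "%y. F y y"]) auto
qed

section \<open>Smooth functions up to the boundary\<close>

definition smooth_on :: "'e::euclidean_space set => ('e => 'b::real_normed_vector) => bool" where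
 "smooth_on S f \<longleftrightarrow> (\<forall>j. Hd 0 j S f)"

lemma Ck_Frechet_alt: "Ck_Frechet k S f \<longleftrightarrow> (\<forall>j. enat j <= k --> Hd 0 j S f)"
 by (simp add: Ck_Frechet_def loc_holder_zero)

lemma Ck_Frechet_infinity: "Ck_Frechet \<infinity> S f \<longleftrightarrow> smooth_on S f"
 by (simp add: Ck_Frechet_alt smooth_on_def)

lemma smooth_onD: "smooth_on S f ==> Hd 0 j S f"
 by (simp add: smooth_on_def)

lemma smooth_on_H:
 assumes "half_open S" "0 <= \<alpha>" "\<alpha> <= 1" "smooth_on S f"
 shows "Hd \<alpha> k S f"
 using H_Suc_D assms smooth_onD by blast

lemma smooth_on_continuous: "smooth_on S f ==> continuous_on S f"
 using smooth_onD[of S f 0] by (simp add: loc_holder_zero)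

lemma smooth_on_cong: "(!!x. x \<in> S ==> f x = g x) ==> smooth_on S f \<longleftrightarrow> smooth_on S g"
 unfolding smooth_on_def using H_cong by blast

lemma smooth_on_subset: "smooth_on S f ==> T \<subseteq> S ==> smooth_on T f"
 unfolding smooth_on_def using H_subset by blast

lemma smooth_on_add: "smooth_on S f ==> smooth_on S g ==> smooth_on S (%x. f x + g x)"
 unfolding smooth_on_def using H_add by blast

lemma smooth_on_linear: "bounded_linear L ==> smooth_on S f ==> smooth_on S (%x. L (f x))"
 unfolding smooth_on_def using H_linear by blast

lemma smooth_on_const: "smooth_on S (%x. c)"
 unfolding smooth_on_def using H_const[of 0] by auto

lemma smooth_on_sum: "(!!i. i \<in> I ==> smooth_on S (f i)) ==> smooth_on S (%x. \<Sum>i\<in>I. f i x)"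
 unfolding smooth_on_def by (intro allI H_sum) auto

lemma smooth_on_scaleR:
 fixes h :: "'e::euclidean_space => real"
 shows "half_open S ==> smooth_on S h ==> smooth_on S f ==> smooth_on S (%x. h x *\<^sub>R f x)"
 unfolding smooth_on_def by (intro allI H_mult) auto

lemma smooth_on_mult:
 fixes h :: "'e::euclidean_space => real"
 shows "half_open S ==> smooth_on S h ==> smooth_on S f ==> smooth_on S (%x. h x * f x)"
 using smooth_on_scaleR[of S h f] by simp

lemma smooth_on_inverse:
 fixes h :: "'e::euclidean_space => real"
 shows "half_open S ==> (!!x. x \<in> S ==> h x ~= 0) ==> smooth_on S h ==> smooth_on S (%x. inverse (h x))"
 unfolding smooth_on_def by (intro allI H_inverse) auto

lemma smooth_on_compose:
 "half_open S ==> half_open T ==> \<tau> ` S \<subseteq> T ==> smooth_on S \<tau> ==> smooth_on T f ==> smooth_on S (%x. f (\<tau> x))"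
 unfolding smooth_on_def using H_compose by blast

lemma smooth_on_glue:
 "half_open S ==> (!!x. x \<in> S ==> \<exists>N. open N & x \<in> N & smooth_on (S \<inter> N) f) ==> smooth_on S f"
 unfolding smooth_on_def by (intro allI H_glue) blast+

lemma smooth_on_Suc:
 assumes der: "!!x. x \<in> S ==> (f has_derivative f' x) (at x within S)" and "!!v. smooth_on S (%x. f' x v)"
 shows "smooth_on S f"
 unfolding smooth_on_def
proof
 fix j
 show "Hd 0 j S f"
 proof (cases j)
  case 0
  have "continuous_on S f" using der
   by (auto simp: continuous_on_eq_continuous_within intro: has_derivative_continuous)
  with 0 show ?thesis by (simp add: loc_holder_zero)
 next
  case (Suc i)
  with assms show ?thesis by (auto simp: smooth_on_def)
 qed
qed

lemma smooth_on_ident: "smooth_on S (%x. x)"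
 by (rule smooth_on_Suc[of _ _ "%x v. v"]) (auto intro: smooth_on_const)

text \<open>Each order k comes with its own derivative; uniqueness shows that one of them serves all
  orders.\<close>

lemma smooth_on_derivative:
 assumes S: "half_open S" and f: "smooth_on S f"
 obtains f' where "!!x. x \<in> S ==> (f has_derivative f' x) (at x within S)" "!!v. smooth_on S (%x. f' x v)"
proof -
 have "\<exists>f'. (\<forall>x\<in>S. (f has_derivative f' x) (at x within S)) & (\<forall>v. Hd 0 k S (%x. f' x v))" for k
  using smooth_onD[OF f, of "Suc k"] by simp
 then obtain F where F: "!!k x. x \<in> S ==> (f has_derivative F k x) (at x within S)"
   "!!k v. Hd 0 k S (%x. F k x v)" by metis
 have eq: "F k x = F 0 x" if "x \<in> S" for k x
  using half_open_derivative_unique[OF S that F(1) F(1)] that by blast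
 show ?thesis
 proof (rule that[of "F 0"])
  show "smooth_on S (%x. F 0 x v)" for v unfolding smooth_on_def
   using F(2) eq H_cong[of S "%x. F _ x v" "%x. F 0 x v"] by metis
 qed (use F in auto)
qed

section \<open>Equivalence of the Michal-Bastiani and the Frechet sense\<close>

text \<open>The interior is dense in S. Michal-Bastiani derivatives are derivatives in the interior
  only, and identities between them reach the boundary in this way.\<close>

lemma half_open_eqI:
 fixes g1 g2 :: "'e::euclidean_space => 'b::real_normed_vector"
 assumes S: "half_open S" and c: "continuous_on S g1" "continuous_on S g2"
  and eq: "!!x. x \<in> interior S ==> g1 x = g2 x" and x: "x \<in> S"
 shows "g1 x = g2 x"
proof (rule ccontr)
 assume "g1 x ~= g2 x"
 define e where "e = norm (g1 x - g2 x)"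
 have e: "e > 0" using \<open>g1 x ~= g2 x\<close> by (simp add: e_def)
 have "continuous_on S (%x. g1 x - g2 x)" using c by (intro continuous_intros)
 with x e obtain d where d: "d > 0" "!!y. y \<in> S ==> dist y x < d ==> dist (g1 y - g2 y) (g1 x - g2 x) < e"
  unfolding continuous_on_iff by metis
 from half_open_interior_near[OF S x d(1)] obtain y where y: "y \<in> interior S" "dist x y < d" by blast
 with d(2)[of y] eq[OF y(1)] interior_subset show False by (auto simp: dist_norm dist_commute e_def norm_minus_commute)
qed

lemma has_vector_derivative_affine:
 assumes "(\<phi> has_vector_derivative v) (at (c * s + b))"
 shows "((%r::real. \<phi> (c * r + b)) has_vector_derivative c *\<^sub>R v) (at s)"
proof -
 have "((%r. c * r + b) has_vector_derivative c) (at s)" by (auto intro!: derivative_eq_intros)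
 from vector_diff_chain_at[OF this, of \<phi> v] assms show ?thesis by (simp add: o_def)
qed

text \<open>The mean value inequality for s -> g (x + s h) - s L h on a segment. The bound is asked
  for on unit vectors only, where compactness of the sphere can supply it; homogeneity extends it to
  all h.\<close>

lemma directional_estimate:
 fixes g :: "'e::euclidean_space => 'b::real_normed_vector"
 assumes C: "convex C" 
  and der: "!!x h. x \<in> C ==> ((%t. g (x + t *\<^sub>R h)) has_vector_derivative G x h) (at 0)"
  and est: "!!z u. z \<in> C ==> norm u = 1 ==> norm (G z u - L u) <= e"
  and hom: "!!z c h. z \<in> C ==> G z (c *\<^sub>R h) = c *\<^sub>R G z h" "!!c h. L (c *\<^sub>R h) = c *\<^sub>R L h"
  and xy: "x \<in> C" "y \<in> C"
 shows "norm (g y - g x - L (y - x)) <= e * norm (y - x)"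
proof -
 define h where "h = y - x"
 have inC: "x + s *\<^sub>R h \<in> C" if "s \<in> {0..1}" for s
 proof -
  have "x + s *\<^sub>R h = (1 - s) *\<^sub>R x + s *\<^sub>R y" by (simp add: h_def algebra_simps)
  with C xy that show ?thesis by (auto intro: convexD_alt)
 qed
 have bound: "norm (G z h - L h) <= e * norm h" if "z \<in> C" for z
 proof (cases "h = 0")
  case True
  thus ?thesis using hom(1)[OF that, of 0 0] hom(2)[of 0 0] by simp
 next
  case False
  define u where "u = h /\<^sub>R norm h"
  have u: "norm u = 1" "h = norm h *\<^sub>R u" using False by (auto simp: u_def)
  have "G z h - L h = norm h *\<^sub>R (G z u - L u)"
   by (subst (1 2) u(2)) (simp only: hom(1)[OF that] hom(2) scaleR_right_diff_distrib)
  thus ?thesis using mult_left_mono[OF est[OF that u(1)], of "norm h"] by (simp add: mult.commute)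
 qed
 define \<phi> where "\<phi> s = g (x + s *\<^sub>R h) - s *\<^sub>R L h" for s
 have d: "(\<phi> has_vector_derivative (G (x + s *\<^sub>R h) h - L h)) (at s within {0..1})" if "s \<in> {0..1}" for s
 proof -
  have "((%t. g ((x + s *\<^sub>R h) + t *\<^sub>R h)) has_vector_derivative G (x + s *\<^sub>R h) h) (at 0)"
   by (rule der[OF inC[OF that]])
  hence "((%r. g ((x + s *\<^sub>R h) + (1 * r + (- s)) *\<^sub>R h)) has_vector_derivative 1 *\<^sub>R G (x + s *\<^sub>R h) h) (at s)"
   by (intro has_vector_derivative_affine) simp
  hence "((%r. g (x + r *\<^sub>R h)) has_vector_derivative G (x + s *\<^sub>R h) h) (at s within {0..1})"
   by (simp add: algebra_simps has_vector_derivative_at_within)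
  thus ?thesis unfolding \<phi>_def
   by (auto intro!: derivative_eq_intros)
 qed
 have "norm (\<phi> 1 - \<phi> 0) <= (e * norm h) * norm (1 - 0 :: real)"
 proof (rule differentiable_bound[where S = "{0..1}" and f' = "%s r. r *\<^sub>R (G (x + s *\<^sub>R h) h - L h)"])
  fix s :: real assume s: "s \<in> {0..1}"
  show "(\<phi> has_derivative (%r. r *\<^sub>R (G (x + s *\<^sub>R h) h - L h))) (at s within {0..1})"
   using d[OF s] by (simp add: has_vector_derivative_def)
  show "onorm (%r. r *\<^sub>R (G (x + s *\<^sub>R h) h - L h)) <= e * norm h"
   by (rule onorm_le) (use bound[OF inC[OF s]] in \<open>auto simp: mult.commute intro: mult_left_mono\<close>)
 qed auto
 thus ?thesis by (simp add: \<phi>_def h_def algebra_simps)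
qed

text \<open>Linearity of \<open>G x\<close> is not given. Homogeneity follows from uniqueness of
  directional derivatives; the estimate holds in the interior of a convex piece and extends to
  nearby points of S by continuity; additivity is then read off from the estimate.\<close>

lemma directional_imp_derivative:
 fixes g :: "'e::euclidean_space => 'b::real_normed_vector"
 assumes S: "half_open S" and g: "continuous_on S g" and G: "continuous_on (S \<times> UNIV) (%(x, h). G x h)"
  and der: "!!x h. x \<in> interior S ==> ((%t. g (x + t *\<^sub>R h)) has_vector_derivative G x h) (at 0)"
  and x: "x \<in> S"
 shows "(g has_derivative G x) (at x within S)"
proof -
 have Gh: "continuous_on S (%x. G x h)" for h
 proof -
  have "continuous_on S ((%(x, h). G x h) \<circ> (%x. (x, h)))"
   by (intro continuous_on_compose continuous_on_subset[OF G] continuous_intros) auto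
  thus ?thesis by (simp add: o_def)
 qed
 have hom: "G z (c *\<^sub>R h) = c *\<^sub>R G z h" if "z \<in> S" for z c h
 proof (rule half_open_eqI[OF S _ _ _ that])
  show "continuous_on S (%a. G a (c *\<^sub>R h))" "continuous_on S (%a. c *\<^sub>R G a h)" using Gh by (auto intro: continuous_intros)
  fix z assume z: "z \<in> interior S"
  have "((%r. g (z + (c * r + 0) *\<^sub>R h)) has_vector_derivative c *\<^sub>R G z h) (at 0)"
   by (rule has_vector_derivative_affine) (use der[OF z] in simp)
  hence "((%t. g (z + t *\<^sub>R (c *\<^sub>R h))) has_vector_derivative c *\<^sub>R G z h) (at 0)"
   by (simp add: mult.commute)
  with der[OF z, of "c *\<^sub>R h"] show "G z (c *\<^sub>R h) = c *\<^sub>R G z h"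
   using vector_derivative_unique_at by blast
 qed
 \<comment> \<open>Both y and z vary near x. This two-point form is what yields additivity
   below.\<close>
 have est: "\<exists>d>0. \<forall>y\<in>S. \<forall>z\<in>S. dist x y < d --> dist x z < d --> norm (g y - g z - G x (y - z)) <= e * norm (y - z)"
  if x: "x \<in> S" and e: "e > 0" for x e
 proof -
  from half_openE[OF S x] obtain r M where r: "r > 0" "convex M" "closed M" "M \<inter> ball x r \<subseteq> S" "S \<subseteq> M" by metis
  define Kc where "Kc = M \<inter> cball x (r/2)"
  have "compact (Kc \<times> sphere (0::'e) 1)" unfolding Kc_def using r by (intro compact_Times closed_Int_compact) auto
  moreover have KS: "Kc \<subseteq> S" using r unfolding Kc_def by (auto simp: subset_iff)
  hence "continuous_on (Kc \<times> sphere 0 1) (%(x, h). G x h)" by (intro continuous_on_subset[OF G]) auto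
  ultimately have "uniformly_continuous_on (Kc \<times> sphere 0 1) (%(x, h). G x h)" by (rule compact_uniformly_continuous[rotated])
  with e obtain d where d: "d > 0" and D: "!!p q. p \<in> Kc \<times> sphere 0 1 ==> q \<in> Kc \<times> sphere 0 1 ==> dist q p < d ==>
   dist ((%(x, h). G x h) q) ((%(x, h). G x h) p) < e"
   unfolding uniformly_continuous_on_def by metis
  have D': "norm (G z u - G x u) <= e" if "z \<in> S" "dist x z < min d (r/2)" "norm u = 1" for z u
  proof -
   have "dist (z,u) (x,u) < d" using that by (simp add: dist_Pair_Pair dist_commute)
   moreover have "x \<in> Kc" "z \<in> Kc" using that r x by (auto simp: Kc_def)
   ultimately show ?thesis using D[of "(x,u)" "(z,u)"] that by (auto simp: dist_norm)
  qed
  define \<delta> where "\<delta> = min d (r/2)"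
  \<comment> \<open>The interior of a convex set is convex, so segments stay where the directional
    derivatives exist.\<close>
  define Cc where "Cc = interior (M \<inter> ball x \<delta>)"
  have \<delta>: "\<delta> > 0" "\<delta> <= d" "\<delta> < r" using d r by (auto simp: \<delta>_def)
  have Cc: "convex Cc" unfolding Cc_def using r by (intro convex_interior convex_Int) auto
  have CcS: "Cc \<subseteq> interior S" unfolding Cc_def using r \<delta> by (intro interior_mono) (auto simp: subset_iff)
  have CcS': "Cc \<subseteq> S" using CcS interior_subset by blast
  have Ccd: "z \<in> Cc ==> dist x z < \<delta>" for z unfolding Cc_def using interior_subset by fastforce
  have inner: "norm (g y - g z - G x (y - z)) <= e * norm (y - z)" if "y \<in> Cc" "z \<in> Cc" for y z
  proof (rule directional_estimate[OF Cc _ _ _ _ that(2,1)])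
   show "((%t. g (x + t *\<^sub>R h)) has_vector_derivative G x h) (at 0)" if "x \<in> Cc" for x h using der CcS that by blast
   show "norm (G z u - G x u) <= e" if "z \<in> Cc" "norm u = 1" for z u using D'[of z u] that Ccd[of z] CcS' by (auto simp: \<delta>_def)
  qed (use hom CcS' x in auto)
  have near: "\<exists>p\<in>Cc. dist y p < \<eta>" if "y \<in> S" "dist x y < \<delta>" "\<eta> > 0" for y \<eta>
  proof -
   have "y \<in> S \<inter> ball x \<delta>" "half_open (S \<inter> ball x \<delta>)" using that half_open_Int[OF S] by auto
   from half_open_interior_near[OF this(2,1) that(3)] 
   obtain p where p: "p \<in> interior (S \<inter> ball x \<delta>)" "dist y p < \<eta>" by blast
   moreover have "interior (S \<inter> ball x \<delta>) \<subseteq> Cc" unfolding Cc_def using r by (intro interior_mono) auto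
   ultimately show ?thesis by blast
  qed
  have "norm (g y - g z - G x (y - z)) <= e * norm (y - z)" if yz: "y \<in> S" "z \<in> S" "dist x y < \<delta>" "dist x z < \<delta>" for y z
  proof -
   from near[OF yz(1,3)] have "\<forall>n. \<exists>p\<in>Cc. dist y p < inverse (real (Suc n))" by auto
   then obtain p where p: "!!n. p n \<in> Cc" "!!n. dist y (p n) < inverse (real (Suc n))" by metis
   from near[OF yz(2,4)] have "\<forall>n. \<exists>p\<in>Cc. dist z p < inverse (real (Suc n))" by auto
   then obtain q where q: "!!n. q n \<in> Cc" "!!n. dist z (q n) < inverse (real (Suc n))" by metis
   have lim: "s \<longlonglongrightarrow> y" if "!!n. dist y (s n) < inverse (real (Suc n))" for s and y :: 'e
   proof -
    have "(%n. dist y (s n)) \<longlonglongrightarrow> 0"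
     by (rule tendsto_sandwich[OF _ _ tendsto_const LIMSEQ_inverse_real_of_nat])
       (use that in \<open>auto intro!: always_eventually less_imp_le\<close>)
    thus ?thesis by (subst tendsto_dist_iff) (simp add: dist_commute)
   qed
   have pl: "p \<longlonglongrightarrow> y" "q \<longlonglongrightarrow> z" using lim p q by auto
   have gp: "(%n. g (p n)) \<longlonglongrightarrow> g y" "(%n. g (q n)) \<longlonglongrightarrow> g z"
    using g pl yz p(1) q(1) CcS' by (auto simp: continuous_on_sequentially o_def subset_iff)
   have G2: "continuous_on UNIV (G x)"
   proof -
    have "continuous_on UNIV ((%(x, h). G x h) \<circ> (%h. (x, h)))"
     by (intro continuous_on_compose continuous_on_subset[OF G] continuous_intros) (use x in auto)
    thus ?thesis by (simp add: o_def)
   qed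
   hence "(%n. G x (p n - q n)) \<longlonglongrightarrow> G x (y - z)"
    by (rule continuous_on_tendsto_compose) (use pl in \<open>auto intro!: tendsto_intros\<close>)
   hence "(%n. norm (g (p n) - g (q n) - G x (p n - q n))) \<longlonglongrightarrow> norm (g y - g z - G x (y - z))"
    by (intro tendsto_intros gp)
   moreover have "(%n. e * norm (p n - q n)) \<longlonglongrightarrow> e * norm (y - z)"
    by (intro tendsto_intros pl)
   ultimately show ?thesis by (rule LIMSEQ_le) (use inner p q in blast)
  qed
  with \<delta>(1) show ?thesis by blast
 qed
 have add: "G z (h + k) = G z h + G z k" if "z \<in> S" for z h k
 proof (rule half_open_eqI[OF S _ _ _ that])
  show "continuous_on S (%a. G a (h + k))" "continuous_on S (%a. G a h + G a k)" using Gh by (auto intro: continuous_intros)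
  fix z assume z: "z \<in> interior S"
  hence zS: "z \<in> S" using interior_subset by blast
  let ?\<Delta> = "%v w t. g (z + t *\<^sub>R v) - g (z + t *\<^sub>R w)"
  \<comment> \<open>Additivity results from comparing the limits for (h + k, 0) and (h, 0) with the
    limit for (h + k, h).\<close>
  have lim: "((%t. ?\<Delta> v w t /\<^sub>R t) \<longlongrightarrow> G z (v - w)) (at 0)" for v w
  proof (rule tendstoI)
   fix e :: real assume e: "e > 0"
   define e' where "e' = e / (norm (v - w) + 1)"
   have n: "0 < norm (v - w) + 1" by (rule add_nonneg_pos) auto
   hence e': "e' > 0" "e' * norm (v - w) < e" using e by (auto simp: e'_def field_simps)
   from est[OF zS e'(1)] obtain d where d: "d > 0"
    and D: "!!y y'. y \<in> S ==> y' \<in> S ==> dist z y < d ==> dist z y' < d ==> norm (g y - g y' - G z (y - y')) <= e' * norm (y - y')" by metis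
   have ev: "\<forall>\<^sub>F t in at 0. z + t *\<^sub>R v \<in> interior S \<inter> ball z d" for v
    by (rule topological_tendstoD[where l = z]) (use z d in \<open>auto intro!: tendsto_eq_intros\<close>)
   show "\<forall>\<^sub>F t in at 0. dist (?\<Delta> v w t /\<^sub>R t) (G z (v - w)) < e"
    using ev[of v] ev[of w] eventually_neq_at_within[of 0]
   proof eventually_elim
    case (elim t)
    have "norm (?\<Delta> v w t - t *\<^sub>R G z (v - w)) <= e' * (\<bar>t\<bar> * norm (v - w))"
     using D[of "z + t *\<^sub>R v" "z + t *\<^sub>R w"] elim interior_subset[of S] hom[OF zS, of t "v - w"] by (auto simp: scaleR_right_diff_distrib simp flip: norm_scaleR)
    moreover have eq: "?\<Delta> v w t /\<^sub>R t - G z (v - w) = (?\<Delta> v w t - t *\<^sub>R G z (v - w)) /\<^sub>R t"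
     using elim(3) by (simp add: scaleR_right_diff_distrib)
    ultimately have "dist (?\<Delta> v w t /\<^sub>R t) (G z (v - w)) <= e' * norm (v - w)"
     unfolding dist_norm eq using elim(3) by (simp add: divide_inverse_commute[symmetric] divide_le_eq mult_ac del: scaleR_right_diff_distrib)
    with e'(2) show ?case by linarith
   qed
  qed
  have "((%t. ?\<Delta> (h + k) h t /\<^sub>R t) \<longlongrightarrow> G z (h + k) - G z h) (at 0)"
   using tendsto_diff[OF lim[of "h + k" 0] lim[of h 0]] by (simp flip: scaleR_right_diff_distrib)
  from tendsto_unique[OF _ this lim[of "h + k" h]] show "G z (h + k) = G z h + G z k" by (simp add: algebra_simps)
 qed
 have bl: "bounded_linear (G x)"
  using add[OF x] hom[OF x] by (intro linear_conv_bounded_linear[THEN iffD1] linearI) auto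
 show ?thesis unfolding has_derivative_within_alt
 proof (intro conjI allI impI bl)
  fix e :: real assume "e > 0"
  from est[OF x this] obtain d where "d > 0" "!!y z. y \<in> S ==> z \<in> S ==> dist x y < d ==> dist x z < d ==>
   norm (g y - g z - G x (y - z)) <= e * norm (y - z)" by metis
  thus "\<exists>d>0. \<forall>y\<in>S. norm (y - x) < d --> norm (g y - g x - G x (y - x)) <= e * norm (y - x)"
   using x by (intro exI[of _ d]) (auto simp: dist_norm norm_minus_commute)
 qed
qed

lemma Ck_MB_imp_Frechet:
 fixes f :: "'e::euclidean_space => 'b::real_normed_vector"
 assumes S: "half_open S" and f: "Ck_MB k S f"
 shows "Ck_Frechet k S f"
proof -
 from f obtain d :: "nat => 'e => (nat => 'e) => 'b" where d0: "!!x v. x \<in> S ==> d 0 x v = f x"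
  and dc: "!!j. enat j <= k ==> continuous_on (S \<times> UNIV) (%(x, v). d j x v)"
  and dd: "!!j x v. enat (Suc j) <= k ==> x \<in> interior S ==>
    ((%t. d j (x + t *\<^sub>R v j) v) has_vector_derivative d (Suc j) x v) (at 0)"
  unfolding Ck_MB_def by blast
 have leD: "enat j <= k" if "enat (Suc j) <= k" for j using that by (cases k) auto
 have cont_x: "continuous_on S (%x. d j x v)" if "enat j <= k" for j v
 proof -
  have "continuous_on S ((%(x, v). d j x v) \<circ> (%x. (x, v)))"
   by (intro continuous_on_compose continuous_on_subset[OF dc[OF that]] continuous_intros) auto
  thus ?thesis by (simp add: o_def)
 qed
 \<comment> \<open>Since \<open>d i\<close> depends only on the directions before i, entry i of v
   can be changed freely: the derivative of \<open>d i\<close> in direction h is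
   \<open>d (Suc i)\<close> at \<open>v(i := h)\<close>.\<close>
 have dep: "\<forall>x\<in>S. d j x v = d j x v'" if "enat j <= k" "!!l. l < j ==> v l = v' l" for j v v'
  using that
 proof (induction j)
  case 0
  thus ?case by (simp add: d0)
 next
  case (Suc j)
  hence IH: "!!x. x \<in> S ==> d j x v = d j x v'" using leD by simp
  show ?case
  proof
   fix x assume "x \<in> S"
   show "d (Suc j) x v = d (Suc j) x v'"
   proof (rule half_open_eqI[OF S cont_x[OF Suc.prems(1)] cont_x[OF Suc.prems(1)] _ \<open>x \<in> S\<close>])
    fix z assume z: "z \<in> interior S"
    let ?N = "(%t. z + t *\<^sub>R v j) -` interior S"
    have N: "open ?N" "0 \<in> ?N" using z by (auto intro!: open_vimage continuous_intros)
    have eq: "d j (z + t *\<^sub>R v j) v = d j (z + t *\<^sub>R v' j) v'" if "t \<in> ?N" for t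
     using IH that interior_subset Suc.prems(2)[of j] by auto
    have "((%t. d j (z + t *\<^sub>R v' j) v') has_vector_derivative d (Suc j) z v) (at 0)"
     by (rule has_vector_derivative_transform_within_open[OF dd[OF Suc.prems(1) z, of v] N eq])
    with dd[OF Suc.prems(1) z, of v'] show "d (Suc j) z v = d (Suc j) z v'"
     using vector_derivative_unique_at by blast
   qed
  qed
 qed
 have "Hd 0 j S (%x. d i x v)" if "enat (i + j) <= k" for i j v
  using that
 proof (induction j arbitrary: i v)
  case 0
  thus ?case using cont_x by (simp add: loc_holder_zero)
 next
  case (Suc j)
  have ik: "enat (Suc i) <= k" "enat i <= k" using Suc.prems by (cases k; simp)+
  have c: "continuous_on (S \<times> UNIV) (%(x, h). d (Suc i) x (v(i := h)))"
  proof -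
   have "continuous_on (S \<times> UNIV) ((%(x, v). d (Suc i) x v) \<circ> (%p. (fst p, v(i := snd p))))"
   proof (intro continuous_on_compose continuous_on_subset[OF dc[OF ik(1)]] continuous_on_Pair
     continuous_on_coordinatewise_then_product continuous_intros)
    fix l show "continuous_on (S \<times> UNIV) (%p. (v(i := snd p)) l)"
     by (cases "l = i") (auto intro!: continuous_intros)
   qed auto
   thus ?thesis by (simp add: o_def case_prod_unfold)
  qed
  have der: "((%x. d i x v) has_derivative (%h. d (Suc i) x (v(i := h)))) (at x within S)" if x: "x \<in> S" for x
  proof (rule directional_imp_derivative[OF S cont_x[OF ik(2)] c _ x])
   fix x h assume x: "x \<in> interior S"
   let ?N = "(%t. x + t *\<^sub>R h) -` interior S"
   have N: "open ?N" "0 \<in> ?N" using x by (auto intro!: open_vimage continuous_intros)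
   have eq: "d i (x + t *\<^sub>R (v(i := h)) i) (v(i := h)) = d i (x + t *\<^sub>R h) v" if "t \<in> ?N" for t
    using dep[OF ik(2), of v "v(i := h)"] that interior_subset[of S] by (simp add: subset_iff)
   show "((%t. d i (x + t *\<^sub>R h) v) has_vector_derivative d (Suc i) x (v(i := h))) (at 0)"
    by (rule has_vector_derivative_transform_within_open[OF dd[OF ik(1) x, of "v(i := h)"] N eq])
  qed
  have "enat (Suc i + j) <= k" using Suc.prems by simp
  with der Suc.IH[of "Suc i"] show ?case
   unfolding iter_diff.simps by (intro exI[of _ "%x h. d (Suc i) x (v(i := h))"]) auto
 qed
 from this[of 0] show ?thesis unfolding Ck_Frechet_alt using H_cong[of S "%x. d 0 x _" f] d0 by auto
qed

lemma Ck_Frechet_imp_MB: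
 fixes f :: "'e::euclidean_space => 'b::real_normed_vector"
 assumes S: "half_open S" and f: "Ck_Frechet k S f"
 shows "Ck_MB k S f"
proof -
 \<comment> \<open>Iterated partial derivatives along a list of basis vectors, the head of the list
   being taken last.\<close>
 define D where "D = rec_list f (%b _ g x. frechet_derivative g (at x within S) (b::'e))"
 have D_simps: "D [] = f" "!!b bs. D (b # bs) = (%x. frechet_derivative (D bs) (at x within S) b)"
  by (simp_all add: D_def)
 have D_iter: "Hd 0 j S (D bs)" if "enat (length bs + j) <= k" for bs j
  using that
 proof (induction bs arbitrary: j)
  case Nil
  thus ?case using f by (simp add: D_simps Ck_Frechet_alt)
 next
  case (Cons b bs)
  have "Hd 0 (Suc j) S (D bs)" using Cons.IH[of "Suc j"] Cons.prems by (simp del: iter_diff.simps)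
  then obtain g' where g': "!!x. x \<in> S ==> (D bs has_derivative g' x) (at x within S)" "!!h. Hd 0 j S (%x. g' x h)"
   by auto
  have "frechet_derivative (D bs) (at x within S) = g' x" if "x \<in> S" for x
   using half_open_derivative_unique[OF S that g'(1)[OF that]] g'(1)[OF that]
   by (metis differentiableI frechet_derivative_works)
  thus ?case using g'(2)[of b] H_cong[of S "%x. g' x b" "D (b # bs)"] by (simp add: D_simps)
 qed
 have D_der: "(D bs has_derivative frechet_derivative (D bs) (at x within S)) (at x within S)"
  if "enat (Suc (length bs)) <= k" "x \<in> S" for bs x
 proof -
  have "Hd 0 1 S (D bs)" using that by (intro D_iter) simp
  hence "D bs differentiable (at x within S)" using that(2) by (auto intro: differentiableI)
  thus ?thesis by (simp add: frechet_derivative_works)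
 qed
 \<comment> \<open>The product of coordinates of \<open>v 0\<close>, \<open>v 1\<close>, ...,
   matched with the list from its end. The sum \<open>d\<close> below is the multilinear expansion
   of the j-th derivative; as a finite sum of such products it is jointly continuous in x and
   v.\<close>
 define cf where "cf = rec_list (%v. 1) (%b bs g v. g v * (v (length bs) \<bullet> (b::'e)))"
 have cf_simps: "cf [] = (%v. 1)" "!!b bs. cf (b # bs) = (%v. cf bs v * (v (length bs) \<bullet> b))"
  by (simp_all add: cf_def)
 define L where "L j = {bs. set bs \<subseteq> (Basis::'e set) & length bs = j}" for j
 have finL: "finite (L j)" for j unfolding L_def by (rule finite_lists_length_eq) simp
 have L_Suc: "L (Suc j) = (%(b, bs). b # bs) ` (Basis \<times> L j)" for j
  unfolding L_def by (auto simp: length_Suc_conv image_iff)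
 define d where "d j x v = (\<Sum>bs\<in>L j. cf bs v *\<^sub>R D bs x)" for j x v
 have cf_cont: "continuous_on UNIV (cf bs)" for bs
  by (induction bs) (auto simp: cf_simps intro!: continuous_intros continuous_on_product_coordinates)
 have "d 0 x v = f x" for x v
 proof -
  have "L 0 = {[]}" by (auto simp: L_def)
  thus ?thesis by (simp add: d_def cf_simps D_simps)
 qed
 moreover have "continuous_on (S \<times> UNIV) (%(x, v). d j x v)" if j: "enat j <= k" for j
 proof -
  have "continuous_on (S \<times> UNIV) (%p. cf bs (snd p) *\<^sub>R D bs (fst p))" if "bs \<in> L j" for bs
  proof -
   have "continuous_on S (D bs)" using D_iter[of bs 0] that j by (simp add: L_def loc_holder_zero)
   thus ?thesis
    by (intro continuous_on_scaleR continuous_on_compose2[OF cf_cont continuous_on_snd]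
      continuous_on_compose2[OF _ continuous_on_fst, of S "D bs"] continuous_on_id) auto
  qed
  thus ?thesis unfolding d_def case_prod_unfold by (rule continuous_on_sum)
 qed
 moreover have "((%t. d j (x + t *\<^sub>R v j) v) has_vector_derivative d (Suc j) x v) (at 0)"
  if j: "enat (Suc j) <= k" and x: "x \<in> interior S" for j x v
 proof -
  have xS: "x \<in> S" and at: "at x within S = at x" using x interior_subset at_within_interior by auto
  have sumeq: "d (Suc j) x v = (\<Sum>bs\<in>L j. cf bs v *\<^sub>R frechet_derivative (D bs) (at x within S) (v j))"
  proof -
   have "d (Suc j) x v = (\<Sum>p\<in>Basis \<times> L j. cf (fst p # snd p) v *\<^sub>R D (fst p # snd p) x)"
    unfolding d_def L_Suc by (subst sum.reindex) (auto simp: inj_on_def case_prod_unfold)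
   also have "\<dots> = (\<Sum>bs\<in>L j. \<Sum>b\<in>Basis. cf (b # bs) v *\<^sub>R D (b # bs) x)"
    by (subst sum.swap) (simp add: sum.cartesian_product case_prod_unfold)
   also have "\<dots> = (\<Sum>bs\<in>L j. cf bs v *\<^sub>R frechet_derivative (D bs) (at x within S) (v j))"
   proof (rule sum.cong[OF refl])
    fix bs assume bs: "bs \<in> L j"
    have "linear (frechet_derivative (D bs) (at x within S))"
     using D_der[of bs x] bs j xS by (auto simp: L_def intro: has_derivative_linear)
    from linear_basis_expansion[OF this, of "v j"] bs
    show "(\<Sum>b\<in>Basis. cf (b # bs) v *\<^sub>R D (b # bs) x) = cf bs v *\<^sub>R frechet_derivative (D bs) (at x within S) (v j)"
     by (simp add: cf_simps D_simps L_def scaleR_sum_right)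
   qed
   finally show ?thesis .
  qed
  have line: "((%t. x + t *\<^sub>R v j) has_derivative (%t. t *\<^sub>R v j)) (at 0)"
   by (auto intro!: derivative_eq_intros)
  have "((%t. cf bs v *\<^sub>R D bs (x + t *\<^sub>R v j)) has_derivative
    (%t. cf bs v *\<^sub>R frechet_derivative (D bs) (at x within S) (t *\<^sub>R v j))) (at 0)" if bs: "bs \<in> L j" for bs
  proof -
   have "(D bs has_derivative frechet_derivative (D bs) (at x within S)) (at ((%t. x + t *\<^sub>R v j) 0))"
    using D_der[of bs x] bs j xS at by (simp add: L_def)
   from diff_chain_at[OF line this] show ?thesis
    by (intro has_derivative_scaleR_right) (simp add: o_def)
  qed
  hence "((%t. \<Sum>bs\<in>L j. cf bs v *\<^sub>R D bs (x + t *\<^sub>R v j)) has_derivative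
    (%t. \<Sum>bs\<in>L j. cf bs v *\<^sub>R frechet_derivative (D bs) (at x within S) (t *\<^sub>R v j))) (at 0)"
   by (rule has_derivative_sum)
  moreover have "(\<Sum>bs\<in>L j. cf bs v *\<^sub>R frechet_derivative (D bs) (at x within S) (t *\<^sub>R v j)) = t *\<^sub>R d (Suc j) x v" for t
  proof -
   have "linear (frechet_derivative (D bs) (at x within S))" if "bs \<in> L j" for bs
    using D_der[of bs x] that j xS by (auto simp: L_def intro: has_derivative_linear)
   thus ?thesis unfolding sumeq scaleR_sum_right
    by (intro sum.cong refl) (simp add: linear_scale)
  qed
  ultimately show ?thesis unfolding has_vector_derivative_def d_def[symmetric] by simp
 qed
 ultimately show ?thesis unfolding Ck_MB_def by (intro exI[of _ d]) blast
qed

lemma Ck_MB_iff: "half_open S ==> Ck_MB k S f \<longleftrightarrow> Ck_Frechet k S f"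
 using Ck_MB_imp_Frechet Ck_Frechet_imp_MB by blast

abbreviation "L1 \<equiv> integrable lborel"

subsection \<open>Bump functions\<close>

text \<open>For t > 0 this is t^(-m) exp(-1/t). Derivatives stay in the linear span of the family,
  so one induction for all m gives smoothness.\<close>

definition flat_fun :: "nat => real => real" where
 "flat_fun m t = (if t <= 0 then 0 else inverse t ^ m * exp (- inverse t))"

lemma power_le_fact_exp:
 fixes x :: real
 assumes "x >= 0"
 shows "x ^ n <= fact n * exp x"
proof -
 have s: "(%n. x ^ n /\<^sub>R fact n) sums exp x" by (rule exp_converges)
 have "x ^ n /\<^sub>R fact n = (\<Sum>i\<in>{n}. x ^ i /\<^sub>R fact i)" by simp
 also have "\<dots> <= (\<Sum>i. x ^ i /\<^sub>R fact i)"
  by (rule sum_le_suminf) (use s assms in \<open>auto intro: sums_summable\<close>)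
 also have "\<dots> = exp x" using s by (simp add: sums_iff)
 finally show ?thesis by (simp add: field_simps)
qed

text \<open>With u = 1/t, the exponential series gives u^(m+2) <= (m+2)! exp u. A quadratic bound is
  what makes the derivative at 0 vanish.\<close>

lemma flat_fun_bound:
 obtains C where "C >= 0" "!!t. \<bar>flat_fun m t\<bar> <= C * t\<^sup>2"
proof -
 define C :: real where "C = fact (m + 2)"
 have "\<bar>flat_fun m t\<bar> <= C * t\<^sup>2" for t
 proof (cases "t <= 0")
  case False
  define u where "u = inverse t"
  have u: "u > 0" "t = inverse u" using False by (auto simp: u_def)
  have "u ^ (m + 2) <= C * exp u" using u unfolding C_def by (intro power_le_fact_exp) simp
  hence "u ^ (m + 2) * exp (- u) <= C * exp u * exp (- u)" by (intro mult_right_mono) auto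
  also have "\<dots> = C" by (simp add: exp_minus)
  finally have "u ^ m * exp (- u) * u\<^sup>2 <= C" by (simp add: power_add power2_eq_square mult_ac)
  hence "(u ^ m * exp (- u) * u\<^sup>2) * t\<^sup>2 <= C * t\<^sup>2" by (intro mult_right_mono) auto
  moreover have "(u ^ m * exp (- u) * u\<^sup>2) * t\<^sup>2 = u ^ m * exp (- u)"
  proof -
   have "u\<^sup>2 * t\<^sup>2 = 1" using u by (simp flip: power_mult_distrib)
   thus ?thesis by (simp only: mult.assoc mult_1_right)
  qed
  ultimately have "u ^ m * exp (- u) <= C * t\<^sup>2" by simp
  thus ?thesis using False by (simp add: flat_fun_def u_def)
 qed (simp add: flat_fun_def C_def)
 moreover have "C >= 0" by (simp add: C_def)
 ultimately show ?thesis using that by blast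
qed

lemma flat_fun_derivative:
 "(flat_fun m has_real_derivative - real m * flat_fun (m + 1) t + flat_fun (m + 2) t) (at t)"
proof -
 consider "t < 0" | "t = 0" | "t > 0" by linarith
 thus ?thesis
 proof cases
  case 1
  have "((%t. 0) has_real_derivative - real m * flat_fun (m + 1) t + flat_fun (m + 2) t) (at t)"
   using 1 by (simp add: flat_fun_def)
  thus ?thesis
   by (rule has_field_derivative_transform_within_open[where S = "{..<0}"]) (use 1 in \<open>auto simp: flat_fun_def\<close>)
 next
  case 2
  from flat_fun_bound[of m] obtain C where C: "C >= 0" "!!t. \<bar>flat_fun m t\<bar> <= C * t\<^sup>2" by metis
  have "((%h. (flat_fun m (0 + h) - flat_fun m 0) / h) \<longlongrightarrow> 0) (at 0)"
  proof (rule Lim_null_comparison)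
   show "\<forall>\<^sub>F h in at 0. norm ((flat_fun m (0 + h) - flat_fun m 0) / h) <= C * \<bar>h\<bar>"
   proof (rule always_eventually, rule)
    fix h show "norm ((flat_fun m (0 + h) - flat_fun m 0) / h) <= C * \<bar>h\<bar>"
    proof (cases "h = 0")
     case False
     have "flat_fun m 0 = 0" by (simp add: flat_fun_def)
     moreover have "h\<^sup>2 = \<bar>h\<bar> * \<bar>h\<bar>" by (simp add: power2_eq_square)
     ultimately show ?thesis using False C(2)[of h] by (simp add: divide_le_eq)
    qed simp
   qed
   show "((%h. C * \<bar>h\<bar>) \<longlongrightarrow> (0::real)) (at 0)" by (auto intro!: tendsto_eq_intros)
  qed
  hence "(flat_fun m has_real_derivative 0) (at 0)" by (simp add: DERIV_def)
  thus ?thesis using 2 by (simp add: flat_fun_def)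
 next
  case 3
  have "((%t. inverse t ^ m * exp (- inverse t)) has_real_derivative
    - real m * (inverse t ^ (m + 1) * exp (- inverse t)) + inverse t ^ (m + 2) * exp (- inverse t)) (at t)"
  proof -
   have u: "(inverse has_real_derivative - (inverse t)\<^sup>2) (at t)"
    using DERIV_inverse[of t] 3 by (simp add: power2_eq_square)
   have "((%t. inverse t ^ m) has_real_derivative real m * (- (inverse t)\<^sup>2 * inverse t ^ (m - Suc 0))) (at t)"
    by (rule DERIV_power[OF u])
   moreover have "((%t. exp (- inverse t)) has_real_derivative exp (- inverse t) * (inverse t)\<^sup>2) (at t)"
    by (rule derivative_eq_intros u refl | simp)+
   ultimately have "((%t. inverse t ^ m * exp (- inverse t)) has_real_derivative
     real m * (- (inverse t)\<^sup>2 * inverse t ^ (m - Suc 0)) * exp (- inverse t) + exp (- inverse t) * (inverse t)\<^sup>2 * inverse t ^ m) (at t)"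
    by (rule DERIV_mult)
   thus ?thesis by (cases m) (simp_all add: power2_eq_square algebra_simps)
  qed
  hence "((%t. inverse t ^ m * exp (- inverse t)) has_real_derivative - real m * flat_fun (m + 1) t + flat_fun (m + 2) t) (at t)"
   using 3 by (simp add: flat_fun_def)
  thus ?thesis
   by (rule has_field_derivative_transform_within_open[where S = "{0<..}"]) (use 3 in \<open>auto simp: flat_fun_def\<close>)
 qed
qed

lemma flat_fun_smooth: "smooth_on UNIV (flat_fun m)"
 unfolding smooth_on_def
proof
 fix j show "Hd 0 j UNIV (flat_fun m)"
 proof (induction j arbitrary: m)
  case 0
  have "continuous_on UNIV (flat_fun m)"
   by (meson DERIV_isCont continuous_at_imp_continuous_on flat_fun_derivative)
  thus ?case by (simp add: loc_holder_zero)
 next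
  case (Suc j)
  have "Hd 0 j UNIV (%t. (- real m * flat_fun (m + 1) t + flat_fun (m + 2) t) * h)" for h :: real
   by (intro H_linear[OF bounded_linear_mult_left] H_add H_linear[OF bounded_linear_mult_right] Suc.IH)
  moreover have "(flat_fun m has_derivative (%h. (- real m * flat_fun (m + 1) t + flat_fun (m + 2) t) * h)) (at t)" for t
   using flat_fun_derivative[of m t] by (simp add: has_field_derivative_def)
  ultimately show ?case unfolding iter_diff.simps
   by (intro exI[of _ "%t h. (- real m * flat_fun (m + 1) t + flat_fun (m + 2) t) * h"]) auto
 qed
qed

lemma half_open_UNIV: "half_open UNIV"
 by (simp add: open_half_open)

text \<open>The quotient p / (p + p'), where p vanishes outside radius r and p' inside radius r/2,
  so that the denominator is positive. Both depend on the squared distance, which is smooth at the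
  centre.\<close>

lemma euclidean_bump:
 fixes a :: "'e::euclidean_space"
 assumes r: "r > 0"
 obtains e :: "'e => real" where "smooth_on UNIV e" "!!x. 0 <= e x" "!!x. e x <= 1"
  "!!x. dist a x <= r/2 ==> e x = 1" "!!x. dist a x >= r ==> e x = 0"
proof -
 define q where "q = (%x. (x - a) \<bullet> (x - a))"
 define p where "p = (%x. flat_fun 0 (r\<^sup>2 - q x))"
 define p' where "p' = (%x. flat_fun 0 (q x - (r/2)\<^sup>2))"
 define e where "e = (%x. p x * inverse (p x + p' x))"
 have sq: "smooth_on UNIV q"
 proof -
  have "smooth_on UNIV (%x. x - a)"
   using smooth_on_add[OF smooth_on_ident smooth_on_const[of _ "-a"]] by simp
  hence "smooth_on UNIV (%x. (x - a) \<bullet> i)" for i by (rule smooth_on_linear[OF bounded_linear_inner_left])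
  hence "smooth_on UNIV (%x. \<Sum>i\<in>Basis. ((x - a) \<bullet> i) * ((x - a) \<bullet> i))"
   by (intro smooth_on_sum smooth_on_mult half_open_UNIV)
  thus ?thesis unfolding q_def by (subst euclidean_inner) 
 qed
 have sp: "smooth_on UNIV p"
 proof -
  have "smooth_on UNIV (%x. r\<^sup>2 + - q x)"
   by (intro smooth_on_add smooth_on_const smooth_on_linear[OF bounded_linear_minus[OF bounded_linear_ident]] sq)
  from smooth_on_compose[OF half_open_UNIV half_open_UNIV subset_UNIV this flat_fun_smooth[of 0]]
  show ?thesis by (simp add: p_def)
 qed
 have sp': "smooth_on UNIV p'"
 proof -
  have "smooth_on UNIV (%x. q x + - (r/2)\<^sup>2)"
   by (intro smooth_on_add smooth_on_const sq)
  from smooth_on_compose[OF half_open_UNIV half_open_UNIV subset_UNIV this flat_fun_smooth[of 0]]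
  show ?thesis by (simp add: p'_def)
 qed
 have qd: "q x = (dist a x)\<^sup>2" for x
  by (simp add: q_def dist_norm power2_norm_eq_inner inner_diff_left inner_diff_right inner_commute)
 have pos: "p x >= 0" "p' x >= 0" for x by (auto simp: p_def p'_def flat_fun_def)
 have r2: "(r/2)\<^sup>2 < r\<^sup>2" using r by (simp add: power2_eq_square)
 have pp: "p x + p' x > 0" for x
 proof (cases "q x < r\<^sup>2")
  case True
  hence "p x > 0" by (simp add: p_def flat_fun_def)
  with pos[of x] show ?thesis by simp
 next
  case False
  hence "p' x > 0" using r2 by (simp add: p'_def flat_fun_def)
  with pos[of x] show ?thesis by simp
 qed
 show ?thesis
 proof (rule that[of e])
  show "smooth_on UNIV e" unfolding e_def
  proof (intro smooth_on_mult smooth_on_inverse half_open_UNIV sp smooth_on_add sp')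
   show "p x + p' x ~= 0" for x using pp[of x] by simp
  qed
  show "0 <= e x" for x using pos[of x] pp[of x] by (simp add: e_def)
  show "e x <= 1" for x using pos[of x] pp[of x] by (simp add: e_def field_simps)
  show "e x = 1" if "dist a x <= r/2" for x
  proof -
   have "(dist a x)\<^sup>2 <= (r/2)\<^sup>2" using that by (intro power_mono) auto
   hence "p' x = 0" by (simp add: p'_def flat_fun_def qd)
   with pp[of x] show ?thesis by (simp add: e_def)
  qed
  show "e x = 0" if "dist a x >= r" for x
  proof -
   have "r\<^sup>2 <= (dist a x)\<^sup>2" using that r by (intro power_mono) auto
   thus ?thesis by (simp add: e_def p_def flat_fun_def qd)
  qed
 qed
qed

subsection \<open>Test functions\<close>

definition pd :: "'e::euclidean_space => ('e => real) => 'e => real" where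
 "pd b \<psi> x = frechet_derivative \<psi> (at x) b"

lemma iter_partial_simps: "iter_partial [] \<psi> = \<psi>" "iter_partial (b # bs) \<psi> = pd b (iter_partial bs \<psi>)"
 "iter_partial (bs @ [b]) \<psi> = iter_partial bs (pd b \<psi>)"
 by (auto simp: iter_partial_def pd_def[abs_def])

lemma test_function_alt:
 "test_function Om \<psi> \<longleftrightarrow> smooth_on UNIV \<psi> & (\<exists>K. compact K & K \<subseteq> Om & (\<forall>x. x \<notin> K --> \<psi> x = 0))"
 by (simp add: test_function_def Ck_Frechet_infinity)

lemma pd_eq: "(\<psi> has_derivative D) (at x) ==> pd b \<psi> x = D b"
 unfolding pd_def by (metis frechet_derivative_at)

lemma smooth_has_derivative:
 assumes "smooth_on UNIV (\<psi> :: 'e::euclidean_space => real)"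
 shows "(\<psi> has_derivative (%h. pd h \<psi> x)) (at x)" "smooth_on UNIV (pd b \<psi>)"
proof -
 from smooth_on_derivative[OF half_open_UNIV assms] obtain f' where
  f': "!!x. (\<psi> has_derivative f' x) (at x)" "!!v. smooth_on UNIV (%x. f' x v)" by auto
 have "pd h \<psi> x = f' x h" for x h using pd_eq f' by blast
 hence eq: "pd h \<psi> = (%x. f' x h)" for h by auto
 with f' show "(\<psi> has_derivative (%h. pd h \<psi> x)) (at x)" "smooth_on UNIV (pd b \<psi>)" by auto
qed

lemma pd_zero_outside:
 assumes "closed K" "!!x. x \<notin> K ==> \<psi> x = 0" "x \<notin> K"
 shows "pd b \<psi> x = 0"
proof -
 have "((%x. 0) has_derivative (%h. 0)) (at x)" by simp
 hence "(\<psi> has_derivative (%h. 0)) (at x)"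
  by (rule has_derivative_transform_within_open[where s = "- K"]) (use assms in auto)
 thus ?thesis using pd_eq by blast
qed

lemma test_function_pd: "test_function Om \<psi> ==> test_function Om (pd b \<psi>)"
 unfolding test_function_alt using smooth_has_derivative(2) pd_zero_outside compact_imp_closed by metis

lemma test_function_iter: "test_function Om \<psi> ==> test_function Om (iter_partial bs \<psi>)"
 by (induction bs) (auto simp: iter_partial_simps test_function_pd)

lemma test_function_mono: "test_function Om \<psi> ==> Om \<subseteq> Om' ==> test_function Om' \<psi>"
 unfolding test_function_alt by blast

lemma test_function_zero: "test_function Om \<psi> ==> x \<notin> Om ==> \<psi> x = 0"
 unfolding test_function_alt by blast

lemma compact_support_uniformly_continuous:
 fixes f :: "'e::euclidean_space => 'b::real_normed_vector"
 assumes "continuous_on UNIV f" "compact K" "!!x. x \<notin> K ==> f x = 0"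
 shows "uniformly_continuous_on UNIV f"
 unfolding uniformly_continuous_on_def
proof (intro allI impI)
 fix e :: real assume e: "e > 0"
 from compact_imp_bounded[OF \<open>compact K\<close>] obtain R where "\<forall>x\<in>K. norm x <= R" unfolding bounded_iff by blast
 hence R: "K \<subseteq> cball 0 R" by auto
 have "uniformly_continuous_on (cball 0 (R + 1)) f"
  using assms(1) by (intro compact_uniformly_continuous) (auto intro: continuous_on_subset)
 with e obtain d where d: "d > 0" "!!x y. x \<in> cball 0 (R+1) ==> y \<in> cball 0 (R+1) ==> dist y x < d ==> dist (f y) (f x) < e"
  unfolding uniformly_continuous_on_def by metis
 have "dist (f y) (f x) < e" if "dist y x < min d 1" for x y
 proof (cases "x \<in> cball 0 (R+1) & y \<in> cball 0 (R+1)")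
  case True
  with d that show ?thesis by auto
 next
  case False
  have "norm x <= norm y + dist y x" "norm y <= norm x + dist y x"
   by (metis dist_commute dist_norm norm_triangle_sub, metis dist_norm norm_triangle_sub)
  with False that have "norm x > R" "norm y > R" by auto
  hence "x \<notin> K" "y \<notin> K" using R by auto
  with assms(3) e show ?thesis by simp
 qed
 with d show "\<exists>d>0. \<forall>x\<in>UNIV. \<forall>x'\<in>UNIV. dist x' x < d --> dist (f x') (f x) < e"
  by (intro exI[of _ "min d 1"]) auto
qed

lemma compact_support_bounded:
 fixes f :: "'e::euclidean_space => 'b::real_normed_vector"
 assumes "continuous_on UNIV f" "compact K" "!!x. x \<notin> K ==> f x = 0"
 obtains C where "C >= 0" "!!x. norm (f x) <= C"
proof -
 have "bounded (f ` K)" using assms by (meson compact_continuous_image compact_imp_bounded continuous_on_subset subset_UNIV)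
 then obtain C where "!!x. x \<in> K ==> norm (f x) <= C" by (auto simp: bounded_iff)
 hence "norm (f x) <= \<bar>C\<bar>" for x using assms(3)[of x] by (cases "x \<in> K") force+
 thus ?thesis using that[of "\<bar>C\<bar>"] by simp
qed

text \<open>Compact support makes the first order expansion uniform in x, as needed to differentiate
  under the integral in \<open>conv_has_derivative\<close>.\<close>

lemma uniform_taylor:
 assumes \<psi>: "smooth_on UNIV (\<psi> :: 'e::euclidean_space => real)" "compact K" "!!x. x \<notin> K ==> \<psi> x = 0" and e: "e > 0"
 obtains d where "d > 0" "!!x h. norm h < d ==> \<bar>\<psi> (x + h) - \<psi> x - pd h \<psi> x\<bar> <= e * norm h"
proof -
 have "uniformly_continuous_on UNIV (pd i \<psi>)" for i
  using smooth_on_continuous[OF smooth_has_derivative(2)[OF \<psi>(1)]] \<psi>(2) pd_zero_outside[OF compact_imp_closed[OF \<psi>(2)] \<psi>(3)]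
  by (rule compact_support_uniformly_continuous)
 moreover define e' where "e' = e / DIM('e)"
 moreover have e': "e' > 0" using e by (simp add: e'_def)
 ultimately have "\<exists>d>0. \<forall>x y. dist y x < d --> \<bar>pd i \<psi> y - pd i \<psi> x\<bar> < e'" for i
  unfolding uniformly_continuous_on_def dist_real_def by blast
 then obtain d where d: "!!i. d i > 0" "!!i x y. dist y x < d i ==> \<bar>pd i \<psi> y - pd i \<psi> x\<bar> < e'" by metis
 define D where "D = Min (d ` Basis)"
 have D: "D > 0" unfolding D_def using d by (subst Min_gr_iff) auto
 have lin: "linear (%h. pd h \<psi> x)" for x using smooth_has_derivative(1)[OF \<psi>(1)] has_derivative_linear by blast
 have on: "onorm (%h. pd h \<psi> y - pd h \<psi> x) <= e" if "dist y x < D" for x y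
 proof -
  have "\<bar>pd i \<psi> y - pd i \<psi> x\<bar> <= e'" if i: "i \<in> Basis" for i
  proof -
   have "D <= d i" using i unfolding D_def by (intro Min_le) auto
   thus ?thesis using d(2)[of y x i] \<open>dist y x < D\<close> by auto
  qed
  with onorm_basis_bound[OF linear_compose_sub[OF lin[of y] lin[of x]], of "%i. e'"] show ?thesis
   using e by (simp add: e'_def)
 qed
 show ?thesis
 proof (rule that[OF D])
  fix x h :: 'e assume h: "norm h < D"
  have "norm (\<psi> (x + h) - \<psi> x - (%h. pd h \<psi> x) (x + h - x)) <= norm (x + h - x) * e"
  proof (rule differentiable_bound_linearization[where S = "ball x D" and f' = "%y h. pd h \<psi> y"])
   show "x + t *\<^sub>R (x + h - x) \<in> ball x D" if "t \<in> {0..1}" for t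
   proof -
    have "\<bar>t\<bar> * norm h <= 1 * norm h" using that by (intro mult_right_mono) auto
    with h show ?thesis by (simp add: dist_norm)
   qed
   show "(\<psi> has_derivative (%h. pd h \<psi> y)) (at y within ball x D)" for y
    using smooth_has_derivative(1)[OF \<psi>(1)] has_derivative_at_withinI by blast
   show "onorm ((%h. pd h \<psi> y) - (%h. pd h \<psi> x)) <= e" if "y \<in> ball x D" for y
    using on[of y x] that by (simp add: dist_commute fun_diff_def)
  qed (use D in auto)
  thus "\<bar>\<psi> (x + h) - \<psi> x - pd h \<psi> x\<bar> <= e * norm h" by (simp add: mult.commute)
 qed
qed

lemma lborel_integral_translate:
 fixes f :: "'e::euclidean_space => 'b::euclidean_space"
 assumes [measurable]: "f \<in> borel_measurable borel"
 shows "integral\<^sup>L lborel (%x. f (c + x)) = integral\<^sup>L lborel f"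
  "L1 (%x. f (c + x)) \<longleftrightarrow> L1 f"
proof -
 have "integral\<^sup>L lborel f = integral\<^sup>L (distr lborel borel ((+) c)) f" by (simp add: lborel_distr_plus)
 also have "\<dots> = integral\<^sup>L lborel (%x. f (c + x))" by (rule integral_distr) auto
 finally show "integral\<^sup>L lborel (%x. f (c + x)) = integral\<^sup>L lborel f" by simp
 have "L1 f = integrable (distr lborel borel ((+) c)) f" by (simp add: lborel_distr_plus)
 also have "\<dots> = L1 (%x. f (c + x))" by (rule integrable_distr_eq) auto
 finally show "L1 (%x. f (c + x)) \<longleftrightarrow> L1 f" by simp
qed

lemma integrable_bounded_indicator:
 fixes K :: "'e::euclidean_space set"
 assumes "K \<in> sets borel" "bounded K"
 shows "L1 (%x. indicator K x * (C::real))"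
proof -
 have "L1 (indicator K :: 'e => real)"
  by (rule integrable_real_indicator) (use assms emeasure_bounded_finite in auto)
 thus ?thesis by (rule integrable_mult_left)
qed

lemma integrable_compact_support:
 fixes f :: "'e::euclidean_space => 'b::euclidean_space"
 assumes "continuous_on UNIV f" "compact K" "!!x. x \<notin> K ==> f x = 0"
 shows "L1 f"
proof -
 from compact_support_bounded[OF assms] obtain C where C: "C >= 0" "!!x. norm (f x) <= C" by metis
 have m: "f \<in> borel_measurable borel" using assms(1) by (rule borel_measurable_continuous_onI)
 have "L1 (%x. indicator K x * C)"
  by (rule integrable_bounded_indicator) (use assms(2) compact_imp_bounded borel_compact in auto)
 thus ?thesis
 proof (rule Bochner_Integration.integrable_bound)
  show "AE x in lborel. norm (f x) <= norm (indicator K x * C)"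
   using C assms(3) by (intro always_eventually) (auto simp: indicator_def)
 qed (use m in simp)
qed

text \<open>Convolution with the reflected kernel x -> rho(-x). The reflection makes y -> rho(y - x)
  a test function in y and causes the minus sign in \<open>conv_has_derivative\<close>.\<close>

definition conv :: "('e::euclidean_space => real) => ('e => real) => 'e => real" where
 "conv \<rho> u x = (LINT y|lborel. \<rho> (y - x) * u y)"

definition kernel :: "real => ('e::euclidean_space => real) => bool" where
 "kernel eps \<rho> \<longleftrightarrow> smooth_on UNIV \<rho> & (\<forall>x. eps < norm x --> \<rho> x = 0)"

lemma kernelD:
 assumes "kernel eps \<rho>"
 shows "smooth_on UNIV \<rho>" "continuous_on UNIV \<rho>" "\<rho> \<in> borel_measurable borel" "L1 \<rho>" "x \<notin> cball 0 eps ==> \<rho> x = 0"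
  "\<exists>C\<ge>0. \<forall>x. \<bar>\<rho> x\<bar> <= C" "kernel eps (pd b \<rho>)"
proof -
 show s: "smooth_on UNIV \<rho>" using assms by (simp add: kernel_def)
 thus c: "continuous_on UNIV \<rho>" by (rule smooth_on_continuous)
 thus "\<rho> \<in> borel_measurable borel" by (rule borel_measurable_continuous_onI)
 show z: "\<rho> x = 0" if "x \<notin> cball 0 eps" for x using assms that by (auto simp: kernel_def not_le)
 show "L1 \<rho>" by (rule integrable_compact_support[OF c compact_cball z])
 show "\<exists>C\<ge>0. \<forall>x. \<bar>\<rho> x\<bar> <= C" using compact_support_bounded[OF c compact_cball z] unfolding real_norm_def by metis
 have "pd b \<rho> x = 0" if "eps < norm x" for x using that by (intro pd_zero_outside[of "cball 0 eps"] z) auto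
 with smooth_has_derivative(2)[OF s] show "kernel eps (pd b \<rho>)" by (simp add: kernel_def)
qed

lemma conv_integrable:
 assumes k: "kernel eps \<rho>" and u: "L1 u"
 shows "L1 (%y. \<rho> (y - x) * u y)"
proof -
 obtain C where C: "!!x. \<bar>\<rho> x\<bar> <= C" using kernelD(6)[OF k] by blast
 note [measurable] = kernelD(3)[OF k]
 show ?thesis
 proof (rule Bochner_Integration.integrable_bound[OF integrable_mult_right[OF u, of C]])
  show "AE y in lborel. norm (\<rho> (y - x) * u y) <= norm (C * u y)"
  proof (rule always_eventually, rule)
   fix y
   have "\<bar>\<rho> (y - x)\<bar> * \<bar>u y\<bar> <= \<bar>C\<bar> * \<bar>u y\<bar>" using C[of "y - x"] by (intro mult_right_mono) auto
   thus "norm (\<rho> (y - x) * u y) <= norm (C * u y)" by (simp add: abs_mult)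
  qed
  show "(%y. \<rho> (y - x) * u y) \<in> borel_measurable lborel" using u by simp
 qed
qed

lemma conv_has_derivative:
 fixes u :: "'e::euclidean_space => real"
 assumes k: "kernel eps \<rho>" and u: "L1 u"
 shows "(conv \<rho> u has_derivative (%h. - conv (pd h \<rho>) u x)) (at x)"
 unfolding has_derivative_at_alt
proof (intro conjI allI impI)
 have lin: "linear (%h. pd h \<rho> y)" for y
  using smooth_has_derivative(1)[OF kernelD(1)[OF k]] has_derivative_linear by blast
 note int = conv_integrable[OF kernelD(7)[OF k] u]
 have "linear (%h. - conv (pd h \<rho>) u x)"
 proof (rule linearI)
  show "- conv (pd (a + b) \<rho>) u x = - conv (pd a \<rho>) u x + - conv (pd b \<rho>) u x" for a b
   using int[of a x] int[of b x] linear_add[OF lin] by (simp add: conv_def distrib_right)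
  show "- conv (pd (r *\<^sub>R b) \<rho>) u x = r *\<^sub>R (- conv (pd b \<rho>) u x)" for r b
   using linear_scale[OF lin] by (simp add: conv_def mult.assoc)
 qed
 thus "bounded_linear (%h. - conv (pd h \<rho>) u x)" by (simp add: linear_conv_bounded_linear)
 fix e :: real assume e: "e > 0"
 define N where "N = (LINT y|lborel. \<bar>u y\<bar>)"
 have N: "N >= 0" by (simp add: N_def)
 have "e / (N + 1) > 0" using e N by simp
 from uniform_taylor[OF kernelD(1)[OF k] compact_cball kernelD(5)[OF k] this]
 obtain d where d: "d > 0" "!!x h. norm h < d ==> \<bar>\<rho> (x + h) - \<rho> x - pd h \<rho> x\<bar> <= e / (N + 1) * norm h" by blast
 show "\<exists>d>0. \<forall>y. norm (y - x) < d --> norm (conv \<rho> u y - conv \<rho> u x - - conv (pd (y - x) \<rho>) u x) <= e * norm (y - x)"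
 proof (intro exI[of _ d] conjI allI impI)
  fix z assume z: "norm (z - x) < d"
  have pdm: "pd (x - z) \<rho> y = - pd (z - x) \<rho> y" for y using linear_neg[OF lin, of "z - x"] by simp
  have "conv \<rho> u z - conv \<rho> u x - - conv (pd (z - x) \<rho>) u x =
   (LINT y|lborel. (\<rho> ((y - x) + (x - z)) - \<rho> (y - x) - pd (x - z) \<rho> (y - x)) * u y)"
   using conv_integrable[OF k u, of x] conv_integrable[OF k u, of z] int[of "z - x" x]
   by (simp add: conv_def pdm left_diff_distrib distrib_right)
  also have "norm \<dots> <= (LINT y|lborel. (e / (N + 1) * norm (z - x)) * \<bar>u y\<bar>)"
  proof (rule Bochner_Integration.integral_norm_bound_integral)
   show "L1 (%y. (\<rho> ((y - x) + (x - z)) - \<rho> (y - x) - pd (x - z) \<rho> (y - x)) * u y)"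
    using conv_integrable[OF k u, of x] conv_integrable[OF k u, of z] int[of "x - z" x] by (simp add: left_diff_distrib)
   show "norm ((\<rho> ((y - x) + (x - z)) - \<rho> (y - x) - pd (x - z) \<rho> (y - x)) * u y) <= e / (N + 1) * norm (z - x) * \<bar>u y\<bar>" for y
    using mult_right_mono[OF d(2)[of "x - z" "y - x"], of "\<bar>u y\<bar>"] z by (simp add: abs_mult norm_minus_commute)
  qed (use u in auto)
  also have "\<dots> = e * norm (z - x) * (N / (N + 1))" by (simp add: N_def[symmetric])
  also have "\<dots> <= e * norm (z - x) * 1" using e N by (intro mult_left_mono) auto
  finally show "norm (conv \<rho> u z - conv \<rho> u x - - conv (pd (z - x) \<rho>) u x) <= e * norm (z - x)" by simp
 qed (rule d)
qed

text \<open>Convolving psi with the indicator of a large ball gives, near 0, the constant integral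
  of psi by translation invariance. Its derivative is 0 on the one hand and minus the integral of
  \<open>pd b \<psi>\<close> on the other.\<close>

lemma integral_pd_zero:
 fixes \<psi> :: "'e::euclidean_space => real"
 assumes \<psi>: "smooth_on UNIV \<psi>" "compact K" "!!x. x \<notin> K ==> \<psi> x = 0"
 shows "integral\<^sup>L lborel (pd b \<psi>) = 0"
proof -
 from compact_imp_bounded[OF \<psi>(2)] obtain R where R: "!!x. x \<in> K ==> norm x <= R" unfolding bounded_iff by blast
 have k: "kernel R \<psi>" unfolding kernel_def using \<psi> R by force
 \<comment> \<open>Radius R + 1 makes u equal to 1 on the support of every translate by a vector of
   the unit ball.\<close>
 define u :: "'e => real" where "u = indicator (cball 0 (R + 1))"
 have u: "L1 u" unfolding u_def
  by (rule integrable_real_indicator) (use emeasure_bounded_finite[OF bounded_cball] in auto)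
 have 1: "conv \<sigma> u x = integral\<^sup>L lborel \<sigma>" if \<sigma>: "kernel R \<sigma>" and x: "x \<in> ball 0 1" for \<sigma> x
 proof -
  have eq: "\<sigma> (y - x) * u y = \<sigma> (- x + y)" for y
  proof (cases "y \<in> cball 0 (R + 1)")
   case False
   hence "R < norm (y - x)" using x norm_triangle_ineq2[of y x] by auto
   thus ?thesis using \<sigma> False by (simp add: kernel_def u_def)
  qed (simp add: u_def)
  show ?thesis unfolding conv_def eq by (rule lborel_integral_translate(1)[OF kernelD(3)[OF \<sigma>]])
 qed
 have "((%x. integral\<^sup>L lborel \<psi>) has_derivative (%h. - conv (pd h \<psi>) u 0)) (at 0)"
  by (rule has_derivative_transform_within_open[OF conv_has_derivative[OF k u] open_ball[of 0 1]]) (use 1[OF k] in auto)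
 hence "(%h. - conv (pd h \<psi>) u 0) = (%h. 0)" using has_derivative_unique[OF _ has_derivative_const] by blast
 from fun_cong[OF this, of b] show ?thesis using 1[OF kernelD(7)[OF k], of 0] by simp
qed

subsection \<open>Sobolev functions\<close>

lemma weak_partial_alt:
 "weak_partial Om bs u g \<longleftrightarrow> (\<forall>\<psi>. test_function Om \<psi> -->
   integral\<^sup>L lborel (%x. iter_partial bs \<psi> x *\<^sub>R u x) = (-1) ^ length bs *\<^sub>R integral\<^sup>L lborel (%x. \<psi> x *\<^sub>R g x))"
proof -
 have "(%x. indicator Om x *\<^sub>R (\<psi> x *\<^sub>R u x)) = (%x. \<psi> x *\<^sub>R u x)" if "test_function Om \<psi>" for \<psi> and u :: "'a => 'b"
  using test_function_zero[OF that] by (auto simp: indicator_def fun_eq_iff)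
 thus ?thesis unfolding weak_partial_def set_lebesgue_integral_def
  by (simp add: test_function_iter cong: imp_cong)
qed

lemma weak_partial_single:
 "weak_partial Om [b] u g \<longleftrightarrow> (\<forall>\<psi>. test_function Om \<psi> -->
   integral\<^sup>L lborel (%x. pd b \<psi> x *\<^sub>R u x) = - integral\<^sup>L lborel (%x. \<psi> x *\<^sub>R g x))"
 unfolding weak_partial_alt by (simp add: iter_partial_simps)

lemma weak_partial_mono: "weak_partial Om bs u g ==> Om' \<subseteq> Om ==> weak_partial Om' bs u g"
 unfolding weak_partial_alt using test_function_mono by blast

lemma weak_partial_cong:
 assumes "!!x. x \<in> Om ==> u x = u' x" "!!x. x \<in> Om ==> g x = g' x"
 shows "weak_partial Om bs u g \<longleftrightarrow> weak_partial Om bs u' g'"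
proof -
 have eq: "(%x. \<psi> x *\<^sub>R v x) = (%x. \<psi> x *\<^sub>R v' x)"
  if "test_function Om \<psi>" "!!x. x \<in> Om ==> v x = v' x" for \<psi> and v v' :: "'a => 'b"
 proof
  fix x show "\<psi> x *\<^sub>R v x = \<psi> x *\<^sub>R v' x"
   using test_function_zero[OF that(1), of x] that(2)[of x] by (cases "x \<in> Om") auto
 qed
 have "test_function Om \<psi> ==> (%x. \<psi> x *\<^sub>R g x) = (%x. \<psi> x *\<^sub>R g' x)" for \<psi> by (rule eq[OF _ assms(2)])
 moreover have "test_function Om \<psi> ==> (%x. iter_partial bs \<psi> x *\<^sub>R u x) = (%x. iter_partial bs \<psi> x *\<^sub>R u' x)" for \<psi>
  by (rule eq[OF test_function_iter assms(1)])
 ultimately show ?thesis unfolding weak_partial_alt by (simp cong: imp_cong)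
qed

lemma in_Lp_alt:
 "in_Lp p Om u \<longleftrightarrow> (%x. indicator Om x *\<^sub>R u x) \<in> borel_measurable borel & L1 (%x. indicator Om x *\<^sub>R norm (u x) powr p)"
 by (simp add: in_Lp_def set_borel_measurable_def set_integrable_def)

lemma in_Lp_cong: "(!!x. x \<in> Om ==> u x = v x) ==> in_Lp p Om u \<longleftrightarrow> in_Lp p Om v"
proof -
 assume "!!x. x \<in> Om ==> u x = v x"
 hence "(%x. indicator Om x *\<^sub>R u x) = (%x. indicator Om x *\<^sub>R v x)"
  "(%x. indicator Om x *\<^sub>R norm (u x) powr p) = (%x. indicator Om x *\<^sub>R norm (v x) powr p)"
  by (auto simp: indicator_def fun_eq_iff)
 thus ?thesis unfolding in_Lp_alt by (simp only:)
qed

lemma in_Lp_mono: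
 assumes "in_Lp p Om u" "Om' \<subseteq> Om" "Om' \<in> sets borel"
 shows "in_Lp p Om' u"
proof -
 have eq: "indicator Om' x *\<^sub>R w = indicator Om' x *\<^sub>R (indicator Om x *\<^sub>R w)" for x and w :: "'c::real_vector"
  using assms(2) by (auto simp: indicator_def)
 from assms(1) have m: "(%x. indicator Om x *\<^sub>R u x) \<in> borel_measurable borel"
  and i: "L1 (%x. indicator Om x *\<^sub>R norm (u x) powr p)" by (auto simp: in_Lp_alt)
 note [measurable] = m assms(3)
 show ?thesis unfolding in_Lp_alt
 proof
  have "(%x. indicator Om' x *\<^sub>R (indicator Om x *\<^sub>R u x)) \<in> borel_measurable borel" by measurable
  thus "(%x. indicator Om' x *\<^sub>R u x) \<in> borel_measurable borel" by (subst eq)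
  have "L1 (%x. indicator Om' x *\<^sub>R (indicator Om x *\<^sub>R norm (u x) powr p))"
   by (rule integrable_mult_indicator[OF _ i]) (use assms(3) in simp)
  thus "L1 (%x. indicator Om' x *\<^sub>R norm (u x) powr p)" by (subst eq)
 qed
qed

lemma le_one_plus_powr: "0 <= (t::real) ==> 1 <= p ==> t <= 1 + t powr p"
proof (cases "t <= 1")
 case False
 assume "0 <= t" "1 <= p"
 with False have "t powr 1 <= t powr p" by (intro powr_mono) auto
 with False show ?thesis by simp
next
 case True
 have "0 <= t powr p" by simp
 with True show ?thesis by linarith
qed

lemma powr_add_le:
 fixes a b :: "'a::real_normed_vector"
 assumes "0 <= p"
 shows "norm (a + b) powr p <= 2 powr p * (norm a powr p + norm b powr p)"
proof -
 have "norm (a + b) powr p <= (2 * max (norm a) (norm b)) powr p"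
  using norm_triangle_ineq[of a b] assms by (intro powr_mono2) auto
 also have "\<dots> = 2 powr p * max (norm a) (norm b) powr p" by (simp add: powr_mult)
 also have "\<dots> <= 2 powr p * (norm a powr p + norm b powr p)"
  by (intro mult_left_mono) (auto simp: max_def)
 finally show ?thesis .
qed

text \<open>Since t <= 1 + t^p, the product is dominated by a constant on the compact support plus a
  multiple of |u|^p.\<close>

lemma test_mult_integrable:
 fixes \<psi> :: "'e::euclidean_space => real" and u :: "'e => 'b::euclidean_space"
 assumes p: "1 <= p" and u: "in_Lp p Om u" and \<psi>: "test_function Om \<psi>"
 shows "L1 (%x. \<psi> x *\<^sub>R u x)"
proof -
 from \<psi> obtain K where K: "compact K" "K \<subseteq> Om" "!!x. x \<notin> K ==> \<psi> x = 0" and c: "continuous_on UNIV \<psi>"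
  unfolding test_function_alt using smooth_on_continuous by blast
 from compact_support_bounded[OF c K(1,3)] obtain C where C: "C >= 0" "!!x. norm (\<psi> x) <= C" by metis
 have [measurable]: "\<psi> \<in> borel_measurable borel" using c by (rule borel_measurable_continuous_onI)
 from u have [measurable]: "(%x. indicator Om x *\<^sub>R u x) \<in> borel_measurable borel"
  and i: "L1 (%x. indicator Om x *\<^sub>R norm (u x) powr p)" by (auto simp: in_Lp_alt)
 have eq: "(%x. \<psi> x *\<^sub>R u x) = (%x. \<psi> x *\<^sub>R (indicator Om x *\<^sub>R u x))"
  using K by (auto simp: indicator_def fun_eq_iff)
 have "L1 (%x. indicator K x * C + C * (indicator Om x *\<^sub>R norm (u x) powr p))"
  by (intro Bochner_Integration.integrable_add integrable_bounded_indicator integrable_mult_right i)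
    (use K compact_imp_bounded borel_compact in auto)
 thus ?thesis
 proof (rule Bochner_Integration.integrable_bound)
  show "(%x. \<psi> x *\<^sub>R u x) \<in> borel_measurable lborel" unfolding eq by measurable
  show "AE x in lborel. norm (\<psi> x *\<^sub>R u x) <= norm (indicator K x * C + C * (indicator Om x *\<^sub>R norm (u x) powr p))"
  proof (rule always_eventually, rule)
   fix x
   show "norm (\<psi> x *\<^sub>R u x) <= norm (indicator K x * C + C * (indicator Om x *\<^sub>R norm (u x) powr p))"
   proof (cases "x \<in> K")
    case True
    have "norm (\<psi> x *\<^sub>R u x) <= C * (1 + norm (u x) powr p)"
     using C p by (auto intro!: mult_mono le_one_plus_powr)
    also have "\<dots> = indicator K x * C + C * (indicator Om x *\<^sub>R norm (u x) powr p)"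
     using True K by (auto simp: algebra_simps)
    finally show ?thesis by simp
   qed (use K in simp)
  qed
 qed
qed

lemma in_Lp_add:
 assumes p: "0 <= p" and "in_Lp p Om u" "in_Lp p Om v"
 shows "in_Lp p Om (%x. u x + v x)"
proof -
 from assms have [measurable]: "(%x. indicator Om x *\<^sub>R u x) \<in> borel_measurable borel" "(%x. indicator Om x *\<^sub>R v x) \<in> borel_measurable borel"
  and i: "L1 (%x. indicator Om x *\<^sub>R norm (u x) powr p)" "L1 (%x. indicator Om x *\<^sub>R norm (v x) powr p)" by (auto simp: in_Lp_alt)
 have m: "(%x. indicator Om x *\<^sub>R (u x + v x)) \<in> borel_measurable borel"
  unfolding scaleR_add_right by measurable
 have "L1 (%x. 2 powr p * (indicator Om x *\<^sub>R norm (u x) powr p + indicator Om x *\<^sub>R norm (v x) powr p))"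
  by (intro integrable_mult_right Bochner_Integration.integrable_add i)
 hence "L1 (%x. indicator Om x *\<^sub>R norm (u x + v x) powr p)"
 proof (rule Bochner_Integration.integrable_bound)
  have eq: "(%x. indicator Om x *\<^sub>R norm (u x + v x) powr p) = (%x. norm (indicator Om x *\<^sub>R (u x + v x)) powr p)"
   using p by (auto simp: indicator_def fun_eq_iff)
  show "(%x. indicator Om x *\<^sub>R norm (u x + v x) powr p) \<in> borel_measurable lborel"
   unfolding eq using m by measurable
  show "AE x in lborel. norm (indicator Om x *\<^sub>R norm (u x + v x) powr p) <=
    norm (2 powr p * (indicator Om x *\<^sub>R norm (u x) powr p + indicator Om x *\<^sub>R norm (v x) powr p))"
   by (rule always_eventually) (use powr_add_le[OF p] in \<open>auto simp: indicator_def\<close>)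
 qed
 with m show ?thesis by (simp add: in_Lp_alt)
qed

lemma in_Lp_bound:
 assumes p: "0 <= p" and u: "in_Lp p Om u" and m: "(%x. indicator Om x *\<^sub>R v x) \<in> borel_measurable borel"
  and le: "!!x. x \<in> Om ==> norm (v x) <= C * norm (u x)" and C: "C >= 0"
 shows "in_Lp p Om v"
proof -
 from u have "L1 (%x. indicator Om x *\<^sub>R norm (u x) powr p)" by (auto simp: in_Lp_alt)
 hence "L1 (%x. C powr p * (indicator Om x *\<^sub>R norm (u x) powr p))" by (rule integrable_mult_right)
 hence "L1 (%x. indicator Om x *\<^sub>R norm (v x) powr p)"
 proof (rule Bochner_Integration.integrable_bound)
  have eq: "(%x. indicator Om x *\<^sub>R norm (v x) powr p) = (%x. norm (indicator Om x *\<^sub>R v x) powr p)"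
   using p by (auto simp: indicator_def fun_eq_iff)
  show "(%x. indicator Om x *\<^sub>R norm (v x) powr p) \<in> borel_measurable lborel"
   unfolding eq using m by measurable
  have "norm (v x) powr p <= C powr p * norm (u x) powr p" if "x \<in> Om" for x
   using le[OF that] p C by (auto simp: powr_mono2 simp flip: powr_mult)
  thus "AE x in lborel. norm (indicator Om x *\<^sub>R norm (v x) powr p) <= norm (C powr p * (indicator Om x *\<^sub>R norm (u x) powr p))"
   by (intro always_eventually) (auto simp: indicator_def abs_mult)
 qed
 with m show ?thesis by (simp add: in_Lp_alt)
qed

lemma in_Lp_const:
 assumes "Om \<in> sets borel" "bounded Om"
 shows "in_Lp p Om (%x. c)"
 unfolding in_Lp_alt
proof
 show "(%x. indicator Om x *\<^sub>R c) \<in> borel_measurable borel" using assms by measurable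
 show "L1 (%x. indicator Om x *\<^sub>R norm c powr p)" using integrable_bounded_indicator[OF assms, of "norm c powr p"] by simp
qed

lemma in_Lp_bounded:
 assumes "0 <= p" "open Om" "bounded Om" "continuous_on Om u" "!!x. x \<in> Om ==> norm (u x) <= C"
 shows "in_Lp p Om u"
proof (rule in_Lp_bound[OF assms(1) in_Lp_const[of Om p "1::real"], where C = "\<bar>C\<bar>"])
 show "(%x. indicator Om x *\<^sub>R u x) \<in> borel_measurable borel"
  using assms by (intro borel_measurable_continuous_on_indicator) auto
 show "norm (u x) <= \<bar>C\<bar> * norm (1::real)" if "x \<in> Om" for x using assms(5)[OF that] by simp
qed (use assms in auto)

lemma in_Lp_linear:
 assumes p: "0 <= p" and u: "in_Lp p Om u" and L: "bounded_linear L"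
 shows "in_Lp p Om (%x. L (u x))"
proof -
 interpret L: bounded_linear L by fact
 obtain B where B: "B >= 0" "!!x. norm (L x) <= norm x * B" using L.nonneg_bounded by blast
 from u have [measurable]: "(%x. indicator Om x *\<^sub>R u x) \<in> borel_measurable borel" by (simp add: in_Lp_alt)
 have [measurable]: "L \<in> borel_measurable borel" by (intro borel_measurable_continuous_onI L.continuous_on continuous_on_id)
 show ?thesis
 proof (rule in_Lp_bound[OF p u])
  have "(%x. L (indicator Om x *\<^sub>R u x)) \<in> borel_measurable borel" by measurable
  thus "(%x. indicator Om x *\<^sub>R L (u x)) \<in> borel_measurable borel" by (simp add: L.scaleR)
  show "norm (L (u x)) <= B * norm (u x)" for x using B(2)[of "u x"] by (simp add: mult.commute)
 qed fact
qed

text \<open>One derivative at a time, with u itself required to be in L^p. In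
  \<open>in_sobolev\<close> the empty multi-index only yields some g in L^p with the same pairings
  with test functions as u.\<close>

primrec sob :: "nat => real => 'e::euclidean_space set => ('e => 'b::euclidean_space) => bool" where
 "sob 0 p Om u \<longleftrightarrow> in_Lp p Om u"
| "sob (Suc k) p Om u \<longleftrightarrow> in_Lp p Om u & (\<forall>b\<in>Basis. \<exists>g. weak_partial Om [b] u g & sob k p Om g)"

lemma sob_in_Lp: "sob k p Om u ==> in_Lp p Om u"
 by (cases k) auto

lemma sob_imp_in_sobolev: "sob k p Om u ==> in_sobolev k p Om u"
proof (induction k arbitrary: u)
 case 0
 thus ?case unfolding in_sobolev_def by (auto simp: weak_partial_alt iter_partial_simps)
next
 case (Suc k)
 show ?case unfolding in_sobolev_def
 proof (intro allI impI)
  fix bs :: "'a list" assume bs: "set bs \<subseteq> Basis & length bs <= Suc k"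
  show "\<exists>g. in_Lp p Om g & weak_partial Om bs u g"
  proof (cases bs)
   case Nil
   with Suc.prems show ?thesis by (auto simp: weak_partial_alt iter_partial_simps)
  next
   case (Cons b bs')
   with Suc.prems bs obtain g where g: "weak_partial Om [b] u g" "sob k p Om g" by auto
   from Suc.IH[OF g(2)] bs Cons obtain G where G: "in_Lp p Om G" "weak_partial Om bs' g G"
    by (auto simp: in_sobolev_def)
   have "weak_partial Om bs u G" unfolding weak_partial_alt
   proof (intro allI impI)
    fix \<psi> assume \<psi>: "test_function Om \<psi>"
    have "integral\<^sup>L lborel (%x. iter_partial bs \<psi> x *\<^sub>R u x) = - integral\<^sup>L lborel (%x. iter_partial bs' \<psi> x *\<^sub>R g x)"
     using g(1) test_function_iter[OF \<psi>, of bs'] by (auto simp: weak_partial_single Cons iter_partial_simps)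
    with G(2) \<psi> show "integral\<^sup>L lborel (%x. iter_partial bs \<psi> x *\<^sub>R u x) = (-1) ^ length bs *\<^sub>R integral\<^sup>L lborel (%x. \<psi> x *\<^sub>R G x)"
     by (simp add: weak_partial_alt Cons)
   qed
   with G show ?thesis by blast
  qed
 qed
qed

lemma in_sobolev_imp_sob: "in_sobolev k p Om u ==> in_Lp p Om u ==> sob k p Om u"
proof (induction k arbitrary: u)
 case (Suc k)
 have "\<exists>g. weak_partial Om [b] u g & sob k p Om g" if b: "b \<in> Basis" for b
 proof -
  from Suc.prems(1)[unfolded in_sobolev_def, rule_format, of "[b]"] b
  obtain g where g: "in_Lp p Om g" "weak_partial Om [b] u g" by auto
  have "in_sobolev k p Om g" unfolding in_sobolev_def
  proof (intro allI impI)
   fix bs :: "'a list" assume bs: "set bs \<subseteq> Basis & length bs <= k"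
   with Suc.prems(1)[unfolded in_sobolev_def, rule_format, of "b # bs"] b
   obtain G where G: "in_Lp p Om G" "weak_partial Om (b # bs) u G" by auto
   have "weak_partial Om bs g G" unfolding weak_partial_alt
   proof (intro allI impI)
    fix \<psi> assume \<psi>: "test_function Om \<psi>"
    have "integral\<^sup>L lborel (%x. iter_partial (b # bs) \<psi> x *\<^sub>R u x) = - integral\<^sup>L lborel (%x. iter_partial bs \<psi> x *\<^sub>R g x)"
     using g(2) test_function_iter[OF \<psi>, of bs] by (auto simp: weak_partial_single iter_partial_simps)
    with G(2) \<psi> show "integral\<^sup>L lborel (%x. iter_partial bs \<psi> x *\<^sub>R g x) = (-1) ^ length bs *\<^sub>R integral\<^sup>L lborel (%x. \<psi> x *\<^sub>R G x)"
     by (auto simp: weak_partial_alt)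
   qed
   with G show "\<exists>G. in_Lp p Om G & weak_partial Om bs g G" by blast
  qed
  with g Suc.IH show ?thesis by blast
 qed
 with Suc.prems show ?case by simp
qed simp

lemma sob_cong: 
 assumes "!!x. x \<in> Om ==> u x = v x" "sob k p Om u"
 shows "sob k p Om v"
proof (cases k)
 case 0
 have "in_Lp p Om u \<longleftrightarrow> in_Lp p Om v" by (rule in_Lp_cong[OF assms(1)])
 with 0 assms(2) show ?thesis by simp
next
 case (Suc j)
 have "in_Lp p Om u \<longleftrightarrow> in_Lp p Om v" by (rule in_Lp_cong[OF assms(1)])
 moreover have "weak_partial Om bs u g \<longleftrightarrow> weak_partial Om bs v g" for bs g by (rule weak_partial_cong[OF assms(1) refl])
 ultimately show ?thesis using Suc assms(2) by simp
qed

lemma sob_Suc_D: "sob (Suc k) p Om u ==> sob k p Om u"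
proof (induction k arbitrary: u)
 case (Suc k)
 show ?case unfolding sob.simps(2)[of k]
 proof (intro conjI ballI)
  show "in_Lp p Om u" using Suc.prems by simp
  fix b :: 'a assume b: "b \<in> Basis"
  from Suc.prems[unfolded sob.simps(2)[of "Suc k"]] b obtain g where "weak_partial Om [b] u g" "sob (Suc k) p Om g" by blast
  with Suc.IH show "\<exists>g. weak_partial Om [b] u g & sob k p Om g" by blast
 qed
qed simp

lemma sob_mono: "sob k p Om u ==> Om' \<subseteq> Om ==> open Om' ==> sob k p Om' u"
proof (induction k arbitrary: u)
 case 0
 thus ?case using in_Lp_mono[of p Om u Om'] by simp
next
 case (Suc k)
 show ?case unfolding sob.simps
 proof (intro conjI ballI)
  show "in_Lp p Om' u" using Suc.prems in_Lp_mono[of p Om u Om'] by simp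
  fix b :: 'a assume b: "b \<in> Basis"
  from Suc.prems b obtain g where "weak_partial Om [b] u g" "sob k p Om g" by auto
  with Suc show "\<exists>g. weak_partial Om' [b] u g & sob k p Om' g" using weak_partial_mono by blast
 qed
qed

lemma sob_add: "1 <= p ==> sob k p Om u ==> sob k p Om v ==> sob k p Om (%x. u x + v x)"
proof (induction k arbitrary: u v)
 case 0
 thus ?case using in_Lp_add[of p Om u v] by simp
next
 case (Suc k)
 have lp: "in_Lp p Om u" "in_Lp p Om v" using Suc.prems by auto
 show ?case unfolding sob.simps
 proof (intro conjI ballI)
  show "in_Lp p Om (%x. u x + v x)" using Suc.prems in_Lp_add[of p Om u v] by simp
  fix b :: 'a assume b: "b \<in> Basis"
  from Suc.prems b obtain g h where g: "weak_partial Om [b] u g" "sob k p Om g"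
   and h: "weak_partial Om [b] v h" "sob k p Om h" by (meson sob.simps(2))
  have "weak_partial Om [b] (%x. u x + v x) (%x. g x + h x)" unfolding weak_partial_single
  proof (intro allI impI)
   fix \<psi> assume \<psi>: "test_function Om \<psi>"
   note ti = test_mult_integrable[OF Suc.prems(1)]
   show "integral\<^sup>L lborel (%x. pd b \<psi> x *\<^sub>R (u x + v x)) = - integral\<^sup>L lborel (%x. \<psi> x *\<^sub>R (g x + h x))"
    using g h \<psi> ti[OF lp(1) test_function_pd[OF \<psi>]] ti[OF lp(2) test_function_pd[OF \<psi>]] 
     ti[OF sob_in_Lp[OF g(2)] \<psi>] ti[OF sob_in_Lp[OF h(2)] \<psi>]
    by (simp add: scaleR_add_right weak_partial_single)
  qed
  with Suc.IH[OF Suc.prems(1) g(2) h(2)] show "\<exists>g. weak_partial Om [b] (%x. u x + v x) g & sob k p Om g" by blast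
 qed
qed

lemma sob_linear:
 fixes L :: "'b::euclidean_space => 'c::euclidean_space"
 assumes p: "1 <= p" and L: "bounded_linear L" 
 shows "sob k p Om u ==> sob k p Om (%x. L (u x))"
proof (induction k arbitrary: u)
 case 0
 thus ?case using in_Lp_linear[OF _ _ L, of p Om u] p by simp
next
 case (Suc k)
 interpret L: bounded_linear L by fact
 have lp: "in_Lp p Om u" using Suc.prems by auto
 show ?case unfolding sob.simps
 proof (intro conjI ballI)
  show "in_Lp p Om (%x. L (u x))" using lp p in_Lp_linear[OF _ _ L, of p Om u] by simp
  fix b :: 'a assume b: "b \<in> Basis"
  from Suc.prems b obtain g where g: "weak_partial Om [b] u g" "sob k p Om g" by (meson sob.simps(2))
  have "weak_partial Om [b] (%x. L (u x)) (%x. L (g x))" unfolding weak_partial_single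
  proof (intro allI impI)
   fix \<psi> assume \<psi>: "test_function Om \<psi>"
   note ti = test_mult_integrable[OF p]
   have "integral\<^sup>L lborel (%x. pd b \<psi> x *\<^sub>R L (u x)) = L (integral\<^sup>L lborel (%x. pd b \<psi> x *\<^sub>R u x))"
    using integral_bounded_linear[OF L ti[OF lp test_function_pd[OF \<psi>]]] by (simp add: L.scaleR)
   moreover have "integral\<^sup>L lborel (%x. \<psi> x *\<^sub>R L (g x)) = L (integral\<^sup>L lborel (%x. \<psi> x *\<^sub>R g x))"
    using integral_bounded_linear[OF L ti[OF sob_in_Lp[OF g(2)] \<psi>]] by (simp add: L.scaleR)
   ultimately show "integral\<^sup>L lborel (%x. pd b \<psi> x *\<^sub>R L (u x)) = - integral\<^sup>L lborel (%x. \<psi> x *\<^sub>R L (g x))"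
    using g(1) \<psi> by (simp add: weak_partial_single linear_neg[OF L.linear_axioms])
  qed
  with Suc.IH[OF g(2)] show "\<exists>g. weak_partial Om [b] (%x. L (u x)) g & sob k p Om g" by blast
 qed
qed

lemma sob_const:
 assumes "open Om" "bounded Om"
 shows "sob k p Om (%x. c)"
proof (induction k arbitrary: c)
 case 0
 thus ?case using in_Lp_const[of Om p c] assms by simp
next
 case (Suc k)
 have "weak_partial Om [b] (%x. c) (%x. 0)" for b unfolding weak_partial_single
 proof (intro allI impI)
  fix \<psi> assume \<psi>: "test_function Om \<psi>"
  then obtain K where K: "smooth_on UNIV \<psi>" "compact K" "!!x. x \<notin> K ==> \<psi> x = 0" by (auto simp: test_function_alt)
  have "L1 (pd b \<psi>)"
   by (rule integrable_compact_support[OF smooth_on_continuous[OF smooth_has_derivative(2)[OF K(1)]] K(2)])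
    (rule pd_zero_outside[OF compact_imp_closed[OF K(2)] K(3)])
  hence "integral\<^sup>L lborel (%x. pd b \<psi> x *\<^sub>R c) = integral\<^sup>L lborel (pd b \<psi>) *\<^sub>R c"
   by (rule integral_scaleR_left)
  thus "integral\<^sup>L lborel (%x. pd b \<psi> x *\<^sub>R c) = - integral\<^sup>L lborel (%x. \<psi> x *\<^sub>R 0)"
   using integral_pd_zero[OF K] by simp
 qed
 with Suc.IH[of 0] show ?case using in_Lp_const[of Om p c] assms by auto
qed

text \<open>h is smooth on Om only; the product extends smoothly by zero because the support of psi
  is a compact subset of Om.\<close>

lemma test_function_smooth_mult:
 assumes \<psi>: "test_function Om \<psi>" and Om: "open Om" and h: "smooth_on Om h"
 shows "test_function Om (%x. \<psi> x * h x)"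
proof -
 from \<psi> obtain K where K: "smooth_on UNIV \<psi>" "compact K" "K \<subseteq> Om" "!!x. x \<notin> K ==> \<psi> x = 0" by (auto simp: test_function_alt)
 have "smooth_on UNIV (%x. \<psi> x * h x)"
 proof (rule smooth_on_glue[OF half_open_UNIV])
  fix x :: 'a
  show "\<exists>N. open N & x \<in> N & smooth_on (UNIV \<inter> N) (%x. \<psi> x * h x)"
  proof (cases "x \<in> Om")
   case True
   have "smooth_on Om (%x. \<psi> x * h x)"
    by (intro smooth_on_mult open_half_open Om h smooth_on_subset[OF K(1)]) auto
   with True Om show ?thesis by (intro exI[of _ Om]) auto
  next
   case False
   have "smooth_on (- K) (%x. \<psi> x * h x)"
    by (subst smooth_on_cong[of _ _ "%x. 0"]) (use K(4) in \<open>auto intro: smooth_on_const\<close>)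
   with False K show ?thesis by (intro exI[of _ "- K"]) (auto simp: compact_imp_closed)
  qed
 qed
 with K show ?thesis unfolding test_function_alt by (intro conjI exI[of _ K]) auto
qed

text \<open>h and its derivatives are continuous on the compact set K and hence bounded there, even
  where K meets the boundary of S. The weak Leibniz rule comes from testing u against psi h.\<close>

lemma sob_smooth_mult:
 fixes h :: "'e::euclidean_space => real" and u :: "'e => 'b::euclidean_space"
 assumes p: "1 <= p" and S: "half_open S" and K: "compact K" "K \<subseteq> S" and Om: "open Om" "Om \<subseteq> K"
 shows "smooth_on S h ==> sob k p Om u ==> sob k p Om (%x. h x *\<^sub>R u x)"
proof (induction k arbitrary: h u)
 case (0 h u)
 have u: "in_Lp p Om u" using 0 by simp
 have c: "continuous_on S h" using 0 smooth_on_continuous by blast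
 have "bounded (h ` K)" using c K by (meson compact_continuous_image compact_imp_bounded continuous_on_subset)
 then obtain C where C: "!!x. x \<in> K ==> norm (h x) <= C" by (auto simp: bounded_iff)
 have "(%x. indicator Om x *\<^sub>R h x) \<in> borel_measurable borel"
  using c Om K by (intro borel_measurable_continuous_on_indicator) (auto intro: continuous_on_subset)
 from u have [measurable]: "(%x. indicator Om x *\<^sub>R u x) \<in> borel_measurable borel" by (simp add: in_Lp_alt)
 have "in_Lp p Om (%x. h x *\<^sub>R u x)"
 proof (rule in_Lp_bound[OF _ u])
  have "(%x. indicator Om x *\<^sub>R (h x *\<^sub>R u x)) = (%x. (indicator Om x *\<^sub>R h x) *\<^sub>R (indicator Om x *\<^sub>R u x))"
   by (auto simp: indicator_def fun_eq_iff)
  moreover have "\<dots> \<in> borel_measurable borel" by (rule borel_measurable_scaleR) (fact+)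
  ultimately show "(%x. indicator Om x *\<^sub>R (h x *\<^sub>R u x)) \<in> borel_measurable borel" by (simp only:)
  show "norm (h x *\<^sub>R u x) <= \<bar>C\<bar> * norm (u x)" if "x \<in> Om" for x
   using C[of x] that Om by (auto intro!: mult_right_mono)
 qed (use p in auto)
 thus ?case by simp
next
 case (Suc k)
 have OmS: "Om \<subseteq> S" using Om K by blast
 from smooth_on_derivative[OF S Suc.prems(1)] obtain h' where
  h': "!!x. x \<in> S ==> (h has_derivative h' x) (at x within S)" "!!v. smooth_on S (%x. h' x v)" by metis
 have h'Om: "(h has_derivative h' x) (at x)" if "x \<in> Om" for x
  using h'(1)[of x] Om OmS that by (metis at_within_open has_derivative_subset subsetD)
 have lp: "in_Lp p Om u" using Suc.prems by auto
 show ?case unfolding sob.simps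
 proof (intro conjI ballI)
  show "in_Lp p Om (%x. h x *\<^sub>R u x)" using Suc.IH[OF Suc.prems(1)] sob_Suc_D[OF Suc.prems(2)] sob_in_Lp by blast
  fix b :: 'e assume b: "b \<in> Basis"
  from Suc.prems b obtain g where g: "weak_partial Om [b] u g" "sob k p Om g" by (meson sob.simps(2))
  have "weak_partial Om [b] (%x. h x *\<^sub>R u x) (%x. h x *\<^sub>R g x + h' x b *\<^sub>R u x)" unfolding weak_partial_single
  proof (intro allI impI)
   fix \<psi> assume \<psi>: "test_function Om \<psi>"
   have sm: "smooth_on Om h" "smooth_on Om (%x. h' x b)" using Suc.prems h'(2) OmS smooth_on_subset by blast+
   note tf = test_function_smooth_mult[OF \<psi> Om(1) sm(1)] test_function_smooth_mult[OF \<psi> Om(1) sm(2)]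
   note ti = test_mult_integrable[OF p]
   have pdm: "pd b (%x. \<psi> x * h x) x *\<^sub>R u x = pd b \<psi> x *\<^sub>R (h x *\<^sub>R u x) + (\<psi> x * h' x b) *\<^sub>R u x" for x
   proof (cases "x \<in> Om")
    case True
    have "((%x. \<psi> x * h x) has_derivative (%v. \<psi> x * h' x v + pd v \<psi> x * h x)) (at x)"
     using \<psi> h'Om[OF True] smooth_has_derivative(1)[of \<psi> x] by (intro has_derivative_mult) (auto simp: test_function_alt)
    from pd_eq[OF this, of b] show ?thesis by (simp add: algebra_simps)
   next
    case False
    thus ?thesis using test_function_zero[OF test_function_pd[OF tf(1)]] test_function_zero[OF test_function_pd[OF \<psi>]]
      test_function_zero[OF \<psi>] by simp
   qed
   have tfm: "test_function Om (%x. pd b \<psi> x * h x)" by (rule test_function_smooth_mult[OF test_function_pd[OF \<psi>] Om(1) sm(1)])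
   have i1: "L1 (%x. pd b \<psi> x *\<^sub>R (h x *\<^sub>R u x))" using ti[OF lp tfm] by simp
   have i2: "L1 (%x. (\<psi> x * h' x b) *\<^sub>R u x)" by (rule ti[OF lp tf(2)])
   have i3: "L1 (%x. (\<psi> x * h x) *\<^sub>R g x)" by (rule ti[OF sob_in_Lp[OF g(2)] tf(1)])
   have "integral\<^sup>L lborel (%x. pd b (%x. \<psi> x * h x) x *\<^sub>R u x) = - integral\<^sup>L lborel (%x. (\<psi> x * h x) *\<^sub>R g x)"
    using g(1) tf(1) by (auto simp: weak_partial_single)
   moreover have "integral\<^sup>L lborel (%x. pd b (%x. \<psi> x * h x) x *\<^sub>R u x) =
     integral\<^sup>L lborel (%x. pd b \<psi> x *\<^sub>R (h x *\<^sub>R u x)) + integral\<^sup>L lborel (%x. (\<psi> x * h' x b) *\<^sub>R u x)"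
    unfolding pdm by (rule Bochner_Integration.integral_add[OF i1 i2])
   moreover have "integral\<^sup>L lborel (%x. \<psi> x *\<^sub>R (h x *\<^sub>R g x + h' x b *\<^sub>R u x)) =
     integral\<^sup>L lborel (%x. (\<psi> x * h x) *\<^sub>R g x) + integral\<^sup>L lborel (%x. (\<psi> x * h' x b) *\<^sub>R u x)"
    using Bochner_Integration.integral_add[OF i3 i2] by (simp add: scaleR_add_right)
   ultimately show "integral\<^sup>L lborel (%x. pd b \<psi> x *\<^sub>R (h x *\<^sub>R u x)) = - integral\<^sup>L lborel (%x. \<psi> x *\<^sub>R (h x *\<^sub>R g x + h' x b *\<^sub>R u x))"
    by (simp add: algebra_simps)
  qed
  moreover have "sob k p Om (%x. h x *\<^sub>R g x + h' x b *\<^sub>R u x)"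
   by (intro sob_add[OF p] Suc.IH Suc.prems(1) g(2) h'(2) sob_Suc_D[OF Suc.prems(2)])
  ultimately show "\<exists>g. weak_partial Om [b] (%x. h x *\<^sub>R u x) g & sob k p Om g" by blast
 qed
qed

text \<open>Continuity bounds u on a small ball, so that u itself is in L^p there; this bridges the
  difference between \<open>in_sobolev\<close> and \<open>sob\<close>.\<close>

lemma loc_sobolev_alt:
 assumes p: "0 <= p" and S: "half_open S"
 shows "loc_sobolev k p S u \<longleftrightarrow> continuous_on S u & (\<forall>x\<in>S. \<exists>N. open N & x \<in> N & sob k p (N \<inter> interior S) u)"
proof (intro iffI conjI ballI)
 assume u: "loc_sobolev k p S u"
 thus c: "continuous_on S u" by (simp add: loc_sobolev_def)
 fix x assume x: "x \<in> S"
 with u obtain N where N: "open N" "x \<in> N" "in_sobolev k p (N \<inter> interior S) u" unfolding loc_sobolev_def by blast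
 have "loc_holder 0 S u" using c by (simp add: loc_holder_zero)
 from loc_holderE[OF this x] obtain e C where e: "e > 0" "!!y. y \<in> S ==> dist x y < e ==> norm (u y) <= C" by metis
 define N' where "N' = N \<inter> ball x e"
 have sub: "N' \<inter> interior S \<subseteq> N \<inter> interior S" "open (N' \<inter> interior S)" using N by (auto simp: N'_def)
 have "in_sobolev k p (N' \<inter> interior S) u" unfolding in_sobolev_def
 proof (intro allI impI)
  fix bs :: "'a list" assume "set bs \<subseteq> Basis & length bs <= k"
  with N(3) obtain g where g: "in_Lp p (N \<inter> interior S) g" "weak_partial (N \<inter> interior S) bs u g"
   unfolding in_sobolev_def by blast
  have "N' \<inter> interior S \<in> sets borel" using sub(2) by simp
  with g show "\<exists>g. in_Lp p (N' \<inter> interior S) g & weak_partial (N' \<inter> interior S) bs u g"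
   by (intro exI[of _ g] conjI in_Lp_mono[OF g(1) sub(1)] weak_partial_mono[OF g(2) sub(1)])
 qed
 moreover have "in_Lp p (N' \<inter> interior S) u"
 proof (rule in_Lp_bounded[OF p sub(2)])
  show "bounded (N' \<inter> interior S)" by (rule bounded_subset[of "ball x e"]) (auto simp: N'_def)
  show "continuous_on (N' \<inter> interior S) u" using c interior_subset by (meson continuous_on_subset inf_le2 order_trans)
  show "norm (u y) <= C" if "y \<in> N' \<inter> interior S" for y
   using e(2)[of y] that interior_subset[of S] by (auto simp: N'_def)
 qed
 ultimately have "sob k p (N' \<inter> interior S) u" by (rule in_sobolev_imp_sob)
 thus "\<exists>N. open N & x \<in> N & sob k p (N \<inter> interior S) u"
  using N e by (intro exI[of _ N']) (auto simp: N'_def)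
next
 assume "continuous_on S u & (\<forall>x\<in>S. \<exists>N. open N & x \<in> N & sob k p (N \<inter> interior S) u)"
 thus "loc_sobolev k p S u" unfolding loc_sobolev_def using sob_imp_in_sobolev by blast
qed

subsection \<open>A uniform interface to the regularity classes\<close>

text \<open>The part of \<open>admissible\<close> that does not mention the dimension, so that one
  predicate speaks about V and W at once.\<close>

fun admissible_class :: "regularity => bool" where
 "admissible_class (Holder k \<alpha>) \<longleftrightarrow> 0 <= \<alpha> & \<alpha> <= 1"
| "admissible_class (Sobolev k p) \<longleftrightarrow> 1 <= p"
| "admissible_class _ \<longleftrightarrow> True"

lemma admissible_imp_class: "admissible \<F> n ==> admissible_class \<F>"
 by (cases \<F>) auto

text \<open>Scalar functions of this class may be multiplied and inverted within it, and multiply functions of class \<open>\<F>\<close>.\<close>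

fun scalar_class :: "regularity => regularity" where
 "scalar_class (Sobolev k p) = smooth"
| "scalar_class \<F> = \<F>"

lemma scalar_class_idem: "scalar_class (scalar_class \<F>) = scalar_class \<F>"
 by (cases \<F>) auto

lemma scalar_class_admissible: "admissible_class \<F> ==> admissible_class (scalar_class \<F>)"
 by (cases \<F>) auto

lemma in_class_smooth_iff: "in_class smooth S f \<longleftrightarrow> smooth_on S f"
 by (simp add: Ck_Frechet_infinity)

text \<open>The manifold of dimension 0: at an isolated point the filter is trivial, so the zero map
  is a derivative of every function.\<close>

lemma iter_diff_trivial:
 assumes "0 <= \<alpha>" "S \<subseteq> {0::'e::euclidean_space}"
 shows "Hd \<alpha> k S f"
proof -
 have "Hd \<alpha> k {0::'e} f"
 proof (induction k arbitrary: f)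
  case 0
  show ?case by (simp, rule loc_holderI) (auto intro: exI[of _ 1])
 next
  case (Suc k)
  show ?case unfolding iter_diff.simps
   by (intro exI[of _ "%x h. 0"]) (auto simp: Suc has_derivative_def at_within_def)
 qed
 thus ?thesis using assms by (rule_tac H_subset) auto
qed

lemma in_class_trivial:
 assumes "admissible_class \<F>" "S \<subseteq> {0::'e::euclidean_space}"
 shows "in_class \<F> S (f :: 'e => 'b::euclidean_space)"
proof (cases \<F>)
 case (MB k)
 have c: "continuous_on (S \<times> UNIV) (%(x, v::nat => 'e). d (0::'e))" for d :: "'e => 'b" by (simp add: case_prod_unfold)
 have int: "interior S = {}" using assms(2)
  by (metis interior_mono interior_singleton subset_empty)
 have "Ck_MB k S f" unfolding Ck_MB_def
  by (rule exI[of _ "%j x v. f 0"]) (use assms(2) int in \<open>auto simp: case_prod_unfold\<close>)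
 with MB show ?thesis by simp
next
 case (Frechet k)
 have "Hd 0 j S f" for j by (rule iter_diff_trivial[OF _ assms(2)]) simp
 thus ?thesis using Frechet by (simp add: Ck_Frechet_alt)
next
 case (Holder k \<alpha>)
 hence "Hd \<alpha> k S f" using assms(1) by (intro iter_diff_trivial[OF _ assms(2)]) simp
 thus ?thesis using Holder by simp
next
 case (Sobolev k p)
 have int: "interior S = {}" using assms(2)
  by (metis interior_mono interior_singleton subset_empty)
 have "continuous_on S f" using assms(2) by (metis continuous_on_empty continuous_on_sing subset_singletonD)
 moreover have "in_sobolev k p {} f"
  unfolding in_sobolev_def in_Lp_def weak_partial_def by (auto simp: set_borel_measurable_def set_integrable_def set_lebesgue_integral_def)
 ultimately show ?thesis using Sobolev by (auto simp: loc_sobolev_def int)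
qed

lemma in_class_smooth_mult_sobolev:
 assumes S: "half_open S" and p: "1 <= p" and h: "smooth_on S h" and f: "loc_sobolev k p S f"
 shows "loc_sobolev k p S (%x. h x *\<^sub>R f x)"
proof -
 have p0: "0 <= p" using p by simp
 from f p0 S have c: "continuous_on S f" and N: "!!x. x \<in> S ==> \<exists>N. open N & x \<in> N & sob k p (N \<inter> interior S) f"
  by (auto simp: loc_sobolev_alt)
 have "\<exists>N'. open N' & x \<in> N' & sob k p (N' \<inter> interior S) (%x. h x *\<^sub>R f x)" if x: "x \<in> S" for x
 proof -
  from N[OF x] obtain N where N: "open N" "x \<in> N" "sob k p (N \<inter> interior S) f" by blast
  from half_openE[OF S x] obtain r M where r: "r > 0" "closed M" "M \<inter> ball x r \<subseteq> S" "S \<subseteq> M" by metis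
  define K where "K = M \<inter> cball x (r/2)"
  have K: "compact K" "K \<subseteq> S" unfolding K_def using r by (auto intro: closed_Int_compact)
  define N' where "N' = N \<inter> ball x (r/2)"
  have sub: "N' \<inter> interior S \<subseteq> K" using r interior_subset[of S] by (auto simp: N'_def K_def)
  have o: "open (N' \<inter> interior S)" using N by (auto simp: N'_def)
  have "sob k p (N' \<inter> interior S) (%x. h x *\<^sub>R f x)"
   by (rule sob_smooth_mult[OF p S K o sub h sob_mono[OF N(3) _ o]]) (auto simp: N'_def)
  with N r show ?thesis by (intro exI[of _ N']) (auto simp: N'_def)
 qed
 moreover have "continuous_on S (%x. h x *\<^sub>R f x)" using c smooth_on_continuous[OF h] by (intro continuous_intros)
 ultimately show ?thesis using p0 S by (auto simp: loc_sobolev_alt)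
qed

section \<open>Chart images and closure properties of the classes\<close>

definition model_open :: "nat => 'e::euclidean_space set => bool" where
 "model_open n S \<longleftrightarrow> (\<exists>M\<in>local_models n. openin (top_of_set M) S)"

lemma model_open_cases: "model_open n S \<longleftrightarrow> (if n = 0 then S \<subseteq> {0} else half_open S)"
proof -
 have "openin (top_of_set {0}) S \<longleftrightarrow> S \<subseteq> {0}" by (metis openin_empty openin_imp_subset openin_subtopology_self subset_singletonD)
 thus ?thesis unfolding model_open_def local_models_def half_open_def by simp
qed

lemma model_open_openin: "model_open n S ==> openin (top_of_set S) T ==> model_open n T"
 unfolding model_open_def by (meson openin_trans)

text \<open>Every class other than the Sobolev ones is the intersection of
  \<open>Hd \<alpha> k\<close> over these pairs (\<open>in_class_Hd\<close>), which reduces MB,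
  Frechet and Hoelder to one case.\<close>

fun hd_orders :: "regularity => (real \<times> nat) set" where
 "hd_orders (MB k) = {0} \<times> {j. enat j <= k}"
| "hd_orders (Frechet k) = {0} \<times> {j. enat j <= k}"
| "hd_orders (Holder k \<alpha>) = {(\<alpha>, k)}"
| "hd_orders (Sobolev k p) = {}"

lemma in_class_Hd:
 assumes "half_open S" "!!k p. \<F> ~= Sobolev k p"
 shows "in_class \<F> S f \<longleftrightarrow> (\<forall>\<alpha> k. (\<alpha>, k) \<in> hd_orders \<F> --> Hd \<alpha> k S f)"
 using assms by (cases \<F>) (auto simp: Ck_MB_iff Ck_Frechet_alt)

lemma hd_orders_range: "admissible_class \<F> ==> (\<alpha>, k) \<in> hd_orders \<F> ==> 0 <= \<alpha> & \<alpha> <= 1"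
 by (cases \<F>) auto

lemma scalar_class_eq: "(!!k p. \<F> ~= Sobolev k p) ==> scalar_class \<F> = \<F>"
 by (cases \<F>) auto

context
 fixes n :: nat and S :: "'e::euclidean_space set" and \<F> :: regularity
 assumes S: "model_open n S" and adm: "admissible_class \<F>"
begin

lemma in_class_dim0: "n = 0 ==> admissible_class \<G> ==> T \<subseteq> S ==> in_class \<G> T f"
 by (rule in_class_trivial) (use S in \<open>auto simp: model_open_cases\<close>)

text \<open>The trichotomy along which the closure properties below are proved: dimension 0, the
  classes described by \<open>hd_orders\<close>, and the Sobolev classes.\<close>

lemma class_cases:
 obtains (triv) "n = 0" | (hd) "n ~= 0" "half_open S" "!!k p. \<F> ~= Sobolev k p"
 | (sob) k p where "n ~= 0" "half_open S" "\<F> = Sobolev k p" "1 <= p" "0 <= p"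
 using S adm by (cases \<F>; cases "n = 0") (auto simp: model_open_cases)

lemma in_class_cong: "in_class \<F> S f ==> (!!x. x \<in> S ==> f x = g x) ==> in_class \<F> S g"
proof -
 assume f: "in_class \<F> S f" and eq: "!!x. x \<in> S ==> f x = g x"
 show ?thesis
 proof (cases rule: class_cases)
  case hd
  with f show ?thesis using H_cong[of S f g, OF eq] by (simp add: in_class_Hd)
 next
  case (sob k p)
  have "sob k p (N \<inter> interior S) g" if "sob k p (N \<inter> interior S) f" for N
   by (rule sob_cong[OF _ that]) (use eq interior_subset[of S] in auto)
  moreover have "continuous_on S g" using f eq sob by (simp add: loc_sobolev_def cong: continuous_on_cong)
  ultimately have "loc_sobolev k p S g" using f sob unfolding in_class.simps sob(3) loc_sobolev_alt[OF sob(5,2)] by metis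
  thus ?thesis using sob by simp
 qed (rule in_class_dim0[OF _ adm order_refl])
qed

lemma in_class_Int: "in_class \<F> S f ==> open N ==> in_class \<F> (S \<inter> N) f"
proof -
 assume f: "in_class \<F> S f" and N: "open N"
 show ?thesis
 proof (cases rule: class_cases)
  case hd
  with f half_open_Int[OF _ N] show ?thesis using H_subset[of _ _ S f "S \<inter> N"] by (auto simp: in_class_Hd)
 next
  case (sob k p)
  with f have c: "continuous_on S f" and M: "!!x. x \<in> S ==> \<exists>N. open N & x \<in> N & sob k p (N \<inter> interior S) f"
   by (auto simp: loc_sobolev_alt)
  have "\<exists>N'. open N' & x \<in> N' & sob k p (N' \<inter> interior (S \<inter> N)) f" if "x \<in> S \<inter> N" for x
  proof -
   from M[of x] that obtain N' where N': "open N'" "x \<in> N'" "sob k p (N' \<inter> interior S) f" by auto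
   have "sob k p (N' \<inter> interior (S \<inter> N)) f" by (rule sob_mono[OF N'(3)]) (use N'(1) in \<open>auto simp: open_Int\<close>)
   with N' show ?thesis by blast
  qed
  with c sob half_open_Int[OF _ N] show ?thesis by (auto simp: loc_sobolev_alt intro: continuous_on_subset)
 qed (rule in_class_dim0[OF _ adm], auto)
qed

lemma in_class_openin:
 assumes "in_class \<F> S f" "openin (top_of_set S) T"
 shows "in_class \<F> T f"
proof -
 from assms(2) obtain N where "open N" "T = S \<inter> N" by (auto simp: openin_open)
 with in_class_Int assms(1) show ?thesis by simp
qed

lemma in_class_glue: "(!!x. x \<in> S ==> \<exists>N. open N & x \<in> N & in_class \<F> (S \<inter> N) f) ==> in_class \<F> S f"
proof -
 assume N: "!!x. x \<in> S ==> \<exists>N. open N & x \<in> N & in_class \<F> (S \<inter> N) f"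
 show ?thesis
 proof (cases rule: class_cases)
  case hd
  have "Hd \<alpha> k S f" if o: "(\<alpha>, k) \<in> hd_orders \<F>" for \<alpha> k
  proof (rule H_glue[OF hd(2)])
   fix x assume "x \<in> S"
   with N obtain N where N: "open N" "x \<in> N" "in_class \<F> (S \<inter> N) f" by blast
   with o show "\<exists>N. open N & x \<in> N & Hd \<alpha> k (S \<inter> N) f" unfolding in_class_Hd[OF half_open_Int[OF hd(2) N(1)] hd(3)] by blast
  qed
  with hd show ?thesis by (auto simp: in_class_Hd)
 next
  case (sob k p)
  have "loc_holder 0 S f"
  proof (rule loc_holder_glue)
   fix x assume "x \<in> S"
   with N sob show "\<exists>N. open N & x \<in> N & loc_holder 0 (S \<inter> N) f" by (auto simp: loc_holder_zero loc_sobolev_def)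
  qed
  hence c: "continuous_on S f" by (simp add: loc_holder_zero)
  have "\<exists>N. open N & x \<in> N & sob k p (N \<inter> interior S) f" if x: "x \<in> S" for x
  proof -
   from N[OF x] sob obtain N where N: "open N" "x \<in> N" "loc_sobolev k p (S \<inter> N) f" by auto
   with x obtain N' where N': "open N'" "x \<in> N'" "sob k p (N' \<inter> interior (S \<inter> N)) f"
    unfolding loc_sobolev_alt[OF sob(5) half_open_Int[OF sob(2) N(1)]] by blast
   moreover have "N' \<inter> interior (S \<inter> N) = (N' \<inter> N) \<inter> interior S" using N(1) by (auto simp: interior_open)
   ultimately show ?thesis using N by (intro exI[of _ "N' \<inter> N"]) auto
  qed
  with c sob show ?thesis by (auto simp: loc_sobolev_alt)
 qed (rule in_class_dim0[OF _ adm order_refl])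
qed

lemma in_class_add: "in_class \<F> S f ==> in_class \<F> S g ==> in_class \<F> S (%x. f x + g x)"
proof -
 assume fg: "in_class \<F> S f" "in_class \<F> S g"
 show ?thesis
 proof (cases rule: class_cases)
  case hd
  from fg show ?thesis unfolding in_class_Hd[OF hd(2,3)] using H_add by blast
 next
  case (sob k p)
  with fg have c: "continuous_on S f" "continuous_on S g" and N: "!!x. x \<in> S ==> \<exists>N. open N & x \<in> N & sob k p (N \<inter> interior S) f"
   "!!x. x \<in> S ==> \<exists>N. open N & x \<in> N & sob k p (N \<inter> interior S) g"
   by (auto simp: loc_sobolev_alt)
  have "\<exists>N'. open N' & x \<in> N' & sob k p (N' \<inter> interior S) (%x. f x + g x)" if "x \<in> S" for x
  proof -
   from N[OF that] obtain N N' where N': "open N" "x \<in> N" "sob k p (N \<inter> interior S) f"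
    "open N'" "x \<in> N'" "sob k p (N' \<inter> interior S) g" by metis
   have "sob k p ((N \<inter> N') \<inter> interior S) (%x. f x + g x)"
    by (intro sob_add[OF sob(4)] sob_mono[OF N'(3)] sob_mono[OF N'(6)]) (use N' in auto)
   with N' show ?thesis by (intro exI[of _ "N \<inter> N'"]) auto
  qed
  with c sob show ?thesis by (auto simp: loc_sobolev_alt intro: continuous_on_add)
 qed (rule in_class_dim0[OF _ adm order_refl])
qed

lemma in_class_linear: "in_class \<F> S f ==> bounded_linear L ==> in_class \<F> S (%x. L (f x))"
proof -
 assume f: "in_class \<F> S f" and L: "bounded_linear L"
 show ?thesis
 proof (cases rule: class_cases)
  case hd
  with f show ?thesis using H_linear[OF L, of _ _ S f] by (auto simp: in_class_Hd)
 next
  case (sob k p)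
  with f have c: "continuous_on S f" and N: "!!x. x \<in> S ==> \<exists>N. open N & x \<in> N & sob k p (N \<inter> interior S) f"
   by (auto simp: loc_sobolev_alt)
  have "\<exists>N'. open N' & x \<in> N' & sob k p (N' \<inter> interior S) (%x. L (f x))" if "x \<in> S" for x
   using N[OF that] sob_linear[OF sob(4) L] by blast
  with sob bounded_linear.continuous_on[OF L c] show ?thesis by (simp add: loc_sobolev_alt)
 qed (rule in_class_dim0[OF _ adm order_refl])
qed

lemma in_class_continuous: "in_class \<F> S f ==> continuous_on S f"
proof (cases rule: class_cases)
 case triv
 with S have "S \<subseteq> {0}" by (simp add: model_open_cases)
 thus ?thesis by (metis continuous_on_empty continuous_on_sing subset_singletonD)
next
 case hd
 hence "\<exists>\<alpha> k. (\<alpha>, k) \<in> hd_orders \<F>" by (cases \<F>) (auto intro: exI[of _ 0] simp flip: zero_enat_def)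
 moreover assume "in_class \<F> S f"
 ultimately show ?thesis unfolding in_class_Hd[OF hd(2,3)] using H_continuous[OF hd(2)] by blast
qed (simp add: loc_sobolev_def)

lemma in_class_scalar_mult: "in_class (scalar_class \<F>) S h ==> in_class \<F> S f ==> in_class \<F> S (%x. h x *\<^sub>R f x)"
proof (cases rule: class_cases)
 case hd
 assume "in_class (scalar_class \<F>) S h" "in_class \<F> S f"
 thus ?thesis unfolding scalar_class_eq[OF hd(3)] in_class_Hd[OF hd(2,3)] using H_mult[OF hd(2)] hd_orders_range[OF adm] by blast
qed (use in_class_dim0[OF _ adm] in_class_smooth_mult_sobolev in \<open>auto simp: in_class_smooth_iff[simplified]\<close>)

lemma in_class_inverse: "in_class (scalar_class \<F>) S (h :: 'e => real) ==> (!!x. x \<in> S ==> h x ~= 0) ==> in_class (scalar_class \<F>) S (%x. inverse (h x))"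
proof (cases rule: class_cases)
 case hd
 assume "in_class (scalar_class \<F>) S h" "!!x. x \<in> S ==> h x ~= 0"
 thus ?thesis unfolding scalar_class_eq[OF hd(3)] in_class_Hd[OF hd(2,3)] using H_inverse[OF hd(2)] hd_orders_range[OF adm] by blast
qed (use in_class_dim0[OF _ scalar_class_admissible[OF adm]] smooth_on_inverse in \<open>auto simp: in_class_smooth_iff[simplified]\<close>)

lemma in_class_const: "in_class \<F> S (%x. c)"
proof (cases rule: class_cases)
 case hd
 show ?thesis unfolding in_class_Hd[OF hd(2,3)] using H_const hd_orders_range[OF adm] by blast
next
 case (sob k p)
 have "\<exists>N. open N & x \<in> N & sob k p (N \<inter> interior S) (%x. c)" for x
  by (intro exI[of _ "ball x 1"] conjI sob_const bounded_Int) auto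
 with sob show ?thesis by (simp add: loc_sobolev_alt)
qed (rule in_class_dim0[OF _ adm order_refl])

lemma in_class_sum: "(!!i. i \<in> I ==> in_class \<F> S (f i)) ==> in_class \<F> S (%x. \<Sum>i\<in>I. f i x)"
proof (induction I rule: infinite_finite_induct)
 case (insert i I)
 thus ?case using in_class_add[of "f i" "%x. \<Sum>i\<in>I. f i x"] by simp
qed (simp_all add: in_class_const del: in_class.simps)

lemma in_class_smooth_imp: "in_class smooth S f ==> in_class \<F> S f"
proof (cases rule: class_cases)
 case hd
 assume "in_class smooth S f"
 thus ?thesis unfolding in_class_Hd[OF hd(2,3)] in_class_smooth_iff using smooth_on_H[OF hd(2)] hd_orders_range[OF adm] by blast
next
 case (sob k p)
 assume "in_class smooth S f"
 \<comment> \<open>A smooth f is a sum of smooth scalars times constant vectors, so closure under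
   multiplication by smooth scalars suffices.\<close>
 hence "in_class \<F> S (%x. \<Sum>i\<in>Basis. (f x \<bullet> i) *\<^sub>R i)"
  by (intro in_class_sum in_class_scalar_mult in_class_const)
    (use sob smooth_on_linear[OF bounded_linear_inner_left] in \<open>simp add: Ck_Frechet_infinity\<close>)
 thus ?thesis by (simp add: euclidean_representation)
qed (rule in_class_dim0[OF _ adm order_refl])

lemma in_class_scalar_imp: "in_class (scalar_class \<F>) S f ==> in_class \<F> S f"
 using in_class_smooth_imp scalar_class_eq by (cases \<F>) auto

end

lemma in_class_smooth_scalar: "model_open n S ==> admissible_class \<F> ==> in_class smooth S f ==> in_class (scalar_class \<F>) S f"
 using in_class_smooth_imp scalar_class_admissible by blast

subsection \<open>Mollifiers\<close>

definition mollifier :: "real => ('e::euclidean_space => real) => bool" where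
 "mollifier eps \<rho> \<longleftrightarrow> kernel eps \<rho> & (\<forall>x. 0 <= \<rho> x) & integral\<^sup>L lborel \<rho> = 1"

lemma mollifier_exists:
 assumes "eps > 0" obtains \<rho> :: "'e::euclidean_space => real" where "mollifier eps \<rho>"
proof -
 from euclidean_bump[OF assms, of "0::'e"] obtain e :: "'e => real" where e: "smooth_on UNIV e" "!!x. 0 <= e x" "!!x. e x <= 1"
  "!!x. dist 0 x <= eps/2 ==> e x = 1" "!!x. dist 0 x >= eps ==> e x = 0" by metis
 have k: "kernel eps e" using e by (auto simp: kernel_def)
 define I where "I = integral\<^sup>L lborel e"
 have "0 < measure lborel (ball (0::'e) (eps/2))" using content_ball_pos[of "eps/2" "0::'e"] assms by simp
 also have "\<dots> = (LINT x|lborel. indicator (ball (0::'e) (eps/2)) x)" by simp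
 also have "\<dots> <= I" unfolding I_def
 proof (rule integral_mono)
  show "L1 (indicator (ball (0::'e) (eps/2)) :: 'e => real)"
   by (rule integrable_real_indicator) (use emeasure_bounded_finite[of "ball (0::'e) (eps/2)"] in auto)
  show "indicator (ball 0 (eps/2)) x <= e x" for x using e(2)[of x] e(4)[of x] by (auto simp: indicator_def)
 qed (rule kernelD(4)[OF k])
 finally have I: "I > 0" .
 have "smooth_on UNIV (%x. inverse I * e x)"
  by (intro smooth_on_mult half_open_UNIV smooth_on_const e)
 hence "mollifier eps (%x. inverse I * e x)"
  using I e k by (auto simp: mollifier_def kernel_def I_def[symmetric])
 thus ?thesis by (rule that)
qed

text \<open>The induction treats the convolution and its negative together, because each
  differentiation of the reflected kernel changes the sign.\<close>

lemma conv_smooth: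
 assumes u: "L1 u" shows "kernel eps \<rho> ==> smooth_on UNIV (conv \<rho> u)"
proof -
 assume k: "kernel eps \<rho>"
 have "Hd 0 j UNIV (conv \<sigma> u) & Hd 0 j UNIV (%x. - conv \<sigma> u x)" if "kernel eps \<sigma>" for \<sigma> j
  using that
 proof (induction j arbitrary: \<sigma>)
  case 0
  have "continuous_on UNIV (conv \<sigma> u)"
   using has_derivative_continuous[OF conv_has_derivative[OF 0 u]] by (intro continuous_at_imp_continuous_on) blast
  thus ?case by (simp add: loc_holder_zero continuous_on_minus)
 next
  case (Suc j)
  note d = conv_has_derivative[OF Suc.prems u] and IH = Suc.IH[OF kernelD(7)[OF Suc.prems]]
  show ?case unfolding iter_diff.simps using d has_derivative_minus[OF d] IH
   by (intro conjI exI[of _ "%x h. - conv (pd h \<sigma>) u x"] exI[of _ "%x h. conv (pd h \<sigma>) u x"]) auto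
 qed
 with k show ?thesis by (simp add: smooth_on_def)
qed

lemma conv_zero_off:
 assumes "kernel eps \<rho>" "!!y. y \<notin> K ==> u y = 0" "!!y. y \<in> K ==> eps < dist y x"
 shows "conv \<rho> u x = 0"
proof -
 have "\<rho> (y - x) * u y = 0" for y using assms by (cases "y \<in> K") (auto simp: kernel_def dist_norm)
 thus ?thesis unfolding conv_def by (simp only: integral_zero)
qed

text \<open>The weak derivative is tested against y -> rho(y - x); its minus sign cancels the one in
  \<open>conv_has_derivative\<close>.\<close>

lemma pd_conv:
 assumes k: "kernel eps \<rho>" and u: "L1 u" and w: "weak_partial UNIV [b] u g"
 shows "pd b (conv \<rho> u) x = conv \<rho> g x"
proof -
 have d: "((%y. \<rho> (y - x)) has_derivative (%h. pd h \<rho> (y - x))) (at y)" for y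
  by (rule has_derivative_compose[of "%y. y - x" "%h. h", where g = \<rho>, simplified])
    (auto intro!: derivative_eq_intros smooth_has_derivative(1)[OF kernelD(1)[OF k]])
 have "smooth_on UNIV (%y. \<rho> (y + - x))"
  by (rule smooth_on_compose[OF half_open_UNIV half_open_UNIV _ smooth_on_add[OF smooth_on_ident smooth_on_const] kernelD(1)[OF k]]) simp
 hence "test_function UNIV (%y. \<rho> (y - x))" unfolding test_function_alt
  using kernelD(5)[OF k] by (intro conjI exI[of _ "cball x eps"]) (auto simp: dist_norm norm_minus_commute)
 with w have "(LINT y|lborel. pd b (%y. \<rho> (y - x)) y *\<^sub>R u y) = - (LINT y|lborel. \<rho> (y - x) *\<^sub>R g y)"
  unfolding weak_partial_single by blast
 hence "conv (pd b \<rho>) u x = - conv \<rho> g x" by (simp add: conv_def pd_eq[OF d])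
 with pd_eq[OF conv_has_derivative[OF k u], of b x] show ?thesis by linarith
qed

lemma weak_partial_smooth:
 assumes "smooth_on UNIV (v :: 'e::euclidean_space => real)"
 shows "weak_partial UNIV [b] v (pd b v)"
 unfolding weak_partial_single
proof (intro allI impI)
 fix \<psi> :: "'e => real" assume \<psi>: "test_function UNIV \<psi>"
 then obtain K where K: "smooth_on UNIV \<psi>" "compact K" "!!x. x \<notin> K ==> \<psi> x = 0" by (auto simp: test_function_alt)
 have t: "test_function UNIV (%x. \<psi> x * v x)" "test_function UNIV (%x. pd b \<psi> x * v x)" "test_function UNIV (%x. \<psi> x * pd b v x)"
  using test_function_smooth_mult[OF \<psi> open_UNIV] test_function_smooth_mult[OF test_function_pd[OF \<psi>] open_UNIV] assms smooth_has_derivative(2)[OF assms]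
  by blast+
 have int: "L1 f" if "test_function UNIV f" for f :: "'e => real"
  using that integrable_compact_support smooth_on_continuous unfolding test_function_alt by blast
 have "pd b (%x. \<psi> x * v x) x = pd b \<psi> x * v x + \<psi> x * pd b v x" for x
  using has_derivative_mult[OF smooth_has_derivative(1)[OF K(1)] smooth_has_derivative(1)[OF assms], of x] pd_eq by fastforce
 hence "pd b (%x. \<psi> x * v x) = (%x. pd b \<psi> x * v x + \<psi> x * pd b v x)" by (rule ext)
 moreover have "integral\<^sup>L lborel (pd b (%x. \<psi> x * v x)) = 0"
  by (rule integral_pd_zero[OF _ K(2)]) (use t(1) K(3) in \<open>auto simp: test_function_alt\<close>)
 ultimately have "(LINT x|lborel. pd b \<psi> x * v x + \<psi> x * pd b v x) = 0" by simp
 thus "(LINT x|lborel. pd b \<psi> x *\<^sub>R v x) = - (LINT x|lborel. \<psi> x *\<^sub>R pd b v x)"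
  using int[OF t(2)] int[OF t(3)] by simp
qed

lemma conv_uniform:
 assumes m: "mollifier eps \<rho>" and u: "L1 u" and close: "!!x y. dist y x <= eps ==> \<bar>u y - u x\<bar> <= c"
 shows "\<bar>u x - conv \<rho> u x\<bar> <= c"
proof -
 have k: "kernel eps \<rho>" and \<rho>: "!!x. 0 <= \<rho> x" "integral\<^sup>L lborel \<rho> = 1" using m by (auto simp: mollifier_def)
 note [measurable] = kernelD(3)[OF k]
 have tr: "(LINT y|lborel. \<rho> (y - x)) = 1" "L1 (%y. \<rho> (y - x))"
  using lborel_integral_translate[OF kernelD(3)[OF k], of "- x"] kernelD(4)[OF k] \<rho>(2) by simp_all
 note i = conv_integrable[OF k u, of x]
 have "u x - conv \<rho> u x = (LINT y|lborel. \<rho> (y - x) * u x - \<rho> (y - x) * u y)"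
  using i tr by (simp add: conv_def)
 also have "norm \<dots> <= (LINT y|lborel. \<rho> (y - x) * c)"
 proof (rule Bochner_Integration.integral_norm_bound_integral)
  fix y
  have "\<rho> (y - x) * \<bar>u x - u y\<bar> <= \<rho> (y - x) * c"
  proof (cases "norm (y - x) <= eps")
   case True
   thus ?thesis using close[of y x] \<rho>(1) by (intro mult_left_mono) (auto simp: dist_norm abs_minus_commute)
  qed (use kernelD(5)[OF k, of "y - x"] in simp)
  thus "norm (\<rho> (y - x) * u x - \<rho> (y - x) * u y) <= \<rho> (y - x) * c"
   using \<rho>(1)[of "y - x"] by (simp add: abs_mult flip: right_diff_distrib)
 qed (use i tr in auto)
 finally show ?thesis using tr by simp
qed

text \<open>Integrated against the mollifier with a = |\<open>conv \<rho> u x\<close>|, this tangent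
  line bound is the needed case of Jensen's inequality.\<close>

lemma powr_tangent:
 assumes "1 <= p" "0 < a" "0 <= (t::real)"
 shows "a powr p + p * a powr (p - 1) * (t - a) <= t powr p"
proof (cases "t = 0")
 case True
 have "a powr (p - 1) * a = a powr p" using assms(2) by (simp add: powr_diff)
 moreover have "0 <= (p - 1) * a powr p" using assms by simp
 ultimately show ?thesis using True by (simp add: algebra_simps)
next
 case False
 have "t powr p - a powr p >= (p * a powr (p - 1)) * (t - a)"
  by (rule convex_on_imp_above_tangent[OF powr_convex[OF assms(1)]])
   (use assms False in \<open>auto intro!: derivative_eq_intros simp: interior_open\<close>)
 thus ?thesis by simp
qed

text \<open>Young's inequality, by Jensen's inequality and Tonelli's theorem.\<close>

lemma conv_Lp:
 fixes u :: "'e::euclidean_space => real"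
 assumes p: "1 <= p" and m: "mollifier eps \<rho>" and u: "L1 u" "L1 (%x. \<bar>u x\<bar> powr p)"
 shows "L1 (%x. \<bar>conv \<rho> u x\<bar> powr p)" "(LINT x|lborel. \<bar>conv \<rho> u x\<bar> powr p) <= (LINT x|lborel. \<bar>u x\<bar> powr p)"
proof -
 have k: "kernel eps \<rho>" and \<rho>: "!!x. 0 <= \<rho> x" "integral\<^sup>L lborel \<rho> = 1" using m by (auto simp: mollifier_def)
 note [measurable] = borel_measurable_integrable[OF u(1)] kernelD(3)[OF k]
  smooth_on_continuous[OF conv_smooth[OF u(1) k], THEN borel_measurable_continuous_onI]
 have ci: "L1 (%z. \<rho> z * u (z + x))" for x
  using conv_integrable[OF k u(1), of x] lborel_integral_translate(2)[of "%y. \<rho> (y - x) * u y" x] by (simp add: add.commute)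
 define a where "a x = \<bar>conv \<rho> u x\<bar>" for x
 have ai: "L1 (%z. \<rho> z * \<bar>u (z + x)\<bar>)" for x
  using integrable_abs[OF ci, of x] \<rho>(1) by (simp add: abs_mult)
 have a: "a x <= (LINT z|lborel. \<rho> z * \<bar>u (z + x)\<bar>)" for x
 proof -
  have "conv \<rho> u x = (LINT z|lborel. \<rho> z * u (z + x))"
   unfolding conv_def using lborel_integral_translate(1)[of "%y. \<rho> (y - x) * u y" x] by (simp add: add.commute)
  thus ?thesis using integral_abs_bound[of lborel "%z. \<rho> z * u (z + x)"] \<rho>(1) by (simp add: a_def abs_mult)
 qed
 \<comment> \<open>For \<open>a x = 0\<close> the left side is 0, and without integrability the
   right side is infinite; only the remaining case uses the tangent.\<close>
 have jensen: "ennreal (a x powr p) <= (\<integral>\<^sup>+z. ennreal (\<rho> z) * ennreal (\<bar>u (z + x)\<bar> powr p) \<partial>lborel)" for x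
 proof (cases "a x > 0 & L1 (%z. \<rho> z * \<bar>u (z + x)\<bar> powr p)")
  case True
  define c where "c = p * a x powr (p - 1)"
  have c: "c >= 0" using p by (simp add: c_def)
  have t: "\<rho> z * a x powr p + c * (\<rho> z * \<bar>u (z + x)\<bar> - \<rho> z * a x) <= \<rho> z * \<bar>u (z + x)\<bar> powr p" for z
   using mult_left_mono[OF powr_tangent[OF p, of "a x" "\<bar>u (z + x)\<bar>"] \<rho>(1)[of z]] True
   by (simp add: c_def algebra_simps)
  have "a x powr p <= a x powr p + c * ((LINT z|lborel. \<rho> z * \<bar>u (z + x)\<bar>) - a x)" using a[of x] c by simp
  also have "\<dots> = (LINT z|lborel. \<rho> z * a x powr p + c * (\<rho> z * \<bar>u (z + x)\<bar> - \<rho> z * a x))"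
   using kernelD(4)[OF k] ai[of x] \<rho>(2) by simp
  also have "\<dots> <= (LINT z|lborel. \<rho> z * \<bar>u (z + x)\<bar> powr p)"
   by (rule integral_mono[OF _ _ t]) (use kernelD(4)[OF k] ai[of x] True in auto)
  also have "ennreal \<dots> = (\<integral>\<^sup>+z. ennreal (\<rho> z * \<bar>u (z + x)\<bar> powr p) \<partial>lborel)"
   by (rule nn_integral_eq_integral[symmetric]) (use True \<rho> in auto)
  finally show ?thesis using \<rho> by (simp add: ennreal_mult ennreal_leI)
 next
  case False
  show ?thesis
  proof (cases "a x > 0")
   case True
   with False have "\<not> (\<integral>\<^sup>+z. ennreal (norm (\<rho> z * \<bar>u (z + x)\<bar> powr p)) \<partial>lborel) < \<infinity>"
    unfolding integrable_iff_bounded by simp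
   hence "(\<integral>\<^sup>+z. ennreal (norm (\<rho> z * \<bar>u (z + x)\<bar> powr p)) \<partial>lborel) = \<infinity>"
    by (simp only: infinity_ennreal_def less_top[symmetric] not_not)
   thus ?thesis using \<rho>(1) by (simp add: ennreal_mult)
  qed (simp add: a_def)
 qed
 define I where "I = (LINT x|lborel. \<bar>u x\<bar> powr p)"
 have inner: "(\<integral>\<^sup>+x. ennreal (\<bar>u (z + x)\<bar> powr p) \<partial>lborel) = ennreal I" for z
  using lborel_integral_translate[of "%x. \<bar>u x\<bar> powr p" z] u(2) by (subst nn_integral_eq_integral) (auto simp: I_def)
 have "(\<integral>\<^sup>+x. ennreal (a x powr p) \<partial>lborel) <= (\<integral>\<^sup>+x. (\<integral>\<^sup>+z. ennreal (\<rho> z) * ennreal (\<bar>u (z + x)\<bar> powr p) \<partial>lborel) \<partial>lborel)"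
  by (rule nn_integral_mono) (rule jensen)
 also have "\<dots> = (\<integral>\<^sup>+z. (\<integral>\<^sup>+x. ennreal (\<rho> z) * ennreal (\<bar>u (z + x)\<bar> powr p) \<partial>lborel) \<partial>lborel)"
  by (rule lborel_pair.Fubini') measurable
 also have "\<dots> = (\<integral>\<^sup>+z. ennreal (\<rho> z) * ennreal I \<partial>lborel)" by (simp add: nn_integral_cmult inner)
 also have "\<dots> = ennreal I"
  using nn_integral_eq_integral[OF kernelD(4)[OF k]] \<rho> by (simp add: nn_integral_multc)
 finally have le: "(\<integral>\<^sup>+x. ennreal (a x powr p) \<partial>lborel) <= ennreal I" .
 have [measurable]: "a \<in> borel_measurable borel" unfolding a_def by measurable
 have i: "L1 (%x. a x powr p)"
  by (rule integrableI_bounded) (use le in \<open>auto intro: le_less_trans\<close>)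
 thus "L1 (%x. \<bar>conv \<rho> u x\<bar> powr p)" by (simp add: a_def)
 have "(LINT x|lborel. a x powr p) <= I"
  using le nn_integral_eq_integral[OF i] by (simp add: I_def)
 thus "(LINT x|lborel. \<bar>conv \<rho> u x\<bar> powr p) <= (LINT x|lborel. \<bar>u x\<bar> powr p)" by (simp add: a_def I_def)
qed

lemma powr_integrable_add:
 fixes u v :: "'e::euclidean_space => real"
 assumes p: "0 <= p" and m[measurable]: "u \<in> borel_measurable borel" "v \<in> borel_measurable borel"
  and i: "L1 (%x. \<bar>u x\<bar> powr p)" "L1 (%x. \<bar>v x\<bar> powr p)"
 shows "L1 (%x. \<bar>u x + v x\<bar> powr p)"
  "(LINT x|lborel. \<bar>u x + v x\<bar> powr p) <= 2 powr p * ((LINT x|lborel. \<bar>u x\<bar> powr p) + (LINT x|lborel. \<bar>v x\<bar> powr p))"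
proof -
 have le: "\<bar>u x + v x\<bar> powr p <= 2 powr p * (\<bar>u x\<bar> powr p + \<bar>v x\<bar> powr p)" for x
  using powr_add_le[OF p, of "u x" "v x"] by simp
 have i': "L1 (%x. 2 powr p * (\<bar>u x\<bar> powr p + \<bar>v x\<bar> powr p))" using i by auto
 show 1: "L1 (%x. \<bar>u x + v x\<bar> powr p)"
  by (rule Bochner_Integration.integrable_bound[OF i']) (use le in \<open>auto intro!: always_eventually intro: order_trans[OF le]\<close>)
 from integral_mono[OF 1 i' le] i
 show "(LINT x|lborel. \<bar>u x + v x\<bar> powr p) <= 2 powr p * ((LINT x|lborel. \<bar>u x\<bar> powr p) + (LINT x|lborel. \<bar>v x\<bar> powr p))" by simp
qed

text \<open>Density of compactly supported continuous functions: truncate u in domain and range,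
  then approximate the truncation almost everywhere. Dominated convergence controls both
  steps.\<close>

lemma Lp_continuous_approx:
 fixes u :: "'e::euclidean_space => real"
 assumes p: "1 <= p" and m[measurable]: "u \<in> borel_measurable borel" and u: "L1 (%x. \<bar>u x\<bar> powr p)" and e: "e > 0"
 shows "\<exists>g R. continuous_on UNIV g & (\<forall>x. x \<notin> cball 0 R --> g x = 0) & L1 (%x. \<bar>u x - g x\<bar> powr p) & (LINT x|lborel. \<bar>u x - g x\<bar> powr p) <= e"
proof -
 define e' where "e' = e / (2 powr p * 2)"
 have e': "e' > 0" using e by (simp add: e'_def)
 define t where "t M x = (if norm x <= real M & \<bar>u x\<bar> <= real M then u x else 0)" for M x
 have [measurable]: "t M \<in> borel_measurable borel" for M unfolding t_def by measurable
 have dom: "\<bar>u x - t M x\<bar> powr p <= \<bar>u x\<bar> powr p" for x M by (simp add: t_def)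
 have ti: "L1 (%x. \<bar>u x - t M x\<bar> powr p)" for M
  by (rule Bochner_Integration.integrable_bound[OF u]) (use dom in auto)
 have "(%M. LINT x|lborel. \<bar>u x - t M x\<bar> powr p) \<longlonglongrightarrow> integral\<^sup>L lborel (%_::'e. 0::real)"
 proof (rule integral_dominated_convergence[where f = "%_. 0" and w = "%x. \<bar>u x\<bar> powr p"])
  have "(%M. \<bar>u x - t M x\<bar> powr p) \<longlonglongrightarrow> 0" for x
  proof -
   obtain M0 where M0: "max (norm x) \<bar>u x\<bar> <= real M0" using real_arch_simple by blast
   have "\<bar>u x - t M x\<bar> powr p = 0" if "M >= M0" for M using that M0 by (auto simp: t_def)
   thus ?thesis by (intro tendsto_eventually) (auto simp: eventually_sequentially)
  qed
  thus "AE x in lborel. (%M. \<bar>u x - t M x\<bar> powr p) \<longlonglongrightarrow> 0" by simp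
 qed (use u dom in auto)
 from LIMSEQ_D[OF this e'] obtain M where M: "(LINT x|lborel. \<bar>u x - t M x\<bar> powr p) < e'" by auto
 have "t M \<in> borel_measurable lebesgue" by (rule measurable_completion) simp
 \<comment> \<open>This notion of measurability provides continuous functions that converge off a
   negligible set.\<close>
 hence "t M measurable_on UNIV" by (simp add: measurable_on_iff_borel_measurable lebesgue_on_UNIV_eq)
 then obtain N g where N: "negligible N" "!!n. continuous_on UNIV (g n)" "!!x. x \<notin> N ==> (%n. g n x) \<longlonglongrightarrow> t M x"
  unfolding measurable_on_def by auto
 \<comment> \<open>A cutoff equal to 1 on the ball of radius M. Together with clamping to [-M, M] it
   gives continuous \<open>h n\<close> with a common integrable majorant.\<close>
 define c where "c x = max 0 (min 1 (real M + 1 - norm x))" for x :: 'e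
 define h where "h n x = c x * max (- real M) (min (real M) (g n x))" for n x
 have hc: "continuous_on UNIV (h n)" for n unfolding h_def c_def by (intro continuous_intros N(2))
 have [measurable]: "h n \<in> borel_measurable borel" for n by (rule borel_measurable_continuous_onI[OF hc])
 have h0: "h n x = 0" if "x \<notin> cball 0 (real M + 1)" for n x using that by (simp add: h_def c_def)
 have c: "0 <= c x" "c x <= 1" "norm x <= real M ==> c x = 1" for x by (auto simp: c_def)
 have hb: "\<bar>h n x\<bar> <= real M" for n x unfolding h_def abs_mult using mult_mono[of "\<bar>c x\<bar>" 1 "\<bar>max (- real M) (min (real M) (g n x))\<bar>" "real M"] c by auto
 have dom: "\<bar>t M x - h n x\<bar> powr p <= indicator (cball 0 (real M + 1)) x * (2 * real M) powr p" for n x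
 proof (cases "x \<in> cball 0 (real M + 1)")
  case True
  have "\<bar>t M x - h n x\<bar> <= 2 * real M" using hb[of n x] by (auto simp: t_def)
  thus ?thesis using True p by (auto intro: powr_mono2)
 next
  case False
  thus ?thesis using h0[OF False, of n] by (simp add: t_def)
 qed
 have wi: "L1 (%x::'e. indicator (cball 0 (real M + 1)) x * (2 * real M) powr p)" by (rule integrable_bounded_indicator) auto
 have hi: "L1 (%x. \<bar>t M x - h n x\<bar> powr p)" for n
  by (rule Bochner_Integration.integrable_bound[OF wi]) (use dom in \<open>auto intro: order_trans[OF dom]\<close>)
 have "(%n. LINT x|lborel. \<bar>t M x - h n x\<bar> powr p) \<longlonglongrightarrow> integral\<^sup>L lborel (%_::'e. 0::real)"
 proof (rule integral_dominated_convergence[where f = "%_. 0" and w = "%x. indicator (cball 0 (real M + 1)) x * (2 * real M) powr p"])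
  have "(%n. \<bar>t M x - h n x\<bar> powr p) \<longlonglongrightarrow> 0" if "x \<notin> N" for x
  proof -
   have "(%n. h n x) \<longlonglongrightarrow> c x * max (- real M) (min (real M) (t M x))" unfolding h_def by (intro tendsto_intros N(3)[OF that])
   also have "c x * max (- real M) (min (real M) (t M x)) = t M x" using c(3)[of x] by (auto simp: t_def)
   finally have "(%n. \<bar>t M x - h n x\<bar>) \<longlonglongrightarrow> 0" by (auto intro!: tendsto_eq_intros)
   from tendsto_powr'[OF this tendsto_const, of p] p show ?thesis by simp
  qed
  moreover have "AE x in lborel. x \<notin> N"
   using N(1) AE_not_in[of N lebesgue] by (simp add: negligible_iff_null_sets AE_completion_iff)
  ultimately show "AE x in lborel. (%n. \<bar>t M x - h n x\<bar> powr p) \<longlonglongrightarrow> 0" by (auto elim: eventually_mono)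
 qed (use wi dom in auto)
 from LIMSEQ_D[OF this e'] obtain n where n: "(LINT x|lborel. \<bar>t M x - h n x\<bar> powr p) < e'" by auto
 have "\<bar>u x - h n x\<bar> = \<bar>(u x - t M x) + (t M x - h n x)\<bar>" for x by simp
 hence "L1 (%x. \<bar>u x - h n x\<bar> powr p)" "(LINT x|lborel. \<bar>u x - h n x\<bar> powr p) <= 2 powr p * ((LINT x|lborel. \<bar>u x - t M x\<bar> powr p) + (LINT x|lborel. \<bar>t M x - h n x\<bar> powr p))"
  using powr_integrable_add[OF _ _ _ ti hi, of M n] p by simp_all
 moreover have "2 powr p * ((LINT x|lborel. \<bar>u x - t M x\<bar> powr p) + (LINT x|lborel. \<bar>t M x - h n x\<bar> powr p)) <= 2 powr p * (2 * e')"
  using M n by (intro mult_left_mono) auto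
 ultimately show ?thesis using hc h0 by (intro exI[of _ "h n"] exI[of _ "real M + 1"]) (auto simp: e'_def)
qed

text \<open>With g continuous and close to u, the error splits into u - g, g - conv g and the
  convolution of u - g. Uniform continuity of g bounds the second part and Young's inequality the
  third.\<close>

lemma conv_close:
 fixes u :: "'e::euclidean_space => real"
 assumes p: "1 <= p" and u: "L1 u" "L1 (%x. \<bar>u x\<bar> powr p)" and e: "e > 0"
 shows "\<exists>d>0. \<forall>eps\<le>d. \<forall>\<rho>. mollifier eps \<rho> -->
  L1 (%x. \<bar>u x - conv \<rho> u x\<bar> powr p) & (LINT x|lborel. \<bar>u x - conv \<rho> u x\<bar> powr p) <= e"
proof -
 note [measurable] = borel_measurable_integrable[OF u(1)]
 have um: "u \<in> borel_measurable borel" by simp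
 define q where "q = 2 powr p"
 \<comment> \<open>Chosen such that the two uses of \<open>powr_integrable_add\<close> add up to q
   (e' + q (e' + e')) = e.\<close>
 define e' where "e' = e / (q * (1 + q * 2))"
 have q: "q > 0" by (simp add: q_def)
 have e': "e' > 0" using e q by (simp add: e'_def add_pos_pos)
 from Lp_continuous_approx[OF p um u(2) e'] obtain g R where g: "continuous_on UNIV g" "!!x. x \<notin> cball 0 R ==> g x = 0"
  "L1 (%x. \<bar>u x - g x\<bar> powr p)" "(LINT x|lborel. \<bar>u x - g x\<bar> powr p) <= e'" by blast
 have gi: "L1 g" by (rule integrable_compact_support[OF g(1) compact_cball g(2)])
 have vi: "L1 (%x. u x - g x)" using u(1) gi by simp
 define B where "B = measure lborel (cball (0::'e) (R + 1))"
 \<comment> \<open>B measures a ball containing the support of g - conv g for eps <= 1. A uniform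
   error of size kappa on that ball contributes at most e' to the integral of the p-th
   power.\<close>
 define \<kappa> where "\<kappa> = (e' / (B + 1)) powr (1 / p)"
 have B: "B >= 0" by (simp add: B_def)
 have \<kappa>: "\<kappa> > 0" "\<kappa> powr p * B <= e'"
 proof -
  show "\<kappa> > 0" using e' B by (simp add: \<kappa>_def)
  have "\<kappa> powr p = e' / (B + 1)" using e' B p by (simp add: \<kappa>_def powr_powr)
  hence "\<kappa> powr p + \<kappa> powr p * B = e'" using e' B by (simp add: field_simps)
  with powr_ge_zero[of \<kappa> p] show "\<kappa> powr p * B <= e'" by linarith
 qed
 have "uniformly_continuous_on UNIV g" by (rule compact_support_uniformly_continuous[OF g(1) compact_cball g(2)])
 with \<kappa>(1) obtain d where d: "d > 0" "!!x y. dist y x < d ==> dist (g y) (g x) < \<kappa>" unfolding uniformly_continuous_on_def by blast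
 have "L1 (%x. \<bar>u x - conv \<rho> u x\<bar> powr p) & (LINT x|lborel. \<bar>u x - conv \<rho> u x\<bar> powr p) <= e"
  if eps: "eps <= min 1 (d / 2)" and m: "mollifier eps \<rho>" for eps \<rho>
 proof -
  have k: "kernel eps \<rho>" using m by (simp add: mollifier_def)
  note [measurable] = smooth_on_continuous[OF conv_smooth[OF gi k], THEN borel_measurable_continuous_onI]
   smooth_on_continuous[OF conv_smooth[OF vi k], THEN borel_measurable_continuous_onI] borel_measurable_continuous_onI[OF g(1)]
  note v = conv_Lp[OF p m vi g(3)]
  have gb: "\<bar>g x - conv \<rho> g x\<bar> powr p <= indicator (cball 0 (R + 1)) x * \<kappa> powr p" for x
  proof (cases "x \<in> cball 0 (R + 1)")
   case True
   have "\<bar>g x - conv \<rho> g x\<bar> <= \<kappa>"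
    by (rule conv_uniform[OF m gi]) (use d eps in \<open>force simp: dist_real_def intro: less_imp_le\<close>)
   thus ?thesis using True p by (simp add: powr_mono2)
  next
   case False
   have "conv \<rho> g x = 0"
   proof (rule conv_zero_off[OF k, where K = "cball 0 R"])
    fix y :: 'e assume "y \<in> cball 0 R"
    thus "eps < dist y x" using False eps norm_triangle_sub[of x y] by (auto simp: dist_norm norm_minus_commute)
   qed (use g(2) in auto)
   thus ?thesis using g(2)[of x] False by auto
  qed
  have wi: "L1 (%x::'e. indicator (cball 0 (R + 1)) x * \<kappa> powr p)" by (rule integrable_bounded_indicator) auto
  have gpi: "L1 (%x. \<bar>g x - conv \<rho> g x\<bar> powr p)"
   by (rule Bochner_Integration.integrable_bound[OF wi]) (use gb in \<open>auto intro: order_trans[OF gb]\<close>)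
  have "(LINT x|lborel. \<bar>g x - conv \<rho> g x\<bar> powr p) <= e'"
   using integral_mono[OF gpi wi gb] \<kappa>(2) by (simp add: B_def mult.commute)
  moreover have "L1 (%x. \<bar>- conv \<rho> (%x. u x - g x) x\<bar> powr p)" using v(1) by simp
  note s = powr_integrable_add[OF _ _ _ gpi this]
  have i2: "L1 (%x. \<bar>(g x - conv \<rho> g x) + - conv \<rho> (%x. u x - g x) x\<bar> powr p)" using s(1) p by simp
  note s2 = powr_integrable_add[OF _ _ _ g(3) i2]
  have eq: "u x - conv \<rho> u x = (u x - g x) + ((g x - conv \<rho> g x) + - conv \<rho> (%x. u x - g x) x)" for x
   using conv_integrable[OF k u(1), of x] conv_integrable[OF k gi, of x] by (simp add: conv_def right_diff_distrib)
  have "L1 (%x. \<bar>u x - conv \<rho> u x\<bar> powr p)"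
   "(LINT x|lborel. \<bar>u x - conv \<rho> u x\<bar> powr p) <= q * ((LINT x|lborel. \<bar>u x - g x\<bar> powr p) + (LINT x|lborel. \<bar>(g x - conv \<rho> g x) + - conv \<rho> (%x. u x - g x) x\<bar> powr p))"
   unfolding eq q_def by (rule s2; use p in simp)+
  moreover have "(LINT x|lborel. \<bar>(g x - conv \<rho> g x) + - conv \<rho> (%x. u x - g x) x\<bar> powr p) <= q * ((LINT x|lborel. \<bar>g x - conv \<rho> g x\<bar> powr p) + (LINT x|lborel. \<bar>conv \<rho> (%x. u x - g x) x\<bar> powr p))"
   using s(2) p by (simp add: q_def)
  moreover have "q * ((LINT x|lborel. \<bar>g x - conv \<rho> g x\<bar> powr p) + (LINT x|lborel. \<bar>conv \<rho> (%x. u x - g x) x\<bar> powr p)) <= q * (e' + e')"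
   using calculation(1) v(2) g(4) q by (intro mult_left_mono) auto
  ultimately have "L1 (%x. \<bar>u x - conv \<rho> u x\<bar> powr p) & (LINT x|lborel. \<bar>u x - conv \<rho> u x\<bar> powr p) <= q * (e' + q * (e' + e'))"
   using g(4) q by (smt (verit) mult_left_mono)
  moreover have "q * (e' + q * (e' + e')) = e"
  proof -
   have "q * (e' + q * (e' + e')) = e' * (q * (1 + q * 2))" by (simp add: algebra_simps)
   thus ?thesis using q by (simp add: e'_def add_pos_pos)
  qed
  ultimately show ?thesis by simp
 qed
 thus ?thesis using d(1) by (intro exI[of _ "min 1 (d / 2)"]) auto
qed

section \<open>Sobolev functions on the whole space with control of size and support\<close>

text \<open>A quantitative form of membership in L^1 and L^p, extended to all weak derivatives by
  \<open>small\<close>. The L^1 bound serves convolution and termwise integration, the L^p bound the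
  Sobolev class, and K records the support.\<close>

definition small0 :: "real => 'e::euclidean_space set => real => ('e => real) => bool" where
 "small0 p K \<eta> u \<longleftrightarrow> L1 u & L1 (%x. \<bar>u x\<bar> powr p) & (LINT x|lborel. \<bar>u x\<bar>) <= \<eta> &
   (LINT x|lborel. \<bar>u x\<bar> powr p) <= \<eta> & (\<forall>x. x \<notin> K --> u x = 0)"

primrec small :: "nat => real => 'e::euclidean_space set => real => ('e => real) => bool" where
 "small 0 p K \<eta> u \<longleftrightarrow> small0 p K \<eta> u"
| "small (Suc k) p K \<eta> u \<longleftrightarrow> small0 p K \<eta> u & (\<forall>b\<in>Basis. \<exists>g. weak_partial UNIV [b] u g & small k p K \<eta> g)"

lemma small_0: "small k p K \<eta> u ==> small0 p K \<eta> u"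
 by (cases k) auto

lemma smallD:
 assumes "small k p K \<eta> u"
 shows "L1 u" "L1 (%x. \<bar>u x\<bar> powr p)" "(LINT x|lborel. \<bar>u x\<bar>) <= \<eta>"
   "(LINT x|lborel. \<bar>u x\<bar> powr p) <= \<eta>" "x \<notin> K ==> u x = 0"
 using small_0[OF assms] by (auto simp: small0_def)

lemma small_mono: "small k p K \<eta> u ==> K \<subseteq> L ==> \<eta> <= \<eta>' ==> small k p L \<eta>' u"
proof (induction k arbitrary: u)
 case 0
 thus ?case by (fastforce simp: small0_def)
next
 case (Suc k)
 have "small0 p L \<eta>' u" using smallD[OF Suc.prems(1)] Suc.prems(2,3) by (fastforce simp: small0_def)
 with Suc show ?case unfolding small.simps by meson
qed

lemma integrable_test_mult:
 fixes u :: "'e::euclidean_space => real"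
 assumes "test_function Om \<psi>" "L1 u"
 shows "L1 (%x. \<psi> x * u x)"
proof -
 have "L1 (%x. \<bar>u x\<bar>)" using assms by (intro integrable_abs)
 hence "L1 (%x. \<bar>u x\<bar> powr 1)" by simp
 with assms(2) have "in_Lp 1 UNIV u" by (auto simp: in_Lp_alt)
 from test_mult_integrable[OF _ this, of \<psi>] test_function_mono[OF assms(1)] show ?thesis by simp
qed

lemma small0_add:
 assumes p: "1 <= p" and "small0 p K \<eta> u" "small0 p K \<eta>' v"
 shows "small0 p K (2 powr p * (\<eta> + \<eta>')) (%x. u x + v x)"
proof -
 have 0: "small 0 p K \<eta> u" "small 0 p K \<eta>' v" using assms by auto
 note u = smallD[OF 0(1)] and v = smallD[OF 0(2)]
 note [measurable] = borel_measurable_integrable[OF u(1)] borel_measurable_integrable[OF v(1)]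
 have ip: "L1 (%x. \<bar>u x + v x\<bar> powr p)"
  "(LINT x|lborel. \<bar>u x + v x\<bar> powr p) <= 2 powr p * ((LINT x|lborel. \<bar>u x\<bar> powr p) + (LINT x|lborel. \<bar>v x\<bar> powr p))"
  using powr_integrable_add[of p u v] p u(2) v(2) by auto
 note ip(2)
 also have "\<dots> <= 2 powr p * (\<eta> + \<eta>')" using u v by simp
 finally have 1: "(LINT x|lborel. \<bar>u x + v x\<bar> powr p) <= 2 powr p * (\<eta> + \<eta>')" .
 have "(LINT x|lborel. \<bar>u x + v x\<bar>) <= (LINT x|lborel. \<bar>u x\<bar> + \<bar>v x\<bar>)"
  by (rule integral_mono) (use u v in auto)
 also have "\<dots> <= 1 * (\<eta> + \<eta>')" using u v by simp
 also have "\<dots> <= 2 powr p * (\<eta> + \<eta>')"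
 proof (rule mult_right_mono)
  show "1 <= 2 powr p" using p by (simp add: ge_one_powr_ge_zero)
  have "0 <= (LINT x|lborel. \<bar>u x\<bar>)" "0 <= (LINT x|lborel. \<bar>v x\<bar>)" by auto
  with u(3) v(3) show "0 <= \<eta> + \<eta>'" by linarith
 qed
 finally show ?thesis using 1 ip(1) u v by (auto simp: small0_def)
qed

lemma small_add:
 assumes p: "1 <= p"
 shows "small k p K \<eta> u ==> small k p K \<eta>' v ==> small k p K (2 powr p * (\<eta> + \<eta>')) (%x. u x + v x)"
proof (induction k arbitrary: u v)
 case 0
 thus ?case using small0_add[OF p] by simp
next
 case (Suc k)
 have 0: "small0 p K (2 powr p * (\<eta> + \<eta>')) (%x. u x + v x)"
  by (rule small0_add[OF p]) (use Suc.prems in simp_all)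
 show ?case unfolding small.simps(2)
 proof (intro conjI ballI 0)
  fix b :: 'a assume b: "b \<in> Basis"
  from b Suc.prems obtain g h where g: "weak_partial UNIV [b] u g" "small k p K \<eta> g"
   and h: "weak_partial UNIV [b] v h" "small k p K \<eta>' h" unfolding small.simps(2) by blast
  have "weak_partial UNIV [b] (%x. u x + v x) (%x. g x + h x)"
   unfolding weak_partial_single
  proof (intro allI impI)
   fix \<psi> :: "'a => real" assume \<psi>: "test_function UNIV \<psi>"
   note i = integrable_test_mult[OF \<psi>] integrable_test_mult[OF test_function_pd[OF \<psi>]]
   show "(LINT x|lborel. pd b \<psi> x *\<^sub>R (u x + v x)) = - (LINT x|lborel. \<psi> x *\<^sub>R (g x + h x))"
    using g h \<psi> i smallD(1)[OF g(2)] smallD(1)[OF h(2)] smallD(1)[OF Suc.prems(1)] smallD(1)[OF Suc.prems(2)]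
    by (simp add: distrib_left weak_partial_single)
  qed
  with Suc.IH[OF g(2) h(2)] show "\<exists>g. weak_partial UNIV [b] (%x. u x + v x) g & small k p K (2 powr p * (\<eta> + \<eta>')) g" by blast
 qed
qed

text \<open>A cutoff carries u from Om to the whole space, where mollification takes place. In the
  Leibniz rule psi e is a test function on Om even though psi is not.\<close>

lemma sob_cutoff:
 fixes u :: "'e::euclidean_space => real"
 assumes p: "1 <= p" and K: "compact K" "K \<subseteq> Om"
 shows "smooth_on UNIV e ==> (!!x. x \<notin> K ==> e x = 0) ==> sob k p Om u ==> \<exists>M. small k p K M (%x. e x * u x)"
proof (induction k arbitrary: e u)
 case (0 e u)
 have t: "test_function Om e" using 0 K unfolding test_function_alt by blast
 have c: "continuous_on UNIV e" using 0 smooth_on_continuous by blast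
 from compact_support_bounded[OF c K(1) 0(2)] obtain C where C: "C >= 0" "!!x. norm (e x) <= C" by metis
 have lp: "in_Lp p Om u" using 0 by simp
 have i: "L1 (%x. e x * u x)" using test_mult_integrable[OF p lp t] by simp
 have ip: "L1 (%x. \<bar>e x * u x\<bar> powr p)"
 proof (rule Bochner_Integration.integrable_bound)
  show "L1 (%x. C powr p * (indicator Om x *\<^sub>R norm (u x) powr p))" using lp unfolding in_Lp_alt by (intro integrable_mult_right) auto
  show "AE x in lborel. norm (\<bar>e x * u x\<bar> powr p) <= norm (C powr p * (indicator Om x *\<^sub>R norm (u x) powr p))"
  proof (rule always_eventually, rule)
   fix x
   have "\<bar>e x\<bar> powr p <= C powr p" if "x \<in> Om" using C(2)[of x] p by (intro powr_mono2) auto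
   thus "norm (\<bar>e x * u x\<bar> powr p) <= norm (C powr p * (indicator Om x *\<^sub>R norm (u x) powr p))"
    using test_function_zero[OF t, of x] C by (cases "x \<in> Om") (auto simp: abs_mult powr_mult intro!: mult_right_mono)
  qed
 qed (use i in measurable)
 show ?case
  by (rule exI[of _ "max (LINT x|lborel. \<bar>e x * u x\<bar>) (LINT x|lborel. \<bar>e x * u x\<bar> powr p)"]) (use i ip 0(2) in \<open>auto simp: small0_def\<close>)
next
 case (Suc k e u)
 have t: "test_function Om e" using Suc.prems K unfolding test_function_alt by blast
 have lp: "in_Lp p Om u" using Suc.prems by auto
 note e' = smooth_has_derivative(2)[OF Suc.prems(1)] pd_zero_outside[OF compact_imp_closed[OF K(1)] Suc.prems(2)]
 from Suc.IH[OF Suc.prems(1,2) sob_Suc_D[OF Suc.prems(3)]] obtain M0 where M0: "small0 p K M0 (%x. e x * u x)" using small_0 by blast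
 have "\<exists>M g. weak_partial UNIV [b] (%x. e x * u x) g & small k p K M g" if b: "b \<in> Basis" for b
 proof -
  from b Suc.prems(3) obtain g where g: "weak_partial Om [b] u g" "sob k p Om g" by auto
  from Suc.IH[OF Suc.prems(1,2) g(2)] Suc.IH[OF e' sob_Suc_D[OF Suc.prems(3)]]
  obtain M M' where M: "small k p K M (%x. e x * g x)" "small k p K M' (%x. pd b e x * u x)" by blast
  have "weak_partial UNIV [b] (%x. e x * u x) (%x. e x * g x + pd b e x * u x)"
   unfolding weak_partial_single
  proof (intro allI impI)
   fix \<psi> :: "'e => real" assume \<psi>: "test_function UNIV \<psi>"
   have s: "smooth_on UNIV \<psi>" using \<psi> by (simp add: test_function_alt)
   have te: "test_function Om (%x. \<psi> x * e x)" unfolding test_function_alt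
    using smooth_on_mult[OF half_open_UNIV s Suc.prems(1)] K Suc.prems(2) by (intro conjI exI[of _ K]) auto
   have pdm: "pd b (%x. \<psi> x * e x) x = pd b \<psi> x * e x + \<psi> x * pd b e x" for x
    using pd_eq[OF has_derivative_mult[OF smooth_has_derivative(1)[OF s] smooth_has_derivative(1)[OF Suc.prems(1)]], of b x] by simp
   have "(LINT x|lborel. pd b (%x. \<psi> x * e x) x *\<^sub>R u x) = - (LINT x|lborel. (\<psi> x * e x) *\<^sub>R g x)"
    using g(1) te unfolding weak_partial_single by blast
   thus "(LINT x|lborel. pd b \<psi> x *\<^sub>R (e x * u x)) = - (LINT x|lborel. \<psi> x *\<^sub>R (e x * g x + pd b e x * u x))"
    using integrable_test_mult[OF test_function_pd[OF \<psi>] smallD(1)[of 0 p K M0 "%x. e x * u x"], of b] M0 integrable_test_mult[OF \<psi> smallD(1)[OF M(1)]]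
     integrable_test_mult[OF \<psi> smallD(1)[OF M(2)]]
    by (simp add: pdm distrib_left distrib_right mult.assoc)
  qed
  with small_add[OF p M] show ?thesis by blast
 qed
 then obtain M where M: "!!b. b \<in> Basis ==> \<exists>g. weak_partial UNIV [b] (%x. e x * u x) g & small k p K (M b) g" by metis
 define L where "L = Max (insert M0 (M ` Basis))"
 have L: "M0 <= L" "!!b. b \<in> Basis ==> M b <= L" unfolding L_def by (intro Max_ge; simp)+
 have "small (Suc k) p K L (%x. e x * u x)" unfolding small.simps(2)
 proof (intro conjI ballI)
  show "small0 p K L (%x. e x * u x)" using M0 L(1) by (auto simp: small0_def)
  fix b :: 'e assume b: "b \<in> Basis"
  from M[OF b] obtain g where g: "weak_partial UNIV [b] (%x. e x * u x) g" "small k p K (M b) g" by blast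
  from small_mono[OF g(2) order_refl L(2)[OF b]] g(1)
  show "\<exists>g. weak_partial UNIV [b] (%x. e x * u x) g & small k p K L g" by blast
 qed
 thus ?case ..
qed

lemma mollify_small0:
 fixes u :: "'e::euclidean_space => real"
 assumes p: "1 <= p" and e: "\<eta> > 0" and KL: "K \<subseteq> L" and small: "small0 p K M u"
 shows "\<forall>\<^sub>F eps in at_right 0. \<forall>\<rho>. mollifier eps \<rho> --> (\<forall>x y. x \<notin> L --> y \<in> K --> eps < dist y x) -->
  small0 p L \<eta> (%x. u x - conv \<rho> u x)"
proof -
 have 0: "small 0 p K M u" using small by simp
 note u = smallD[OF 0]
 have ev: "\<forall>\<^sub>F eps in at_right 0. \<forall>\<rho>. mollifier eps \<rho> --> L1 (%x. \<bar>u x - conv \<rho> u x\<bar> powr q) & (LINT x|lborel. \<bar>u x - conv \<rho> u x\<bar> powr q) <= \<eta>"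
  if "1 <= q" "L1 (%x. \<bar>u x\<bar> powr q)" for q
 proof -
  from conv_close[OF that(1) u(1) that(2) e] show ?thesis unfolding eventually_at_right_field by (meson less_imp_le)
 qed
 have "L1 (%x. \<bar>u x\<bar> powr 1)" using integrable_abs[OF u(1)] by simp
 from ev[OF order_refl this] ev[OF p u(2)]
 show ?thesis
 proof eventually_elim
  case (elim eps)
  show ?case
  proof (intro allI impI)
   fix \<rho> :: "'e => real" assume m: "mollifier eps \<rho>" and far: "\<forall>x y. x \<notin> L --> y \<in> K --> eps < dist y x"
   hence k: "kernel eps \<rho>" by (simp add: mollifier_def)
   note [measurable] = smooth_on_continuous[OF conv_smooth[OF u(1) k], THEN borel_measurable_continuous_onI] borel_measurable_integrable[OF u(1)]
   have "L1 (%x. \<bar>u x - conv \<rho> u x\<bar>)" "(LINT x|lborel. \<bar>u x - conv \<rho> u x\<bar>) <= \<eta>" using elim(1) m by auto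
   moreover have "L1 (%x. u x - conv \<rho> u x)"
    by (rule integrable_abs_cancel) (use calculation in auto)
   moreover have "u x - conv \<rho> u x = 0" if "x \<notin> L" for x
   proof -
    have "conv \<rho> u x = 0" by (rule conv_zero_off[OF k, where K = K]) (use u(5) far that in auto)
    thus ?thesis using u(5)[of x] KL that by auto
   qed
   ultimately show "small0 p L \<eta> (%x. u x - conv \<rho> u x)" using elim(2) m by (auto simp: small0_def)
  qed
 qed
qed

text \<open>Mollification commutes with weak differentiation (\<open>pd_conv\<close>), so the
  approximation in L^1 and L^p applies to every derivative. The filter collects the finitely many
  bounds on eps.\<close>

lemma mollify_small:
 fixes u :: "'e::euclidean_space => real"
 assumes p: "1 <= p" and e: "\<eta> > 0" and KL: "K \<subseteq> L"
 shows "small k p K M u ==> \<forall>\<^sub>F eps in at_right 0. \<forall>\<rho>. mollifier eps \<rho> --> (\<forall>x y. x \<notin> L --> y \<in> K --> eps < dist y x) -->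
  small k p L \<eta> (%x. u x - conv \<rho> u x)"
proof (induction k arbitrary: u)
 case (0 u)
 hence "small0 p K M u" by simp
 from mollify_small0[OF p e KL this] show ?case by simp
next
 case (Suc k u)
 note u = smallD[OF Suc.prems]
 from Suc.prems have "\<forall>b\<in>Basis. \<exists>g. weak_partial UNIV [b] u g & small k p K M g" by simp
 then obtain g where g: "!!b. b \<in> Basis ==> weak_partial UNIV [b] u (g b)" "!!b. b \<in> Basis ==> small k p K M (g b)" by metis
 have ev0: "\<forall>\<^sub>F eps in at_right 0. \<forall>\<rho>. mollifier eps \<rho> --> (\<forall>x y. x \<notin> L --> y \<in> K --> eps < dist y x) -->
  small0 p L \<eta> (%x. u x - conv \<rho> u x)"
  by (rule mollify_small0[OF p e KL, where M = M]) (use Suc.prems in simp)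
 have "\<forall>\<^sub>F eps in at_right 0. \<forall>b\<in>Basis. \<forall>\<rho>. mollifier eps \<rho> --> (\<forall>x y. x \<notin> L --> y \<in> K --> eps < dist y x) -->
  small k p L \<eta> (%x. g b x - conv \<rho> (g b) x)"
  by (rule eventually_ball_finite) (use Suc.IH[OF g(2)] in auto)
 with ev0 show ?case
 proof eventually_elim
  case (elim eps)
  show ?case
  proof (intro allI impI)
   fix \<rho> :: "'e => real" assume m: "mollifier eps \<rho>" and far: "\<forall>x y. x \<notin> L --> y \<in> K --> eps < dist y x"
   hence k: "kernel eps \<rho>" by (simp add: mollifier_def)
   have s0: "small0 p L \<eta> (%x. u x - conv \<rho> u x)" using elim(1) m far by blast
   have ci: "L1 (conv \<rho> u)"
    using Bochner_Integration.integrable_diff[OF u(1), of "%x. u x - conv \<rho> u x"] s0 by (simp add: small0_def)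
   show "small (Suc k) p L \<eta> (%x. u x - conv \<rho> u x)" unfolding small.simps(2)[of k]
   proof (intro conjI ballI s0)
    fix b :: 'e assume b: "b \<in> Basis"
    have s1: "small k p L \<eta> (%x. g b x - conv \<rho> (g b) x)" using elim(2) b m far by blast
    have gi: "L1 (g b)" using smallD(1)[OF g(2)[OF b]] .
    have cgi: "L1 (conv \<rho> (g b))"
     using Bochner_Integration.integrable_diff[OF gi smallD(1)[OF s1]] by simp
    have "pd b (conv \<rho> u) = conv \<rho> (g b)" using pd_conv[OF k u(1) g(1)[OF b]] by (rule ext)
    with weak_partial_smooth[OF conv_smooth[OF u(1) k], of b]
    have w: "weak_partial UNIV [b] (conv \<rho> u) (conv \<rho> (g b))" by simp
    have "weak_partial UNIV [b] (%x. u x - conv \<rho> u x) (%x. g b x - conv \<rho> (g b) x)"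
     unfolding weak_partial_single
    proof (intro allI impI)
     fix \<psi> :: "'e => real" assume \<psi>: "test_function UNIV \<psi>"
     note i = integrable_test_mult[OF \<psi>] integrable_test_mult[OF test_function_pd[OF \<psi>]]
     show "(LINT x|lborel. pd b \<psi> x *\<^sub>R (u x - conv \<rho> u x)) = - (LINT x|lborel. \<psi> x *\<^sub>R (g b x - conv \<rho> (g b) x))"
      using g(1)[OF b] w \<psi> i(1)[OF gi] i(1)[OF cgi] i(2)[OF u(1), of b] i(2)[OF ci, of b]
      by (simp add: right_diff_distrib weak_partial_single)
    qed
    with s1 show "\<exists>h. weak_partial UNIV [b] (%x. u x - conv \<rho> u x) h & small k p L \<eta> h" by blast
   qed
  qed
 qed
qed

section \<open>Series with disjoint supports and the gliding hump\<close>

text \<open>The index j depends on x only and is fixed before the series, so that several series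
  with the same supports are evaluated at the same index.\<close>

lemma sums_disjoint:
 assumes "disjoint_family (K :: nat => 'e set)"
 shows "\<exists>j. \<forall>f :: nat => 'e => real. (\<forall>i. x \<notin> K i --> f i x = 0) --> (%i. f i x) sums f j x"
proof -
 obtain j where j: "!!i. i ~= j ==> x \<notin> K i" using assms unfolding disjoint_family_on_def by (cases "\<exists>j. x \<in> K j") blast+
 have "(%i. f i x) sums f j x" if "!!i. x \<notin> K i ==> f i x = 0" for f :: "nat => 'e => real"
  using sums_finite[of "{j}" "%i. f i x"] that j by auto
 thus ?thesis by blast
qed

lemma integral_suminf_disjoint:
 fixes f :: "nat => 'e::euclidean_space => real"
 assumes K: "disjoint_family K" and f: "!!j. L1 (f j)" "!!j. (LINT x|lborel. \<bar>f j x\<bar>) <= \<eta> j" "!!j x. x \<notin> K j ==> f j x = 0"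
  and \<eta>: "summable \<eta>"
 shows "L1 (%x. \<Sum>j. f j x)" "(%j. LINT x|lborel. f j x) sums (LINT x|lborel. (\<Sum>j. f j x))"
  "(LINT x|lborel. \<bar>\<Sum>j. f j x\<bar>) <= suminf \<eta>"
proof -
 have "summable (%j. norm (f j x))" for x
 proof -
  obtain j where "\<forall>f :: nat => 'e => real. (\<forall>i. x \<notin> K i --> f i x = 0) --> (%i. f i x) sums f j x" using sums_disjoint[OF K, of x] by (rule exE)
  from this[rule_format, of "%j x. norm (f j x)"] f(3) show ?thesis by (auto simp: sums_iff)
 qed
 hence s: "AE x in lborel. summable (%j. norm (f j x))" by simp
 have s2: "summable (%j. LINT x|lborel. norm (f j x))"
  by (rule summable_comparison_test'[OF \<eta>]) (use f(2) in auto)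
 show "L1 (%x. \<Sum>j. f j x)" by (rule integrable_suminf[OF f(1) s s2])
 show "(%j. LINT x|lborel. f j x) sums (LINT x|lborel. (\<Sum>j. f j x))" by (rule sums_integral[OF f(1) s s2])
 have "\<bar>\<Sum>j. f j x\<bar> = (\<Sum>j. \<bar>f j x\<bar>)" for x
 proof -
  obtain j where j: "\<forall>f :: nat => 'e => real. (\<forall>i. x \<notin> K i --> f i x = 0) --> (%i. f i x) sums f j x" using sums_disjoint[OF K, of x] by (rule exE)
  from j[rule_format, of f] j[rule_format, of "%j x. \<bar>f j x\<bar>"] f(3) show ?thesis by (auto simp: sums_iff)
 qed
 hence "(LINT x|lborel. \<bar>\<Sum>j. f j x\<bar>) = (\<Sum>j. (LINT x|lborel. \<bar>f j x\<bar>))"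
  using integral_suminf[of lborel "%j x. \<bar>f j x\<bar>"] f(1) s s2 by simp
 also have "\<dots> <= suminf \<eta>" using s2 f(2) \<eta> by (intro suminf_le) auto
 finally show "(LINT x|lborel. \<bar>\<Sum>j. f j x\<bar>) <= suminf \<eta>" .
qed

text \<open>At each point at most one term is nonzero. Hence the p-th power of the sum is the sum of
  the p-th powers, and the bounds simply add.\<close>

lemma small0_suminf:
 fixes w :: "nat => 'e::euclidean_space => real"
 assumes K: "disjoint_family K" "!!j. K j \<subseteq> L" and \<eta>: "summable \<eta>" and small: "!!j. small0 p (K j) (\<eta> j) (w j)"
 shows "small0 p L (suminf \<eta>) (%x. \<Sum>j. w j x)"
proof -
 have 0: "small 0 p (K j) (\<eta> j) (w j)" for j using small by simp
 note w = smallD[OF 0]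
 note 1 = integral_suminf_disjoint[OF K(1) w(1,3,5) \<eta>]
 have "(LINT x|lborel. \<bar>\<bar>w j x\<bar> powr p\<bar>) <= \<eta> j" for j using w(4) by simp
 note 2 = integral_suminf_disjoint[OF K(1) w(2) this _ \<eta>]
 have eq: "(\<Sum>j. \<bar>w j x\<bar> powr p) = \<bar>\<Sum>j. w j x\<bar> powr p" "x \<notin> L ==> (\<Sum>j. w j x) = 0" for x
 proof -
  obtain j where j: "\<forall>f :: nat => 'e => real. (\<forall>i. x \<notin> K i --> f i x = 0) --> (%i. f i x) sums f j x" using sums_disjoint[OF K(1), of x] by (rule exE)
  have "(%j. w j x) sums w j x" "(%j. \<bar>w j x\<bar> powr p) sums (\<bar>w j x\<bar> powr p)"
   using j[rule_format, of w] j[rule_format, of "%j x. \<bar>w j x\<bar> powr p"] w(5) by auto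
  with w(5)[of x j] K(2)[of j] show "(\<Sum>j. \<bar>w j x\<bar> powr p) = \<bar>\<Sum>j. w j x\<bar> powr p" "x \<notin> L ==> (\<Sum>j. w j x) = 0"
   by (auto simp: sums_iff)
 qed
 show ?thesis using 1 2(1,3) w(5) by (auto simp: small0_def eq)
qed

text \<open>After pairing with a test function, summability of the L^1 bounds allows termwise
  integration, so the weak derivative of the sum is the sum of the weak derivatives.\<close>

lemma small_suminf:
 fixes w :: "nat => 'e::euclidean_space => real"
 assumes K: "disjoint_family K" "!!j. K j \<subseteq> L" and \<eta>: "summable \<eta>"
 shows "(!!j. small k p (K j) (\<eta> j) (w j)) ==> small k p L (suminf \<eta>) (%x. \<Sum>j. w j x)"
proof (induction k arbitrary: w)
 case (0 w)
 thus ?case using small0_suminf[OF K \<eta>] by simp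
next
 case (Suc k w)
 have w: "small0 p (K j) (\<eta> j) (w j)" for j using Suc.prems by simp
 show ?case unfolding small.simps(2)
 proof (intro conjI ballI small0_suminf[OF K \<eta> w])
  fix b :: 'e assume b: "b \<in> Basis"
  have "\<exists>g. weak_partial UNIV [b] (w j) g & small k p (K j) (\<eta> j) g" for j using Suc.prems[of j] b by simp
  then obtain g where g: "!!j. weak_partial UNIV [b] (w j) (g j)" "!!j. small k p (K j) (\<eta> j) (g j)" by metis
  have "weak_partial UNIV [b] (%x. \<Sum>j. w j x) (%x. \<Sum>j. g j x)" unfolding weak_partial_single
  proof (intro allI impI)
   fix \<psi> :: "'e => real" assume \<psi>: "test_function UNIV \<psi>"
   have int: "(%j. LINT x|lborel. \<theta> x * f j x) sums (LINT x|lborel. \<theta> x * (\<Sum>j. f j x))"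
    if \<theta>: "test_function UNIV \<theta>" and f: "!!j. small 0 p (K j) (\<eta> j) (f j)" for \<theta> :: "'e => real" and f
   proof -
    note f = smallD[OF f]
    obtain Q where Q: "smooth_on UNIV \<theta>" "compact Q" "!!x. x \<notin> Q ==> \<theta> x = 0" using \<theta> by (auto simp: test_function_alt)
    from compact_support_bounded[OF smooth_on_continuous[OF Q(1)] Q(2,3)]
    obtain C where C: "C >= 0" "!!x. \<bar>\<theta> x\<bar> <= C" unfolding real_norm_def by metis
    have "(LINT x|lborel. \<bar>\<theta> x * f j x\<bar>) <= C * \<eta> j" for j
    proof -
     have "(LINT x|lborel. \<bar>\<theta> x * f j x\<bar>) <= (LINT x|lborel. C * \<bar>f j x\<bar>)"
      by (rule integral_mono[OF integrable_abs[OF integrable_test_mult[OF \<theta> f(1)]]]) (use f(1) C in \<open>auto simp: abs_mult intro!: mult_right_mono\<close>)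
     also have "\<dots> <= C * \<eta> j" using f(3) C by (simp add: mult_left_mono)
     finally show ?thesis .
    qed
    note i = integral_suminf_disjoint(2)[OF K(1) integrable_test_mult[OF \<theta> f(1)] this _ summable_mult[OF \<eta>]]
    have "(\<Sum>j. \<theta> x * f j x) = \<theta> x * (\<Sum>j. f j x)" for x
    proof -
     obtain j where j: "\<forall>f :: nat => 'e => real. (\<forall>i. x \<notin> K i --> f i x = 0) --> (%i. f i x) sums f j x" using sums_disjoint[OF K(1), of x] by (rule exE)
     have "(%j. f j x) sums f j x" using j f(5) by blast
     thus ?thesis using suminf_mult[of "%j. f j x" "\<theta> x"] by (simp add: sums_iff)
    qed
    with i f(5) show ?thesis by simp
   qed
   have g0: "small 0 p (K j) (\<eta> j) (g j)" "small 0 p (K j) (\<eta> j) (w j)" for j using small_0[OF g(2)] w by auto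
   have "(LINT x|lborel. pd b \<psi> x * w j x) = - (LINT x|lborel. \<psi> x * g j x)" for j
    using g(1) \<psi> by (simp add: weak_partial_single)
   with sums_minus[OF int[OF \<psi> g0(1)]] have "(%j. LINT x|lborel. pd b \<psi> x * w j x) sums - (LINT x|lborel. \<psi> x * (\<Sum>j. g j x))" by simp
   from sums_unique2[OF int[OF test_function_pd[OF \<psi>] g0(2)] this] show "(LINT x|lborel. pd b \<psi> x *\<^sub>R (\<Sum>j. w j x)) = - (LINT x|lborel. \<psi> x *\<^sub>R (\<Sum>j. g j x))" by simp
  qed
  with Suc.IH[OF g(2)] show "\<exists>g. weak_partial UNIV [b] (%x. \<Sum>j. w j x) g & small k p L (suminf \<eta>) g" by blast
 qed
qed

text \<open>The quotient 4 separates the shells between d/2 and 3d/2: the outer radius of a later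
  shell is at most 3/8 of an earlier d, below its inner radius d/2.\<close>

lemma geometric_subsequence:
 fixes d :: "nat => real"
 assumes d: "d \<longlonglongrightarrow> 0" "!!n. d n > 0" and R: "R > 0"
 shows "\<exists>\<phi> :: nat => nat. strict_mono \<phi> & (\<forall>j. d (\<phi> j) <= R) & (\<forall>i j. i < j --> d (\<phi> j) <= d (\<phi> i) / 4)"
proof -
 have small: "\<exists>n>m. d n <= e" if e: "e > 0" for e m
 proof -
  from LIMSEQ_D[OF d(1) e] obtain N where "!!n. n >= N ==> \<bar>d n\<bar> < e" by auto
  from this[of "max N (Suc m)"] show ?thesis by (intro exI[of _ "max N (Suc m)"]) auto
 qed
 have "\<exists>\<phi>. \<forall>n. d (\<phi> n) <= R & (\<phi> n < \<phi> (Suc n) & d (\<phi> (Suc n)) <= d (\<phi> n) / 4)"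
 proof (rule dependent_nat_choice)
  show "\<exists>x. d x <= R" using small[OF R] by blast
  show "\<exists>y. d y <= R & x < y & d y <= d x / 4" for x n using small[of "min R (d x / 4)" x] R d(2)[of x] by auto
 qed
 then obtain \<phi> where \<phi>: "!!n. d (\<phi> n) <= R" "!!n. \<phi> n < \<phi> (Suc n)" "!!n. d (\<phi> (Suc n)) <= d (\<phi> n) / 4" by blast
 have "d (\<phi> (Suc i + k)) <= d (\<phi> i) / 4" for i k
 proof (induction k)
  case (Suc k)
  have "d (\<phi> (Suc i + Suc k)) <= d (\<phi> (Suc i + k)) / 4" using \<phi>(3)[of "Suc i + k"] by simp
  with Suc d(2)[of "\<phi> (Suc i + k)"] show ?case by linarith
 qed (use \<phi>(3) in simp)
 hence "d (\<phi> j) <= d (\<phi> i) / 4" if "i < j" for i j using that less_imp_Suc_add[of i j] by auto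
 with \<phi>(1,2) show ?thesis by (intro exI[of _ \<phi>]) (simp add: strict_mono_Suc_iff)
qed

text \<open>Near a point other than a only finitely many terms are nonzero.\<close>

lemma smooth_suminf:
 fixes q :: "nat => 'e::euclidean_space => real"
 assumes d: "d \<longlonglongrightarrow> 0" and q: "!!j. smooth_on UNIV (q j)" "!!j x. q j x ~= 0 ==> dist a x <= d j"
 shows "smooth_on (- {a}) (%x. \<Sum>j. q j x)"
proof (rule smooth_on_glue)
 show "half_open (- {a})" by (rule open_half_open) auto
 fix x assume "x \<in> - {a}"
 hence x: "dist a x / 2 > 0" by auto
 from LIMSEQ_D[OF d x] obtain J where J: "!!j. j >= J ==> d j < dist a x / 2" by force
 define N where "N = {y. dist a x / 2 < dist a y}"
 have N: "open N" unfolding N_def by (intro open_Collect_less continuous_intros)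
 have "(\<Sum>j. q j y) = (\<Sum>j<J. q j y)" if "y \<in> N" for y
 proof (rule suminf_finite)
  show "q j y = 0" if "j \<notin> {..<J}" for j
   using J[of j] q(2)[of j y] that \<open>y \<in> N\<close> by (force simp: N_def)
 qed simp
 hence "smooth_on (- {a} \<inter> N) (%x. \<Sum>j. q j x) \<longleftrightarrow> smooth_on (- {a} \<inter> N) (%x. \<Sum>j<J. q j x)"
  by (intro smooth_on_cong) auto
 moreover have "smooth_on (- {a} \<inter> N) (%x. \<Sum>j<J. q j x)"
  by (intro smooth_on_sum smooth_on_subset[OF q(1)]) auto
 ultimately show "\<exists>N. open N & x \<in> N & smooth_on (- {a} \<inter> N) (%x. \<Sum>j. q j x)"
  using N x by (intro exI[of _ N]) (auto simp: N_def)
qed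

text \<open>
 The function \<open>h\<close> is a sum of bumps of height \<open>j\<close> around points converging to \<open>a\<close>; on the disjoint balls
 that carry them, \<open>h u\<close> is approximated up to \<open>2\<^sup>-\<^sup>j\<close> by smooth functions, which sum up to \<open>s\<close>.
\<close>

lemma gliding_hump:
 fixes u :: "'e::euclidean_space => real"
 assumes p: "1 <= p" and u: "sob k p Om u" "continuous_on Om u" "open Om" and R: "R > 0" "cball a R \<subseteq> Om"
  and xs: "xs \<longlonglongrightarrow> a" "!!n. xs n ~= a"
 obtains \<phi> h s z M where "strict_mono \<phi>" "smooth_on (- {a}) h" "smooth_on (- {a}) s" "continuous_on UNIV z" "z a = 0"
  "small k p (cball a R) M z" "!!x. x \<in> Om ==> z x = h x * u x - s x" "!!x. x \<notin> cball a R ==> h x = 0 & s x = 0"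
  "!!j. h (xs (\<phi> j)) = real j"
proof -
 define d0 where "d0 n = dist a (xs n)" for n
 have d0: "d0 \<longlonglongrightarrow> 0" "!!n. d0 n > 0"
  using tendsto_dist[OF tendsto_const xs(1), of a] xs(2) by (auto simp: d0_def[abs_def] eq_commute)
 \<comment> \<open>With d <= R/2 the balls \<open>K j\<close> reach at most 3/4 R away from a and
   stay in \<open>cball a R\<close>.\<close>
 have "R / 2 > 0" using R by simp
 from geometric_subsequence[OF d0 this] obtain \<phi> :: "nat => nat" where \<phi>: "strict_mono \<phi>" "!!j. d0 (\<phi> j) <= R / 2" "!!i j. i < j ==> d0 (\<phi> j) <= d0 (\<phi> i) / 4" by blast
 define x where "x j = xs (\<phi> j)" for j
 define d where "d j = dist a (x j)" for j
 have d: "d \<longlonglongrightarrow> 0" "!!j. d j > 0" "!!j. d j <= R / 2" "!!i j. i < j ==> d j <= d i / 4"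
  using LIMSEQ_subseq_LIMSEQ[OF d0(1) \<phi>(1)] d0 \<phi> by (auto simp: d_def[abs_def] x_def d0_def[abs_def] o_def)
 define K where "K j = cball (x j) (d j / 2)" for j
 have Kd: "d j / 2 <= dist a y" "dist a y <= 3/2 * d j" if "y \<in> K j" for y j
  using that dist_triangle[of a "x j" y] dist_triangle[of a y "x j"] by (auto simp: K_def d_def dist_commute)
 have disj: "disjoint_family K" unfolding disjoint_family_on_def
 proof (intro ballI impI)
  fix m n :: nat assume "m ~= n"
  have "K i \<inter> K j = {}" if "i < j" for i j
  proof -
   have "False" if y: "y \<in> K i" "y \<in> K j" for y using Kd[OF y(1)] Kd[OF y(2)] d(4)[OF \<open>i < j\<close>] d(2)[of i] by linarith
   thus ?thesis by blast
  qed
  with \<open>m ~= n\<close> show "K m \<inter> K n = {}" by (metis Int_commute linorder_neqE_nat)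
 qed
 have aK: "a \<notin> K j" for j using Kd(1)[of a j] d(2)[of j] by auto
 have KR: "K j \<subseteq> cball a R" for j using Kd(2)[of _ j] d(3)[of j] d(2)[of j] R by fastforce
 \<comment> \<open>The support radius d/4 leaves a margin of d/4 inside \<open>K j\<close>, so that
   mollified functions still vanish off \<open>K j\<close>.\<close>
 have "\<exists>e. smooth_on UNIV e & (e (x j) :: real) = 1 & (\<forall>y. y \<notin> cball (x j) (d j / 4) --> e y = 0)" for j
 proof -
  have "d j / 4 > 0" using d(2)[of j] by simp
  from euclidean_bump[OF this, of "x j"] obtain e :: "'e => real" where
   e: "smooth_on UNIV e" "!!y. dist (x j) y <= d j / 4 / 2 ==> e y = 1" "!!y. dist (x j) y >= d j / 4 ==> e y = 0" by metis
  thus ?thesis using d(2)[of j] by (intro exI[of _ e]) auto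
 qed
 then obtain e where e: "!!j. smooth_on UNIV (e j)" "!!j. (e j (x j) :: real) = 1" "!!j y. y \<notin> cball (x j) (d j / 4) ==> e j y = 0" by metis
 define k' where "k' j = cball (x j) (d j / 4)" for j
 have k'K: "k' j \<subseteq> K j" for j using d(2)[of j] by (auto simp: k'_def K_def)
 have k'Om: "k' j \<subseteq> Om" for j using k'K KR R(2) by blast
 define q where "q j y = real j * e j y" for j y
 have q: "smooth_on UNIV (q j)" "q j (x j) = real j" "y \<notin> k' j ==> q j y = 0" for j y
  unfolding q_def using e by (auto intro!: smooth_on_mult half_open_UNIV smooth_on_const simp: k'_def)
 define v where "v j y = q j y * u y" for j y
 have v0: "v j y = 0" if "y \<notin> k' j" for j y using q(3)[OF that] by (simp add: v_def)
 have vs: "\<exists>M. small k p (k' j) M (v j)" for j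
  unfolding v_def by (rule sob_cutoff[OF p _ k'Om q(1,3) u(1)]) (auto simp: k'_def)
 have vc: "continuous_on UNIV (v j)" for j
 proof -
  have "continuous_on (Om \<union> - k' j) (v j)"
  proof (rule continuous_on_open_Un)
   show "continuous_on Om (v j)" unfolding v_def
    using smooth_on_continuous[OF q(1)] by (intro continuous_intros u(2)) (auto intro: continuous_on_subset)
   show "continuous_on (- k' j) (v j)" by (subst continuous_on_cong[OF refl, of _ _ "%_. 0"]) (use v0 in auto)
  qed (use u(3) in \<open>auto simp: k'_def\<close>)
  moreover have "Om \<union> - k' j = UNIV" using k'Om by blast
  ultimately show ?thesis by simp
 qed
 \<comment> \<open>The bound (1/2)^j is needed twice: in the Sobolev sense, to sum the errors to a
   Sobolev function, and uniformly, to make the sum z continuous at a.\<close>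
 have "\<exists>t. smooth_on UNIV t & small k p (K j) ((1/2) ^ j) (%y. v j y - t y) & (\<forall>y. \<bar>v j y - t y\<bar> <= (1/2) ^ j)
   & (\<forall>y. y \<notin> K j --> t y = 0)" for j
 proof -
  obtain M where M: "small k p (k' j) M (v j)" using vs by blast
  have lt: "\<forall>\<^sub>F eps in at_right 0. eps < c" if "c > 0" for c :: real
   by (rule order_tendstoD(2)[OF tendsto_ident_at that])
  have d4: "d j / 4 > 0" using d(2)[of j] by simp
  have unif: "uniformly_continuous_on UNIV (v j)" by (rule compact_support_uniformly_continuous[OF vc, where K = "k' j"]) (use v0 in \<open>auto simp: k'_def\<close>)
  have "(1/2::real) ^ j > 0" by simp
  with unif obtain D where D: "D > 0" "!!y y'. dist y' y < D ==> dist (v j y') (v j y) < (1/2) ^ j"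
   unfolding uniformly_continuous_on_def by blast
  have "\<forall>\<^sub>F eps in at_right 0. eps > 0 & eps < d j / 4 & eps < D & (\<forall>\<rho>. mollifier eps \<rho> --> (\<forall>x y. x \<notin> K j --> y \<in> k' j --> eps < dist y x) -->
    small k p (K j) ((1/2) ^ j) (%x. v j x - conv \<rho> (v j) x))"
   by (intro eventually_conj eventually_at_right_less lt d4 D(1) mollify_small[OF p _ k'K M]) simp
  then obtain eps where eps: "0 < eps" "eps < d j / 4" "eps < D" and sm: "!!\<rho>. mollifier eps \<rho> ==> (!!x y. x \<notin> K j ==> y \<in> k' j ==> eps < dist y x) ==>
    small k p (K j) ((1/2) ^ j) (%x. v j x - conv \<rho> (v j) x)"
   using eventually_happens[of _ "at_right (0::real)"] trivial_limit_at_right_real by blast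
  obtain \<rho> :: "'e => real" where \<rho>: "mollifier eps \<rho>" by (rule mollifier_exists[OF eps(1)])
  hence k: "kernel eps \<rho>" by (simp add: mollifier_def)
  have far: "eps < dist y' y" if "y \<notin> K j" "y' \<in> k' j" for y y'
   using that dist_triangle[of "x j" y y'] eps(2) by (auto simp: K_def k'_def dist_commute)
  have "dist y' y <= eps ==> \<bar>v j y' - v j y\<bar> <= (1/2) ^ j" for y y'
   using D(2)[of y' y] eps(3) by (simp add: dist_real_def)
  hence "\<bar>v j y - conv \<rho> (v j) y\<bar> <= (1/2) ^ j" for y by (rule conv_uniform[OF \<rho> smallD(1)[OF M]])
  moreover have "conv \<rho> (v j) y = 0" if "y \<notin> K j" for y by (rule conv_zero_off[OF k, where K = "k' j"]) (use v0 far that in auto)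
  ultimately show ?thesis using sm[OF \<rho> far] conv_smooth[OF smallD(1)[OF M] k] by (intro exI[of _ "conv \<rho> (v j)"]) auto
 qed
 from choice[OF allI[OF this]] obtain t where t': "\<forall>j. smooth_on UNIV (t j) & small k p (K j) ((1/2) ^ j) (%y. v j y - t j y) &
   (\<forall>y. \<bar>v j y - t j y\<bar> <= (1/2) ^ j) & (\<forall>y. y \<notin> K j --> t j y = 0)" by (rule exE)
 hence t: "smooth_on UNIV (t j)" "small k p (K j) ((1/2) ^ j) (%y. v j y - t j y)" "\<bar>v j y - t j y\<bar> <= (1/2) ^ j"
  "y \<notin> K j ==> t j y = 0" for j y by auto
 define w where "w j y = v j y - t j y" for j y
 have wc: "continuous_on UNIV (w j)" for j unfolding w_def using vc smooth_on_continuous[OF t(1)] by (intro continuous_intros)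
 define h where "h y = (\<Sum>j. q j y)" for y
 define s where "s y = (\<Sum>j. t j y)" for y
 define z where "z y = (\<Sum>j. w j y)" for y
 have off: "q j y = 0" "t j y = 0" "w j y = 0" if "y \<notin> K j" for j y
 proof -
  have "y \<notin> k' j" using that k'K by blast
  with that show "q j y = 0" "t j y = 0" "w j y = 0" using q(3) v0 t(4) by (auto simp: w_def)
 qed
 have d2: "(%j. 3/2 * d j) \<longlonglongrightarrow> 0" using tendsto_mult[OF tendsto_const d(1), of "3/2"] by simp
 have near: "dist a y <= 3/2 * d j" if "q j y ~= 0 \<or> t j y ~= 0" for j y using Kd(2) off that by blast
 show ?thesis
 proof (rule that[OF \<phi>(1)])
  show "smooth_on (- {a}) h" unfolding h_def by (rule smooth_suminf[OF d2 q(1)]) (use near in blast)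
  show "smooth_on (- {a}) s" unfolding s_def by (rule smooth_suminf[OF d2 t(1)]) (use near in blast)
  have "uniform_limit UNIV (%n y. \<Sum>j<n. w j y) z sequentially" unfolding z_def
   by (rule Weierstrass_m_test[where M = "%j. (1/2) ^ j"]) (use t(3) in \<open>auto simp: w_def summable_geometric\<close>)
  thus "continuous_on UNIV z"
   by (rule uniform_limit_theorem[rotated]) (auto intro!: always_eventually continuous_on_sum wc)
  show "z a = 0" using off(3)[OF aK] by (simp add: z_def)
  have ws: "small k p (K j) ((1/2) ^ j) (w j)" for j using t(2) by (simp add: w_def[abs_def])
  show "small k p (cball a R) (suminf (%j. (1/2) ^ j)) z" unfolding z_def
   by (rule small_suminf[OF disj KR _ ws]) (simp add: summable_geometric)
  fix y
  obtain j where j: "\<forall>f :: nat => 'e => real. (\<forall>i. y \<notin> K i --> f i y = 0) --> (%i. f i y) sums f j y" using sums_disjoint[OF disj, of y] by (rule exE)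
  have eq: "h y = q j y" "s y = t j y" "z y = w j y"
   using j[rule_format, of q] j[rule_format, of t] j[rule_format, of w] off by (auto simp: sums_iff h_def s_def z_def)
  show "z y = h y * u y - s y" if "y \<in> Om" unfolding eq by (simp add: w_def v_def)
  show "h y = 0 & s y = 0" if "y \<notin> cball a R" unfolding eq using off KR that by blast
 next
  fix j
  have "x j \<in> K j" using d(2)[of j] by (simp add: K_def)
  hence "q i (x j) = 0" if "i ~= j" for i using off(1)[of "x j" i] disj that unfolding disjoint_family_on_def by blast
  hence "(%i. q i (x j)) sums q j (x j)" using sums_finite[of "{j}" "%i. q i (x j)"] by simp
  thus "h (xs (\<phi> j)) = real j" using q(2)[of j] by (simp add: h_def sums_iff x_def)
 qed
qed

subsection \<open>Changes of coordinates\<close>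

abbreviation cube :: "'e::euclidean_space => real => 'e set" where
 "cube a r \<equiv> cbox (a - r *\<^sub>R One) (a + r *\<^sub>R One)"

lemma cball_subset_cube: "R <= r ==> cball a R \<subseteq> cube a r"
proof
 fix x assume R: "R <= r" and x: "x \<in> cball a R"
 have "\<bar>(x - a) \<bullet> i\<bar> <= r" if "i \<in> Basis" for i
  using Basis_le_norm[OF that, of "x - a"] x R by (simp add: dist_norm norm_minus_commute)
 thus "x \<in> cube a r" by (force simp: mem_box inner_simps abs_le_iff)
qed

text \<open>S is covered by cubes with disjoint interiors and total measure at most that of S plus
  e. A cube of side s has diameter at most DIM s, so its image lies in a cube of side 2 L DIM s.
  This one-sided bound takes the place of the change of variables formula.\<close>

lemma lipschitz_emeasure:
 fixes f :: "'e::euclidean_space => 'e"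
 assumes L: "0 <= L" "!!x y. x \<in> cube a r ==> y \<in> cube a r ==> norm (f x - f y) <= L * norm (x - y)"
  and r: "r > 0" and S: "S \<in> sets borel" "S \<subseteq> cube a r" and T: "T \<in> sets borel" "T \<subseteq> f ` S"
 shows "emeasure lborel T <= ennreal ((2 * L * DIM('e)) ^ DIM('e)) * emeasure lborel S"
proof -
 define C where "C = (2 * L * DIM('e)) ^ DIM('e)"
 have C: "C >= 0" using L(1) by (simp add: C_def)
 have bS: "bounded S" using bounded_subset[OF bounded_cbox S(2)] .
 have Sm: "S \<in> lmeasurable" using S(1) by (intro bounded_set_imp_lmeasurable bS) auto
 have fin: "emeasure lborel S = ennreal (measure lborel S)"
  using emeasure_bounded_finite[OF bS] by (intro emeasure_eq_ennreal_measure) auto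
 have le: "emeasure lborel T <= ennreal C * (emeasure lborel S + ennreal e)" if e: "e > 0" for e
 proof -
  obtain \<D> where \<D>: "countable \<D>" "!!K. K \<in> \<D> ==> K \<subseteq> cube a r & K ~= {} & (\<exists>c d. K = cbox c d)"
    "pairwise (%A B. interior A \<inter> interior B = {}) \<D>"
    "!!u v. cbox u v \<in> \<D> ==> \<exists>n. \<forall>i \<in> Basis. v \<bullet> i - u \<bullet> i = ((a + r *\<^sub>R One) \<bullet> i - (a - r *\<^sub>R One) \<bullet> i)/2^n"
    "S \<subseteq> \<Union>\<D>" "\<Union>\<D> \<in> lmeasurable" "measure lebesgue (\<Union>\<D>) <= measure lebesgue S + e"
   by (rule measurable_outer_intervals_bounded[OF Sm S(2) e], rule that) assumption+
  have "\<exists>Z. Z \<in> sets borel & f ` K \<subseteq> Z & emeasure lborel Z <= ennreal C * emeasure lborel (interior K)" if K: "K \<in> \<D>" for K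
  proof -
   from \<D>(2)[OF K] obtain u v where uv: "K = cbox u v" "K ~= {}" "K \<subseteq> cube a r" by blast
   from \<D>(4)[of u v] K uv obtain n where n: "!!i. i \<in> Basis ==> v \<bullet> i - u \<bullet> i = 2 * r / 2 ^ n" by (auto simp: algebra_simps)
   define s where "s = 2 * r / 2 ^ n"
   have s: "s > 0" using r by (simp add: s_def)
   have vi: "v \<bullet> i = u \<bullet> i + s" if "i \<in> Basis" for i using n[OF that] by (simp add: s_def)
   have u: "u \<in> K" using uv by (auto simp: mem_box box_ne_empty)
   define t where "t = L * (DIM('e) * s)"
   have t: "t >= 0" using L s by (simp add: t_def)
   have "f ` K \<subseteq> cube (f u) t"
   proof (rule image_subsetI)
    fix x assume x: "x \<in> K"
    have "norm (x - u) <= (\<Sum>i\<in>Basis. \<bar>(x - u) \<bullet> i\<bar>)" by (rule norm_le_l1)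
    also have "\<dots> <= (\<Sum>i\<in>(Basis::'e set). s)"
     by (rule sum_mono) (use x uv vi in \<open>force simp: mem_box inner_diff_left\<close>)
    finally have "norm (x - u) <= DIM('e) * s" by simp
    hence "norm (f x - f u) <= t" unfolding t_def
     using order_trans[OF L(2)[of x u] mult_left_mono[OF _ L(1)]] x u uv by blast
    hence "\<bar>(f x - f u) \<bullet> i\<bar> <= t" if "i \<in> Basis" for i using Basis_le_norm[OF that, of "f x - f u"] by linarith
    thus "f x \<in> cube (f u) t" by (force simp: mem_box inner_simps abs_le_iff)
   qed
   moreover have "emeasure lborel (cube (f u) t) = ennreal ((2 * t) ^ DIM('e))"
    using t by (simp add: emeasure_lborel_cbox_eq inner_simps)
   moreover have "(2 * t) ^ DIM('e) = C * s ^ DIM('e)" by (simp add: C_def t_def power_mult_distrib mult_ac)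
   moreover have "emeasure lborel (interior K) = ennreal (s ^ DIM('e))"
    using s vi by (simp add: uv(1) interior_cbox emeasure_lborel_box_eq inner_simps)
   ultimately show ?thesis using C s by (intro exI[of _ "cube (f u) t"]) (auto simp: ennreal_mult)
  qed
  then obtain Z where Z: "!!K. K \<in> \<D> ==> Z K \<in> sets borel & f ` K \<subseteq> Z K & emeasure lborel (Z K) <= ennreal C * emeasure lborel (interior K)" by metis
  \<comment> \<open>The cubes are indexed by natural numbers for countable additivity; indices
    outside N carry the empty set.\<close>
  define N where "N = to_nat_on \<D> ` \<D>"
  define k where "k = from_nat_into \<D>"
  have k: "k n \<in> \<D>" if "n \<in> N" for n using that \<D>(1) by (auto simp: N_def k_def)
  have kk: "k (to_nat_on \<D> K) = K" if "K \<in> \<D>" for K using that \<D>(1) by (simp add: k_def)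
  have kinj: "k m ~= k n" if "m \<in> N" "n \<in> N" "m ~= n" for m n using that kk by (auto simp: N_def)
  define X where "X n = (if n \<in> N then interior (k n) else {})" for n
  define Y where "Y n = (if n \<in> N then Z (k n) else {})" for n
  have XY: "Y n \<in> sets borel" "X n \<in> sets borel" "emeasure lborel (Y n) <= ennreal C * emeasure lborel (X n)" for n
   using Z[OF k] by (auto simp: X_def Y_def)
  have disj: "disjoint_family X" unfolding disjoint_family_on_def
  proof (intro ballI impI)
   fix m n :: nat assume "m ~= n"
   thus "X m \<inter> X n = {}" using \<D>(3) k kinj unfolding X_def pairwise_def by (cases "m \<in> N & n \<in> N") auto
  qed
  have "T \<subseteq> (\<Union>n. Y n)"
  proof
   fix y assume "y \<in> T"
   then obtain x K where "y = f x" "x \<in> K" "K \<in> \<D>" using T(2) \<D>(5) by blast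
   thus "y \<in> (\<Union>n. Y n)" using Z[of K] kk by (intro UN_I[of "to_nat_on \<D> K"]) (auto simp: Y_def N_def)
  qed
  hence "emeasure lborel T <= emeasure lborel (\<Union>n. Y n)" using XY by (intro emeasure_mono) auto
  also have "\<dots> <= (\<Sum>n. emeasure lborel (Y n))" using XY by (intro emeasure_subadditive_countably) auto
  also have "\<dots> <= (\<Sum>n. ennreal C * emeasure lborel (X n))" using XY by (intro suminf_le) auto
  also have "\<dots> = ennreal C * (\<Sum>n. emeasure lborel (X n))" by (rule ennreal_suminf_cmult)
  also have "(\<Sum>n. emeasure lborel (X n)) = emeasure lborel (\<Union>n. X n)" using XY disj by (intro suminf_emeasure) auto
  also have "\<dots> = emeasure lebesgue (\<Union>n. X n)" using XY by simp
  also have "\<dots> <= emeasure lebesgue (\<Union>\<D>)"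
  proof (rule emeasure_mono)
   show "(\<Union>n. X n) \<subseteq> \<Union>\<D>"
   proof (rule UN_least)
    show "X n \<subseteq> \<Union>\<D>" for n using k[of n] interior_subset[of "k n"] by (auto simp: X_def)
   qed
  qed (use \<D>(6) in auto)
  also have "\<dots> = ennreal (measure lebesgue (\<Union>\<D>))" using \<D>(6) by (simp add: emeasure_eq_measure2)
  also have "\<dots> <= ennreal (measure lebesgue S + e)" by (rule ennreal_leI) (rule \<D>(7))
  also have "\<dots> = emeasure lborel S + ennreal e" using e S fin by (simp add: ennreal_plus measure_completion)
  finally show ?thesis by (simp add: mult_left_mono)
 qed
 show ?thesis unfolding C_def[symmetric]
 proof (rule ennreal_le_epsilon)
  fix e :: real assume e: "e > 0"
  have "emeasure lborel T <= ennreal C * (emeasure lborel S + ennreal (e / (C + 1)))" using e C by (intro le) auto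
  also have "\<dots> = ennreal C * emeasure lborel S + ennreal (C * (e / (C + 1)))"
   using e C by (subst ennreal_mult) (simp_all add: distrib_left)
  also have "\<dots> <= ennreal C * emeasure lborel S + ennreal e"
   using e C by (intro add_left_mono ennreal_leI) (simp add: field_simps)
  finally show "emeasure lborel T <= ennreal C * emeasure lborel S + ennreal e" .
 qed
qed

lemma smooth_lipschitz:
 fixes f :: "'e::euclidean_space => 'b::euclidean_space"
 assumes f: "smooth_on B f" "open B" and Q: "compact Q" "convex Q" "Q \<subseteq> B"
 obtains L where "0 <= L" "!!x y. x \<in> Q ==> y \<in> Q ==> norm (f x - f y) <= L * norm (x - y)"
proof -
 from smooth_on_derivative[OF open_half_open[OF f(2)] f(1)] obtain f' where
  f': "!!x. x \<in> B ==> (f has_derivative f' x) (at x within B)" "!!v. smooth_on B (%x. f' x v)" by metis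
 have "\<exists>C. \<forall>x\<in>Q. norm (f' x v) <= C" for v
 proof -
  have "compact ((%x. f' x v) ` Q)" using smooth_on_continuous[OF f'(2)] Q by (meson compact_continuous_image continuous_on_subset)
  from compact_imp_bounded[OF this] show ?thesis by (auto simp: bounded_iff)
 qed
 then obtain C where C: "!!x v. x \<in> Q ==> norm (f' x v) <= C v" by metis
 define L where "L = (\<Sum>i\<in>(Basis::'e set). \<bar>C i\<bar>)"
 have on: "onorm (f' x) <= L" if x: "x \<in> Q" for x
  unfolding L_def by (rule onorm_basis_bound[OF has_derivative_linear[OF f'(1)] C[OF x]]) (use x Q(3) in blast)
 have "norm (f x - f y) <= L * norm (x - y)" if "x \<in> Q" "y \<in> Q" for x y
 proof (rule differentiable_bound[OF Q(2) _ on])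
  show "(f has_derivative f' z) (at z within Q)" if "z \<in> Q" for z using f'(1)[of z] Q(3) that has_derivative_subset by blast
 qed (use that in auto)
 moreover have "0 <= L" by (simp add: L_def sum_nonneg)
 ultimately show ?thesis by (rule that[rotated])
qed

text \<open>A transition map tau with inverse sigma. Supports are confined to a cube because
  \<open>lipschitz_emeasure\<close> subdivides boxes.\<close>

locale coordinate_change =
 fixes \<tau> \<sigma> :: "'e::euclidean_space => 'e" and Om B :: "'e set" and a :: 'e and r :: real
 assumes op: "open Om" "open B" and img: "!!x. x \<in> Om ==> \<tau> x \<in> B" "!!y. y \<in> B ==> \<sigma> y \<in> Om"
  and inv: "!!x. x \<in> Om ==> \<sigma> (\<tau> x) = x" "!!y. y \<in> B ==> \<tau> (\<sigma> y) = y"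
  and smooth: "smooth_on Om \<tau>" "smooth_on B \<sigma>" and r: "r > 0" "cube a r \<subseteq> B"
begin

text \<open>Integrating g o tau is integrating g against the push-forward of Lebesgue measure. Its
  value on a set is the measure of an image under sigma, which is Lipschitz on the cube.\<close>

lemma compose_integrable:
 "\<exists>C\<ge>0. \<forall>g. L1 g --> (\<forall>x. x \<notin> cube a r --> g x = (0::real)) -->
  L1 (%x. indicator Om x * g (\<tau> x)) & (LINT x|lborel. \<bar>indicator Om x * g (\<tau> x)\<bar>) <= C * (LINT x|lborel. \<bar>g x\<bar>)"
proof -
 obtain L where L: "0 <= L" "!!x y. x \<in> cube a r ==> y \<in> cube a r ==> norm (\<sigma> x - \<sigma> y) <= L * norm (x - y)"
  by (rule smooth_lipschitz[OF smooth(2) op(2) compact_cbox convex_box(1) r(2)], rule that) assumption+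
 define C where "C = (2 * L * DIM('e)) ^ DIM('e)"
 have C: "C >= 0" using L(1) by (simp add: C_def)
 define P where "P = \<sigma> ` cube a r"
 have P: "x \<in> P \<longleftrightarrow> x \<in> Om & \<tau> x \<in> cube a r" for x
 proof
  assume "x \<in> P"
  then obtain y where y: "x = \<sigma> y" "y \<in> cube a r" unfolding P_def by blast
  with r(2) have "y \<in> B" by blast
  with y show "x \<in> Om & \<tau> x \<in> cube a r" using inv(2) img(2) by simp
 next
  assume x: "x \<in> Om & \<tau> x \<in> cube a r"
  thus "x \<in> P" unfolding P_def by (intro image_eqI[of _ _ "\<tau> x"]) (simp_all add: inv(1))
 qed
 have "compact P" unfolding P_def
  using smooth_on_continuous[OF smooth(2)] r(2) by (intro compact_continuous_image) (auto intro: continuous_on_subset)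
 hence Pb: "P \<in> sets borel" by (simp add: borel_compact)
 have Omb: "Om \<in> sets borel" using op by simp
 have tm: "\<tau> \<in> borel_measurable (restrict_space borel Om)"
  by (rule borel_measurable_continuous_on_restrict[OF smooth_on_continuous[OF smooth(1)]])
 define N where "N = distr (restrict_space lborel P) borel \<tau>"
 have tP: "\<tau> \<in> measurable (restrict_space lborel P) borel"
 proof -
  have "continuous_on P \<tau>" using smooth_on_continuous[OF smooth(1)] P continuous_on_subset by blast
  from borel_measurable_continuous_on_restrict[OF this] show ?thesis
   by (rule measurable_cong_sets[THEN equalityD1, THEN subsetD, rotated 2]) (auto simp: sets_restrict_space)
 qed
 \<comment> \<open>Comparing the measures themselves transfers the bound from sets to all
   nonnegative integrands at once.\<close>
 have NC: "N <= scale_measure (ennreal C) lborel"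
 proof (subst le_measure)
  show "sets N = sets (scale_measure (ennreal C) lborel)" by (simp add: N_def)
  show "\<forall>A\<in>sets N. emeasure N A <= emeasure (scale_measure (ennreal C) lborel) A"
  proof
   fix A assume "A \<in> sets N"
   hence True: "A \<in> sets borel" by (simp add: N_def)
   have T: "\<tau> -` A \<inter> P \<in> sets borel"
    using measurable_sets[OF tP True] Pb by (auto simp: sets_restrict_space_iff space_restrict_space)
   have "emeasure N A = emeasure lborel (\<tau> -` A \<inter> P)" unfolding N_def
    using tP True Pb by (simp add: emeasure_distr space_restrict_space emeasure_restrict_space)
   also have "\<dots> <= ennreal C * emeasure lborel (A \<inter> cube a r)" unfolding C_def
   proof (rule lipschitz_emeasure[OF L r(1) _ _ T])
    show "\<tau> -` A \<inter> P \<subseteq> \<sigma> ` (A \<inter> cube a r)"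
    proof
     fix x assume "x \<in> \<tau> -` A \<inter> P"
     thus "x \<in> \<sigma> ` (A \<inter> cube a r)" using P[of x] inv(1)[of x] by (intro image_eqI[of _ _ "\<tau> x"]) auto
    qed
   qed (use True in auto)
   also have "\<dots> <= ennreal C * emeasure lborel A" using True by (intro mult_left_mono emeasure_mono) auto
   finally show "emeasure N A <= emeasure (scale_measure (ennreal C) lborel) A" by simp
  qed
 qed
 have "L1 (%x. indicator Om x * g (\<tau> x)) & (LINT x|lborel. \<bar>indicator Om x * g (\<tau> x)\<bar>) <= C * (LINT x|lborel. \<bar>g x\<bar>)"
  if g: "L1 g" and g0: "!!x. x \<notin> cube a r ==> g x = (0::real)" for g
 proof -
  have gm[measurable]: "g \<in> borel_measurable borel" using borel_measurable_integrable[OF g] by simp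
  have m: "(%x. indicator Om x * g (\<tau> x)) \<in> borel_measurable borel"
   using measurable_compose[OF tm gm] Omb borel_measurable_restrict_space_iff[of Om borel "%x. g (\<tau> x)"] by (simp add: mult.commute)
  have "(\<integral>\<^sup>+x. ennreal (norm (indicator Om x * g (\<tau> x))) \<partial>lborel) = (\<integral>\<^sup>+x. ennreal \<bar>g (\<tau> x)\<bar> * indicator P x \<partial>lborel)"
   by (rule nn_integral_cong) (use P g0 in \<open>auto simp: indicator_def\<close>)
  also have "\<dots> = (\<integral>\<^sup>+x. ennreal \<bar>g (\<tau> x)\<bar> \<partial>restrict_space lborel P)"
   using Pb by (simp add: nn_integral_restrict_space)
  also have "\<dots> = (\<integral>\<^sup>+x. ennreal \<bar>g x\<bar> \<partial>N)" unfolding N_def by (rule nn_integral_distr[symmetric, OF tP]) simp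
  also have "\<dots> <= (\<integral>\<^sup>+x. ennreal \<bar>g x\<bar> \<partial>scale_measure (ennreal C) lborel)"
   by (rule nn_integral_mono_measure[OF _ NC]) (simp add: N_def)
  also have "\<dots> = ennreal C * (\<integral>\<^sup>+x. ennreal \<bar>g x\<bar> \<partial>lborel)" by (rule nn_integral_scale_measure) simp
  also have "(\<integral>\<^sup>+x. ennreal \<bar>g x\<bar> \<partial>lborel) = ennreal (LINT x|lborel. \<bar>g x\<bar>)"
   by (rule nn_integral_eq_integral) (use g in auto)
  also have "ennreal C * ennreal (LINT x|lborel. \<bar>g x\<bar>) = ennreal (C * (LINT x|lborel. \<bar>g x\<bar>))"
   using C by (simp add: ennreal_mult)
  finally have le: "(\<integral>\<^sup>+x. ennreal (norm (indicator Om x * g (\<tau> x))) \<partial>lborel) <= ennreal (C * (LINT x|lborel. \<bar>g x\<bar>))" .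
  have i: "L1 (%x. indicator Om x * g (\<tau> x))"
   using m le unfolding integrable_iff_bounded by (auto intro: le_less_trans)
  have "ennreal (LINT x|lborel. \<bar>indicator Om x * g (\<tau> x)\<bar>) <= ennreal (C * (LINT x|lborel. \<bar>g x\<bar>))"
   using nn_integral_eq_integral[OF integrable_abs[OF i]] le by simp
  hence "(LINT x|lborel. \<bar>indicator Om x * g (\<tau> x)\<bar>) <= C * (LINT x|lborel. \<bar>g x\<bar>)" by (subst (asm) ennreal_le_iff) (use C in auto)
  with i show ?thesis by blast
 qed
 with C show ?thesis by (intro exI[of _ C]) simp
qed

end

lemma weak_partial_zero_limit:
 fixes c :: real
 assumes "C >= 0" "!!e. e > 0 ==> \<bar>c\<bar> <= C * e" shows "c = 0"
proof (rule ccontr)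
 assume "c ~= 0"
 hence "\<bar>c\<bar> / (2 * (C + 1)) > 0" using assms(1) by simp
 from assms(2)[OF this] have "\<bar>c\<bar> * (2 * (C + 1)) <= C * \<bar>c\<bar>" using assms(1) by (simp add: field_simps)
 hence "\<bar>c\<bar> * (C + 2) <= 0" by (simp add: algebra_simps)
 moreover have "\<bar>c\<bar> * (C + 2) > 0" using \<open>c ~= 0\<close> assms(1) by (intro mult_pos_pos) auto
 ultimately show False by simp
qed

context coordinate_change
begin

lemma test_compose_integrable:
 assumes \<theta>: "test_function Om \<theta>"
 shows "\<exists>C\<ge>0. \<forall>g. L1 g --> (\<forall>x. x \<notin> cube a r --> g x = (0::real)) -->
  L1 (%x. \<theta> x * g (\<tau> x)) & \<bar>LINT x|lborel. \<theta> x * g (\<tau> x)\<bar> <= C * (LINT x|lborel. \<bar>g x\<bar>)"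
proof -
 from compose_integrable obtain D where D: "D >= 0" "!!g. L1 g ==> (!!x. x \<notin> cube a r ==> g x = (0::real)) ==>
  L1 (%x. indicator Om x * g (\<tau> x)) & (LINT x|lborel. \<bar>indicator Om x * g (\<tau> x)\<bar>) <= D * (LINT x|lborel. \<bar>g x\<bar>)"
  by blast
 obtain Q where Q: "smooth_on UNIV \<theta>" "compact Q" "!!x. x \<notin> Q ==> \<theta> x = 0" using \<theta> by (auto simp: test_function_alt)
 from compact_support_bounded[OF smooth_on_continuous[OF Q(1)] Q(2,3)]
 obtain M where M: "M >= 0" "!!x. \<bar>\<theta> x\<bar> <= M" unfolding real_norm_def by metis
 have "L1 (%x. \<theta> x * g (\<tau> x)) & \<bar>LINT x|lborel. \<theta> x * g (\<tau> x)\<bar> <= (M * D) * (LINT x|lborel. \<bar>g x\<bar>)"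
  if g: "L1 g" "!!x. x \<notin> cube a r ==> g x = (0::real)" for g
 proof -
  note d = D(2)[OF g]
  have eq: "\<theta> x * g (\<tau> x) = \<theta> x * (indicator Om x * g (\<tau> x))" for x
   using test_function_zero[OF \<theta>, of x] by (cases "x \<in> Om") auto
  have i: "L1 (%x. \<theta> x * (indicator Om x * g (\<tau> x)))" by (rule integrable_test_mult[OF \<theta>]) (use d in blast)
  have "norm (LINT x|lborel. \<theta> x * (indicator Om x * g (\<tau> x))) <= (LINT x|lborel. M * \<bar>indicator Om x * g (\<tau> x)\<bar>)"
  proof (rule Bochner_Integration.integral_norm_bound_integral[OF i])
   show "L1 (%x. M * \<bar>indicator Om x * g (\<tau> x)\<bar>)"
    by (rule integrable_mult_right[OF integrable_abs]) (use d in blast)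
   show "norm (\<theta> x * (indicator Om x * g (\<tau> x))) <= M * \<bar>indicator Om x * g (\<tau> x)\<bar>" for x
    using M(2)[of x] by (simp add: abs_mult mult_right_mono)
  qed
  also have "\<dots> = M * (LINT x|lborel. \<bar>indicator Om x * g (\<tau> x)\<bar>)" by simp
  also have "\<dots> <= M * (D * (LINT x|lborel. \<bar>g x\<bar>))" by (rule mult_left_mono[OF _ M(1)]) (use d in blast)
  finally show ?thesis unfolding eq using i by (simp add: mult.assoc)
 qed
 moreover have "M * D >= 0" using M D by simp
 ultimately show ?thesis by (intro exI[of _ "M * D"]) simp
qed

text \<open>The mollified u obeys the classical chain rule. Both sides of the tested identity depend
  continuously on u and g in L^1 by \<open>test_compose_integrable\<close>, so the identity survives
  the limit.\<close>

lemma weak_chain_rule: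
 assumes \<tau>': "!!x. x \<in> Om ==> (\<tau> has_derivative \<tau>' x) (at x)" "!!v. smooth_on Om (%x. \<tau>' x v)"
  and R: "R < r" and u: "L1 u" "!!x. x \<notin> cball a R ==> u x = (0::real)"
  and g: "!!i. i \<in> Basis ==> weak_partial UNIV [i] u (g i)" "!!i. i \<in> Basis ==> L1 (g i)"
    "!!i x. i \<in> Basis ==> x \<notin> cball a R ==> g i x = (0::real)"
 shows "weak_partial Om [b] (%x. u (\<tau> x)) (%x. \<Sum>i\<in>Basis. (\<tau>' x b \<bullet> i) * g i (\<tau> x))"
 unfolding weak_partial_single
proof (intro allI impI)
 fix \<psi> :: "'e => real" assume \<psi>: "test_function Om \<psi>"
 define \<theta> where "\<theta> i x = \<psi> x * (\<tau>' x b \<bullet> i)" for i x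
 have \<theta>: "test_function Om (\<theta> i)" for i unfolding \<theta>_def
  by (rule test_function_smooth_mult[OF \<psi> op(1) smooth_on_linear[OF bounded_linear_inner_left \<tau>'(2)]])
 have cube: "x \<in> cube a r" if "dist a x <= r" for x
  using cball_subset_cube[OF order_refl, of a r] that by (simp add: subset_iff)
 have out: "x \<notin> cball a R" if "x \<notin> cube a r" for x using cube[of x] that R by force
 from test_compose_integrable[OF test_function_pd[OF \<psi>]] obtain C0 where C0: "C0 >= 0" "!!g. L1 g ==> (!!x. x \<notin> cube a r ==> g x = (0::real)) ==>
  L1 (%x. pd b \<psi> x * g (\<tau> x)) & \<bar>LINT x|lborel. pd b \<psi> x * g (\<tau> x)\<bar> <= C0 * (LINT x|lborel. \<bar>g x\<bar>)"
  by blast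
 from choice[OF allI[OF test_compose_integrable[OF \<theta>]]] obtain C where C': "\<forall>i. C i >= 0 & (\<forall>g. L1 g --> (\<forall>x. x \<notin> cube a r --> g x = (0::real)) -->
  L1 (%x. \<theta> i x * g (\<tau> x)) & \<bar>LINT x|lborel. \<theta> i x * g (\<tau> x)\<bar> <= C i * (LINT x|lborel. \<bar>g x\<bar>))" by (rule exE)
 hence C: "C i >= 0" "L1 h ==> (!!x. x \<notin> cube a r ==> h x = (0::real)) ==>
  L1 (%x. \<theta> i x * h (\<tau> x)) & \<bar>LINT x|lborel. \<theta> i x * h (\<tau> x)\<bar> <= C i * (LINT x|lborel. \<bar>h x\<bar>)" for i h by auto
 \<comment> \<open>\<open>E v w = 0\<close> is the chain rule tested against psi for a function v
   with gradient w.\<close>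
 define E where "E v w = (LINT x|lborel. pd b \<psi> x * v (\<tau> x)) + (\<Sum>i\<in>Basis. (LINT x|lborel. \<theta> i x * w i (\<tau> x)))" for v and w :: "'e => 'e => real"
 define CC where "CC = C0 + (\<Sum>i\<in>(Basis::'e set). C i)"
 have CC: "CC >= 0" unfolding CC_def using C0 C by (intro add_nonneg_nonneg sum_nonneg) auto
 have u0: "u x = 0" if "x \<notin> cube a r" for x using u(2) out[OF that] by blast
 have g0: "g i x = 0" if "i \<in> Basis" "x \<notin> cube a r" for i x using g(3)[OF that(1)] out[OF that(2)] by blast
 have "E u g = 0"
 proof (rule weak_partial_zero_limit[OF CC])
  fix e :: real assume e: "e > 0"
  have cl: "\<exists>d>0. \<forall>eps\<le>d. \<forall>\<rho>. mollifier eps \<rho> --> L1 (%x. \<bar>v x - conv \<rho> v x\<bar>) & (LINT x|lborel. \<bar>v x - conv \<rho> v x\<bar>) <= e"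
   if v: "L1 v" for v :: "'e => real"
   using conv_close[OF order_refl v _ e] integrable_abs[OF v] by simp
  obtain d0 where d0: "d0 > 0" "!!eps \<rho>. eps <= d0 ==> mollifier eps \<rho> ==> (LINT x|lborel. \<bar>u x - conv \<rho> u x\<bar>) <= e" using cl[OF u(1)] by blast
  have "\<forall>i\<in>Basis. \<exists>d>0. \<forall>eps\<le>d. \<forall>\<rho>. mollifier eps \<rho> --> (LINT x|lborel. \<bar>g i x - conv \<rho> (g i) x\<bar>) <= e"
   using cl[OF g(2)] by blast
  from bchoice[OF this] obtain d where d: "\<forall>i\<in>Basis. d i > 0 & (\<forall>eps\<le>d i. \<forall>\<rho>. mollifier eps \<rho> --> (LINT x|lborel. \<bar>g i x - conv \<rho> (g i) x\<bar>) <= e)" by (rule exE)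
  \<comment> \<open>The entry (r - R) / 2 keeps the mollified functions supported in the cube; the
    other entries make the L^1 errors at most e.\<close>
  define eps where "eps = Min (insert d0 (insert ((r - R) / 2) (d ` Basis)))"
  have "eps > 0" unfolding eps_def using d d0(1) R by (subst Min_gr_iff) auto
  moreover have "eps <= d0" "eps <= (r - R) / 2" "!!i. i \<in> Basis ==> eps <= d i" unfolding eps_def by (rule Min_le; simp)+
  ultimately have eps: "eps > 0" "eps <= d0" "eps <= (r - R) / 2" "!!i. i \<in> Basis ==> eps <= d i" by blast+
  obtain \<rho> :: "'e => real" where \<rho>: "mollifier eps \<rho>" by (rule mollifier_exists[OF eps(1)])
  hence k: "kernel eps \<rho>" by (simp add: mollifier_def)
  have far: "eps < dist y x" if "x \<notin> cube a r" "y \<in> cball a R" for x y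
   using cube[of x] that dist_triangle[of a x y] eps(3) R by (force simp: dist_commute)
  define U where "U = conv \<rho> u"
  define G where "G i = conv \<rho> (g i)" for i
  have U: "smooth_on UNIV U" unfolding U_def by (rule conv_smooth[OF u(1) k])
  have UG: "pd i U x = G i x" if "i \<in> Basis" for i x unfolding U_def G_def by (rule pd_conv[OF k u(1) g(1)[OF that]])
  have U0: "U x = 0" "!!i. i \<in> Basis ==> G i x = 0" if "x \<notin> cube a r" for x
   unfolding U_def G_def using far[OF that] u(2) g(3) by (auto intro!: conv_zero_off[OF k, where K = "cball a R"])
  have Ui: "L1 U" by (rule integrable_compact_support[OF smooth_on_continuous[OF U] compact_cbox U0(1)])
  have Gi: "L1 (G i)" if i: "i \<in> Basis" for i
   using smooth_on_continuous[OF conv_smooth[OF g(2)[OF i] k]] U0(2)[OF _ i]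
   unfolding G_def by (intro integrable_compact_support[of _ "cube a r"]) auto
  note iU = C0(2)[OF Ui U0(1)] and iG = C(2)[OF Gi U0(2)] and iu = C0(2)[OF u(1) u0] and ig = C(2)[OF g(2) g0]
  have "E U G = 0"
  proof -
   define F where "F x = \<psi> x * U (\<tau> x)" for x
   have "smooth_on Om (%x. U (\<tau> x))" by (rule smooth_on_compose[OF open_half_open[OF op(1)] half_open_UNIV _ smooth(1) U]) simp
   hence F: "test_function Om F" unfolding F_def by (rule test_function_smooth_mult[OF \<psi> op(1)])
   have "pd b F x = pd b \<psi> x * U (\<tau> x) + (\<Sum>i\<in>Basis. \<theta> i x * G i (\<tau> x))" for x
   proof (cases "x \<in> Om")
    case True
    have \<psi>d: "(\<psi> has_derivative (%h. pd h \<psi> x)) (at x)" using \<psi> smooth_has_derivative(1) by (auto simp: test_function_alt)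
    have "((%x. U (\<tau> x)) has_derivative (%h. pd (\<tau>' x h) U (\<tau> x))) (at x)"
     by (rule has_derivative_compose[OF \<tau>'(1)[OF True] smooth_has_derivative(1)[OF U]])
    from pd_eq[OF has_derivative_mult[OF \<psi>d this], of b]
    have "pd b F x = \<psi> x * pd (\<tau>' x b) U (\<tau> x) + pd b \<psi> x * U (\<tau> x)" by (simp add: F_def[abs_def])
    also have "pd (\<tau>' x b) U (\<tau> x) = (\<Sum>i\<in>Basis. (\<tau>' x b \<bullet> i) *\<^sub>R pd i U (\<tau> x))"
     by (rule linear_basis_expansion[OF has_derivative_linear[OF smooth_has_derivative(1)[OF U]]])
    finally show ?thesis using UG by (simp add: \<theta>_def sum_distrib_left mult.assoc)
   next
    case False
    thus ?thesis using test_function_zero[OF test_function_pd[OF F]] test_function_zero[OF test_function_pd[OF \<psi>]]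
      test_function_zero[OF \<theta>] by simp
   qed
   hence "pd b F = (%x. pd b \<psi> x * U (\<tau> x) + (\<Sum>i\<in>Basis. \<theta> i x * G i (\<tau> x)))" by (rule ext)
   moreover have "integral\<^sup>L lborel (pd b F) = 0" using F integral_pd_zero unfolding test_function_alt by blast
   moreover have "L1 (%x. \<Sum>i\<in>Basis. \<theta> i x * G i (\<tau> x))" using iG by (intro Bochner_Integration.integrable_sum) blast
   ultimately show ?thesis using iU iG by (simp add: E_def Bochner_Integration.integral_sum)
  qed
  moreover have "\<bar>E (%x. u x - U x) (%i x. g i x - G i x)\<bar> <= CC * e"
  proof -
   have "\<bar>LINT x|lborel. pd b \<psi> x * (u (\<tau> x) - U (\<tau> x))\<bar> <= C0 * (LINT x|lborel. \<bar>u x - U x\<bar>)"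
    using C0(2)[of "%x. u x - U x"] u(1) Ui u0 U0(1) by auto
   also have "\<dots> <= C0 * e" using d0(2)[OF eps(2) \<rho>] C0(1) by (simp add: U_def mult_left_mono)
   finally have 1: "\<bar>LINT x|lborel. pd b \<psi> x * (u (\<tau> x) - U (\<tau> x))\<bar> <= C0 * e" .
   have 2: "\<bar>LINT x|lborel. \<theta> i x * (g i (\<tau> x) - G i (\<tau> x))\<bar> <= C i * e" if i: "i \<in> Basis" for i
   proof -
    have "\<bar>LINT x|lborel. \<theta> i x * (g i (\<tau> x) - G i (\<tau> x))\<bar> <= C i * (LINT x|lborel. \<bar>g i x - G i x\<bar>)"
     using C(2)[of "%x. g i x - G i x" i] g(2)[OF i] Gi[OF i] g0[OF i] U0(2)[OF _ i] by auto
    also have "\<dots> <= C i * e" using d i eps(4)[OF i] \<rho> C(1)[of i] by (simp add: G_def mult_left_mono)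
    finally show ?thesis .
   qed
   have "\<bar>\<Sum>i\<in>Basis. (LINT x|lborel. \<theta> i x * (g i (\<tau> x) - G i (\<tau> x)))\<bar> <= (\<Sum>i\<in>(Basis::'e set). C i * e)"
    by (rule order_trans[OF sum_abs sum_mono[OF 2]])
   with 1 show ?thesis by (simp add: E_def CC_def sum_distrib_right distrib_right)
  qed
  moreover have "E (%x. u x - U x) (%i x. g i x - G i x) = E u g - E U G"
   using iU iG iu ig by (simp add: E_def right_diff_distrib sum_subtractf)
  ultimately show "\<bar>E u g\<bar> <= CC * e" by simp
 qed
 thus "(LINT x|lborel. pd b \<psi> x *\<^sub>R u (\<tau> x)) = - (LINT x|lborel. \<psi> x *\<^sub>R (\<Sum>i\<in>Basis. (\<tau>' x b \<bullet> i) * g i (\<tau> x)))"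
 proof -
  have "(LINT x|lborel. \<psi> x *\<^sub>R (\<Sum>i\<in>Basis. (\<tau>' x b \<bullet> i) * g i (\<tau> x))) = (\<Sum>i\<in>Basis. (LINT x|lborel. \<theta> i x * g i (\<tau> x)))"
   using C(2)[OF g(2) g0] by (simp add: \<theta>_def sum_distrib_left mult.assoc Bochner_Integration.integral_sum)
  with \<open>E u g = 0\<close> show ?thesis by (simp add: E_def)
 qed
qed

lemma in_Lp_compose:
 assumes Om': "open Om'" "Om' \<subseteq> Om" and R: "R < r" and 0: "small k p (cball a R) M z"
 shows "in_Lp p Om' (%x. z (\<tau> x))"
proof -
 note z = smallD[OF 0]
 have "cball a R \<subseteq> cube a r" using R by (intro cball_subset_cube) simp
 hence z0: "z x = 0" if "x \<notin> cube a r" for x using z(5)[of x] that by blast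
 have sub: "indicator Om' x *\<^sub>R w = indicator Om' x * (indicator Om x * w)" for x and w :: real
  using Om' by (auto simp: indicator_def)
 have m: "Om' \<in> sets borel" using Om' by simp
 from compose_integrable obtain C where C: "!!g. L1 g ==> (!!x. x \<notin> cube a r ==> g x = (0::real)) ==>
  L1 (%x. indicator Om x * g (\<tau> x))" by blast
 have "L1 (%x. indicator Om x * z (\<tau> x))" by (rule C[OF z(1) z0])
 moreover have "L1 (%x. indicator Om x * \<bar>z (\<tau> x)\<bar> powr p)"
  using C[OF z(2)] z0 by simp
 ultimately show "in_Lp p Om' (%x. z (\<tau> x))" unfolding in_Lp_alt sub
  using m integrable_mult_indicator[of Om' lborel "%x. indicator Om x * \<bar>z (\<tau> x)\<bar> powr p"] by auto
qed

text \<open>Iterates the chain rule. The factors from tau' are smooth on Om and therefore bounded on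
  the compact set K.\<close>

lemma sob_compose:
 assumes p: "1 <= p" and Om': "open Om'" "Om' \<subseteq> K" "compact K" "K \<subseteq> Om" and R: "R < r"
 shows "small k p (cball a R) M z ==> sob k p Om' (%x. z (\<tau> x))"
proof (induction k arbitrary: z)
 case (0 z)
 have "Om' \<subseteq> Om" using Om' by blast
 from in_Lp_compose[OF Om'(1) this R 0] show ?case by simp
next
 case (Suc k z)
 from smooth_on_derivative[OF open_half_open[OF op(1)] smooth(1)] obtain \<tau>' where
  "!!x. x \<in> Om ==> (\<tau> has_derivative \<tau>' x) (at x within Om)" and \<tau>'2: "!!v. smooth_on Om (%x. \<tau>' x v)" by metis
 hence \<tau>'1: "(\<tau> has_derivative \<tau>' x) (at x)" if "x \<in> Om" for x using op(1) that by (metis at_within_open)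
 have "\<forall>i\<in>Basis. \<exists>g. weak_partial UNIV [i] z g & small k p (cball a R) M g" using Suc.prems by simp
 from bchoice[OF this] obtain g where "\<forall>i\<in>Basis. weak_partial UNIV [i] z (g i) & small k p (cball a R) M (g i)" by (rule exE)
 hence g: "weak_partial UNIV [i] z (g i)" "small k p (cball a R) M (g i)" if "i \<in> Basis" for i using that by auto
 have "small0 p (cball a R) M z" using Suc.prems by simp
 hence z: "small 0 p (cball a R) M z" by simp
 have bd: "bounded Om'" using Om' compact_imp_bounded bounded_subset by blast
 show ?case unfolding sob.simps
 proof (intro conjI ballI)
  have "Om' \<subseteq> Om" using Om' by blast
  from in_Lp_compose[OF Om'(1) this R z] show "in_Lp p Om' (%x. z (\<tau> x))" .
  fix b :: 'e assume "b \<in> Basis"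
  have "weak_partial Om [b] (%x. z (\<tau> x)) (%x. \<Sum>i\<in>Basis. (\<tau>' x b \<bullet> i) * g i (\<tau> x))"
   by (rule weak_chain_rule[OF \<tau>'1 \<tau>'2 R smallD(1,5)[OF z] g(1) smallD(1,5)[OF g(2)]])
  hence "weak_partial Om' [b] (%x. z (\<tau> x)) (%x. \<Sum>i\<in>Basis. (\<tau>' x b \<bullet> i) * g i (\<tau> x))"
   by (rule weak_partial_mono) (use Om' in blast)
  moreover have sum: "sob k p Om' (%x. \<Sum>i\<in>I. (\<tau>' x b \<bullet> i) * g i (\<tau> x))" if "finite I" "I \<subseteq> Basis" for I
   using that
  proof (induction I rule: finite_induct)
   case empty
   thus ?case using sob_const[OF Om'(1) bd, of k p "0::real"] by simp
  next
   case (insert i I)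
   have "sob k p Om' (%x. (\<tau>' x b \<bullet> i) *\<^sub>R g i (\<tau> x))"
    by (rule sob_smooth_mult[OF p open_half_open[OF op(1)] Om'(3,4,1,2) smooth_on_linear[OF bounded_linear_inner_left \<tau>'2]])
      (use Suc.IH g(2) insert.prems in blast)
   with insert sob_add[OF p] show ?case by simp
  qed
  ultimately show "\<exists>h. weak_partial Om' [b] (%x. z (\<tau> x)) h & sob k p Om' h"
   using sum[OF finite_Basis order_refl] by (intro exI conjI)
 qed
qed

end

subsection \<open>Functions on manifolds\<close>

locale smooth_mfd =
 fixes n :: nat and V :: "('v, 'e::euclidean_space) manifold"
 assumes mfd: "smooth_manifold n V"
begin

abbreviation "T \<equiv> mtop V"
abbreviation "X \<equiv> topspace (mtop V)"

lemma hausdorff: "Hausdorff_space T"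
 using mfd by (simp add: smooth_manifold_def)

lemma charts_cover: "v \<in> X ==> \<exists>U c. (U, c) \<in> charts V & v \<in> U"
 using mfd unfolding smooth_manifold_def by blast

lemma chart:
 assumes "(U, c) \<in> charts V"
 shows "openin T U" "model_open n (c ` U)" "homeomorphic_map (subtopology T U) (top_of_set (c ` U)) c" "inj_on c U" "U \<subseteq> X"
proof -
 from mfd assms show o: "openin T U" and "model_open n (c ` U)" and h: "homeomorphic_map (subtopology T U) (top_of_set (c ` U)) c"
  unfolding smooth_manifold_def model_open_def by blast+
 from o show "U \<subseteq> X" by (rule openin_subset)
 with h show "inj_on c U" by (simp add: homeomorphic_eq_everything_map Int_absorb1)
qed

lemma chart_inverse: "(U, c) \<in> charts V ==> v \<in> U ==> inv_into U c (c v) = v"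
 using chart(4) by simp

lemma chart_image_openin:
 assumes c: "(U, c) \<in> charts V" and S: "openin T S"
 shows "openin (top_of_set (c ` U)) (c ` (U \<inter> S))"
proof -
 note h = chart[OF c]
 have "openin (subtopology T U) (U \<inter> S)" using S by (simp add: openin_subtopology_Int2)
 with h(3) show ?thesis
  by (simp add: homeomorphic_map_openness_eq)
qed

lemma openin_preimage:
 assumes S: "openin T S" and g: "continuous_map (subtopology T S) euclidean g" and G: "open G"
 shows "openin T {x \<in> S. g x \<in> G}"
proof -
 have "openin (subtopology T S) {x \<in> topspace (subtopology T S). g x \<in> G}"
  by (rule openin_continuous_map_preimage[OF g]) (use G in simp)
 moreover have "topspace (subtopology T S) = S" using openin_subset[OF S] by auto
 ultimately show ?thesis by (simp only: openin_open_subtopology[OF S])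
qed

lemma chart_image_model_open: "(U, c) \<in> charts V ==> openin T S ==> model_open n (c ` (U \<inter> S))"
 using chart_image_openin chart(2) model_open_openin by blast

lemma chart_continuous: "(U, c) \<in> charts V ==> continuous_map (subtopology T U) euclidean c"
 using chart(3)[of U c] homeomorphic_imp_continuous_map continuous_map_into_fulltopology by blast

lemma chart_inverse_continuous: 
 assumes c: "(U, c) \<in> charts V"
 shows "continuous_map (top_of_set (c ` U)) (subtopology T U) (inv_into U c)"
proof -
 note h = chart[OF c]
 from h(3) obtain g where g: "homeomorphic_maps (subtopology T U) (top_of_set (c ` U)) c g"
  by (auto simp: homeomorphic_map_maps)
 hence "continuous_map (top_of_set (c ` U)) (subtopology T U) g" by (simp add: homeomorphic_maps_def)
 thus ?thesis
 proof (rule continuous_map_eq)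
  fix y assume "y \<in> topspace (top_of_set (c ` U))"
  then obtain v where v: "v \<in> U" "y = c v" by auto
  with g h(5) have "g y = v" by (auto simp: homeomorphic_maps_def)
  with v show "g y = inv_into U c y" using chart_inverse[OF c] by simp
 qed
qed

lemma chart_preimage_open:
 assumes c: "(U, c) \<in> charts V" and N: "open N"
 shows "openin T {v \<in> U. c v \<in> N}"
proof -
 have "openin (subtopology T U) {v \<in> topspace (subtopology T U). c v \<in> N}"
  using chart_continuous[OF c] N by (auto simp: continuous_map_def)
 moreover have "{v \<in> topspace (subtopology T U). c v \<in> N} = {v \<in> U. c v \<in> N}" using chart(5)[OF c] by auto
 ultimately show ?thesis using openin_open_subtopology[OF chart(1)[OF c]] by simp
qed

lemma chart_ball:
 assumes c: "(U, c) \<in> charts V" and v: "v \<in> U" "v \<in> O'" and O': "openin T O'"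
 obtains r M where "r > 0" "closed M" "c ` U \<subseteq> M" "M \<inter> ball (c v) r \<subseteq> c ` (U \<inter> O')"
proof -
 from chart_image_model_open[OF c O'] chart(2)[OF c] obtain M where 
  M: "M \<in> local_models n" "openin (top_of_set M) (c ` U)" by (auto simp: model_open_def)
 have "openin (top_of_set M) (c ` (U \<inter> O'))" using M(2) chart_image_openin[OF c O'] openin_trans by blast
 moreover have "c v \<in> c ` (U \<inter> O')" using v by blast
 ultimately obtain r where r: "r > 0" "ball (c v) r \<inter> M \<subseteq> c ` (U \<inter> O')" by (meson openin_contains_ball)
 have "closed M" using M(1) closed_halfspace_ge[of 0]
  by (auto simp: local_models_def inner_commute split: if_splits)
 moreover have "M \<inter> ball (c v) r \<subseteq> c ` (U \<inter> O')" using r(2) by blast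
 ultimately show ?thesis using that[OF r(1) _ openin_imp_subset[OF M(2)]] by blast
qed

lemma class_funD: "class_fun \<F> V S g ==> (U, c) \<in> charts V ==> in_class \<F> (c ` (U \<inter> S)) (%y. g (inv_into U c y))"
 unfolding class_fun_def by blast

lemma class_funI: "(!!U c. (U, c) \<in> charts V ==> in_class \<F> (c ` (U \<inter> S)) (%y. g (inv_into U c y))) ==> class_fun \<F> V S g"
 unfolding class_fun_def by blast

text \<open>Smoothness in one chart passes to every other chart by composition with the smooth
  transition map.\<close>

lemma class_fun_chart_open:
 assumes c: "(U, c) \<in> charts V" and S: "openin T S" "S \<subseteq> U" and f: "smooth_on (c ` S) f"
 shows "class_fun smooth V S (%v. f (c v))"
proof (rule class_funI)
 fix U' c' assume c': "(U', c') \<in> charts V"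
 have mo: "model_open n (c' ` (U' \<inter> S))" using chart_image_model_open[OF c' S(1)] .
 have mo': "model_open n (c ` S)" using chart_image_model_open[OF c S(1)] S(2) by (simp add: Int_absorb1)
 have tr: "in_class smooth (c' ` (U' \<inter> U)) (%y. c (inv_into U' c' y))"
  using mfd c c' unfolding smooth_manifold_def by blast
 show "in_class smooth (c' ` (U' \<inter> S)) (%y. f (c (inv_into U' c' y)))"
 proof (cases "n = 0")
  case True
  with mo show ?thesis by (intro in_class_trivial) (auto simp: model_open_cases)
 next
  case False
  with mo mo' have ho: "half_open (c' ` (U' \<inter> S))" "half_open (c ` S)" by (auto simp: model_open_cases)
  have tr': "smooth_on (c' ` (U' \<inter> S)) (%y. c (inv_into U' c' y))"
   by (rule smooth_on_subset[OF tr[unfolded in_class_smooth_iff]]) (use S(2) in blast)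
  show ?thesis unfolding in_class_smooth_iff
   by (rule smooth_on_compose[OF ho _ tr' f]) (use chart_inverse[OF c'] in auto)
 qed
qed

lemmas class_fun_chart = class_fun_chart_open[OF _ chart(1) order_refl]

context
 fixes \<F> :: regularity and S :: "'v set"
 assumes adm: "admissible_class \<F>" and S: "openin T S"
begin

lemma chart_model: "(U, c) \<in> charts V ==> model_open n (c ` (U \<inter> S))"
 using chart_image_model_open S by blast

lemma class_fun_cong: 
 assumes "class_fun \<F> V S g" "!!v. v \<in> S ==> g v = h v"
 shows "class_fun \<F> V S h"
proof (rule class_funI)
 fix U c assume c: "(U, c) \<in> charts V"
 show "in_class \<F> (c ` (U \<inter> S)) (%y. h (inv_into U c y))"
  by (rule in_class_cong[OF chart_model[OF c] adm class_funD[OF assms(1) c]]) (use assms(2) chart_inverse[OF c] in auto)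
qed

lemma class_fun_subset:
 assumes "class_fun \<F> V S g" "openin T S'" "S' \<subseteq> S"
 shows "class_fun \<F> V S' g"
proof (rule class_funI)
 fix U c assume c: "(U, c) \<in> charts V"
 have "openin (top_of_set (c ` (U \<inter> S))) (c ` (U \<inter> S'))"
  using chart_image_openin[OF c assms(2)] chart_image_openin[OF c S] assms(3) 
  by (meson Int_mono image_mono openin_imp_subset openin_subset_trans order_refl)
 thus "in_class \<F> (c ` (U \<inter> S')) (%y. g (inv_into U c y))"
  by (rule in_class_openin[OF chart_model[OF c] adm class_funD[OF assms(1) c]])
qed

lemma class_fun_glue:
 assumes "!!v. v \<in> S ==> \<exists>O'. openin T O' & v \<in> O' & class_fun \<F> V (S \<inter> O') g"
 shows "class_fun \<F> V S g"
proof (rule class_funI)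
 fix U c assume c: "(U, c) \<in> charts V"
 show "in_class \<F> (c ` (U \<inter> S)) (%y. g (inv_into U c y))"
 proof (rule in_class_glue[OF chart_model[OF c] adm])
  fix y assume "y \<in> c ` (U \<inter> S)"
  then obtain v where v: "v \<in> U" "v \<in> S" "y = c v" by blast
  from assms[OF v(2)] obtain O' where O': "openin T O'" "v \<in> O'" "class_fun \<F> V (S \<inter> O') g" by blast
  from chart_image_openin[OF c O'(1)] obtain N where N: "open N" "c ` (U \<inter> O') = c ` U \<inter> N" by (auto simp: openin_open)
  have "c ` (U \<inter> S) \<inter> N = c ` (U \<inter> (S \<inter> O'))"
  proof -
   have "c ` (U \<inter> S) \<inter> N = c ` (U \<inter> S) \<inter> (c ` U \<inter> N)" by blast
   also have "\<dots> = c ` ((U \<inter> S) \<inter> (U \<inter> O'))" unfolding N(2)[symmetric]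
    by (rule inj_on_image_Int[OF chart(4)[OF c], symmetric]) auto
   finally show ?thesis by (simp add: Int_ac)
  qed
  moreover have "y \<in> N" using N v O' by blast
  ultimately show "\<exists>N. open N & y \<in> N & in_class \<F> (c ` (U \<inter> S) \<inter> N) (%y. g (inv_into U c y))"
   using N(1) class_funD[OF O'(3) c] by auto
 qed
qed

lemma class_fun_add: "class_fun \<F> V S g ==> class_fun \<F> V S h ==> class_fun \<F> V S (%v. g v + h v)"
 unfolding class_fun_def using in_class_add[OF chart_model adm] by blast

lemma class_fun_linear: "class_fun \<F> V S g ==> bounded_linear L ==> class_fun \<F> V S (%v. L (g v))"
 unfolding class_fun_def using in_class_linear[OF chart_model adm] by blast

lemma class_fun_scaleR: "class_fun (scalar_class \<F>) V S h ==> class_fun \<F> V S g ==> class_fun \<F> V S (%v. h v *\<^sub>R g v)"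
 unfolding class_fun_def using in_class_scalar_mult[OF chart_model adm] by blast

lemma class_fun_inverse:
 assumes "class_fun (scalar_class \<F>) V S (h :: 'v => real)" "!!v. v \<in> S ==> h v ~= 0"
 shows "class_fun (scalar_class \<F>) V S (%v. inverse (h v))"
proof (rule class_funI)
 fix U c assume c: "(U, c) \<in> charts V"
 show "in_class (scalar_class \<F>) (c ` (U \<inter> S)) (%y. inverse (h (inv_into U c y)))"
  by (rule in_class_inverse[OF chart_model[OF c] adm class_funD[OF assms(1) c]]) (use assms(2) chart_inverse[OF c] in auto)
qed

lemma class_fun_const: "class_fun \<F> V S (%v. a)"
 unfolding class_fun_def using in_class_const[OF chart_model adm] by blast

lemma class_fun_sum: 
 assumes "!!i. i \<in> I ==> class_fun \<F> V S (g i)"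
 shows "class_fun \<F> V S (%v. \<Sum>i\<in>I. g i v)"
proof (rule class_funI)
 fix U c assume c: "(U, c) \<in> charts V"
 show "in_class \<F> (c ` (U \<inter> S)) (%y. \<Sum>i\<in>I. g i (inv_into U c y))"
  by (rule in_class_sum[OF chart_model[OF c] adm class_funD[OF assms c]])
qed

lemma class_fun_smooth_imp: "class_fun smooth V S g ==> class_fun \<F> V S g"
 unfolding class_fun_def using in_class_smooth_imp[OF chart_model adm] by blast

lemma class_fun_scalar_imp: "class_fun (scalar_class \<F>) V S g ==> class_fun \<F> V S g"
 unfolding class_fun_def using in_class_scalar_imp[OF chart_model adm] by blast

lemma class_fun_smooth_scalar: "class_fun smooth V S g ==> class_fun (scalar_class \<F>) V S g"
 unfolding class_fun_def using in_class_smooth_scalar[OF chart_model adm] by blast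

lemma class_fun_componentwise:
 assumes "!!j. j \<in> Basis ==> class_fun \<F> V S (%v. g v \<bullet> j)"
 shows "class_fun \<F> V S g"
proof -
 have "class_fun \<F> V S (%v. (g v \<bullet> j) *\<^sub>R j)" if "j \<in> Basis" for j
  by (rule class_fun_linear[OF assms[OF that] bounded_linear_scaleR_left])
 hence "class_fun \<F> V S (%v. \<Sum>j\<in>Basis. (g v \<bullet> j) *\<^sub>R j)"
  by (rule class_fun_sum)
 thus ?thesis by (simp add: euclidean_representation)
qed

lemma class_fun_continuous:
 assumes "class_fun \<F> V S g"
 shows "continuous_map (subtopology T S) euclidean g"
proof -
 have top: "topspace (subtopology T S) = S" using openin_subset[OF S] by (simp add: Int_absorb1)
 have loc: "continuous_map (subtopology T (U \<inter> S)) euclidean g" if c: "(U, c) \<in> charts V" for U c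
 proof -
 have cont: "continuous_on (c ` (U \<inter> S)) (%y. g (inv_into U c y))"
  by (rule in_class_continuous[OF chart_model[OF c] adm class_funD[OF assms c]])
 have op: "openin T (U \<inter> S)" using chart(1)[OF c] S by blast
 have "continuous_map (subtopology T (U \<inter> S)) (top_of_set (c ` (U \<inter> S))) c"
 proof -
  have "continuous_map (subtopology T (U \<inter> S)) euclidean c"
   using continuous_map_from_subtopology_mono[OF chart_continuous[OF c]] by auto
  thus ?thesis using openin_subset[OF op] by (auto simp: continuous_map_in_subtopology)
 qed
 moreover have "continuous_map (top_of_set (c ` (U \<inter> S))) euclidean (%y. g (inv_into U c y))"
  using cont by simp
 ultimately have "continuous_map (subtopology T (U \<inter> S)) euclidean ((%y. g (inv_into U c y)) \<circ> c)"
  by (rule continuous_map_compose)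
 hence "continuous_map (subtopology T (U \<inter> S)) euclidean g"
  by (rule continuous_map_eq) (use chart_inverse[OF c] in auto)
 thus ?thesis .
 qed
 show ?thesis
 proof (rule pasting_lemma[where I = "charts V" and T = "%(U, c). U \<inter> S" and f = "%_. g"])
  fix i assume i: "i \<in> charts V"
  then obtain U c where [simp]: "i = (U, c)" and c: "(U, c) \<in> charts V" by (cases i) auto
  show "openin (subtopology T S) (case i of (U, c) => U \<inter> S)"
   using chart(1)[OF c] by (auto simp: openin_subtopology)
  show "continuous_map (subtopology (subtopology T S) (case i of (U, c) => U \<inter> S)) euclidean g"
   using loc[OF c] by (simp add: subtopology_subtopology Int_ac)
 next
  fix x assume "x \<in> topspace (subtopology T S)"
  hence x: "x \<in> S" "x \<in> X" using top openin_subset[OF S] by auto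
  from charts_cover[OF x(2)] obtain U c where "(U, c) \<in> charts V" "x \<in> U" by blast
  with x show "\<exists>j. j \<in> charts V & x \<in> (case j of (U, c) => U \<inter> S) & g x = g x"
   by (intro exI[of _ "(U, c)"]) auto
 qed auto
qed

end

text \<open>The support is compact because the model M is closed, and closed in V by the Hausdorff
  property, so extension by zero is smooth. As V need not be paracompact, such bumps take the place
  of partitions of unity.\<close>

lemma bump:
 assumes O': "openin T O'" and v: "v \<in> O'"
 obtains e :: "'v => real" and C P where "class_fun smooth V X e" "compactin T C" "C \<subseteq> O'" "!!x. x \<notin> C ==> e x = 0"
  "openin T P" "v \<in> P" "P \<subseteq> C" "!!x. x \<in> P ==> e x = 1" "!!x. 0 <= e x" "!!x. e x <= 1"
proof -
 from v O' have "v \<in> X" using openin_subset by blast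
 from charts_cover[OF this] obtain U c where c: "(U, c) \<in> charts V" "v \<in> U" by blast
 from chart_ball[OF c(1,2) v O'] obtain r M where r: "r > 0" "closed M" "c ` U \<subseteq> M" "M \<inter> ball (c v) r \<subseteq> c ` (U \<inter> O')" .
 have r2: "r / 2 > 0" using r by simp
 from euclidean_bump[OF r2, of "c v"] obtain b :: "'e => real" where b: "smooth_on UNIV b" "!!x. 0 <= b x" "!!x. b x <= 1"
  "!!x. dist (c v) x <= r/2/2 ==> b x = 1" "!!x. dist (c v) x >= r/2 ==> b x = 0" by metis
 define K where "K = M \<inter> cball (c v) (r/2)"
 have K: "compact K" "K \<subseteq> c ` (U \<inter> O')" unfolding K_def using r by (auto intro: closed_Int_compact simp: subset_iff)
 define C where "C = inv_into U c ` K"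
 have C_alt: "C = {x \<in> U. c x \<in> K}"
 proof (intro equalityI subsetI)
  fix x assume "x \<in> C"
  then obtain y where y: "y \<in> K" "x = inv_into U c y" unfolding C_def by blast
  with K(2) obtain u where "u \<in> U" "y = c u" by blast
  with y show "x \<in> {x \<in> U. c x \<in> K}" using chart_inverse[OF c(1)] by simp
 next
  fix x assume "x \<in> {x \<in> U. c x \<in> K}"
  thus "x \<in> C" unfolding C_def using chart_inverse[OF c(1)] by (metis imageI mem_Collect_eq)
 qed
 have "compactin (top_of_set (c ` U)) K" using K by (auto simp: compactin_subtopology)
 hence "compactin (subtopology T U) C" unfolding C_def
  using image_compactin chart_inverse_continuous[OF c(1)] by blast
 hence Cc: "compactin T C" by (simp add: compactin_subtopology)
 hence Ccl: "closedin T C" using hausdorff compactin_imp_closedin by blast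
 have CO: "C \<subseteq> O'" unfolding C_def using K(2) chart_inverse[OF c(1)] by (force simp: subset_iff image_iff)
 define e where "e = (%x. if x \<in> U then b (c x) else 0)"
 have e0: "e x = 0" if "x \<notin> C" for x
 proof (cases "x \<in> U")
  case True
  with that have "c x \<notin> K" by (simp add: C_alt)
  moreover have "c x \<in> M" using r True by blast
  ultimately show ?thesis using b(5)[of "c x"] True by (simp add: K_def e_def)
 qed (simp add: e_def)
 have "class_fun smooth V X e"
 proof (rule class_fun_glue)
  fix x assume x: "x \<in> X"
  show "\<exists>O'. openin T O' & x \<in> O' & class_fun smooth V (X \<inter> O') e"
  proof (cases "x \<in> U")
   case True
   have "class_fun smooth V U (%x. b (c x))"
    by (rule class_fun_chart[OF c(1) c(1) smooth_on_subset[OF b(1)]]) auto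
   hence "class_fun smooth V U e"
    by (rule class_fun_cong[rotated 2]) (use chart(1)[OF c(1)] in \<open>auto simp: e_def\<close>)
   moreover have "X \<inter> U = U" using chart(5)[OF c(1)] by blast
   ultimately show ?thesis using True chart(1)[OF c(1)] by (intro exI[of _ U]) simp
  next
   case False
   hence "x \<in> X - C" using x C_alt by blast
   moreover have "openin T (X - C)" using Ccl by (simp add: closedin_def)
   moreover have "class_fun smooth V (X - C) e"
    by (rule class_fun_cong[OF _ _ class_fun_const[where a = 0]]) (use e0 \<open>openin T (X - C)\<close> in auto)
   moreover have "X \<inter> (X - C) = X - C" by blast
   ultimately show ?thesis by (intro exI[of _ "X - C"]) simp
  qed
 qed auto
 moreover define P where "P = {x \<in> U. c x \<in> ball (c v) (r/2/2)}"
 have "openin T P" unfolding P_def by (rule chart_preimage_open[OF c(1)]) simp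
 moreover have "v \<in> P" using c r by (simp add: P_def)
 moreover have "P \<subseteq> C" using r by (auto simp: P_def C_alt K_def)
 moreover have "e x = 1" if "x \<in> P" for x using that b(4)[of "c x"] by (auto simp: P_def e_def)
 moreover have "0 <= e x" "e x <= 1" for x using b by (auto simp: e_def)
 ultimately show ?thesis using that[of e C P] Cc CO e0 by blast
qed

lemma class_fun_extend_zero:
 assumes adm: "admissible_class \<F>" and C: "compactin T C" "C \<subseteq> O'" and O': "openin T O'"
  and g: "class_fun \<F> V O' g" "!!x. x \<in> X ==> x \<notin> C ==> g x = 0"
 shows "class_fun \<F> V X g"
proof (rule class_fun_glue[OF adm])
 fix x assume x: "x \<in> X"
 have cl: "openin T (X - C)" using compactin_imp_closedin[OF hausdorff C(1)] by (simp add: closedin_def)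
 show "\<exists>O'. openin T O' & x \<in> O' & class_fun \<F> V (X \<inter> O') g"
 proof (cases "x \<in> O'")
  case True
  moreover have "X \<inter> O' = O'" using openin_subset[OF O'] by blast
  ultimately show ?thesis using g(1) O' by (intro exI[of _ O']) simp
 next
  case False
  hence "x \<in> X - C" using x C by blast
  moreover have "class_fun \<F> V (X - C) g"
   by (rule class_fun_cong[OF adm cl class_fun_const[OF adm cl, where a = 0]]) (use g in auto)
  moreover have "X \<inter> (X - C) = X - C" by blast
  ultimately show ?thesis using cl by (intro exI[of _ "X - C"]) simp
 qed
qed simp

end

subsection \<open>Algebra bundles\<close>

locale alg_bundle = smooth_mfd n V
 for n :: nat and V :: "('v, 'e::euclidean_space) manifold" +
 fixes K :: "complex set" and A :: "(complex, 'a::euclidean_space) module" and B :: "('v, 'x, 'a) fibre_bundle"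
 assumes K: "K = \<real> \<or> K = UNIV" and euclid: "on_euclidean_space A" and simple: "simple_algebra K A"
  and is_bundle: "algebra_bundle K V A B"
begin

abbreviation "F \<equiv> fibre B"

lemma real_in_K [simp]: "complex_of_real r \<in> K"
 using K by auto

lemma A_simps: "carrier A = UNIV" "\<zero>\<^bsub>A\<^esub> = 0" "x \<oplus>\<^bsub>A\<^esub> y = x + y" "complex_of_real r \<odot>\<^bsub>A\<^esub> x = r *\<^sub>R x"
 using euclid by (auto simp: on_euclidean_space_def)

lemma A_ring: "ring A" and A_alg: "unital_algebra K A"
 using simple by (auto simp: simple_algebra_def unital_algebra_def)

lemma fibre_alg: "v \<in> X ==> unital_algebra K (F v)"
 using is_bundle by (simp add: algebra_bundle_def)

lemma fibre_ring: "v \<in> X ==> ring (F v)"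
 using fibre_alg by (simp add: unital_algebra_def)

lemma fibre_module: "v \<in> X ==> Module.module (scalar_ring K) (F v)"
 using fibre_alg by (simp add: unital_algebra_def)

lemma bundle_axioms: "vector_bundle smooth V B"
 using is_bundle by (simp add: algebra_bundle_def)

lemma carrier_fibre: "v \<in> X ==> x \<in> carrier (F v) \<longleftrightarrow> x \<in> total B & proj B x = v"
 using bundle_axioms by (auto simp: vector_bundle_def)

lemma fibre_smult_closed: "v \<in> X ==> c \<in> K ==> x \<in> carrier (F v) ==> c \<odot>\<^bsub>F v\<^esub> x \<in> carrier (F v)"
 using module.smult_closed[OF fibre_module] by (simp add: scalar_ring_def)

lemma fibre_smult_mult:
 assumes "v \<in> X" "c \<in> K" "x \<in> carrier (F v)" "y \<in> carrier (F v)"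
 shows "(c \<odot>\<^bsub>F v\<^esub> x) \<otimes>\<^bsub>F v\<^esub> y = c \<odot>\<^bsub>F v\<^esub> (x \<otimes>\<^bsub>F v\<^esub> y)"
  "x \<otimes>\<^bsub>F v\<^esub> (c \<odot>\<^bsub>F v\<^esub> y) = c \<odot>\<^bsub>F v\<^esub> (x \<otimes>\<^bsub>F v\<^esub> y)"
 using fibre_alg[OF assms(1)] assms unfolding unital_algebra_def by blast+

lemma A_smult_mult: "(r *\<^sub>R x) \<otimes>\<^bsub>A\<^esub> y = r *\<^sub>R (x \<otimes>\<^bsub>A\<^esub> y)" "x \<otimes>\<^bsub>A\<^esub> (r *\<^sub>R y) = r *\<^sub>R (x \<otimes>\<^bsub>A\<^esub> y)"
 using A_alg real_in_K[of r] unfolding unital_algebra_def A_simps(4)[symmetric] by (auto simp: A_simps(1))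

lemma A_distrib: "(x + y) \<otimes>\<^bsub>A\<^esub> z = x \<otimes>\<^bsub>A\<^esub> z + y \<otimes>\<^bsub>A\<^esub> z" "z \<otimes>\<^bsub>A\<^esub> (x + y) = z \<otimes>\<^bsub>A\<^esub> x + z \<otimes>\<^bsub>A\<^esub> y"
 using ring.ring_simprules(13)[OF A_ring, of x y z] ring.ring_simprules(23)[OF A_ring, of x y z] by (auto simp: A_simps)

lemma A_assoc: "(x \<otimes>\<^bsub>A\<^esub> y) \<otimes>\<^bsub>A\<^esub> z = x \<otimes>\<^bsub>A\<^esub> (y \<otimes>\<^bsub>A\<^esub> z)"
 using ring.ring_simprules(11)[OF A_ring] by (simp add: A_simps)

lemma A_one: "\<one>\<^bsub>A\<^esub> \<otimes>\<^bsub>A\<^esub> x = x" "x \<otimes>\<^bsub>A\<^esub> \<one>\<^bsub>A\<^esub> = x"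
 using monoid.l_one[OF ring.is_monoid[OF A_ring], of x] monoid.r_one[OF ring.is_monoid[OF A_ring], of x] by (auto simp: A_simps)

lemma A_one_nonzero: "\<one>\<^bsub>A\<^esub> ~= 0"
proof
 assume 0: "\<one>\<^bsub>A\<^esub> = 0"
 have "x = 0" for x :: 'a using A_one(1)[of x] A_smult_mult(1)[of 0 0 x] 0 by simp
 thus False using simple by (auto simp: simple_algebra_def A_simps)
qed

lemma A_zero_mult: "0 \<otimes>\<^bsub>A\<^esub> x = 0" "x \<otimes>\<^bsub>A\<^esub> 0 = 0"
 using A_smult_mult(1)[of 0 0 x] A_smult_mult(2)[of x 0 0] by auto

text \<open>Simplicity in terms of plain set operations; additive inverses come from multiplication
  by minus the unit.\<close>

lemma A_ideal:
 assumes "I ~= {}" "!!x y. x \<in> I ==> y \<in> I ==> x + y \<in> I" "!!x a. x \<in> I ==> a \<otimes>\<^bsub>A\<^esub> x \<in> I" "!!x a. x \<in> I ==> x \<otimes>\<^bsub>A\<^esub> a \<in> I"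
 shows "I = {0} \<or> I = UNIV"
proof -
 interpret ring A by (rule A_ring)
 have ms: "- x = (- \<one>\<^bsub>A\<^esub>) \<otimes>\<^bsub>A\<^esub> x" for x using A_smult_mult(1)[of "-1" "\<one>\<^bsub>A\<^esub>" x] A_one(1) by simp
 have neg: "\<ominus>\<^bsub>A\<^esub> x = - x" for x
  using a_inv_closed[of x] l_neg[of x] by (simp add: A_simps eq_neg_iff_add_eq_0)
 have "additive_subgroup I A"
 proof (rule additive_subgroup.intro, rule subgroup.intro)
  from assms(1) obtain x where "x \<in> I" by blast
  hence "- x \<in> I" "x \<in> I" using ms[of x] assms(3) by auto
  hence "0 \<in> I" using assms(2)[of x "-x"] by simp
  thus "\<one>\<^bsub>add_monoid A\<^esub> \<in> I" by (simp add: A_simps)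
  show "I \<subseteq> carrier (add_monoid A)" by (simp add: A_simps)
  show "x \<otimes>\<^bsub>add_monoid A\<^esub> y \<in> I" if "x \<in> I" "y \<in> I" for x y using assms(2) that by (simp add: A_simps)
  show "inv\<^bsub>add_monoid A\<^esub> x \<in> I" if "x \<in> I" for x
  proof -
   have "- x \<in> I" using ms[of x] assms(3) that by auto
   thus ?thesis using neg[of x] by (simp add: a_inv_def)
  qed
 qed
 hence "ideal I A" using assms(3,4) by (intro idealI A_ring) (auto simp: additive_subgroup_def)
 thus ?thesis using simple by (auto simp: simple_algebra_def A_simps)
qed

text \<open>The annihilator of a central element is a two-sided ideal, and it misses the
  unit.\<close>

lemma A_central_nonzero_divisor:
 assumes "!!x. z \<otimes>\<^bsub>A\<^esub> x = x \<otimes>\<^bsub>A\<^esub> z" "z ~= 0" "z \<otimes>\<^bsub>A\<^esub> x = 0"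
 shows "x = 0"
proof -
 have "{x. z \<otimes>\<^bsub>A\<^esub> x = 0} = {0} \<or> {x. z \<otimes>\<^bsub>A\<^esub> x = 0} = UNIV"
 proof (rule A_ideal)
  show "{x. z \<otimes>\<^bsub>A\<^esub> x = 0} ~= {}" using A_zero_mult by blast
  show "a \<otimes>\<^bsub>A\<^esub> x \<in> {x. z \<otimes>\<^bsub>A\<^esub> x = 0}" if "x \<in> {x. z \<otimes>\<^bsub>A\<^esub> x = 0}" for x a
  proof -
   have "z \<otimes>\<^bsub>A\<^esub> (a \<otimes>\<^bsub>A\<^esub> x) = a \<otimes>\<^bsub>A\<^esub> (z \<otimes>\<^bsub>A\<^esub> x)" using assms(1)[of a] A_assoc by metis
   with that show ?thesis by (simp add: A_zero_mult)
  qed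
  show "x \<otimes>\<^bsub>A\<^esub> a \<in> {x. z \<otimes>\<^bsub>A\<^esub> x = 0}" if "x \<in> {x. z \<otimes>\<^bsub>A\<^esub> x = 0}" for x a
   using that A_assoc[of z x a] by (simp add: A_zero_mult)
 qed (simp add: A_distrib)
 moreover have "z \<otimes>\<^bsub>A\<^esub> \<one>\<^bsub>A\<^esub> ~= 0" using assms(2) A_one by simp
 ultimately show ?thesis using assms(3) by blast
qed

text \<open>The atlas \<open>trivs B\<close> consists of fibrewise linear trivializations; these
  ones are compatible with it and also respect the product.\<close>

definition atriv :: "'v set => ('v => 'a => 'x) => bool" where
 "atriv O' \<tau> \<longleftrightarrow> vector_bundle smooth V (B\<lparr>trivs := insert (O', \<tau>) (trivs B)\<rparr>) & (\<forall>u\<in>O'. algebra_iso K A (F u) (\<tau> u))"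

lemma ex_atriv: "v \<in> X ==> \<exists>O' \<tau>. atriv O' \<tau> & v \<in> O'"
 using is_bundle unfolding algebra_bundle_def atriv_def by blast

context
 fixes O' \<tau>
 assumes at: "atriv O' \<tau>"
begin

lemma atriv_open: "openin T O'"
 using at unfolding atriv_def vector_bundle_def by simp

lemma atriv_sub: "O' \<subseteq> X"
 using atriv_open openin_subset by blast

lemma atriv_transition:
 assumes "(O'', \<sigma>) \<in> trivs B"
 shows "class_matrix smooth V (O' \<inter> O'') (%v. inv_into UNIV (\<sigma> v) \<circ> \<tau> v)"
  "class_matrix smooth V (O' \<inter> O'') (%v. inv_into UNIV (\<tau> v) \<circ> \<sigma> v)"
proof -
 have "\<forall>(O1, \<tau>1)\<in>insert (O', \<tau>) (trivs B). \<forall>(O2, \<tau>2)\<in>insert (O', \<tau>) (trivs B). class_matrix smooth V (O1 \<inter> O2) (%v. inv_into UNIV (\<tau>2 v) \<circ> \<tau>1 v)"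
  using at unfolding atriv_def vector_bundle_def by simp
 with assms show "class_matrix smooth V (O' \<inter> O'') (%v. inv_into UNIV (\<sigma> v) \<circ> \<tau> v)"
  "class_matrix smooth V (O' \<inter> O'') (%v. inv_into UNIV (\<tau> v) \<circ> \<sigma> v)" by (auto simp: Int_commute)
qed

lemma atriv_linear_iso: "v \<in> O' ==> linear_iso (F v) (\<tau> v)"
 using at unfolding atriv_def vector_bundle_def by simp

lemma atriv_iso: "v \<in> O' ==> algebra_iso K A (F v) (\<tau> v)"
 using at unfolding atriv_def by simp

end

lemma linear_isoD:
 assumes "linear_iso R h"
 shows "h a \<in> carrier R" "inv_into UNIV h (h a) = a" "x \<in> carrier R ==> h (inv_into UNIV h x) = x"
  "h (a + b) = h a \<oplus>\<^bsub>R\<^esub> h b" "h (r *\<^sub>R a) = complex_of_real r \<odot>\<^bsub>R\<^esub> h a"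
proof -
 have b: "bij_betw h UNIV (carrier R)" using assms by (simp add: linear_iso_def)
 thus "h a \<in> carrier R" "inv_into UNIV h (h a) = a" "x \<in> carrier R ==> h (inv_into UNIV h x) = x"
  by (auto simp: bij_betw_def f_inv_into_f)
qed (use assms in \<open>auto simp: linear_iso_def\<close>)

lemma linear_iso_inv_add:
 assumes "linear_iso R h" "x \<in> carrier R" "y \<in> carrier R"
 shows "inv_into UNIV h (x \<oplus>\<^bsub>R\<^esub> y) = inv_into UNIV h x + inv_into UNIV h y"
proof -
 note d = linear_isoD[OF assms(1)]
 have "inv_into UNIV h (x \<oplus>\<^bsub>R\<^esub> y) = inv_into UNIV h (h (inv_into UNIV h x + inv_into UNIV h y))"
  using d(3)[OF assms(2)] d(3)[OF assms(3)] d(4) by simp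
 thus ?thesis by (simp only: d(2))
qed

lemma linear_iso_inv_scale:
 assumes "linear_iso R h" "x \<in> carrier R"
 shows "inv_into UNIV h (complex_of_real r \<odot>\<^bsub>R\<^esub> x) = r *\<^sub>R inv_into UNIV h x"
proof -
 note d = linear_isoD[OF assms(1)]
 have "inv_into UNIV h (complex_of_real r \<odot>\<^bsub>R\<^esub> x) = inv_into UNIV h (h (r *\<^sub>R inv_into UNIV h x))"
  using d(3)[OF assms(2)] d(5) by simp
 thus ?thesis by (simp only: d(2))
qed

abbreviation "coord \<tau> v x \<equiv> inv_into UNIV (\<tau> v) x"

context
 fixes O' \<tau> v
 assumes at: "atriv O' \<tau>" and v: "v \<in> O'"
begin

lemma triv_iso: "linear_iso (F v) (\<tau> v)" "v \<in> X" "algebra_iso K A (F v) (\<tau> v)"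
 using atriv_linear_iso[OF at v] atriv_sub[OF at] v atriv_iso[OF at v] by auto

lemma tau_carrier: "\<tau> v a \<in> carrier (F v)"
 by (rule linear_isoD(1)[OF triv_iso(1)])

lemma coord_tau: "coord \<tau> v (\<tau> v a) = a"
 by (rule linear_isoD(2)[OF triv_iso(1)])

lemma tau_coord: "x \<in> carrier (F v) ==> \<tau> v (coord \<tau> v x) = x"
 by (rule linear_isoD(3)[OF triv_iso(1)])

lemma tau_add: "\<tau> v (a + b) = \<tau> v a \<oplus>\<^bsub>F v\<^esub> \<tau> v b"
 by (rule linear_isoD(4)[OF triv_iso(1)])

lemma tau_scale: "\<tau> v (r *\<^sub>R a) = complex_of_real r \<odot>\<^bsub>F v\<^esub> \<tau> v a"
 by (rule linear_isoD(5)[OF triv_iso(1)])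

lemma tau_mult: "\<tau> v (a \<otimes>\<^bsub>A\<^esub> b) = \<tau> v a \<otimes>\<^bsub>F v\<^esub> \<tau> v b"
 using triv_iso(3) by (simp add: algebra_iso_def A_simps)

lemma tau_smult: "c \<in> K ==> \<tau> v (c \<odot>\<^bsub>A\<^esub> a) = c \<odot>\<^bsub>F v\<^esub> \<tau> v a"
 using triv_iso(3) by (simp add: algebra_iso_def A_simps)

lemma tau_zero: "\<tau> v 0 = \<zero>\<^bsub>F v\<^esub>"
proof -
 interpret ring "F v" by (rule fibre_ring[OF triv_iso(2)])
 have "\<tau> v 0 \<oplus>\<^bsub>F v\<^esub> \<tau> v 0 = \<tau> v 0" using tau_add[of 0 0] by simp
 thus ?thesis using tau_carrier[of 0] by (metis r_neg l_zero add.m_assoc r_zero a_inv_closed)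
qed

lemma tau_one: "\<tau> v \<one>\<^bsub>A\<^esub> = \<one>\<^bsub>F v\<^esub>"
proof -
 interpret ring "F v" by (rule fibre_ring[OF triv_iso(2)])
 have "\<tau> v \<one>\<^bsub>A\<^esub> \<otimes>\<^bsub>F v\<^esub> \<tau> v (coord \<tau> v \<one>\<^bsub>F v\<^esub>) = \<tau> v (coord \<tau> v \<one>\<^bsub>F v\<^esub>)"
  by (simp flip: tau_mult add: A_one)
 thus ?thesis using tau_carrier by (simp add: tau_coord)
qed

lemma coord_carrier_eq: "x \<in> carrier (F v) ==> y \<in> carrier (F v) ==> coord \<tau> v x = coord \<tau> v y \<longleftrightarrow> x = y"
 using tau_coord by metis

lemma coord_zero: "coord \<tau> v \<zero>\<^bsub>F v\<^esub> = 0"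
 using coord_tau[of 0] tau_zero by simp

lemma coord_one: "coord \<tau> v \<one>\<^bsub>F v\<^esub> = \<one>\<^bsub>A\<^esub>"
 using coord_tau[of "\<one>\<^bsub>A\<^esub>"] tau_one by simp

lemma coord_add: "x \<in> carrier (F v) ==> y \<in> carrier (F v) ==> coord \<tau> v (x \<oplus>\<^bsub>F v\<^esub> y) = coord \<tau> v x + coord \<tau> v y"
 by (rule linear_iso_inv_add[OF triv_iso(1)])

lemma coord_scale: "x \<in> carrier (F v) ==> coord \<tau> v (complex_of_real r \<odot>\<^bsub>F v\<^esub> x) = r *\<^sub>R coord \<tau> v x"
 by (rule linear_iso_inv_scale[OF triv_iso(1)])

lemma coord_mult:
 assumes "x \<in> carrier (F v)" "y \<in> carrier (F v)"
 shows "coord \<tau> v (x \<otimes>\<^bsub>F v\<^esub> y) = coord \<tau> v x \<otimes>\<^bsub>A\<^esub> coord \<tau> v y"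
proof -
 have "x \<otimes>\<^bsub>F v\<^esub> y = \<tau> v (coord \<tau> v x \<otimes>\<^bsub>A\<^esub> coord \<tau> v y)" using assms by (simp add: tau_mult tau_coord)
 thus ?thesis by (simp add: coord_tau)
qed

lemma coord_eq_zero: "x \<in> carrier (F v) ==> coord \<tau> v x = 0 \<longleftrightarrow> x = \<zero>\<^bsub>F v\<^esub>"
 using tau_coord tau_zero coord_zero by metis

end

lemma fibre_one_nonzero: "v \<in> X ==> \<one>\<^bsub>F v\<^esub> ~= \<zero>\<^bsub>F v\<^esub>"
 using ex_atriv[of v] coord_one coord_zero A_one_nonzero by metis

lemma fibre_central_nonzero_divisor:
 assumes v: "v \<in> X" and z: "z \<in> carrier (F v)" "!!x. x \<in> carrier (F v) ==> z \<otimes>\<^bsub>F v\<^esub> x = x \<otimes>\<^bsub>F v\<^esub> z"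
  "z ~= \<zero>\<^bsub>F v\<^esub>" and x: "x \<in> carrier (F v)" "z \<otimes>\<^bsub>F v\<^esub> x = \<zero>\<^bsub>F v\<^esub>"
 shows "x = \<zero>\<^bsub>F v\<^esub>"
proof -
 from ex_atriv[OF v] obtain O' \<tau> where at: "atriv O' \<tau>" "v \<in> O'" by blast
 have "coord \<tau> v x = 0"
 proof (rule A_central_nonzero_divisor)
  show "coord \<tau> v z \<otimes>\<^bsub>A\<^esub> a = a \<otimes>\<^bsub>A\<^esub> coord \<tau> v z" for a
   using z(2)[OF tau_carrier[OF at, of a]] coord_mult[OF at z(1) tau_carrier[OF at, of a]]
    coord_mult[OF at tau_carrier[OF at, of a] z(1)] by (simp add: coord_tau[OF at])
  show "coord \<tau> v z ~= 0" using z coord_eq_zero[OF at] by blast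
  show "coord \<tau> v z \<otimes>\<^bsub>A\<^esub> coord \<tau> v x = 0" using x coord_mult[OF at z(1) x(1)] coord_zero[OF at] by simp
 qed
 thus ?thesis using coord_eq_zero[OF at x(1)] by simp
qed

subsection \<open>Sections\<close>

text \<open>Regularity over an open subset S of the base, so that sections can be glued.\<close>

definition lsec :: "regularity => 'v set => ('v => 'x) => bool" where
 "lsec \<F> S s \<longleftrightarrow> (\<forall>v\<in>S. s v \<in> carrier (F v)) & (\<forall>(O', \<tau>)\<in>trivs B. class_fun \<F> V (S \<inter> O') (%v. inv_into UNIV (\<tau> v) (s v)))"

lemma trivs_cover:
 assumes "v \<in> X" obtains O' \<tau> where "(O', \<tau>) \<in> trivs B" "v \<in> O'"
proof -
 have "(\<Union>(O', \<tau>)\<in>trivs B. O') = X" using bundle_axioms by (simp add: vector_bundle_def)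
 with assms that show ?thesis by blast
qed

lemma trivs_facts:
 assumes "(O', \<tau>) \<in> trivs B"
 shows "openin T O'" "v \<in> O' ==> linear_iso (F v) (\<tau> v)"
proof -
 have "\<forall>(O', \<tau>)\<in>trivs B. openin T O' & (\<forall>v\<in>O'. linear_iso (F v) (\<tau> v))"
  using bundle_axioms by (simp add: vector_bundle_def)
 with assms show "openin T O'" "v \<in> O' ==> linear_iso (F v) (\<tau> v)" by auto
qed

lemma sections_iff: "s \<in> sections \<F> V B \<longleftrightarrow> s \<in> extensional X & lsec \<F> X s"
proof -
 have "X \<inter> O' = O'" if "(O', \<tau>) \<in> trivs B" for O' \<tau> using trivs_facts(1)[OF that] openin_subset by blast
 thus ?thesis unfolding sections_def lsec_def using carrier_fibre by auto
qed

text \<open>The entries of a smooth matrix lie in the scalar class, so they may multiply functions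
  of class F also in the Sobolev case.\<close>

lemma class_fun_matrix:
 fixes L :: "'v => 'c::euclidean_space => 'd::euclidean_space"
 assumes adm: "admissible_class \<F>" and S: "openin T S" and L: "class_matrix smooth V S L" "!!v. v \<in> S ==> linear (L v)"
  and g: "class_fun \<F> V S g"
 shows "class_fun \<F> V S (%v. L v (g v))"
proof (rule class_fun_componentwise[OF adm S])
 fix j :: 'd assume j: "j \<in> Basis"
 have "class_fun \<F> V S (%v. (L v i \<bullet> j) *\<^sub>R (g v \<bullet> i))" if "i \<in> Basis" for i
  using L(1) j that unfolding class_matrix_def
  by (intro class_fun_scaleR[OF adm S] class_fun_smooth_scalar[OF adm S] class_fun_linear[OF adm S g] bounded_linear_inner_left) blast
 hence "class_fun \<F> V S (%v. \<Sum>i\<in>Basis. (L v i \<bullet> j) *\<^sub>R (g v \<bullet> i))" by (rule class_fun_sum[OF adm S])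
 thus "class_fun \<F> V S (%v. L v (g v) \<bullet> j)"
 proof (rule class_fun_cong[OF adm S])
  fix v assume "v \<in> S"
  from linear_basis_expansion[OF L(2)[OF this], of "g v"]
  show "(\<Sum>i\<in>Basis. (L v i \<bullet> j) *\<^sub>R (g v \<bullet> i)) = L v (g v) \<bullet> j"
   by (simp add: inner_sum_left mult.commute)
 qed
qed

lemma linear_transition:
 assumes "linear_iso R \<tau>" "linear_iso R \<sigma>"
 shows "linear (inv_into UNIV \<sigma> \<circ> \<tau>)"
 using linear_isoD(1,4,5)[OF assms(1)] linear_iso_inv_add[OF assms(2)] linear_iso_inv_scale[OF assms(2)] by (intro linearI) auto

text \<open>Sections are defined by means of the linear atlas; the smooth transition matrices carry
  their regularity to algebra trivializations.\<close>

lemma lsec_coord: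
 assumes adm: "admissible_class \<F>" and S: "openin T S" and s: "lsec \<F> S s" and at: "atriv O' \<tau>"
 shows "class_fun \<F> V (S \<inter> O') (%v. coord \<tau> v (s v))"
proof (rule class_fun_glue[OF adm])
 show op: "openin T (S \<inter> O')" using S atriv_open[OF at] by blast
 fix v assume v: "v \<in> S \<inter> O'"
 hence "v \<in> X" using S openin_subset by blast
 from trivs_cover[OF this] obtain O'' \<sigma> where t: "(O'', \<sigma>) \<in> trivs B" "v \<in> O''" by blast
 note tf = trivs_facts[OF t(1)]
 have op': "openin T (S \<inter> O' \<inter> O'')" using op tf(1) by blast
 have "class_fun \<F> V (S \<inter> O' \<inter> O'') (%v. (coord \<tau> v \<circ> \<sigma> v) (inv_into UNIV (\<sigma> v) (s v)))"
 proof (rule class_fun_matrix[OF adm op', where L = "%v. coord \<tau> v \<circ> \<sigma> v"])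
  show "class_matrix smooth V (S \<inter> O' \<inter> O'') (%v. coord \<tau> v \<circ> \<sigma> v)"
   unfolding class_matrix_def
  proof (intro ballI)
   fix i j :: 'a assume "i \<in> Basis" "j \<in> Basis"
   hence "class_fun smooth V (O' \<inter> O'') (%v. (coord \<tau> v \<circ> \<sigma> v) i \<bullet> j)"
    using atriv_transition(2)[OF at t(1)] unfolding class_matrix_def by blast
   thus "class_fun smooth V (S \<inter> O' \<inter> O'') (%v. (coord \<tau> v \<circ> \<sigma> v) i \<bullet> j)"
    by (rule class_fun_subset[rotated 2]) (use op' atriv_open[OF at] tf(1) in auto)
  qed
  show "linear (coord \<tau> v \<circ> \<sigma> v)" if "v \<in> S \<inter> O' \<inter> O''" for v
   by (rule linear_transition[OF tf(2) atriv_linear_iso[OF at]]) (use that in auto)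
  have "class_fun \<F> V (S \<inter> O'') (%v. inv_into UNIV (\<sigma> v) (s v))" using s t(1) unfolding lsec_def by blast
  thus "class_fun \<F> V (S \<inter> O' \<inter> O'') (%v. inv_into UNIV (\<sigma> v) (s v))"
   by (rule class_fun_subset[OF adm, rotated]) (use op' S tf(1) in auto)
 qed
 hence "class_fun \<F> V (S \<inter> O' \<inter> O'') (%v. coord \<tau> v (s v))"
 proof (rule class_fun_cong[OF adm op'])
  fix v assume "v \<in> S \<inter> O' \<inter> O''"
  thus "(coord \<tau> v \<circ> \<sigma> v) (inv_into UNIV (\<sigma> v) (s v)) = coord \<tau> v (s v)"
   using linear_isoD(3)[OF tf(2)[of v], of "s v"] s by (auto simp: lsec_def)
 qed
 with tf(1) t(2) show "\<exists>O''. openin T O'' & v \<in> O'' & class_fun \<F> V (S \<inter> O' \<inter> O'') (%v. coord \<tau> v (s v))" by blast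
qed

lemma lsecI:
 assumes adm: "admissible_class \<F>" and S: "openin T S" "S \<subseteq> O'" and at: "atriv O' \<tau>"
  and c: "!!v. v \<in> S ==> s v \<in> carrier (F v)" and g: "class_fun \<F> V S (%v. coord \<tau> v (s v))"
 shows "lsec \<F> S s"
 unfolding lsec_def
proof (intro conjI ballI)
 fix p assume "p \<in> trivs B"
 then obtain O'' \<sigma> where [simp]: "p = (O'', \<sigma>)" and t: "(O'', \<sigma>) \<in> trivs B" by (cases p) auto
 note tf = trivs_facts[OF t]
 have op': "openin T (S \<inter> O'')" using S tf(1) by blast
 have "class_fun \<F> V (S \<inter> O'') (%v. (inv_into UNIV (\<sigma> v) \<circ> \<tau> v) (coord \<tau> v (s v)))"
 proof (rule class_fun_matrix[OF adm op', where L = "%v. inv_into UNIV (\<sigma> v) \<circ> \<tau> v"])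
  show "class_matrix smooth V (S \<inter> O'') (%v. inv_into UNIV (\<sigma> v) \<circ> \<tau> v)"
   unfolding class_matrix_def
  proof (intro ballI)
   fix i j :: 'a assume "i \<in> Basis" "j \<in> Basis"
   hence "class_fun smooth V (O' \<inter> O'') (%v. (inv_into UNIV (\<sigma> v) \<circ> \<tau> v) i \<bullet> j)"
    using atriv_transition(1)[OF at t(1)] unfolding class_matrix_def by blast
   thus "class_fun smooth V (S \<inter> O'') (%v. (inv_into UNIV (\<sigma> v) \<circ> \<tau> v) i \<bullet> j)"
    by (rule class_fun_subset[rotated 2]) (use op' atriv_open[OF at] tf(1) S in auto)
  qed
  show "linear (inv_into UNIV (\<sigma> v) \<circ> \<tau> v)" if "v \<in> S \<inter> O''" for v
   by (rule linear_transition[OF atriv_linear_iso[OF at] tf(2)]) (use that S in auto)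
  show "class_fun \<F> V (S \<inter> O'') (%v. coord \<tau> v (s v))"
   by (rule class_fun_subset[OF adm S(1) g op']) auto
 qed
 hence "class_fun \<F> V (S \<inter> O'') (%v. inv_into UNIV (\<sigma> v) (s v))"
 proof (rule class_fun_cong[OF adm op'])
  fix v assume v: "v \<in> S \<inter> O''"
  thus "(inv_into UNIV (\<sigma> v) \<circ> \<tau> v) (coord \<tau> v (s v)) = inv_into UNIV (\<sigma> v) (s v)"
   using tau_coord[OF at, of v "s v"] S c by auto
 qed
 thus "case p of (O', \<tau>) => class_fun \<F> V (S \<inter> O') (%v. inv_into UNIV (\<tau> v) (s v))" by simp
qed (use c in auto)

lemma lsec_glue:
 assumes adm: "admissible_class \<F>" and S: "openin T S"
  and l: "!!v. v \<in> S ==> \<exists>O'. openin T O' & v \<in> O' & lsec \<F> (S \<inter> O') s"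
 shows "lsec \<F> S s"
 unfolding lsec_def
proof (intro conjI ballI)
 show "s v \<in> carrier (F v)" if "v \<in> S" for v using l[OF that] that by (auto simp: lsec_def)
 fix p assume "p \<in> trivs B"
 then obtain O'' \<sigma> where [simp]: "p = (O'', \<sigma>)" and t: "(O'', \<sigma>) \<in> trivs B" by (cases p) auto
 note tf = trivs_facts[OF t]
 have "class_fun \<F> V (S \<inter> O'') (%v. inv_into UNIV (\<sigma> v) (s v))"
 proof (rule class_fun_glue[OF adm])
  show "openin T (S \<inter> O'')" using S tf(1) by blast
  fix v assume v: "v \<in> S \<inter> O''"
  with l obtain O' where O': "openin T O'" "v \<in> O'" "lsec \<F> (S \<inter> O') s" by blast
  hence "class_fun \<F> V (S \<inter> O' \<inter> O'') (%v. inv_into UNIV (\<sigma> v) (s v))" using t unfolding lsec_def by blast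
  moreover have "S \<inter> O' \<inter> O'' = S \<inter> O'' \<inter> O'" by blast
  ultimately show "\<exists>O'. openin T O' & v \<in> O' & class_fun \<F> V (S \<inter> O'' \<inter> O') (%v. inv_into UNIV (\<sigma> v) (s v))"
   using O' by auto
 qed
 thus "case p of (O', \<tau>) => class_fun \<F> V (S \<inter> O') (%v. inv_into UNIV (\<tau> v) (s v))" by simp
qed

lemma lsec_atrivI:
 assumes adm: "admissible_class \<F>" and c: "!!v. v \<in> X ==> s v \<in> carrier (F v)"
  and g: "!!O' \<tau>. atriv O' \<tau> ==> class_fun \<F> V O' (%v. coord \<tau> v (s v))"
 shows "lsec \<F> X s"
proof (rule lsec_glue[OF adm])
 fix v assume "v \<in> X"
 from ex_atriv[OF this] obtain O' \<tau> where at: "atriv O' \<tau>" "v \<in> O'" by blast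
 have "lsec \<F> O' s" by (rule lsecI[OF adm atriv_open[OF at(1)] order_refl at(1) _ g[OF at(1)]]) (use c atriv_sub[OF at(1)] in auto)
 moreover have "X \<inter> O' = O'" using atriv_sub[OF at(1)] by blast
 ultimately show "\<exists>O'. openin T O' & v \<in> O' & lsec \<F> (X \<inter> O') s" using at atriv_open by (intro exI[of _ O']) auto
qed simp

lemma lsec_coordX: "admissible_class \<F> ==> lsec \<F> X s ==> atriv O' \<tau> ==> class_fun \<F> V O' (%v. coord \<tau> v (s v))"
 using lsec_coord[of \<F> X s O' \<tau>] atriv_sub[of O' \<tau>] by (simp add: Int_absorb1)

end

section \<open>Bumps, supports and operations on sections\<close>

context alg_bundle
begin

definition is_bump :: "'v set => 'v => ('v => real) => 'v set => 'v set => bool" where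
 "is_bump O' v e C P \<longleftrightarrow> class_fun smooth V X e & compactin T C & C \<subseteq> O' & (\<forall>x. x \<notin> C --> e x = 0) &
   openin T P & v \<in> P & P \<subseteq> C & (\<forall>x\<in>P. e x = 1) & (\<forall>x. 0 <= e x & e x <= 1)"

lemma ex_bump:
 assumes "openin T O'" "v \<in> O'"
 shows "\<exists>e C P. is_bump O' v e C P"
proof (rule bump[OF assms], goal_cases)
 case (1 e C P)
 thus ?case unfolding is_bump_def by (intro exI[of _ e] exI[of _ C] exI[of _ P]) simp
qed

lemma is_bumpD:
 assumes "is_bump O' v e C P"
 shows "class_fun smooth V X e" "compactin T C" "C \<subseteq> O'" "x \<notin> C ==> e x = 0"
  "openin T P" "v \<in> P" "P \<subseteq> C" "x \<in> P ==> e x = 1" "0 <= e x" "e x <= 1"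
 using assms unfolding is_bump_def by blast+

text \<open>The flag \<open>cpt\<close> selects the compactly supported sections or all of them, so
  that both halves of the theorem share one proof.\<close>

definition sect :: "regularity => bool => ('v => 'x) => bool" where
 "sect \<F> cpt s \<longleftrightarrow> s \<in> (if cpt then sections_c \<F> V B else sections \<F> V B)"

definition scal :: "regularity => bool => ('v => real) => bool" where
 "scal \<F> cpt h \<longleftrightarrow> class_fun \<F> V X h & (cpt --> (\<exists>C. compactin T C & (\<forall>v\<in>X - C. h v = 0)))"

text \<open>In a Hausdorff space a compact C is closed, so it contains the closure of the
  support.\<close>

lemma compact_closure_support_iff:
 "compactin T (T closure_of {v \<in> X. P v}) \<longleftrightarrow> (\<exists>C. compactin T C & (\<forall>v\<in>X - C. \<not> P v))"
proof
 assume "compactin T (T closure_of {v \<in> X. P v})"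
 moreover have "{v \<in> X. P v} \<subseteq> T closure_of {v \<in> X. P v}" by (rule closure_of_subset) auto
 ultimately show "\<exists>C. compactin T C & (\<forall>v\<in>X - C. \<not> P v)" by blast
next
 assume "\<exists>C. compactin T C & (\<forall>v\<in>X - C. \<not> P v)"
 then obtain C where C: "compactin T C" "\<forall>v\<in>X - C. \<not> P v" by blast
 hence "T closure_of {v \<in> X. P v} \<subseteq> C" using compactin_imp_closedin[OF hausdorff] by (intro closure_of_minimal) auto
 thus "compactin T (T closure_of {v \<in> X. P v})" using C(1) closed_compactin closedin_closure_of by blast
qed

lemma sect_iff: "sect \<F> cpt s \<longleftrightarrow> s \<in> extensional X & lsec \<F> X s &
  (cpt --> (\<exists>C. compactin T C & (\<forall>v\<in>X - C. s v = \<zero>\<^bsub>F v\<^esub>)))"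
proof -
 have "s \<in> sections_c \<F> V B \<longleftrightarrow> s \<in> sections \<F> V B & (\<exists>C. compactin T C & (\<forall>v\<in>X - C. s v = \<zero>\<^bsub>F v\<^esub>))"
  using compact_closure_support_iff[of "%v. s v ~= \<zero>\<^bsub>F v\<^esub>"] by (simp add: sections_c_def)
 thus ?thesis using sections_iff[of s \<F>] by (auto simp: sect_def)
qed

lemma sect_carrier: "sect \<F> cpt s ==> v \<in> X ==> s v \<in> carrier (F v)"
 by (simp add: sect_iff lsec_def)

lemma sect_coord: "admissible_class \<F> ==> sect \<F> cpt s ==> atriv O' \<tau> ==> class_fun \<F> V O' (%v. coord \<tau> v (s v))"
 using lsec_coordX by (simp add: sect_iff)

lemma sect_eqI: "sect \<F> cpt s ==> sect \<F> cpt t ==> (!!v. v \<in> X ==> s v = t v) ==> s = t"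
 unfolding sect_iff by (metis extensionalityI)

definition smul :: "('v => real) => ('v => 'x) => 'v => 'x" where
 "smul h s = (\<lambda>v\<in>X. complex_of_real (h v) \<odot>\<^bsub>F v\<^esub> s v)"

text \<open>Scalar functions enter the algebra of sections as multiples of the unit; multiplying by
  \<open>usec h\<close> on either side is \<open>smul h\<close>.\<close>

definition usec :: "('v => real) => 'v => 'x" where
 "usec h = (\<lambda>v\<in>X. complex_of_real (h v) \<odot>\<^bsub>F v\<^esub> \<one>\<^bsub>F v\<^esub>)"

definition sadd :: "('v => 'x) => ('v => 'x) => 'v => 'x" where
 "sadd s t = (\<lambda>v\<in>X. s v \<oplus>\<^bsub>F v\<^esub> t v)"

definition smult2 :: "('v => 'x) => ('v => 'x) => 'v => 'x" where
 "smult2 s t = (\<lambda>v\<in>X. s v \<otimes>\<^bsub>F v\<^esub> t v)"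

text \<open>Sections given by coordinates in a single trivialization. With g a scalar times a fixed
  vector they reduce statements about sections to statements about scalar functions.\<close>

definition vsec :: "'v set => ('v => 'a => 'x) => ('v => 'a) => 'v => 'x" where
 "vsec O' \<tau> g = (\<lambda>v\<in>X. if v \<in> O' then \<tau> v (g v) else \<zero>\<^bsub>F v\<^esub>)"

lemma fibre_simps:
 assumes "v \<in> X"
 shows "\<one>\<^bsub>F v\<^esub> \<in> carrier (F v)" "\<zero>\<^bsub>F v\<^esub> \<in> carrier (F v)"
  "x \<in> carrier (F v) ==> \<one>\<^bsub>F v\<^esub> \<otimes>\<^bsub>F v\<^esub> x = x"
  "x \<in> carrier (F v) ==> x \<otimes>\<^bsub>F v\<^esub> \<one>\<^bsub>F v\<^esub> = x"
  "x \<in> carrier (F v) ==> \<zero>\<^bsub>F v\<^esub> \<oplus>\<^bsub>F v\<^esub> x = x"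
  "x \<in> carrier (F v) ==> x \<oplus>\<^bsub>F v\<^esub> \<zero>\<^bsub>F v\<^esub> = x"
  "x \<in> carrier (F v) ==> y \<in> carrier (F v) ==> x \<oplus>\<^bsub>F v\<^esub> y \<in> carrier (F v)"
  "x \<in> carrier (F v) ==> y \<in> carrier (F v) ==> x \<otimes>\<^bsub>F v\<^esub> y \<in> carrier (F v)"
  "x \<in> carrier (F v) ==> \<zero>\<^bsub>F v\<^esub> \<otimes>\<^bsub>F v\<^esub> x = \<zero>\<^bsub>F v\<^esub>"
  "x \<in> carrier (F v) ==> x \<otimes>\<^bsub>F v\<^esub> \<zero>\<^bsub>F v\<^esub> = \<zero>\<^bsub>F v\<^esub>"
  "x \<in> carrier (F v) ==> complex_of_real r \<odot>\<^bsub>F v\<^esub> x \<in> carrier (F v)"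
  "x \<in> carrier (F v) ==> complex_of_real 0 \<odot>\<^bsub>F v\<^esub> x = \<zero>\<^bsub>F v\<^esub>"
  "complex_of_real r \<odot>\<^bsub>F v\<^esub> \<zero>\<^bsub>F v\<^esub> = \<zero>\<^bsub>F v\<^esub>"
  "x \<in> carrier (F v) ==> complex_of_real 1 \<odot>\<^bsub>F v\<^esub> x = x"
  "x \<in> carrier (F v) ==> complex_of_real r \<odot>\<^bsub>F v\<^esub> (complex_of_real q \<odot>\<^bsub>F v\<^esub> x) = complex_of_real (r * q) \<odot>\<^bsub>F v\<^esub> x"
 using fibre_ring[OF assms] fibre_smult_closed[OF assms real_in_K]
  module.smult_one[OF fibre_module[OF assms]] module.smult_l_null[OF fibre_module[OF assms]]
  module.smult_r_null[OF fibre_module[OF assms]] module.smult_assoc1[OF fibre_module[OF assms]]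
 by (simp_all add: scalar_ring_def ring.ring_simprules monoid.one_closed monoid.l_one monoid.r_one ring.is_monoid)

lemma fibre_smult_eq_zero:
 assumes "v \<in> X" "x \<in> carrier (F v)"
 shows "complex_of_real r \<odot>\<^bsub>F v\<^esub> x = \<zero>\<^bsub>F v\<^esub> \<longleftrightarrow> r = 0 \<or> x = \<zero>\<^bsub>F v\<^esub>"
proof -
 from ex_atriv[OF assms(1)] obtain O' \<tau> where at: "atriv O' \<tau>" "v \<in> O'" by blast
 show ?thesis
  using coord_eq_zero[OF at fibre_simps(11)[OF assms], of r] coord_eq_zero[OF at assms(2)] by (simp add: coord_scale[OF at assms(2)])
qed

lemma usec_mult:
 assumes "!!v. v \<in> X ==> s v \<in> carrier (F v)"
 shows "smult2 (usec h) s = smul h s" "smult2 s (usec h) = smul h s"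
 unfolding smult2_def usec_def smul_def
 by (auto simp: fun_eq_iff restrict_def fibre_smult_mult fibre_simps assms)

lemma usec_usec: "smul h (usec k) = usec (%v. h v * k v)"
 unfolding usec_def smul_def by (auto simp: fun_eq_iff restrict_def fibre_simps)

lemma sect_smul:
 assumes adm: "admissible_class \<F>" and h: "class_fun (scalar_class \<F>) V X h" and s: "sect \<F> cpt s"
 shows "sect \<F> cpt (smul h s)"
proof -
 have c: "s v \<in> carrier (F v)" if "v \<in> X" for v using sect_carrier[OF s that] .
 have "lsec \<F> X (smul h s)"
 proof (rule lsec_atrivI[OF adm])
  show "smul h s v \<in> carrier (F v)" if "v \<in> X" for v using that c by (simp add: smul_def fibre_simps)
  fix O' \<tau> assume at: "atriv O' \<tau>"
  note op = atriv_open[OF at]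
  have "class_fun (scalar_class \<F>) V O' h"
   by (rule class_fun_subset[OF scalar_class_admissible[OF adm] _ h op]) (use atriv_sub[OF at] in auto)
  from class_fun_scaleR[OF adm op this sect_coord[OF adm s at]]
  show "class_fun \<F> V O' (%v. coord \<tau> v (smul h s v))"
  proof (rule class_fun_cong[OF adm op])
   fix v assume v: "v \<in> O'"
   hence "v \<in> X" using atriv_sub[OF at] by blast
   thus "h v *\<^sub>R coord \<tau> v (s v) = coord \<tau> v (smul h s v)"
    using coord_scale[OF at v c] by (simp add: smul_def)
  qed
 qed
 moreover have "smul h s v = \<zero>\<^bsub>F v\<^esub>" if "v \<in> X" "s v = \<zero>\<^bsub>F v\<^esub>" for v using that by (simp add: smul_def fibre_simps)
 ultimately show ?thesis using s unfolding sect_iff by (auto simp: smul_def)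
qed

lemma sect_usec:
 assumes adm: "admissible_class \<F>" and h: "scal \<F> cpt h"
 shows "sect \<F> cpt (usec h)"
proof -
 have "lsec \<F> X (usec h)"
 proof (rule lsec_atrivI[OF adm])
  show "usec h v \<in> carrier (F v)" if "v \<in> X" for v using that by (simp add: usec_def fibre_simps)
  fix O' \<tau> assume at: "atriv O' \<tau>"
  note op = atriv_open[OF at]
  have "class_fun \<F> V O' h"
   by (rule class_fun_subset[OF adm _ _ op]) (use h atriv_sub[OF at] in \<open>auto simp: scal_def\<close>)
  from class_fun_linear[OF adm op this bounded_linear_scaleR_left[of "\<one>\<^bsub>A\<^esub>"]]
  show "class_fun \<F> V O' (%v. coord \<tau> v (usec h v))"
  proof (rule class_fun_cong[OF adm op])
   fix v assume v: "v \<in> O'"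
   hence "v \<in> X" using atriv_sub[OF at] by blast
   thus "h v *\<^sub>R \<one>\<^bsub>A\<^esub> = coord \<tau> v (usec h v)"
    using coord_scale[OF at v fibre_simps(1)] coord_one[OF at v] by (simp add: usec_def)
  qed
 qed
 moreover have "usec h v = \<zero>\<^bsub>F v\<^esub>" if "v \<in> X" "h v = 0" for v
  using fibre_simps(12)[OF that(1) fibre_simps(1)[OF that(1)]] that by (simp add: usec_def)
 ultimately show ?thesis using h unfolding sect_iff scal_def by (auto simp: usec_def)
qed

lemma sect_sadd:
 assumes adm: "admissible_class \<F>" and s: "sect \<F> cpt s" and t: "sect \<F> cpt t"
 shows "sect \<F> cpt (sadd s t)"
proof -
 have c: "s v \<in> carrier (F v)" "t v \<in> carrier (F v)" if "v \<in> X" for v using sect_carrier[OF s that] sect_carrier[OF t that] .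
 have "lsec \<F> X (sadd s t)"
 proof (rule lsec_atrivI[OF adm])
  show "sadd s t v \<in> carrier (F v)" if "v \<in> X" for v using that c by (simp add: sadd_def fibre_simps)
  fix O' \<tau> assume at: "atriv O' \<tau>"
  note op = atriv_open[OF at]
  from class_fun_add[OF adm op sect_coord[OF adm s at] sect_coord[OF adm t at]]
  show "class_fun \<F> V O' (%v. coord \<tau> v (sadd s t v))"
  proof (rule class_fun_cong[OF adm op])
   fix v assume v: "v \<in> O'"
   hence "v \<in> X" using atriv_sub[OF at] by blast
   thus "coord \<tau> v (s v) + coord \<tau> v (t v) = coord \<tau> v (sadd s t v)"
    using coord_add[OF at v c] by (simp add: sadd_def)
  qed
 qed
 moreover have "\<exists>C. compactin T C & (\<forall>v\<in>X - C. sadd s t v = \<zero>\<^bsub>F v\<^esub>)" if cpt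
 proof -
  from s t that obtain C D where "compactin T C" "\<forall>v\<in>X - C. s v = \<zero>\<^bsub>F v\<^esub>" "compactin T D" "\<forall>v\<in>X - D. t v = \<zero>\<^bsub>F v\<^esub>"
   unfolding sect_iff by blast
  thus ?thesis by (intro exI[of _ "C \<union> D"]) (auto simp: compactin_Un sadd_def fibre_simps)
 qed
 ultimately show ?thesis unfolding sect_iff by (auto simp: sadd_def)
qed

lemma sect_vsec:
 assumes adm: "admissible_class \<F>" and at: "atriv O' \<tau>" and g: "class_fun \<F> V X g"
  and C: "compactin T C" "C \<subseteq> O'" "!!v. v \<in> X ==> v \<notin> C ==> g v = 0"
 shows "sect \<F> cpt (vsec O' \<tau> g)"
proof -
 note op = atriv_open[OF at]
 have c: "vsec O' \<tau> g v \<in> carrier (F v)" if "v \<in> X" for v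
  using that tau_carrier[OF at] by (auto simp: vsec_def fibre_simps)
 have z: "vsec O' \<tau> g v = \<zero>\<^bsub>F v\<^esub>" if "v \<in> X - C" for v
  using that C(3)[of v] tau_zero[OF at] by (auto simp: vsec_def)
 have clo: "openin T (X - C)" using compactin_imp_closedin[OF hausdorff C(1)] by (simp add: closedin_def)
 have "lsec \<F> X (vsec O' \<tau> g)"
 proof (rule lsec_glue[OF adm])
  fix v assume v: "v \<in> X"
  show "\<exists>O'a. openin T O'a & v \<in> O'a & lsec \<F> (X \<inter> O'a) (vsec O' \<tau> g)"
  proof (cases "v \<in> O'")
   case True
   have "class_fun \<F> V O' g" by (rule class_fun_subset[OF adm _ g op]) (use atriv_sub[OF at] in auto)
   hence "class_fun \<F> V O' (%v. coord \<tau> v (vsec O' \<tau> g v))"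
    by (rule class_fun_cong[OF adm op]) (use atriv_sub[OF at] coord_tau[OF at] in \<open>auto simp: vsec_def subset_iff\<close>)
   hence "lsec \<F> O' (vsec O' \<tau> g)" by (rule lsecI[OF adm op order_refl at, rotated]) (use c atriv_sub[OF at] in auto)
   moreover have "X \<inter> O' = O'" using atriv_sub[OF at] by blast
   ultimately show ?thesis using op True by (intro exI[of _ O']) auto
  next
   case False
   from ex_atriv[OF v] obtain O'' \<sigma> where at': "atriv O'' \<sigma>" "v \<in> O''" by blast
   let ?N = "O'' \<inter> (X - C)"
   have op': "openin T ?N" using atriv_open[OF at'(1)] clo by blast
   have "class_fun \<F> V ?N (%v. 0 :: 'a)" by (rule class_fun_const[OF adm op'])
   hence "class_fun \<F> V ?N (%v. coord \<sigma> v (vsec O' \<tau> g v))"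
    by (rule class_fun_cong[OF adm op']) (use z coord_zero[OF at'(1)] in auto)
   hence "lsec \<F> ?N (vsec O' \<tau> g)" by (rule lsecI[OF adm op' _ at'(1), rotated 2]) (use c in auto)
   moreover have "X \<inter> ?N = ?N" by blast
   ultimately show ?thesis using op' False at' C(2) v by (intro exI[of _ ?N]) auto
  qed
 qed simp
 moreover have "vsec O' \<tau> g \<in> extensional X" by (simp add: vsec_def)
 ultimately show ?thesis using z C(1) unfolding sect_iff by blast
qed

lemma vsec_add:
 assumes at: "atriv O' \<tau>"
 shows "vsec O' \<tau> (%v. g v + h v) = sadd (vsec O' \<tau> g) (vsec O' \<tau> h)"
 using tau_add[OF at] by (auto simp: vsec_def sadd_def fun_eq_iff restrict_def fibre_simps)

lemma smul_vsec:
 assumes at: "atriv O' \<tau>"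
 shows "smul h (vsec O' \<tau> g) = vsec O' \<tau> (%v. h v *\<^sub>R g v)"
 using tau_scale[OF at] by (auto simp: vsec_def smul_def fun_eq_iff restrict_def fibre_simps)

lemma smul_eq_vsec:
 assumes at: "atriv O' \<tau>" and s: "sect \<F> cpt s" and e: "!!v. v \<in> X ==> v \<notin> O' ==> e v = 0"
 shows "smul e s = vsec O' \<tau> (%v. if v \<in> O' then e v *\<^sub>R coord \<tau> v (s v) else 0)"
proof
 fix v
 show "smul e s v = vsec O' \<tau> (%v. if v \<in> O' then e v *\<^sub>R coord \<tau> v (s v) else 0) v"
 proof (cases "v \<in> X")
  case True
  note c = sect_carrier[OF s True]
  show ?thesis
  proof (cases "v \<in> O'")
   case vO: True
   thus ?thesis using True tau_scale[OF at vO] tau_coord[OF at vO c] by (simp add: smul_def vsec_def)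
  next
   case False
   thus ?thesis using True e[OF True False] fibre_simps(12)[OF True c] by (simp add: smul_def vsec_def)
  qed
 qed (simp add: smul_def vsec_def)
qed

lemma bump_section:
 assumes v: "v \<in> X" and x: "x \<in> carrier (F v)" and N: "openin T N" "v \<in> N" and adm: "admissible_class \<F>"
 obtains s C where "sect \<F> cpt s" "s v = x" "compactin T C" "C \<subseteq> N" "!!u. u \<in> X ==> u \<notin> C ==> s u = \<zero>\<^bsub>F u\<^esub>"
proof -
 from ex_atriv[OF v] obtain O' \<tau> where at: "atriv O' \<tau>" "v \<in> O'" by blast
 have op: "openin T (O' \<inter> N)" "v \<in> O' \<inter> N" using atriv_open[OF at(1)] N at(2) by auto
 from ex_bump[OF op] obtain e C P where b: "is_bump (O' \<inter> N) v e C P" by blast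
 note e = is_bumpD[OF b]
 have opX: "openin T X" by simp
 define g where "g = (%u. e u *\<^sub>R coord \<tau> v x)"
 have "class_fun \<F> V X g" unfolding g_def
  by (rule class_fun_linear[OF adm opX class_fun_smooth_imp[OF adm opX e(1)] bounded_linear_scaleR_left])
 hence "sect \<F> cpt (vsec O' \<tau> g)"
  by (rule sect_vsec[OF adm at(1) _ e(2)]) (use e in \<open>auto simp: g_def\<close>)
 moreover have "vsec O' \<tau> g v = x" using at v e x tau_coord[OF at x] by (simp add: vsec_def g_def)
 moreover have "vsec O' \<tau> g u = \<zero>\<^bsub>F u\<^esub>" if "u \<in> X" "u \<notin> C" for u
  using that e(4) tau_zero[OF at(1)] by (simp add: vsec_def g_def)
 ultimately show ?thesis using that[of "vsec O' \<tau> g" C] e by blast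
qed

lemma section_nonzero_open:
 assumes adm: "admissible_class \<F>" and s: "sect \<F> cpt s"
 shows "openin T {v \<in> X. s v ~= \<zero>\<^bsub>F v\<^esub>}"
proof (subst openin_subopen, intro ballI)
 fix v assume v: "v \<in> {v \<in> X. s v ~= \<zero>\<^bsub>F v\<^esub>}"
 then obtain O' \<tau> where at: "atriv O' \<tau>" "v \<in> O'" using ex_atriv by blast
 note op = atriv_open[OF at(1)] and sub = atriv_sub[OF at(1)]
 have "openin T {u \<in> O'. coord \<tau> u (s u) ~= 0}"
  using openin_preimage[OF op class_fun_continuous[OF adm op sect_coord[OF adm s at(1)]], of "- {0}"] by (simp add: open_Compl)
 moreover have "{u \<in> O'. coord \<tau> u (s u) ~= 0} \<subseteq> {v \<in> X. s v ~= \<zero>\<^bsub>F v\<^esub>}"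
  using sub coord_zero[OF at(1)] by auto
 moreover have "v \<in> {u \<in> O'. coord \<tau> u (s u) ~= 0}"
  using v at coord_eq_zero[OF at sect_carrier[OF s]] by auto
 ultimately show "\<exists>T'. openin T T' & v \<in> T' & T' \<subseteq> {v \<in> X. s v ~= \<zero>\<^bsub>F v\<^esub>}" by blast
qed

lemma pointwise_simps:
 "carrier (pointwise_algebra V B S) = S"
 "s \<oplus>\<^bsub>pointwise_algebra V B S\<^esub> t = sadd s t"
 "s \<otimes>\<^bsub>pointwise_algebra V B S\<^esub> t = smult2 s t"
 "c \<odot>\<^bsub>pointwise_algebra V B S\<^esub> s = (\<lambda>v\<in>X. c \<odot>\<^bsub>F v\<^esub> s v)"
 by (simp_all add: pointwise_algebra_def sadd_def smult2_def)

end

context smooth_mfd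
begin

text \<open>First countability at v, from shrinking balls in a chart.\<close>

lemma nbhd_sequence:
 assumes v: "v \<in> X"
 shows "\<exists>N :: nat => 'v set. (\<forall>j. openin T (N j) & v \<in> N j) &
  (\<forall>O'. openin T O' --> v \<in> O' --> (\<exists>J. \<forall>j\<ge>J. N j \<subseteq> O'))"
proof -
 from charts_cover[OF v] obtain U c where c: "(U, c) \<in> charts V" "v \<in> U" by blast
 define N where "N j = {u \<in> U. c u \<in> ball (c v) (inverse (real (Suc j)))}" for j
 have "openin T (N j)" for j unfolding N_def by (rule chart_preimage_open[OF c(1)]) simp
 moreover have "v \<in> N j" for j using c by (simp add: N_def)
 moreover have "\<exists>J. \<forall>j\<ge>J. N j \<subseteq> O'" if O': "openin T O'" "v \<in> O'" for O'
 proof -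
  from chart_ball[OF c O'(2,1)] obtain r M where r: "r > 0" "c ` U \<subseteq> M" "M \<inter> ball (c v) r \<subseteq> c ` (U \<inter> O')" by metis
  from reals_Archimedean[OF r(1)] obtain J where J: "inverse (real (Suc J)) < r" by blast
  have "N j \<subseteq> O'" if "j >= J" for j
  proof
   fix u assume u: "u \<in> N j"
   have "inverse (real (Suc j)) <= inverse (real (Suc J))" using that by simp
   moreover have "dist (c v) (c u) < inverse (real (Suc j))" and uU: "u \<in> U" using u by (auto simp: N_def)
   ultimately have "dist (c v) (c u) < r" using J by linarith
   with uU r(2) have "c u \<in> M \<inter> ball (c v) r" by auto
   hence "c u \<in> c ` (U \<inter> O')" using r(3) by (rule rev_subsetD)
   then obtain u' where u': "u' \<in> U" "u' \<in> O'" "c u = c u'" by blast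
   hence "u = u'" using chart(4)[OF c(1)] uU by (auto dest: inj_onD)
   with u' show "u \<in> O'" by simp
  qed
  thus ?thesis by blast
 qed
 ultimately show ?thesis by (intro exI[of _ N]) simp
qed

end

subsection \<open>Isomorphisms of algebras of sections\<close>

text \<open>Multiplicativity is assumed only when the product is a section, because closure of
  Sobolev sections under products is not established. In this form the assumptions pass to the
  inverse map. Only real scalars occur; linearity over K is added when the fibre maps are shown to
  be algebra isomorphisms.\<close>

locale section_iso =
 b1: alg_bundle n V K A1 B1 + b2: alg_bundle m W K A2 B2
 for n m :: nat and V :: "('v, 'e::euclidean_space) manifold" and W :: "('w, 'd::euclidean_space) manifold"
  and K :: "complex set" and A1 :: "(complex, 'a::euclidean_space) module" and A2 :: "(complex, 'b::euclidean_space) module"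
  and B1 :: "('v, 'x, 'a) fibre_bundle" and B2 :: "('w, 'y, 'b) fibre_bundle" +
 fixes \<F> :: regularity and cpt :: bool and f :: "('v => 'x) => 'w => 'y"
 assumes adm: "admissible_class \<F>"
  and f_bij: "bij_betw f {s. b1.sect \<F> cpt s} {t. b2.sect \<F> cpt t}"
  and f_add: "b1.sect \<F> cpt s ==> b1.sect \<F> cpt t ==> f (b1.sadd s t) = b2.sadd (f s) (f t)"
  and f_mult: "b1.sect \<F> cpt s ==> b1.sect \<F> cpt t ==> b1.sect \<F> cpt (b1.smult2 s t) ==> f (b1.smult2 s t) = b2.smult2 (f s) (f t)"
  and f_scaleR: "b1.sect \<F> cpt s ==> f (b1.smul (%_. r) s) = b2.smul (%_. r) (f s)"
begin

abbreviation "sect1 \<equiv> b1.sect \<F> cpt"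
abbreviation "sect2 \<equiv> b2.sect \<F> cpt"
abbreviation "F1 \<equiv> fibre B1"
abbreviation "F2 \<equiv> fibre B2"
abbreviation "zero1 v \<equiv> \<zero>\<^bsub>F1 v\<^esub>"
abbreviation "zero2 w \<equiv> \<zero>\<^bsub>F2 w\<^esub>"
text \<open>Scalars h that may multiply every section and for which \<open>usec h\<close> is itself
  a section of the algebra.\<close>

abbreviation "sc \<equiv> b1.scal (scalar_class \<F>) cpt"

lemma sadm: "admissible_class (scalar_class \<F>)"
 by (rule scalar_class_admissible[OF adm])

lemma f_sect: "sect1 s ==> sect2 (f s)"
 using f_bij by (auto simp: bij_betw_def)

lemma f_inj: "sect1 s ==> sect1 t ==> f s = f t ==> s = t"
 using f_bij by (auto simp: bij_betw_def inj_on_def)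

lemma f_surj: 
 assumes "sect2 t" obtains s where "sect1 s" "f s = t"
proof -
 have "t \<in> f ` {s. sect1 s}" using assms f_bij by (simp add: bij_betw_def)
 with that show ?thesis by blast
qed

lemma f_carrier: "sect1 s ==> w \<in> b2.X ==> f s w \<in> carrier (F2 w)"
 using b2.sect_carrier f_sect by blast

lemma carrier1: "sect1 s ==> v \<in> b1.X ==> s v \<in> carrier (F1 v)"
 using b1.sect_carrier by blast

lemma f_add_at: "sect1 s ==> sect1 t ==> w \<in> b2.X ==> f (b1.sadd s t) w = f s w \<oplus>\<^bsub>F2 w\<^esub> f t w"
 by (simp add: f_add b2.sadd_def)

lemma f_zero_at: assumes "sect1 s" "!!v. v \<in> b1.X ==> s v = zero1 v" "w \<in> b2.X" shows "f s w = zero2 w"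
proof -
 have "b1.sadd s s = s" using assms(1,2)
  by (intro b1.sect_eqI[OF b1.sect_sadd[OF adm assms(1,1)] assms(1)]) (simp add: b1.sadd_def b1.fibre_simps)
 with f_add_at[OF assms(1,1,3)] have eq: "f s w = f s w \<oplus>\<^bsub>F2 w\<^esub> f s w" by simp
 interpret ring "F2 w" by (rule b2.fibre_ring[OF assms(3)])
 from eq f_carrier[OF assms(1,3)] show ?thesis by (metis add.r_cancel_one')
qed

lemma zero_section1: "sect1 (b1.usec (%_. 0))" "v \<in> b1.X ==> b1.usec (%_. 0) v = zero1 v"
proof -
 have "b1.scal \<F> cpt (%_. 0)" unfolding b1.scal_def by (auto intro: b1.class_fun_const[OF adm] exI[of _ "{}"])
 thus "sect1 (b1.usec (%_. 0))" by (rule b1.sect_usec[OF adm])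
 show "v \<in> b1.X ==> b1.usec (%_. 0) v = zero1 v"
  using b1.fibre_simps(12)[OF _ b1.fibre_simps(1)] by (simp add: b1.usec_def)
qed

lemma f_nonzero:
 assumes "sect1 s" "v \<in> b1.X" "s v ~= zero1 v"
 shows "\<exists>w\<in>b2.X. f s w ~= zero2 w"
proof (rule ccontr)
 assume "\<not> ?thesis"
 hence z: "f s w = f (b1.usec (%_. 0)) w" if "w \<in> b2.X" for w
  using f_zero_at[OF zero_section1(1) zero_section1(2) that] that by simp
 have "f s = f (b1.usec (%_. 0))"
  by (rule b2.sect_eqI[OF f_sect[OF assms(1)] f_sect[OF zero_section1(1)] z])
 hence "s = b1.usec (%_. 0)" by (rule f_inj[OF assms(1) zero_section1(1)])
 with assms(2,3) zero_section1(2) show False by simp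
qed

lemma scD: "sc h ==> class_fun (scalar_class \<F>) V b1.X h"
 by (simp add: b1.scal_def)

lemma sc_usec: "sc h ==> sect1 (b1.usec h)"
 by (rule b1.sect_usec[OF adm]) (auto simp: b1.scal_def intro: b1.class_fun_scalar_imp[OF adm])

lemma sc_smul: "sc h ==> sect1 s ==> sect1 (b1.smul h s)"
 by (rule b1.sect_smul[OF adm scD])

lemma sc_mult: 
 assumes "sc h" "class_fun (scalar_class \<F>) V b1.X k"
 shows "sc (%v. h v * k v)"
proof -
 have "class_fun (scalar_class \<F>) V b1.X (%v. h v *\<^sub>R k v)"
  by (rule b1.class_fun_scaleR[OF sadm]) (use assms in \<open>auto simp: scalar_class_idem b1.scal_def\<close>)
 moreover have "cpt --> (\<exists>C. compactin b1.T C & (\<forall>v\<in>b1.X - C. h v * k v = 0))"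
  using assms(1) unfolding b1.scal_def by fastforce
 ultimately show ?thesis by (simp add: b1.scal_def)
qed

lemma sc_add:
 assumes "sc h" "sc k"
 shows "sc (%v. h v + k v)"
proof -
 have "class_fun (scalar_class \<F>) V b1.X (%v. h v + k v)"
  by (rule b1.class_fun_add[OF sadm]) (use assms in \<open>auto simp: b1.scal_def\<close>)
 moreover have "\<exists>C. compactin b1.T C & (\<forall>v\<in>b1.X - C. h v + k v = 0)" if cpt
 proof -
  from assms that obtain C D where "compactin b1.T C" "\<forall>v\<in>b1.X - C. h v = 0" "compactin b1.T D" "\<forall>v\<in>b1.X - D. k v = 0"
   unfolding b1.scal_def by blast
  thus ?thesis by (intro exI[of _ "C \<union> D"]) (auto simp: compactin_Un)
 qed
 ultimately show ?thesis by (simp add: b1.scal_def)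
qed

lemma sc_const_mult: "sc h ==> sc (%v. h v * r)"
 by (rule sc_mult) (auto intro: b1.class_fun_const[OF sadm])

lemma sc_bump: 
 assumes "b1.is_bump O' v e C P"
 shows "sc e"
proof -
 note e = b1.is_bumpD[OF assms]
 have "class_fun (scalar_class \<F>) V b1.X e" by (rule b1.class_fun_smooth_imp[OF sadm _ e(1)]) simp
 thus ?thesis using e(2,4) unfolding b1.scal_def by blast
qed

section \<open>Action of scalar functions on the fibres over W\<close>

definition Xi :: "('v => real) => 'w => 'y" where
 "Xi h w = f (b1.usec h) w"

lemma Xi_carrier: "sc h ==> w \<in> b2.X ==> Xi h w \<in> carrier (F2 w)"
 unfolding Xi_def using f_carrier sc_usec by blast

lemma f_smul: 
 assumes "sc h" "sect1 s" "w \<in> b2.X"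
 shows "f (b1.smul h s) w = Xi h w \<otimes>\<^bsub>F2 w\<^esub> f s w" "f (b1.smul h s) w = f s w \<otimes>\<^bsub>F2 w\<^esub> Xi h w"
proof -
 have "b1.smul h s = b1.smult2 (b1.usec h) s" "b1.smul h s = b1.smult2 s (b1.usec h)"
  using b1.usec_mult[of s h] carrier1[OF assms(2)] by auto
 hence eq: "f (b1.smul h s) = b2.smult2 (f (b1.usec h)) (f s)" "f (b1.smul h s) = b2.smult2 (f s) (f (b1.usec h))"
  using f_mult[OF sc_usec[OF assms(1)] assms(2)] f_mult[OF assms(2) sc_usec[OF assms(1)]] sc_smul[OF assms(1,2)] by simp_all
 show "f (b1.smul h s) w = Xi h w \<otimes>\<^bsub>F2 w\<^esub> f s w" unfolding eq(1) using assms(3) by (simp add: b2.smult2_def Xi_def)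
 show "f (b1.smul h s) w = f s w \<otimes>\<^bsub>F2 w\<^esub> Xi h w" unfolding eq(2) using assms(3) by (simp add: b2.smult2_def Xi_def)
qed

lemma surj_at:
 assumes "w \<in> b2.X" "x \<in> carrier (F2 w)"
 shows "\<exists>s. sect1 s & f s w = x"
proof -
 have "openin b2.T b2.X" by simp
 from b2.bump_section[OF assms this assms(1) adm, of cpt] obtain t where "sect2 t" "t w = x" by metis
 with f_surj show ?thesis by metis
qed

text \<open>Every element of the fibre is the value of some f s, and h s can be written as a product
  in either order.\<close>

lemma Xi_commute:
 assumes "sc h" "w \<in> b2.X" "x \<in> carrier (F2 w)"
 shows "Xi h w \<otimes>\<^bsub>F2 w\<^esub> x = x \<otimes>\<^bsub>F2 w\<^esub> Xi h w"
 using surj_at[OF assms(2,3)] f_smul[OF assms(1) _ assms(2)] by metis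

lemma Xi_nzd:
 assumes "sc h" "w \<in> b2.X" "x \<in> carrier (F2 w)" "Xi h w \<otimes>\<^bsub>F2 w\<^esub> x = zero2 w" "Xi h w ~= zero2 w"
 shows "x = zero2 w"
 using b2.fibre_central_nonzero_divisor[OF assms(2) Xi_carrier[OF assms(1,2)] Xi_commute[OF assms(1,2)] assms(5,3,4)] .

lemma f_smul_nonzero:
 assumes "sc h" "sect1 s" "w \<in> b2.X" "f (b1.smul h s) w ~= zero2 w"
 shows "Xi h w ~= zero2 w" "f s w ~= zero2 w"
 using assms(4) f_smul(1)[OF assms(1-3)] b2.fibre_simps(9,10)[OF assms(3)] f_carrier[OF assms(2,3)] Xi_carrier[OF assms(1,3)] by metis+

lemma Xi_mult:
 assumes "sc h" "sc k" "w \<in> b2.X"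
 shows "Xi (%v. h v * k v) w = Xi h w \<otimes>\<^bsub>F2 w\<^esub> Xi k w"
 using f_smul(1)[OF assms(1) sc_usec[OF assms(2)] assms(3)] by (simp add: b1.usec_usec Xi_def)

lemma Xi_add:
 assumes "sc h" "sc k" "w \<in> b2.X"
 shows "Xi (%v. h v + k v) w = Xi h w \<oplus>\<^bsub>F2 w\<^esub> Xi k w"
proof -
 have "b1.usec (%v. h v + k v) = b1.sadd (b1.usec h) (b1.usec k)"
 proof
  fix v show "b1.usec (%v. h v + k v) v = b1.sadd (b1.usec h) (b1.usec k) v"
  proof (cases "v \<in> b1.X")
   case True
   then obtain O' \<tau> where at: "b1.atriv O' \<tau>" "v \<in> O'" using b1.ex_atriv by blast
   note [simp] = b1.fibre_simps(1,11)[OF True]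
   have "b1.coord \<tau> v (b1.usec (%v. h v + k v) v) = b1.coord \<tau> v (b1.sadd (b1.usec h) (b1.usec k) v)"
    using True b1.fibre_simps(1)[OF True] by (simp add: b1.usec_def b1.sadd_def b1.coord_add[OF at] b1.coord_scale[OF at] scaleR_add_left del: of_real_add)
   thus ?thesis
    using b1.coord_carrier_eq[OF at carrier1[OF sc_usec[OF sc_add[OF assms(1,2)]] True]
      carrier1[OF b1.sect_sadd[OF adm sc_usec[OF assms(1)] sc_usec[OF assms(2)]] True]] by blast
  qed (simp add: b1.usec_def b1.sadd_def)
 qed
 thus ?thesis using f_add_at[OF sc_usec[OF assms(1)] sc_usec[OF assms(2)] assms(3)] by (simp add: Xi_def)
qed

lemma f_scale:
 assumes "sect1 s" "w \<in> b2.X"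
 shows "f (b1.smul (%_. r) s) w = complex_of_real r \<odot>\<^bsub>F2 w\<^esub> f s w"
 using f_scaleR[OF assms(1), of r] assms(2) by (simp add: b2.smul_def)

lemma Xi_scale:
 assumes "sc h" "w \<in> b2.X"
 shows "Xi (%v. h v * r) w = complex_of_real r \<odot>\<^bsub>F2 w\<^esub> Xi h w"
 using f_scale[OF sc_usec[OF assms(1)] assms(2), of r] by (simp add: b1.usec_usec Xi_def mult.commute)

text \<open>The section e y vanishes identically, so \<open>Xi e w\<close> annihilates
  \<open>f y w\<close>; a nonzero central element of a simple algebra cancels.\<close>

lemma f_disjoint:
 assumes y: "sect1 y" "!!u. u \<in> O' ==> y u = zero1 u" and e: "sc e" "!!u. u \<in> b1.X ==> u \<notin> O' ==> e u = 0"
  and w: "w \<in> b2.X" "Xi e w ~= zero2 w"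
 shows "f y w = zero2 w"
proof -
 have "b1.smul e y v = zero1 v" if v: "v \<in> b1.X" for v
  using y(2)[of v] e(2)[OF v] v b1.fibre_simps(12,13)[OF v] carrier1[OF y(1) v] by (cases "v \<in> O'") (auto simp: b1.smul_def)
 from f_zero_at[OF sc_smul[OF e(1) y(1)] this w(1)]
 have "Xi e w \<otimes>\<^bsub>F2 w\<^esub> f y w = zero2 w" using f_smul(1)[OF e(1) y(1) w(1)] by simp
 from Xi_nzd[OF e(1) w(1) f_carrier[OF y(1) w(1)] this w(2)] show ?thesis .
qed

text \<open>The section e a is nonzero at u, so its image is nonzero somewhere, and there both
  factors of that image are nonzero.\<close>

lemma Xi_nonzero_near:
 assumes a: "sect1 a" "u \<in> b1.X" "a u ~= zero1 u" and e: "sc e" "e u = 1"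
 shows "\<exists>w\<in>b2.X. Xi e w ~= zero2 w & f a w ~= zero2 w"
proof -
 have "b1.smul e a u ~= zero1 u" using a(2,3) e(2) b1.fibre_simps(14)[OF a(2) carrier1[OF a(1,2)]] by (simp add: b1.smul_def)
 from f_nonzero[OF sc_smul[OF e(1) a(1)] a(2) this] obtain w where w: "w \<in> b2.X" "f (b1.smul e a) w ~= zero2 w" by blast
 with f_smul_nonzero[OF e(1) a(1) w] show ?thesis by blast
qed

section \<open>Existence of support points\<close>

definition supp_pt :: "'w => 'v => bool" where
 "supp_pt w v \<longleftrightarrow> v \<in> b1.X & (\<forall>y O'. sect1 y --> openin b1.T O' --> v \<in> O' --> (\<forall>u\<in>O'. y u = zero1 u) --> f y w = zero2 w)"

context
 fixes w :: 'w and N :: "nat => 'w set" and a :: "nat => 'v => 'x"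
 assumes w: "w \<in> b2.X"
  and N: "!!j. openin b2.T (N j)" "!!j. w \<in> N j" "!!O'. openin b2.T O' ==> w \<in> O' ==> \<exists>J. \<forall>j\<ge>J. N j \<subseteq> O'"
  and a: "!!j. sect1 (a j)" "!!j. \<exists>u\<in>b1.X. a j u ~= zero1 u" "!!j w. w \<in> b2.X ==> w \<notin> N j ==> f (a j) w = zero2 w"
begin

text \<open>If f y were nonzero at w, it would be nonzero on \<open>N j\<close> for large j. A bump
  e inside O' around a point with \<open>a j\<close> nonzero has nonzero \<open>Xi e\<close> at some
  point of \<open>N j\<close>, and there \<open>f_disjoint\<close> forces f y to vanish.\<close>

lemma accumulation_supp_pt:
 assumes v: "v \<in> b1.X" and acc: "!!O' J. openin b1.T O' ==> v \<in> O' ==> \<exists>j\<ge>J. \<exists>u\<in>O'. a j u ~= zero1 u"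
 shows "supp_pt w v"
 unfolding supp_pt_def
proof (intro conjI allI impI v)
 fix y O' assume y: "sect1 y" and O': "openin b1.T O'" "v \<in> O'" "\<forall>u\<in>O'. y u = zero1 u"
 show "f y w = zero2 w"
 proof (rule ccontr)
  assume nz: "f y w ~= zero2 w"
  have "openin b2.T {w' \<in> b2.X. f y w' ~= zero2 w'}" by (rule b2.section_nonzero_open[OF adm f_sect[OF y]])
  from N(3)[OF this] nz w obtain J where J: "!!j. j >= J ==> N j \<subseteq> {w' \<in> b2.X. f y w' ~= zero2 w'}" by auto
  from acc[OF O'(1,2), of J] obtain j u where j: "j >= J" "u \<in> O'" "a j u ~= zero1 u" by blast
  have uX: "u \<in> b1.X" using O'(1) j(2) openin_subset by blast
  from b1.ex_bump[OF O'(1) j(2)] obtain e C P where b: "b1.is_bump O' u e C P" by blast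
  note e = b1.is_bumpD[OF b]
  have "e u = 1" by (rule e(8)[OF e(6)])
  from Xi_nonzero_near[OF a(1) uX j(3) sc_bump[OF b] this] obtain w' where
   w': "w' \<in> b2.X" "Xi e w' ~= zero2 w'" "f (a j) w' ~= zero2 w'" by blast
  hence "w' \<in> N j" using a(3) by blast
  with J[OF j(1)] have "f y w' ~= zero2 w'" by blast
  moreover have "f y w' = zero2 w'"
   by (rule f_disjoint[OF y _ sc_bump[OF b] _ w'(1,2), of O']) (use O'(3) e(3,4) in auto)
  ultimately show False by simp
 qed
qed

text \<open>A section y with f y w = 1 has compact support C. For large j the same bump argument
  makes \<open>a j\<close> vanish off C, and finitely many open sets on which the sequence is
  eventually zero cover C, so some \<open>a j\<close> vanishes everywhere.\<close>

lemma accumulation_compact: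
 assumes cpt and nacc: "!!v. v \<in> b1.X ==> \<exists>O' J. openin b1.T O' & v \<in> O' & (\<forall>j\<ge>J. \<forall>u\<in>O'. a j u = zero1 u)"
 shows False
proof -
 from surj_at[OF w b2.fibre_simps(1)[OF w]] obtain y where y: "sect1 y" "f y w = \<one>\<^bsub>F2 w\<^esub>" by blast
 with b2.fibre_one_nonzero[OF w] have nz: "f y w ~= zero2 w" by simp
 from y \<open>cpt\<close> obtain C where C: "compactin b1.T C" "\<forall>v\<in>b1.X - C. y v = zero1 v" by (auto simp: b1.sect_iff)
 have op: "openin b1.T (b1.X - C)" using compactin_imp_closedin[OF b1.hausdorff C(1)] by (simp add: closedin_def)
 have "openin b2.T {w' \<in> b2.X. f y w' ~= zero2 w'}" by (rule b2.section_nonzero_open[OF adm f_sect[OF y(1)]])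
 from N(3)[OF this] nz w obtain J where J: "!!j. j >= J ==> N j \<subseteq> {w' \<in> b2.X. f y w' ~= zero2 w'}" by auto
 have off: "a j u = zero1 u" if j: "j >= J" and u: "u \<in> b1.X" "u \<notin> C" for j u
 proof (rule ccontr)
  assume anz: "a j u ~= zero1 u"
  have "u \<in> b1.X - C" using u by blast
  from b1.ex_bump[OF op this] obtain e D P where b: "b1.is_bump (b1.X - C) u e D P" by blast
  note e = b1.is_bumpD[OF b]
  have "e u = 1" by (rule e(8)[OF e(6)])
  from Xi_nonzero_near[OF a(1) u(1) anz sc_bump[OF b] this] obtain w' where
   w': "w' \<in> b2.X" "Xi e w' ~= zero2 w'" "f (a j) w' ~= zero2 w'" by blast
  hence "w' \<in> N j" using a(3) by blast
  with J[OF j] have "f y w' ~= zero2 w'" by blast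
  moreover have "f y w' = zero2 w'"
   by (rule f_disjoint[OF y(1) _ sc_bump[OF b] _ w'(1,2), of "b1.X - C"]) (use C(2) e(3,4) in auto)
  ultimately show False by simp
 qed
 from nacc obtain Q Jv where Q: "!!v. v \<in> b1.X ==> openin b1.T (Q v)" "!!v. v \<in> b1.X ==> v \<in> Q v"
  "!!v j u. v \<in> b1.X ==> j >= Jv v ==> u \<in> Q v ==> a j u = zero1 u" by metis
 have CX: "C \<subseteq> b1.X" using C(1) compactin_subset_topspace by blast
 have "\<exists>\<G>. finite \<G> & \<G> \<subseteq> Q ` C & C \<subseteq> \<Union>\<G>"
  by (rule compactinD[OF C(1)]) (use Q(1,2) CX in auto)
 then obtain \<G> where \<G>: "finite \<G>" "\<G> \<subseteq> Q ` C" "C \<subseteq> \<Union>\<G>" by blast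
 from finite_subset_image[OF \<G>(1,2)] \<G>(3) obtain I where I: "finite I" "I \<subseteq> C" "C \<subseteq> \<Union>(Q ` I)" by blast
 define j where "j = J + sum Jv I"
 have "a j u = zero1 u" if u: "u \<in> b1.X" for u
 proof (cases "u \<in> C")
  case True
  with I obtain v where v: "v \<in> I" "u \<in> Q v" by blast
  have "Jv v <= sum Jv I" using v I(1) by (intro member_le_sum) auto
  thus ?thesis using Q(3)[of v j u] v I CX by (auto simp: j_def)
 qed (use off[of j u] u in \<open>simp add: j_def\<close>)
 with a(2)[of j] show False by blast
qed

text \<open>The supports of the \<open>a j\<close> are locally finite, so bumps on a thinned out
  disjoint subfamily may be added with arbitrary coefficients. These are chosen such that the image
  of the sum has norm k at points \<open>p k\<close> tending to w, against continuity at w.\<close>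

lemma accumulation_noncompact:
 assumes "\<not> cpt" and nacc: "!!v. v \<in> b1.X ==> \<exists>O' J. openin b1.T O' & v \<in> O' & (\<forall>j\<ge>J. \<forall>u\<in>O'. a j u = zero1 u)"
 shows False
proof -
 from nacc obtain Q Jv where Q: "!!v. v \<in> b1.X ==> openin b1.T (Q v)" "!!v. v \<in> b1.X ==> v \<in> Q v"
  "!!v j u. v \<in> b1.X ==> j >= Jv v ==> u \<in> Q v ==> a j u = zero1 u" by metis
 from a(2) obtain u where u: "!!j. u j \<in> b1.X" "!!j. a j (u j) ~= zero1 (u j)" by metis
 define R where "R j = Q (u j) \<inter> {v \<in> b1.X. a j v ~= zero1 v}" for j
 have R: "openin b1.T (R j)" "u j \<in> R j" for j
  unfolding R_def using Q(1,2)[OF u(1)] b1.section_nonzero_open[OF adm a(1)] u by auto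
 \<comment> \<open>Iterating M gives indices such that later sections vanish on the neighbourhood Q
   of every earlier point, which makes the sets \<open>R (J k)\<close> disjoint. The summand j + 1
   makes the indices strictly increase.\<close>
 define M where "M j = Jv (u j) + j + 1" for j
 define J where "J k = (M ^^ k) 0" for k
 have JS: "J (Suc k) = M (J k)" for k by (simp add: J_def)
 have JS2: "J k < J (Suc k)" for k by (simp add: JS M_def)
 have Jmono: "J k <= J l" if "k <= l" for k l using lift_Suc_mono_le[of J] JS2 that less_imp_le by blast
 have Jge: "k <= J k" for k by (induction k) (use JS2 in \<open>auto intro: Suc_leI le_less_trans\<close>)
 have disj1: "R (J k) \<inter> R (J l) = {}" if "k < l" for k l
 proof -
  have "Jv (u (J k)) <= J (Suc k)" by (simp add: JS M_def)
  also have "\<dots> <= J l" using that by (intro Jmono) simp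
  finally have "a (J l) x = zero1 x" if "x \<in> Q (u (J k))" for x using Q(3)[OF u(1)] that by blast
  thus ?thesis unfolding R_def by blast
 qed
 have disj: "k = l" if "x \<in> R (J k)" "x \<in> R (J l)" for k l x
  using disj1[of k l] disj1[of l k] that by (cases k l rule: linorder_cases) auto
 have "\<exists>e C P. b1.is_bump (R (J k)) (u (J k)) e C P" for k by (rule b1.ex_bump[OF R])
 then obtain e C P where b: "!!k. b1.is_bump (R (J k)) (u (J k)) (e k) (C k) (P k)" by metis
 note ee = b1.is_bumpD[OF b]
 have eR: "x \<in> R (J k)" if "e k x ~= 0" for k x using that ee(3,4) by blast
 have sce: "sc (e k)" for k by (rule sc_bump[OF b])
 have "\<exists>w'\<in>b2.X. Xi (e k) w' ~= zero2 w' & f (a (J k)) w' ~= zero2 w'" for k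
  by (rule Xi_nonzero_near[OF a(1) u(1) u(2) sce ee(8)[OF ee(6)]])
 then obtain p where p: "!!k. p k \<in> b2.X" "!!k. Xi (e k) (p k) ~= zero2 (p k)" "!!k. f (a (J k)) (p k) ~= zero2 (p k)" by metis
 have pN: "p k \<in> N (J k)" for k using a(3)[OF p(1)] p(3) by blast
 from b2.ex_atriv[OF w] obtain O2 \<sigma> where at: "b2.atriv O2 \<sigma>" "w \<in> O2" by blast
 \<comment> \<open>Scales the coordinate vector of \<open>Xi (e k)\<close> at \<open>p k\<close> to
   norm k. The divisor is nonzero when \<open>p k\<close> lies in O2, which holds for all large
   k.\<close>
 define c where "c k = real k / norm (b2.coord \<sigma> (p k) (Xi (e k) (p k)))" for k
 define h where "h v = (\<Sum>k | e k v ~= 0. c k * e k v)" for v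
 have fin1: "{k. e k v ~= 0} \<subseteq> {l}" if "e l v ~= 0" for v l using that eR disj by blast
 \<comment> \<open>The relation e_l h = e_l (c_l e_l) lets the nonzerodivisor
   \<open>Xi (e l)\<close> be cancelled at \<open>p l\<close>, so that h acts there as c_l
   e_l.\<close>
 have eh: "e l v * h v = e l v * (e l v * c l)" for l v
 proof (cases "e l v = 0")
  case False
  hence "{k. e k v ~= 0} = {l}" using fin1 by blast
  thus ?thesis by (simp add: h_def)
 qed simp
 have "sc h" unfolding b1.scal_def
 proof (intro conjI impI)
  show "\<exists>C. compactin b1.T C & (\<forall>v\<in>b1.X - C. h v = 0)" if cpt using assms(1) that by simp
  show "class_fun (scalar_class \<F>) V b1.X h"
  proof (rule b1.class_fun_glue[OF sadm])
   fix v assume v: "v \<in> b1.X"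
   have zero: "e k x = 0" if "x \<in> Q v" "k >= Jv v" for x k
   proof (rule ccontr)
    assume "e k x ~= 0"
    hence "a (J k) x ~= zero1 x" using eR unfolding R_def by blast
    moreover have "Jv v <= J k" using that(2) Jge[of k] by simp
    ultimately show False using Q(3)[OF v _ that(1)] by blast
   qed
   have QX: "b1.X \<inter> Q v = Q v" using Q(1)[OF v] openin_subset by blast
   have hs: "(\<Sum>k<Jv v. c k * e k x) = h x" if "x \<in> Q v" for x
    unfolding h_def by (rule sum.mono_neutral_right) (use zero[OF that] in \<open>auto simp: not_less[symmetric]\<close>)
   have ek: "class_fun (scalar_class \<F>) V (Q v) (e k)" for k
    by (rule b1.class_fun_subset[OF sadm _ scD[OF sce] Q(1)[OF v]]) (use QX in auto)
   have "class_fun (scalar_class \<F>) V (Q v) (%x. \<Sum>k<Jv v. c k * e k x)"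
    by (intro b1.class_fun_sum[OF sadm Q(1)[OF v]] b1.class_fun_linear[OF sadm Q(1)[OF v] ek bounded_linear_mult_right])
   hence "class_fun (scalar_class \<F>) V (Q v) h" by (rule b1.class_fun_cong[OF sadm Q(1)[OF v]]) (rule hs)
   thus "\<exists>O'. openin b1.T O' & v \<in> O' & class_fun (scalar_class \<F>) V (b1.X \<inter> O') h"
    using Q(1,2)[OF v] QX by (intro exI[of _ "Q v"]) simp
  qed simp
 qed
 have Xih: "Xi h (p k) = complex_of_real (c k) \<odot>\<^bsub>F2 (p k)\<^esub> Xi (e k) (p k)" for k
 proof -
  let ?A = "F2 (p k)"
  have scc: "sc (%v. e k v * c k)" by (rule sc_const_mult[OF sce])
  have "(%v. e k v * h v) = (%v. e k v * (e k v * c k))" using eh by auto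
  hence "Xi (e k) (p k) \<otimes>\<^bsub>?A\<^esub> Xi h (p k) = Xi (e k) (p k) \<otimes>\<^bsub>?A\<^esub> Xi (%v. e k v * c k) (p k)"
   using Xi_mult[OF sce \<open>sc h\<close> p(1)] Xi_mult[OF sce scc p(1)] by metis
  moreover interpret ring ?A by (rule b2.fibre_ring[OF p(1)])
  note car = Xi_carrier[OF sce p(1)] Xi_carrier[OF \<open>sc h\<close> p(1)] Xi_carrier[OF scc p(1)]
  ultimately have "Xi (e k) (p k) \<otimes>\<^bsub>?A\<^esub> (Xi h (p k) \<ominus>\<^bsub>?A\<^esub> Xi (%v. e k v * c k) (p k)) = zero2 (p k)"
   using car by (simp add: r_distr a_minus_def r_minus r_neg)
  from Xi_nzd[OF sce p(1) _ this p(2)] car have "Xi h (p k) \<ominus>\<^bsub>?A\<^esub> Xi (%v. e k v * c k) (p k) = zero2 (p k)" by simp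
  hence "Xi h (p k) = Xi (%v. e k v * c k) (p k)"
   using minus_equality[of "Xi h (p k)" "\<ominus>\<^bsub>?A\<^esub> Xi (%v. e k v * c k) (p k)"] car(2)[of k] car(3)[of k]
   by (simp add: a_minus_def)
  thus ?thesis using Xi_scale[OF sce p(1)] by simp
 qed
 define g where "g w' = b2.coord \<sigma> w' (Xi h w')" for w'
 have op: "openin b2.T O2" by (rule b2.atriv_open[OF at(1)])
 have "class_fun \<F> W O2 g" unfolding g_def Xi_def by (rule b2.sect_coord[OF adm f_sect[OF sc_usec[OF \<open>sc h\<close>]] at(1)])
 from b2.openin_preimage[OF op b2.class_fun_continuous[OF adm op this] open_ball]
 have "openin b2.T {w' \<in> O2. g w' \<in> ball 0 (norm (g w) + 1)}" .
 from N(3)[OF this] obtain J0 where J0: "!!j w'. j >= J0 ==> w' \<in> N j ==> w' \<in> O2 & norm (g w') < norm (g w) + 1"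
  using at(2) w by (auto simp: subset_iff)
 obtain k0 where k0: "real k0 >= norm (g w) + 1" using real_arch_simple by blast
 define k where "k = max k0 J0"
 have pk: "p k \<in> O2" "norm (g (p k)) < norm (g w) + 1" using J0[of "J k" "p k"] pN Jge[of k] by (auto simp: k_def)
 have nz: "b2.coord \<sigma> (p k) (Xi (e k) (p k)) ~= 0"
  using b2.coord_eq_zero[OF at(1) pk(1) Xi_carrier[OF sce p(1)]] p(2) by simp
 have "g (p k) = c k *\<^sub>R b2.coord \<sigma> (p k) (Xi (e k) (p k))"
  unfolding g_def Xih using b2.coord_scale[OF at(1) pk(1) Xi_carrier[OF sce p(1)]] .
 hence "norm (g (p k)) = real k" using nz by (simp add: c_def)
 with pk(2) k0 show False by (simp add: k_def)
qed

end

lemma ex_supp_pt: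
 assumes w: "w \<in> b2.X"
 shows "\<exists>v. supp_pt w v"
proof -
 from b2.nbhd_sequence[OF w] obtain N :: "nat => 'w set" where "(\<forall>j. openin b2.T (N j) & w \<in> N j) &
  (\<forall>O'. openin b2.T O' --> w \<in> O' --> (\<exists>J. \<forall>j\<ge>J. N j \<subseteq> O'))" by (elim exE)
 hence N: "!!j. openin b2.T (N j)" "!!j. w \<in> N j" "!!O'. openin b2.T O' ==> w \<in> O' ==> \<exists>J. \<forall>j\<ge>J. N j \<subseteq> O'" by simp_all
 have "\<exists>a. sect1 a & (\<exists>u\<in>b1.X. a u ~= zero1 u) & (\<forall>w'\<in>b2.X. w' \<notin> N j --> f a w' = zero2 w')" for j
 proof -
  \<comment> \<open>The test sequence consists of preimages of bump sections in ever smaller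
    neighbourhoods of w.\<close>
  obtain t C where t: "sect2 t" "t w = \<one>\<^bsub>F2 w\<^esub>" "C \<subseteq> N j" "!!u. u \<in> b2.X ==> u \<notin> C ==> t u = zero2 u"
   using b2.bump_section[OF w b2.fibre_simps(1)[OF w] N(1,2) adm] by metis
  obtain a where a: "sect1 a" "f a = t" by (rule f_surj[OF t(1)])
  have "\<exists>u\<in>b1.X. a u ~= zero1 u"
  proof (rule ccontr)
   assume "\<not> ?thesis"
   hence "f a w = zero2 w" by (intro f_zero_at[OF a(1) _ w]) blast
   with a t(2) b2.fibre_one_nonzero[OF w] show False by simp
  qed
  with a t(3,4) show ?thesis by blast
 qed
 then obtain a where a: "!!j. sect1 (a j)" "!!j. \<exists>u\<in>b1.X. a j u ~= zero1 u" "!!j w'. w' \<in> b2.X ==> w' \<notin> N j ==> f (a j) w' = zero2 w'"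
  by metis
 show ?thesis
 proof (rule ccontr)
  assume no: "\<not> ?thesis"
  have nacc: "\<exists>O' J. openin b1.T O' & v \<in> O' & (\<forall>j\<ge>J. \<forall>u\<in>O'. a j u = zero1 u)" if v: "v \<in> b1.X" for v
  proof (rule ccontr)
   assume n: "\<not> ?thesis"
   have "supp_pt w v"
    by (rule accumulation_supp_pt[of w N a, OF w N a v]) (use n in blast)+
   with no show False by blast
  qed
  show False
  proof (cases cpt)
   case True
   show False by (rule accumulation_compact[of w N a, OF w N a True nacc])
  next
   case False
   show False by (rule accumulation_noncompact[of w N a, OF w N a False nacc])
  qed
 qed
qed

section \<open>The point map and the action of scalars through it\<close>

definition phi :: "'w => 'v" where
 "phi w = (SOME v. supp_pt w v)"

lemma supp_phi: "w \<in> b2.X ==> supp_pt w (phi w)"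
 unfolding phi_def using ex_supp_pt someI_ex by metis

lemma phi_in: "w \<in> b2.X ==> phi w \<in> b1.X"
 using supp_phi unfolding supp_pt_def by blast

lemma f_local_zero:
 "w \<in> b2.X ==> sect1 y ==> openin b1.T O' ==> phi w \<in> O' ==> (!!u. u \<in> O' ==> y u = zero1 u) ==> f y w = zero2 w"
 using supp_phi unfolding supp_pt_def by blast

lemma f_cutoff:
 assumes w: "w \<in> b2.X" and y: "sect1 y" and e: "sc e" and P: "openin b1.T P" "phi w \<in> P" "!!u. u \<in> P ==> e u = 1"
 shows "f (b1.smul e y) w = f y w"
proof -
 \<comment> \<open>1 - e may lack compact support; it still multiplies sections, since y already has
   the required support.\<close>
 have cf: "class_fun (scalar_class \<F>) V b1.X (%v. 1 + - e v)"
  by (intro b1.class_fun_add[OF sadm] b1.class_fun_const[OF sadm] b1.class_fun_linear[OF sadm _ scD[OF e] bounded_linear_minus[OF bounded_linear_ident]]) auto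
 let ?d = "%v. 1 + - e v"
 have s: "sect1 (b1.smul ?d y)" by (rule b1.sect_smul[OF adm cf y])
 have se: "sect1 (b1.smul e y)" by (rule sc_smul[OF e y])
 have PX: "P \<subseteq> b1.X" using P(1) openin_subset by blast
 have "f (b1.smul ?d y) w = zero2 w"
 proof (rule f_local_zero[OF w s P(1,2)])
  fix u assume u: "u \<in> P"
  with PX have "u \<in> b1.X" by blast
  thus "b1.smul ?d y u = zero1 u" using P(3)[OF u] b1.fibre_simps(12)[OF _ carrier1[OF y]] by (simp add: b1.smul_def)
 qed
 moreover have "y = b1.sadd (b1.smul e y) (b1.smul ?d y)"
 proof (rule b1.sect_eqI[OF y b1.sect_sadd[OF adm se s]])
  fix v assume v: "v \<in> b1.X"
  then obtain O' \<tau> where at: "b1.atriv O' \<tau>" "v \<in> O'" using b1.ex_atriv by blast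
  note c = carrier1[OF y v] carrier1[OF se v] carrier1[OF s v]
  have "b1.coord \<tau> v (b1.sadd (b1.smul e y) (b1.smul ?d y) v) = b1.coord \<tau> v (y v)"
   using v c b1.coord_add[OF at c(2,3)] by (simp add: b1.sadd_def b1.smul_def b1.coord_scale[OF at] scaleR_add_left scaleR_diff_left del: of_real_add of_real_minus of_real_diff)
  thus "y v = b1.sadd (b1.smul e y) (b1.smul ?d y) v"
   using b1.coord_carrier_eq[OF at c(1) carrier1[OF b1.sect_sadd[OF adm se s] v]] by simp
 qed
 ultimately show ?thesis
  using f_add_at[OF se s w] b2.fibre_simps(6)[OF w f_carrier[OF se w]] by simp
qed

text \<open>Replaces the statement that 1 acts as the unit, because the constant 1 need not have
  compact support.\<close>

lemma Xi_one:
 assumes w: "w \<in> b2.X" and e: "sc e" and P: "openin b1.T P" "phi w \<in> P" "!!u. u \<in> P ==> e u = 1"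
 shows "Xi e w = \<one>\<^bsub>F2 w\<^esub>"
proof -
 from surj_at[OF w b2.fibre_simps(1)[OF w]] obtain y where y: "sect1 y" "f y w = \<one>\<^bsub>F2 w\<^esub>" by blast
 from f_cutoff[OF w y(1) e P] f_smul(1)[OF e y(1) w] y(2)
 show ?thesis using b2.fibre_simps(4)[OF w Xi_carrier[OF e w]] by simp
qed

lemma f_local_eq:
 assumes w: "w \<in> b2.X" and y: "sect1 y" "sect1 y'" and O': "openin b1.T O'" "phi w \<in> O'" "!!u. u \<in> O' ==> y u = y' u"
 shows "f y w = f y' w"
proof -
 from b1.ex_bump[OF O'(1,2)] obtain e C P where b: "b1.is_bump O' (phi w) e C P" by blast
 note e = b1.is_bumpD[OF b]
 have "b1.smul e y = b1.smul e y'"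
 proof (rule b1.sect_eqI[OF sc_smul[OF sc_bump[OF b] y(1)] sc_smul[OF sc_bump[OF b] y(2)]])
  fix v assume v: "v \<in> b1.X"
  show "b1.smul e y v = b1.smul e y' v"
  proof (cases "v \<in> O'")
   case False
   hence "e v = 0" using e(3,4) by blast
   thus ?thesis using v b1.fibre_simps(12)[OF v] carrier1[OF y(1) v] carrier1[OF y(2) v] by (simp add: b1.smul_def)
  qed (use v O'(3) in \<open>simp add: b1.smul_def\<close>)
 qed
 thus ?thesis
  using f_cutoff[OF w y(1) sc_bump[OF b] e(5,6,8)] f_cutoff[OF w y(2) sc_bump[OF b] e(5,6,8)] by simp
qed

end

context section_iso
begin

lemma sc_zero: "sc (%_. 0)"
 unfolding b1.scal_def by (auto intro: b1.class_fun_const[OF sadm] exI[of _ "{}"])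

lemma openin_neq:
 assumes h: "class_fun (scalar_class \<F>) V b1.X h"
 shows "openin b1.T {u \<in> b1.X. h u ~= (r::real)}"
 using b1.openin_preimage[OF _ b1.class_fun_continuous[OF sadm _ h], of "- {r}"] by (simp add: open_Compl)

lemma sc_extend:
 assumes O': "openin b1.T O'" and b: "b1.is_bump O' v e C P" and g: "class_fun (scalar_class \<F>) V O' g"
 shows "sc (%u. if u \<in> O' then e u * g u else 0)"
proof -
 note e = b1.is_bumpD[OF b]
 have OX: "O' \<subseteq> b1.X" using O' openin_subset by blast
 have "class_fun (scalar_class \<F>) V O' e"
  by (rule b1.class_fun_subset[OF sadm _ scD[OF sc_bump[OF b]] O' OX]) simp
 hence "class_fun (scalar_class \<F>) V O' (%u. e u *\<^sub>R g u)"
  by (intro b1.class_fun_scaleR[OF sadm O' _ g]) (simp add: scalar_class_idem)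
 hence "class_fun (scalar_class \<F>) V O' (%u. if u \<in> O' then e u * g u else 0)"
  by (rule b1.class_fun_cong[OF sadm O']) simp
 hence "class_fun (scalar_class \<F>) V b1.X (%u. if u \<in> O' then e u * g u else 0)"
  by (rule b1.class_fun_extend_zero[OF sadm e(2,3) O']) (use e(4) in auto)
 thus ?thesis unfolding b1.scal_def using e(2,4) by (intro conjI impI exI[of _ C]) auto
qed

lemma Xi_vanish:
 assumes w: "w \<in> b2.X" and h: "sc h" and h0: "h (phi w) = 0"
 shows "Xi h w = zero2 w"
proof (rule ccontr)
 assume nz: "Xi h w ~= zero2 w"
 from b2.ex_atriv[OF w] obtain O2 \<sigma> where at: "b2.atriv O2 \<sigma>" "w \<in> O2" by blast
 define q where "q = b2.coord \<sigma> w"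
 \<comment> \<open>Values at w, in coordinates, of the scalars that vanish at phi w: a finite
   dimensional subspace that is stable under multiplication by \<open>Xi h w\<close>.\<close>
 define I where "I = {q (Xi k w) | k. sc k & k (phi w) = 0}"
 note car = Xi_carrier[OF _ w]
 have sub: "subspace I"
 proof (rule subspaceI)
  have "Xi (%_. 0) w = zero2 w" unfolding Xi_def by (rule f_zero_at[OF zero_section1 w])
  hence "q (Xi (%_. 0) w) = 0" using b2.coord_zero[OF at] by (simp add: q_def)
  thus "0 \<in> I" unfolding I_def using sc_zero by force
 next
  fix x y assume "x \<in> I" "y \<in> I"
  then obtain k l where k: "sc k" "k (phi w) = 0" "x = q (Xi k w)" "sc l" "l (phi w) = 0" "y = q (Xi l w)" unfolding I_def by blast
  have "x + y = q (Xi (%v. k v + l v) w)"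
   using k b2.coord_add[OF at car[OF k(1)] car[OF k(4)]] Xi_add[OF k(1,4) w] by (simp add: q_def)
  thus "x + y \<in> I" unfolding I_def using sc_add[OF k(1,4)] k(2,5) by force
 next
  fix r x assume "x \<in> I"
  then obtain k where k: "sc k" "k (phi w) = 0" "x = q (Xi k w)" unfolding I_def by blast
  have "r *\<^sub>R x = q (Xi (%v. k v * r) w)"
   using k b2.coord_scale[OF at car[OF k(1)]] Xi_scale[OF k(1) w] by (simp add: q_def)
  thus "r *\<^sub>R x \<in> I" unfolding I_def using sc_const_mult[OF k(1)] k(2) by force
 qed
 define L where "L x = q (Xi h w) \<otimes>\<^bsub>A2\<^esub> x" for x
 have L: "linear L" unfolding L_def by (intro linearI) (simp_all add: b2.A_distrib b2.A_smult_mult)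
 have zc: "q (Xi h w) \<otimes>\<^bsub>A2\<^esub> x = x \<otimes>\<^bsub>A2\<^esub> q (Xi h w)" for x
  using Xi_commute[OF h w b2.tau_carrier[OF at, of x]] b2.coord_mult[OF at car[OF h] b2.tau_carrier[OF at, of x]]
   b2.coord_mult[OF at b2.tau_carrier[OF at, of x] car[OF h]] by (simp add: b2.coord_tau[OF at] q_def)
 have qnz: "q (Xi h w) ~= 0" using nz b2.coord_eq_zero[OF at car[OF h]] by (simp add: q_def)
 have L0: "x = 0" if "L x = 0" for x using b2.A_central_nonzero_divisor[OF zc qnz] that by (simp add: L_def)
 hence injL: "inj L" using L by (simp add: linear_injective_0)
 have LI: "L ` I \<subseteq> I"
 proof
  fix y assume "y \<in> L ` I"
  then obtain k where k: "sc k" "k (phi w) = 0" "y = L (q (Xi k w))" unfolding I_def by blast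
  have "y = q (Xi (%v. h v * k v) w)"
   using k b2.coord_mult[OF at car[OF h] car[OF k(1)]] Xi_mult[OF h k(1) w] by (simp add: q_def L_def)
  thus "y \<in> I" unfolding I_def using sc_mult[OF h scD[OF k(1)]] k(2) by force
 qed
 \<comment> \<open>An injective linear map of I into itself is onto. Hence \<open>Xi h w\<close> is
   its own product with some \<open>Xi k w\<close>, and cancelling it leaves the unit as
   \<open>Xi k w\<close>.\<close>
 have "dim (L ` I) = dim I" by (rule dim_image_eq[OF L]) (use injL inj_on_subset in blast)
 hence "L ` I = I" by (intro subspace_dim_equal linear_subspace_image L sub LI) simp
 moreover have "q (Xi h w) \<in> I" unfolding I_def using h h0 by blast
 ultimately obtain k where k: "sc k" "k (phi w) = 0" "q (Xi h w) = L (q (Xi k w))" unfolding I_def by blast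
 have "L (q (Xi k w) - \<one>\<^bsub>A2\<^esub>) = 0" using k(3) L by (simp add: linear_diff) (simp add: L_def b2.A_one)
 hence "q (Xi k w) = q (\<one>\<^bsub>F2 w\<^esub>)" using L0 b2.coord_one[OF at] by (fastforce simp: q_def)
 hence k1: "Xi k w = \<one>\<^bsub>F2 w\<^esub>" using b2.coord_carrier_eq[OF at car[OF k(1)] b2.fibre_simps(1)[OF w]] by (simp add: q_def)
 define O' where "O' = {u \<in> b1.X. k u ~= 1}"
 have O': "openin b1.T O'" unfolding O'_def by (rule openin_neq[OF scD[OF k(1)]])
 have v: "phi w \<in> O'" using k(2) phi_in[OF w] by (simp add: O'_def)
 from b1.ex_bump[OF O' v] obtain e C P where b: "b1.is_bump O' (phi w) e C P" by blast
 note e = b1.is_bumpD[OF b]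
 have OX: "O' \<subseteq> b1.X" by (auto simp: O'_def)
 have kO: "class_fun (scalar_class \<F>) V O' k" by (rule b1.class_fun_subset[OF sadm _ scD[OF k(1)] O' OX]) simp
 have "class_fun (scalar_class \<F>) V O' (%u. 1 + - k u)"
  by (rule b1.class_fun_add[OF sadm O' b1.class_fun_const[OF sadm O'] b1.class_fun_linear[OF sadm O' kO bounded_linear_minus[OF bounded_linear_ident]]])
 hence "class_fun (scalar_class \<F>) V O' (%u. inverse (1 + - k u))"
  by (rule b1.class_fun_inverse[OF adm O']) (simp add: O'_def)
 from sc_extend[OF O' b this] have sp: "sc (%u. if u \<in> O' then e u * inverse (1 + - k u) else 0)" (is "sc ?p") .
 \<comment> \<open>\<open>?p\<close> is e / (1 - k) extended by zero. On O' this is the identity e +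
   p k = p, and off O' all terms vanish; applying \<open>Xi\<close> at w gives 1 + Xi p = Xi
   p.\<close>
 have "(%u. e u + ?p u * k u) u = ?p u" for u
 proof (cases "u \<in> O'")
  case True
  hence "1 - k u ~= 0" by (simp add: O'_def)
  with True show ?thesis by (simp add: field_simps)
 next
  case False
  thus ?thesis using e(3,4) by auto
 qed
 hence eq: "(%u. e u + ?p u * k u) = ?p" by blast
 have e1: "Xi e w = \<one>\<^bsub>F2 w\<^esub>" by (rule Xi_one[OF w sc_bump[OF b] e(5,6,8)])
 have "Xi ?p w = Xi e w \<oplus>\<^bsub>F2 w\<^esub> (Xi ?p w \<otimes>\<^bsub>F2 w\<^esub> Xi k w)"
  using Xi_add[OF sc_bump[OF b] sc_mult[OF sp scD[OF k(1)]] w] Xi_mult[OF sp k(1) w] unfolding eq by simp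
 also have "\<dots> = \<one>\<^bsub>F2 w\<^esub> \<oplus>\<^bsub>F2 w\<^esub> Xi ?p w" unfolding e1 k1 using b2.fibre_simps(4)[OF w car[OF sp]] by simp
 finally have "b2.coord \<sigma> w (Xi ?p w) = b2.coord \<sigma> w (\<one>\<^bsub>F2 w\<^esub> \<oplus>\<^bsub>F2 w\<^esub> Xi ?p w)" by simp
 hence "b2.coord \<sigma> w \<one>\<^bsub>F2 w\<^esub> = 0"
  by (simp add: b2.coord_add[OF at b2.fibre_simps(1)[OF w] car[OF sp]])
 thus False using b2.coord_one[OF at] b2.A_one_nonzero by simp
qed

text \<open>For a bump e at phi w the function h - h(phi w) e vanishes at phi w, so it acts as 0
  there, while e acts as the unit.\<close>

lemma Xi_eval:
 assumes w: "w \<in> b2.X" and h: "sc h"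
 shows "Xi h w = complex_of_real (h (phi w)) \<odot>\<^bsub>F2 w\<^esub> \<one>\<^bsub>F2 w\<^esub>"
proof -
 have "openin b1.T b1.X" by simp
 from b1.ex_bump[OF this phi_in[OF w]] obtain e C P where b: "b1.is_bump b1.X (phi w) e C P" by blast
 note e = b1.is_bumpD[OF b]
 define r where "r = h (phi w)"
 have e1: "Xi e w = \<one>\<^bsub>F2 w\<^esub>" by (rule Xi_one[OF w sc_bump[OF b] e(5,6,8)])
 have s: "sc (%u. h u + e u * - r)" by (rule sc_add[OF h sc_const_mult[OF sc_bump[OF b]]])
 have "Xi (%u. h u + e u * - r) w = zero2 w"
  by (rule Xi_vanish[OF w s]) (use e(8)[OF e(6)] in \<open>simp add: r_def\<close>)
 moreover have "h = (%u. (h u + e u * - r) + e u * r)" by simp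
 ultimately have "Xi h w = zero2 w \<oplus>\<^bsub>F2 w\<^esub> Xi (%u. e u * r) w"
  using Xi_add[OF s sc_const_mult[OF sc_bump[OF b]] w, of r] by simp
 also have "\<dots> = complex_of_real r \<odot>\<^bsub>F2 w\<^esub> \<one>\<^bsub>F2 w\<^esub>"
  using b2.fibre_simps(5)[OF w Xi_carrier[OF sc_const_mult[OF sc_bump[OF b]] w]] Xi_scale[OF sc_bump[OF b] w] e1 by simp
 finally show ?thesis by (simp add: r_def)
qed

lemma Xi_eq_zero: "w \<in> b2.X ==> sc h ==> Xi h w = zero2 w \<longleftrightarrow> h (phi w) = 0"
 using Xi_eval b2.fibre_smult_eq_zero[OF _ b2.fibre_simps(1)] b2.fibre_one_nonzero by metis

lemma f_smul_eval:
 assumes "w \<in> b2.X" "sc h" "sect1 s"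
 shows "f (b1.smul h s) w = complex_of_real (h (phi w)) \<odot>\<^bsub>F2 w\<^esub> f s w"
proof -
 have "f (b1.smul h s) w = (complex_of_real (h (phi w)) \<odot>\<^bsub>F2 w\<^esub> \<one>\<^bsub>F2 w\<^esub>) \<otimes>\<^bsub>F2 w\<^esub> f s w"
  using f_smul(1)[OF assms(2,3,1)] Xi_eval[OF assms(1,2)] by simp
 also have "\<dots> = complex_of_real (h (phi w)) \<odot>\<^bsub>F2 w\<^esub> (\<one>\<^bsub>F2 w\<^esub> \<otimes>\<^bsub>F2 w\<^esub> f s w)"
  by (rule b2.fibre_smult_mult(1)[OF assms(1) b2.real_in_K b2.fibre_simps(1)[OF assms(1)] f_carrier[OF assms(3,1)]])
 finally show ?thesis using b2.fibre_simps(3)[OF assms(1) f_carrier[OF assms(3,1)]] by simp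
qed

text \<open>Nonvanishing of \<open>Xi e\<close> is an open condition on w' and means that e is
  nonzero at phi w'.\<close>

lemma phi_nbhd:
 assumes w: "w \<in> b2.X" and O': "openin b1.T O'" "phi w \<in> O'"
 shows "\<exists>Q. openin b2.T Q & w \<in> Q & (\<forall>w'\<in>Q. phi w' \<in> O')"
proof -
 from b1.ex_bump[OF O'] obtain e C P where b: "b1.is_bump O' (phi w) e C P" by blast
 note e = b1.is_bumpD[OF b]
 define Q where "Q = {w' \<in> b2.X. Xi e w' ~= zero2 w'}"
 have "openin b2.T Q" unfolding Q_def Xi_def
  by (rule b2.section_nonzero_open[OF adm f_sect[OF sc_usec[OF sc_bump[OF b]]]])
 moreover have "w \<in> Q" using w Xi_eq_zero[OF w sc_bump[OF b]] e(8)[OF e(6)] by (simp add: Q_def)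
 moreover have "phi w' \<in> O'" if "w' \<in> Q" for w'
  using that Xi_eq_zero[OF _ sc_bump[OF b], of w'] e(3,4) by (auto simp: Q_def)
 ultimately show ?thesis by blast
qed

lemma phi_preimage_open:
 assumes O': "openin b1.T O'"
 shows "openin b2.T {w \<in> b2.X. phi w \<in> O'}"
proof (subst openin_subopen, intro ballI)
 fix w assume "w \<in> {w \<in> b2.X. phi w \<in> O'}"
 with phi_nbhd[OF _ O', of w] obtain Q where Q: "openin b2.T Q" "w \<in> Q" "\<forall>w'\<in>Q. phi w' \<in> O'" by blast
 hence "Q \<subseteq> {w \<in> b2.X. phi w \<in> O'}" using openin_subset by blast
 with Q show "\<exists>T'. openin b2.T T' & w \<in> T' & T' \<subseteq> {w \<in> b2.X. phi w \<in> O'}" by blast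
qed

lemma phi_continuous: "continuous_map b2.T b1.T phi"
 unfolding continuous_map_def using phi_in phi_preimage_open by auto

text \<open>A refined density of the image of phi. It stands in for surjectivity, which is obtained
  only from the inverse of f.\<close>

lemma phi_dense_support:
 assumes a: "sect1 a" "u \<in> b1.X" "a u ~= zero1 u" and O': "openin b1.T O'" "u \<in> O'"
 shows "\<exists>w\<in>b2.X. phi w \<in> O' & f a w ~= zero2 w"
proof -
 from b1.ex_bump[OF O'] obtain e C P where b: "b1.is_bump O' u e C P" by blast
 note e = b1.is_bumpD[OF b]
 from Xi_nonzero_near[OF a sc_bump[OF b] e(8)[OF e(6)]] obtain w where
  w: "w \<in> b2.X" "Xi e w ~= zero2 w" "f a w ~= zero2 w" by blast
 thus ?thesis using Xi_eq_zero[OF w(1) sc_bump[OF b]] e(3,4) by blast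
qed

lemma phi_dense:
 assumes O': "openin b1.T O'" "v \<in> O'"
 shows "\<exists>w\<in>b2.X. phi w \<in> O'"
proof -
 have v: "v \<in> b1.X" using O' openin_subset by blast
 obtain s where "sect1 s" "s v = \<one>\<^bsub>F1 v\<^esub>"
  using b1.bump_section[OF v b1.fibre_simps(1)[OF v] O' adm] by metis
 with phi_dense_support[OF _ v _ O'] b1.fibre_one_nonzero[OF v] show ?thesis by metis
qed

text \<open>By \<open>Xi_eval\<close> the section f(h 1) is h o phi times the unit, so h o phi is
  one of its coordinates divided by a nonzero coordinate of the unit.\<close>

lemma class_fun_phi:
 assumes h: "sc h"
 shows "class_fun \<F> W b2.X (%w. h (phi w))"
proof (rule b2.class_fun_glue[OF adm])
 fix w assume w: "w \<in> b2.X"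
 then obtain O2 \<sigma> where at: "b2.atriv O2 \<sigma>" "w \<in> O2" using b2.ex_atriv by blast
 note op = b2.atriv_open[OF at(1)] and sub = b2.atriv_sub[OF at(1)]
 from b2.A_one_nonzero obtain j where j: "j \<in> Basis" "\<one>\<^bsub>A2\<^esub> \<bullet> j ~= 0" using euclidean_eq_iff[of "\<one>\<^bsub>A2\<^esub>" 0] by auto
 have bl: "bounded_linear (%x. (x \<bullet> j) / (\<one>\<^bsub>A2\<^esub> \<bullet> j))"
  by (rule bounded_linear_compose[OF bounded_linear_divide bounded_linear_inner_left])
 have "class_fun \<F> W O2 (%w. b2.coord \<sigma> w (f (b1.usec h) w))" by (rule b2.sect_coord[OF adm f_sect[OF sc_usec[OF h]] at(1)])
 hence "class_fun \<F> W O2 (%w. (b2.coord \<sigma> w (f (b1.usec h) w) \<bullet> j) / (\<one>\<^bsub>A2\<^esub> \<bullet> j))"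
  by (rule b2.class_fun_linear[OF adm op _ bl])
 hence "class_fun \<F> W O2 (%w. h (phi w))"
 proof (rule b2.class_fun_cong[OF adm op])
  fix w assume w: "w \<in> O2"
  hence wX: "w \<in> b2.X" using sub by blast
  have "b2.coord \<sigma> w (f (b1.usec h) w) = h (phi w) *\<^sub>R \<one>\<^bsub>A2\<^esub>"
   using Xi_eval[OF wX h] b2.coord_scale[OF at(1) w b2.fibre_simps(1)[OF wX]] b2.coord_one[OF at(1) w] by (simp add: Xi_def)
  with j show "(b2.coord \<sigma> w (f (b1.usec h) w) \<bullet> j) / (\<one>\<^bsub>A2\<^esub> \<bullet> j) = h (phi w)" by simp
 qed
 moreover have "b2.X \<inter> O2 = O2" using sub by blast
 ultimately show "\<exists>O'. openin b2.T O' & w \<in> O' & class_fun \<F> W (b2.X \<inter> O') (%w. h (phi w))"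
  using op at(2) by (intro exI[of _ O2]) simp
qed simp

text \<open>Point evaluation for sections with a single scalar coordinate u of class F. It is
  isolated because u acts as a scalar if F is its own scalar class, whereas for Sobolev classes a
  different argument is needed.\<close>

definition scalar_eval :: bool where
 "scalar_eval \<longleftrightarrow> (\<forall>O' \<tau> u C i w. b1.atriv O' \<tau> --> class_fun \<F> V b1.X u --> compactin b1.T C --> C \<subseteq> O' -->
   (\<forall>v\<in>b1.X. v \<notin> C --> u v = 0) --> w \<in> b2.X --> phi w \<in> O' --> u (phi w) = 0 --> f (b1.vsec O' \<tau> (%v. u v *\<^sub>R i)) w = zero2 w)"

lemma sect_vsec_scalar:
 assumes "b1.atriv O' \<tau>" "class_fun \<F> V b1.X u" "compactin b1.T C" "C \<subseteq> O'" "!!v. v \<in> b1.X ==> v \<notin> C ==> u v = 0"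
 shows "sect1 (b1.vsec O' \<tau> (%v. u v *\<^sub>R i))"
proof (rule b1.sect_vsec[OF adm assms(1) _ assms(3,4)])
 show "class_fun \<F> V b1.X (%v. u v *\<^sub>R i)" by (rule b1.class_fun_linear[OF adm _ assms(2) bounded_linear_scaleR_left]) simp
qed (use assms(5) in simp)

lemma bump_vsec:
 assumes at: "b1.atriv O' \<tau>" and b: "b1.is_bump Q v e C P" and Q: "Q \<subseteq> O'"
 shows "sect1 (b1.vsec O' \<tau> (%v. e v *\<^sub>R i))"
proof -
 note e = b1.is_bumpD[OF b]
 show ?thesis by (rule sect_vsec_scalar[OF at b1.class_fun_smooth_imp[OF adm _ e(1)] e(2)]) (use e(3,4) Q in auto)
qed

text \<open>Near phi w the section y is a sum of sections with one coordinate each; a bump makes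
  them global.\<close>

lemma point_eval:
 assumes se: scalar_eval and y: "sect1 y" and w: "w \<in> b2.X" and y0: "y (phi w) = zero1 (phi w)"
 shows "f y w = zero2 w"
proof -
 note v = phi_in[OF w]
 from b1.ex_atriv[OF v] obtain O' \<tau> where at: "b1.atriv O' \<tau>" "phi w \<in> O'" by blast
 note op = b1.atriv_open[OF at(1)]
 from b1.ex_bump[OF op at(2)] obtain e C P where b: "b1.is_bump O' (phi w) e C P" by blast
 note e = b1.is_bumpD[OF b]
 define g where "g = (%v. if v \<in> O' then e v *\<^sub>R b1.coord \<tau> v (y v) else 0)"
 have opX: "openin b1.T b1.X" by simp
 have "class_fun \<F> V O' e" by (rule b1.class_fun_subset[OF adm opX b1.class_fun_smooth_imp[OF adm opX e(1)] op b1.atriv_sub[OF at(1)]])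
 have "class_fun (scalar_class \<F>) V O' e"
  by (rule b1.class_fun_subset[OF sadm opX scD[OF sc_bump[OF b]] op b1.atriv_sub[OF at(1)]])
 from b1.class_fun_scaleR[OF adm op this b1.sect_coord[OF adm y at(1)]]
 have "class_fun \<F> V O' g" by (rule b1.class_fun_cong[OF adm op]) (simp add: g_def)
 hence g: "class_fun \<F> V b1.X g"
  by (rule b1.class_fun_extend_zero[OF adm e(2,3) op]) (use e(4) in \<open>simp add: g_def\<close>)
 have g0: "g v = 0" if "v \<notin> C" for v using e(4)[OF that] by (simp add: g_def)
 have gv: "g (phi w) = 0" using y0 b1.coord_zero[OF at] by (simp add: g_def)
 have gi: "class_fun \<F> V b1.X (%v. g v \<bullet> i)" for i by (rule b1.class_fun_linear[OF adm opX g bounded_linear_inner_left])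
 have comp: "f (b1.vsec O' \<tau> (%v. (g v \<bullet> i) *\<^sub>R i)) w = zero2 w" "sect1 (b1.vsec O' \<tau> (%v. (g v \<bullet> i) *\<^sub>R i))" for i
 proof -
  show "f (b1.vsec O' \<tau> (%v. (g v \<bullet> i) *\<^sub>R i)) w = zero2 w"
   using se[unfolded scalar_eval_def, rule_format, OF at(1) gi[of i] e(2,3) _ w at(2)] g0 gv by simp
  show "sect1 (b1.vsec O' \<tau> (%v. (g v \<bullet> i) *\<^sub>R i))"
   by (rule sect_vsec_scalar[OF at(1) gi e(2,3)]) (use g0 in simp)
 qed
 have "sect1 (b1.vsec O' \<tau> (%v. \<Sum>i\<in>I. (g v \<bullet> i) *\<^sub>R i)) & f (b1.vsec O' \<tau> (%v. \<Sum>i\<in>I. (g v \<bullet> i) *\<^sub>R i)) w = zero2 w"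
  if "finite I" for I using that
 proof (induction I)
  case empty
  have "sect1 (b1.vsec O' \<tau> (%v. 0))"
   by (rule b1.sect_vsec[OF adm at(1) b1.class_fun_const[OF adm opX] e(2,3)]) simp
  moreover have "f (b1.vsec O' \<tau> (%v. 0)) w = zero2 w"
   by (rule f_zero_at[OF calculation _ w]) (use b1.tau_zero[OF at(1)] in \<open>simp add: b1.vsec_def\<close>)
  ultimately show ?case by simp
 next
  case (insert i I)
  have eq: "b1.vsec O' \<tau> (%v. \<Sum>i\<in>insert i I. (g v \<bullet> i) *\<^sub>R i) =
   b1.sadd (b1.vsec O' \<tau> (%v. (g v \<bullet> i) *\<^sub>R i)) (b1.vsec O' \<tau> (%v. \<Sum>i\<in>I. (g v \<bullet> i) *\<^sub>R i))"
   using b1.vsec_add[OF at(1), of "%v. (g v \<bullet> i) *\<^sub>R i" "%v. \<Sum>i\<in>I. (g v \<bullet> i) *\<^sub>R i"] insert.hyps by simp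
  show ?case unfolding eq
   using insert.IH comp[of i] b1.sect_sadd[OF adm] f_add_at[OF _ _ w] b2.fibre_simps(2,5)[OF w] by simp
 qed
 from this[of Basis] have "f (b1.vsec O' \<tau> g) w = zero2 w" by (simp add: euclidean_representation)
 moreover have "b1.smul e y = b1.vsec O' \<tau> g" unfolding g_def
  by (rule b1.smul_eq_vsec[OF at(1) y]) (use e(3,4) in auto)
 ultimately show ?thesis using f_cutoff[OF w y sc_bump[OF b] e(5,6,8)] by simp
qed

end

section \<open>Point evaluation for Sobolev classes\<close>

lemma small_sob: "small k p K M z ==> sob k p UNIV z"
proof (induction k arbitrary: z)
 case 0
 thus ?case by (auto simp: small0_def in_Lp_alt)
next
 case (Suc k)
 have "in_Lp p UNIV z" using Suc.prems by (auto simp: small0_def in_Lp_alt)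
 with Suc show ?case unfolding sob.simps small.simps by meson
qed

lemma ex_cube:
 assumes "open S" "a \<in> S" obtains r where "r > 0" "cube a r \<subseteq> S"
proof -
 from assms open_contains_cball obtain d where d: "d > 0" "cball a d \<subseteq> S" by blast
 define r where "r = d / DIM('a)"
 have "cube a r \<subseteq> cball a d"
 proof
  fix x assume x: "x \<in> cube a r"
  have "norm (x - a) <= (\<Sum>i\<in>Basis. \<bar>(x - a) \<bullet> i\<bar>)" by (rule norm_le_l1)
  also have "\<dots> <= (\<Sum>i\<in>(Basis::'a set). r)"
   by (rule sum_mono) (use x in \<open>force simp: mem_box inner_simps abs_le_iff\<close>)
  finally show "x \<in> cball a d" by (simp add: r_def dist_norm norm_minus_commute)
 qed
 moreover have "r > 0" using d by (simp add: r_def)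
 ultimately show ?thesis using d by (intro that[of r]) auto
qed

context smooth_mfd
begin

lemma class_fun_limit:
 assumes adm: "admissible_class \<F>" and S: "openin T S" and g: "class_fun \<F> V S g"
  and x: "limitin T x l sequentially" "l \<in> S"
 shows "(%j. g (x j)) \<longlonglongrightarrow> g l"
proof -
 have "\<forall>\<^sub>F j in sequentially. x j \<in> S" using x S by (auto simp: limitin_def)
 with x have "limitin (subtopology T S) x l sequentially" by (simp add: limitin_subtopology)
 from continuous_map_limit[OF class_fun_continuous[OF adm S g] this] show ?thesis by (simp add: o_def)
qed

lemma chart_limit:
 assumes c: "(U, c) \<in> charts V" and x: "limitin T x l sequentially" "l \<in> U"
 shows "(%j. c (x j)) \<longlonglongrightarrow> c l"
proof -
 have "\<forall>\<^sub>F j in sequentially. x j \<in> U" using x chart(1)[OF c] by (auto simp: limitin_def)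
 with x have "limitin (subtopology T U) x l sequentially" by (simp add: limitin_subtopology)
 from continuous_map_limit[OF chart_continuous[OF c] this] show ?thesis by (simp add: o_def)
qed

lemma chart_image_open:
 assumes c: "(U, c) \<in> charts V" and O': "openin T O'"
 shows "open (c ` (U \<inter> O') \<inter> interior (c ` U))"
proof -
 from chart_image_openin[OF c O'] obtain G where G: "open G" "c ` (U \<inter> O') = c ` U \<inter> G" unfolding openin_open by blast
 have "c ` (U \<inter> O') \<inter> interior (c ` U) = G \<inter> interior (c ` U)" using G(2) interior_subset[of "c ` U"] by blast
 with open_Int[OF G(1) open_interior] show ?thesis by (simp only:)
qed

text \<open>Regularity at \<open>v\<close> is given in one chart only; the other charts need the chain rule for weak derivatives.\<close>

lemma class_fun_across_point:
 assumes p: "1 <= p" and c: "(U, c) \<in> charts V" and v: "v \<in> U" "c v \<in> interior (c ` U)"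
  and z: "small k p K M z" "continuous_on UNIV z" and Z: "!!x. x \<in> U ==> Z x = (z (c x) :: real)"
  and off: "class_fun (Sobolev k p) V (X - {v}) Z"
 shows "class_fun (Sobolev k p) V X Z"
proof (rule class_funI)
 fix U1 c1 assume c1: "(U1, c1) \<in> charts V"
 have adm: "admissible_class (Sobolev k p)" using p by simp
 have U1X: "U1 \<inter> X = U1" using chart(5)[OF c1] by blast
 define g where "g = (%y. Z (inv_into U1 c1 y))"
 have "in_class (Sobolev k p) (c1 ` U1) g"
 proof (rule in_class_glue[OF chart(2)[OF c1] adm])
  fix y assume "y \<in> c1 ` U1"
  then obtain w where w: "w \<in> U1" "y = c1 w" by blast
  show "\<exists>N. open N & y \<in> N & in_class (Sobolev k p) (c1 ` U1 \<inter> N) g"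
  proof (cases "w = v")
   case False
   have "openin T (X - {v})"
    using hausdorff closedin_Hausdorff_singleton chart(5)[OF c] v by (metis closedin_def subsetD)
   from chart_image_openin[OF c1 this] obtain N where N: "open N" "c1 ` (U1 \<inter> (X - {v})) = c1 ` U1 \<inter> N"
    unfolding openin_open by blast
   have "w \<in> U1 \<inter> (X - {v})" using w False U1X by blast
   hence "y \<in> N" using N(2) w(2) by blast
   with N class_funD[OF off c1] show ?thesis unfolding g_def by (intro exI[of _ N]) auto
  next
   case True
   hence v1: "v \<in> U1" "y = c1 v" using w by auto
   define B where "B = c ` (U \<inter> U1) \<inter> interior (c ` U)"
   have B: "open B" unfolding B_def by (rule chart_image_open[OF c chart(1)[OF c1]])
   have vB: "c v \<in> B" using v v1 by (auto simp: B_def)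
   define \<sigma> where "\<sigma> = (%x. c1 (inv_into U c x))"
   define \<tau> where "\<tau> = (%x. c (inv_into U1 c1 x))"
   have tr: "smooth_on (c ` (U \<inter> U1)) \<sigma>" "smooth_on (c1 ` (U1 \<inter> U)) \<tau>"
    using mfd c c1 unfolding smooth_manifold_def in_class_smooth_iff[symmetric] \<sigma>_def \<tau>_def by blast+
   have \<sigma>c: "\<sigma> (c x) = c1 x" if "x \<in> U" for x using chart_inverse[OF c that] by (simp add: \<sigma>_def)
   have \<tau>c: "\<tau> (c1 x) = c x" if "x \<in> U1" for x using chart_inverse[OF c1 that] by (simp add: \<tau>_def)
   have \<sigma>B: "smooth_on B \<sigma>" by (rule smooth_on_subset[OF tr(1)]) (auto simp: B_def)
   define Om where "Om = \<sigma> ` B"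
   have Bx: "\<exists>x. x \<in> U & x \<in> U1 & b = c x" if "b \<in> B" for b using that by (auto simp: B_def)
   have inj: "inj_on \<sigma> B"
   proof (rule inj_onI)
    fix b b' assume "b \<in> B" "b' \<in> B" and eq: "\<sigma> b = \<sigma> b'"
    then obtain x x' where "x \<in> U" "x \<in> U1" "b = c x" "x' \<in> U" "x' \<in> U1" "b' = c x'" using Bx by metis
    with eq \<sigma>c chart(4)[OF c1] show "b = b'" by (metis inj_onD)
   qed
   \<comment> \<open>Invariance of domain: a point interior in the chart c is interior in the chart
     c1 as well, so both coordinate domains are open in the full space.\<close>
   have Om: "open Om" unfolding Om_def by (rule invariance_of_domain[OF smooth_on_continuous[OF \<sigma>B] B inj])
   have Omx: "\<exists>x. x \<in> U & x \<in> U1 & y = c1 x & c x \<in> B" if "y \<in> Om" for y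
    using that Bx \<sigma>c unfolding Om_def by (metis (no_types, lifting) imageE)
   have Omsub: "Om \<subseteq> c1 ` (U1 \<inter> U)" using Omx by blast
   obtain r where r: "r > 0" "cube (c v) r \<subseteq> B" by (rule ex_cube[OF B vB])
   interpret cc: coordinate_change \<tau> \<sigma> Om B "c v" r
   proof
    show "\<tau> x \<in> B" if "x \<in> Om" for x using Omx[OF that] \<tau>c by metis
    show "\<sigma> y \<in> Om" if "y \<in> B" for y using that by (simp add: Om_def)
    show "\<sigma> (\<tau> x) = x" if "x \<in> Om" for x using Omx[OF that] \<tau>c \<sigma>c by metis
    show "\<tau> (\<sigma> y) = y" if "y \<in> B" for y using Bx[OF that] \<tau>c \<sigma>c by metis
    show "smooth_on Om \<tau>" by (rule smooth_on_subset[OF tr(2) Omsub])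
   qed (fact B Om \<sigma>B r)+
   define R where "R = r / 2"
   have R: "R > 0" "R < r" using r by (auto simp: R_def)
   \<comment> \<open>The cutoff confines z to the cube of the coordinate change and equals 1 near
     \<open>c v\<close>, so that e z and z agree near v.\<close>
   obtain e :: "'e => real" where e: "smooth_on UNIV e" "!!x. dist (c v) x <= R / 2 ==> e x = 1" "!!x. dist (c v) x >= R ==> e x = 0"
    using euclidean_bump[OF R(1), of "c v"] by metis
   obtain M' where M': "small k p (cball (c v) R) M' (%x. e x * z x)"
    using sob_cutoff[OF p compact_cball subset_UNIV e(1) _ small_sob[OF z(1)], of "c v" R] e(3) by force
   have yO: "y \<in> Om" using v1 vB \<sigma>c[OF v(1)] unfolding Om_def by force
   have "open (Om \<inter> \<tau> -` ball (c v) (R / 2))"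
    using smooth_on_continuous[OF cc.smooth(1)] Om by (intro continuous_open_preimage) auto
   moreover have "y \<in> Om \<inter> \<tau> -` ball (c v) (R / 2)" using yO v1 \<tau>c[OF v1(1)] R by simp
   ultimately obtain \<delta> where \<delta>: "\<delta> > 0" "cball y \<delta> \<subseteq> Om \<inter> \<tau> -` ball (c v) (R / 2)" using open_contains_cball by blast
   define N where "N = ball y \<delta>"
   have N: "open N" "y \<in> N" "N \<subseteq> cball y \<delta>" using \<delta> by (auto simp: N_def)
   have gN: "g x = z (\<tau> x)" "e (\<tau> x) = 1" if x: "x \<in> N" for x
   proof -
    have xO: "x \<in> Om" "dist (c v) (\<tau> x) <= R / 2" using \<delta>(2) x N(3) by force+
    from Omx[OF xO(1)] obtain x' where x': "x' \<in> U" "x' \<in> U1" "x = c1 x'" by blast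
    thus "g x = z (\<tau> x)" using chart_inverse[OF c1] Z by (simp add: g_def \<tau>_def)
    show "e (\<tau> x) = 1" by (rule e(2)[OF xO(2)])
   qed
   have "sob k p N (%x. e (\<tau> x) * z (\<tau> x))"
    by (rule cc.sob_compose[OF p N(1,3) compact_cball _ R(2) M']) (use \<delta> in blast)
   hence "sob k p N g" by (rule sob_cong[rotated]) (use gN in simp)
   moreover have "continuous_on N g"
   proof -
    have "continuous_on N (%x. z (\<tau> x))"
     by (rule continuous_on_compose2[OF z(2) continuous_on_subset[OF smooth_on_continuous[OF cc.smooth(1)]]]) (use \<delta> N in auto)
    thus ?thesis by (subst continuous_on_cong[OF refl gN(1)])
   qed
   ultimately have "loc_sobolev k p N g"
    using p N(1) by (subst loc_sobolev_alt) (auto intro!: open_half_open exI[of _ N] simp: interior_open)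
   moreover have "c1 ` U1 \<inter> N = N" using Omsub \<delta> N by blast
   ultimately show ?thesis using N by (intro exI[of _ N]) simp
  qed
 qed
 thus "in_class (Sobolev k p) (c1 ` (U1 \<inter> X)) (%y. Z (inv_into U1 c1 y))" by (simp add: U1X g_def)
qed

end

context section_iso
begin

text \<open>Near phi w the section is u times a bump section, and u acts by its value at phi
  w.\<close>

lemma f_vsec_zero:
 assumes at: "b1.atriv O' \<tau>" and su: "sc u" and C: "compactin b1.T C" "C \<subseteq> O'" "!!v. v \<in> b1.X ==> v \<notin> C ==> u v = 0"
  and w: "w \<in> b2.X" and v: "phi w \<in> O'" "u (phi w) = 0"
 shows "f (b1.vsec O' \<tau> (%v. u v *\<^sub>R i)) w = zero2 w"
proof -
 note op = b1.atriv_open[OF at]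
 have u: "class_fun \<F> V b1.X u" by (rule b1.class_fun_scalar_imp[OF adm _ scD[OF su]]) simp
 from b1.ex_bump[OF op v(1)] obtain e D P where b: "b1.is_bump O' (phi w) e D P" by blast
 note e = b1.is_bumpD[OF b]
 have s1: "sect1 (b1.vsec O' \<tau> (%v. e v *\<^sub>R i))" by (rule bump_vsec[OF at b order_refl])
 have s2: "sect1 (b1.vsec O' \<tau> (%v. u v *\<^sub>R i))" by (rule sect_vsec_scalar[OF at u C])
 have "f (b1.vsec O' \<tau> (%v. u v *\<^sub>R i)) w = f (b1.smul u (b1.vsec O' \<tau> (%v. e v *\<^sub>R i))) w"
 proof (rule f_local_eq[OF w s2 sc_smul[OF su s1] e(5,6)])
  fix x assume "x \<in> P"
  thus "b1.vsec O' \<tau> (%v. u v *\<^sub>R i) x = b1.smul u (b1.vsec O' \<tau> (%v. e v *\<^sub>R i)) x"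
   unfolding b1.smul_vsec[OF at] using e(8) by (simp add: b1.vsec_def)
 qed
 also have "\<dots> = zero2 w" unfolding f_smul_eval[OF w su s1] v(2) by (rule b2.fibre_simps(12)[OF w f_carrier[OF s1 w]])
 finally show ?thesis .
qed

lemma scalar_eval_scalar:
 assumes "scalar_class \<F> = \<F> \<or> n = 0"
 shows scalar_eval
 unfolding scalar_eval_def
proof (intro allI impI)
 fix O' \<tau> C i w and u :: "'v => real"
 assume at: "b1.atriv O' \<tau>" and u: "class_fun \<F> V b1.X u" and C: "compactin b1.T C" "C \<subseteq> O'" "\<forall>v\<in>b1.X. v \<notin> C --> u v = 0"
  and w: "w \<in> b2.X" "phi w \<in> O'" "u (phi w) = 0"
 have "class_fun (scalar_class \<F>) V b1.X u"
 proof (cases "n = 0")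
  case True
  show ?thesis
  proof (rule b1.class_funI)
   fix U c assume "(U, c) \<in> charts V"
   hence "model_open n (c ` (U \<inter> b1.X))" by (rule b1.chart_image_model_open) simp
   with True show "in_class (scalar_class \<F>) (c ` (U \<inter> b1.X)) (%y. u (inv_into U c y))"
    by (intro in_class_trivial[OF sadm]) (simp add: model_open_cases)
  qed
 qed (use assms u in auto)
 hence "sc u" unfolding b1.scal_def using C by blast
 from f_vsec_zero[OF at this C(1,2) _ w] C(3) show "f (b1.vsec O' \<tau> (%v. u v *\<^sub>R i)) w = zero2 w" by blast
qed

text \<open>Otherwise take a section whose image is supported in Q. By
  \<open>phi_dense_support\<close> its support is the single point phi w, yet it is open, which is
  impossible at an interior point of a chart in a Euclidean space of positive dimension.\<close>

lemma phi_not_locally_constant: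
 assumes w: "w \<in> b2.X" and c: "(U, c) \<in> charts V" "phi w \<in> U" "c (phi w) \<in> interior (c ` U)" and Q: "openin b2.T Q" "w \<in> Q"
 shows "\<exists>w'\<in>Q. phi w' ~= phi w"
proof (rule ccontr)
 assume no: "\<not> ?thesis"
 obtain t C where t: "sect2 t" "t w = \<one>\<^bsub>F2 w\<^esub>" "C \<subseteq> Q" "!!u. u \<in> b2.X ==> u \<notin> C ==> t u = zero2 u"
  using b2.bump_section[OF w b2.fibre_simps(1)[OF w] Q adm] by metis
 obtain a where a: "sect1 a" "f a = t" by (rule f_surj[OF t(1)])
 define D where "D = {v \<in> b1.X. a v ~= zero1 v}"
 have D: "openin b1.T D" unfolding D_def by (rule b1.section_nonzero_open[OF adm a(1)])
 have "D ~= {}"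
 proof
  assume "D = {}"
  hence "f a w = zero2 w" by (intro f_zero_at[OF a(1) _ w]) (auto simp: D_def)
  with a(2) t(2) b2.fibre_one_nonzero[OF w] show False by simp
 qed
 moreover have "v = phi w" if v: "v \<in> D" for v
 proof (rule ccontr)
  assume ne: "v ~= phi w"
  have "closedin b1.T {phi w}" by (rule closedin_Hausdorff_singleton[OF b1.hausdorff phi_in[OF w]])
  hence "openin b1.T (b1.X - {phi w})" by (rule openin_diff[OF openin_topspace])
  from phi_dense_support[OF a(1) _ _ this, of v] v ne obtain w' where w': "w' \<in> b2.X" "phi w' ~= phi w" "f a w' ~= zero2 w'"
   by (auto simp: D_def)
  hence "w' \<in> Q" using a(2) t(3,4) by blast
  with w' no show False by blast
 qed
 ultimately have "D = {phi w}" by blast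
 hence "c ` (U \<inter> D) \<inter> interior (c ` U) = {c (phi w)}" using c by auto
 with b1.chart_image_open[OF c(1) D] show False using not_open_singleton by metis
qed

text \<open>The hump needs a full ball around the chart point. Interior points are dense in chart
  images, and points phi w' with t w' nonzero are dense in the support of the preimage of t.\<close>

lemma interior_support:
 assumes n: "n ~= 0" and t: "sect2 t" "w \<in> b2.X" "t w ~= zero2 w"
 obtains w' U c where "w' \<in> b2.X" "t w' ~= zero2 w'" "(U, c) \<in> charts V" "phi w' \<in> U" "c (phi w') \<in> interior (c ` U)"
proof -
 obtain a where a: "sect1 a" "f a = t" by (rule f_surj[OF t(1)])
 define D where "D = {v \<in> b1.X. a v ~= zero1 v}"
 have D: "openin b1.T D" unfolding D_def by (rule b1.section_nonzero_open[OF adm a(1)])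
 obtain v where v: "v \<in> b1.X" "a v ~= zero1 v" using f_zero_at[OF a(1) _ t(2)] a(2) t(3) by blast
 obtain U c where c: "(U, c) \<in> charts V" "v \<in> U" using b1.charts_cover[OF v(1)] by blast
 have "half_open (c ` (U \<inter> D))" using b1.chart_image_model_open[OF c(1) D] n by (simp add: model_open_cases)
 moreover have "c v \<in> c ` (U \<inter> D)" using c v by (auto simp: D_def)
 ultimately obtain y where y: "y \<in> interior (c ` (U \<inter> D))" using half_open_interior_near[of "c ` (U \<inter> D)" "c v" 1] by auto
 then obtain v' where v': "v' \<in> U" "v' \<in> D" "y = c v'" using interior_subset by blast
 define Q where "Q = {u \<in> U. c u \<in> interior (c ` (U \<inter> D))}"
 have Q: "openin b1.T Q" unfolding Q_def by (rule b1.chart_preimage_open[OF c(1)]) simp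
 have "v' \<in> Q" using v' y by (simp add: Q_def)
 from phi_dense_support[OF a(1) _ _ Q this] v'(2) obtain w' where w': "w' \<in> b2.X" "phi w' \<in> Q" "f a w' ~= zero2 w'" by (auto simp: D_def)
 moreover have "interior (c ` (U \<inter> D)) \<subseteq> interior (c ` U)" by (intro interior_mono image_mono) simp
 ultimately show ?thesis using c(1) a(2) by (intro that[of w' U c]) (auto simp: Q_def)
qed

lemma approaching_sequence:
 assumes w: "w \<in> b2.X" and c: "(U, c) \<in> charts V" "phi w \<in> U" "c (phi w) \<in> interior (c ` U)" and Q: "openin b2.T Q" "w \<in> Q"
 obtains ws where "limitin b2.T ws w sequentially" "!!j. ws j \<in> Q" "!!j. phi (ws j) ~= phi w"
proof -
 from b2.nbhd_sequence[OF w] obtain N :: "nat => 'w set" where N: "(\<forall>j. openin b2.T (N j) & w \<in> N j) &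
  (\<forall>O'. openin b2.T O' --> w \<in> O' --> (\<exists>J. \<forall>j\<ge>J. N j \<subseteq> O'))" by (elim exE)
 have "\<exists>w'. w' \<in> N j \<inter> Q & phi w' ~= phi w" for j
  using phi_not_locally_constant[OF w c, of "N j \<inter> Q"] N Q by blast
 from choice[OF allI[OF this]] obtain ws where ws: "\<forall>j. ws j \<in> N j \<inter> Q & phi (ws j) ~= phi w" by (rule exE)
 have "limitin b2.T ws w sequentially" unfolding limitin_def
 proof (intro conjI allI impI w)
  fix O' assume "openin b2.T O' & w \<in> O'"
  with N obtain J where "!!j. j >= J ==> N j \<subseteq> O'" by blast
  with ws show "\<forall>\<^sub>F j in sequentially. ws j \<in> O'" unfolding eventually_sequentially by blast
 qed
 with ws show ?thesis by (intro that[of ws]) auto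
qed

text \<open>In the application h and l are singular at one point and regular near phi w. A bump
  turns them into global scalars, to which \<open>f_smul_eval\<close> applies, and f depends only on
  values near phi w.\<close>

lemma f_vsec_split:
 assumes at: "b1.atriv O' \<tau>" and s: "sect1 (b1.vsec O' \<tau> (%v. u v *\<^sub>R i))" "sect1 (b1.vsec O' \<tau> (%v. e v *\<^sub>R i))" "sect1 (b1.vsec O' \<tau> (%v. Z v *\<^sub>R i))"
  and w: "w \<in> b2.X" and Q: "openin b1.T Q" "phi w \<in> Q" "!!v. v \<in> Q ==> e v = (1::real)"
  and h: "class_fun (scalar_class \<F>) V Q h" "class_fun (scalar_class \<F>) V Q l" and Z: "!!v. v \<in> Q ==> Z v = h v * u v - l v"
 shows "f (b1.vsec O' \<tau> (%v. Z v *\<^sub>R i)) w = complex_of_real (h (phi w)) \<odot>\<^bsub>F2 w\<^esub> f (b1.vsec O' \<tau> (%v. u v *\<^sub>R i)) w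
   \<oplus>\<^bsub>F2 w\<^esub> complex_of_real (- l (phi w)) \<odot>\<^bsub>F2 w\<^esub> f (b1.vsec O' \<tau> (%v. e v *\<^sub>R i)) w"
proof -
 from b1.ex_bump[OF Q(1,2)] obtain d C P where b: "b1.is_bump Q (phi w) d C P" by blast
 note d = b1.is_bumpD[OF b]
 have PQ: "x \<in> P ==> x \<in> Q" for x using d(3,7) by blast
 define H where "H v = (if v \<in> Q then d v * h v else 0)" for v
 define L where "L v = (if v \<in> Q then d v * l v else 0) * (- 1)" for v
 have H: "sc H" unfolding H_def[abs_def] by (rule sc_extend[OF Q(1) b h(1)])
 have L: "sc L" unfolding L_def[abs_def] by (rule sc_const_mult[OF sc_extend[OF Q(1) b h(2)]])
 note s' = sc_smul[OF H s(1)] sc_smul[OF L s(2)]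
 have "f (b1.vsec O' \<tau> (%v. Z v *\<^sub>R i)) w = f (b1.sadd (b1.smul H (b1.vsec O' \<tau> (%v. u v *\<^sub>R i))) (b1.smul L (b1.vsec O' \<tau> (%v. e v *\<^sub>R i)))) w"
 proof (rule f_local_eq[OF w s(3) b1.sect_sadd[OF adm s'] d(5,6)])
  fix x assume x: "x \<in> P"
  have "Z x *\<^sub>R i = H x *\<^sub>R u x *\<^sub>R i + L x *\<^sub>R e x *\<^sub>R i"
   using Z[OF PQ[OF x]] Q(3)[OF PQ[OF x]] PQ[OF x] d(8)[OF x] by (simp add: H_def L_def scaleR_diff_left)
  thus "b1.vsec O' \<tau> (%v. Z v *\<^sub>R i) x = b1.sadd (b1.smul H (b1.vsec O' \<tau> (%v. u v *\<^sub>R i))) (b1.smul L (b1.vsec O' \<tau> (%v. e v *\<^sub>R i))) x"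
   unfolding b1.smul_vsec[OF at] b1.vsec_add[OF at, symmetric] by (simp add: b1.vsec_def)
 qed
 also have "\<dots> = f (b1.smul H (b1.vsec O' \<tau> (%v. u v *\<^sub>R i))) w \<oplus>\<^bsub>F2 w\<^esub> f (b1.smul L (b1.vsec O' \<tau> (%v. e v *\<^sub>R i))) w"
  by (rule f_add_at[OF s' w])
 finally show ?thesis
  unfolding f_smul_eval[OF w H s(1)] f_smul_eval[OF w L s(2)] using PQ[OF d(6)] d(8)[OF d(6)] by (simp add: H_def L_def)
qed

lemma scalar_eval_sobolev:
 assumes F: "\<F> = Sobolev k p" and n: "n ~= 0"
 shows scalar_eval
 unfolding scalar_eval_def
proof (intro allI impI, rule ccontr)
 fix O' \<tau> C0 i w0 and u :: "'v => real"
 assume at: "b1.atriv O' \<tau>" and u: "class_fun \<F> V b1.X u" and C0: "compactin b1.T C0" "C0 \<subseteq> O'" "\<forall>v\<in>b1.X. v \<notin> C0 --> u v = 0"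
  and w0: "w0 \<in> b2.X" and v0: "phi w0 \<in> O'" "u (phi w0) = 0"
  and nz: "f (b1.vsec O' \<tau> (%v. u v *\<^sub>R i)) w0 ~= zero2 w0"
 have p: "1 <= p" using adm by (simp add: F)
 have sF: "scalar_class \<F> = smooth" by (simp add: F)
 have opX: "openin b1.T b1.X" by simp
 note op = b1.atriv_open[OF at]
 from b1.ex_bump[OF op v0(1)] obtain e D P where b: "b1.is_bump O' (phi w0) e D P" by blast
 note e = b1.is_bumpD[OF b]
 define su where "su = b1.vsec O' \<tau> (%v. u v *\<^sub>R i)"
 define se where "se = b1.vsec O' \<tau> (%v. e v *\<^sub>R i)"
 have s: "sect1 su" "sect1 se" unfolding su_def se_def
  by (rule sect_vsec_scalar[OF at u C0(1,2)], use C0(3) in blast) (rule bump_vsec[OF at b order_refl])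
 from b2.ex_atriv[OF w0] obtain O2 \<sigma> where at2: "b2.atriv O2 \<sigma>" "w0 \<in> O2" by blast
 note op2 = b2.atriv_open[OF at2(1)] and O2X = b2.atriv_sub[OF at2(1)]
 define q where "q s w = b2.coord \<sigma> w (f s w)" for s w
 have q: "class_fun \<F> W O2 (q s)" if "sect1 s" for s
  using b2.sect_coord[OF adm f_sect[OF that] at2(1)] by (simp add: q_def[abs_def])
 \<comment> \<open>The excess of f(u i) over point evaluation. If it is nonzero at w0, it is so on a
   neighbourhood, which allows w0 to be exchanged for a better point.\<close>
 define \<delta> where "\<delta> w = q su w - u (phi w) *\<^sub>R q se w" for w
 have up: "continuous_map b2.T euclidean (%w. u (phi w))"
  using continuous_map_compose[OF phi_continuous, of euclidean u] b1.class_fun_continuous[OF adm opX u]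
  by (simp add: subtopology_topspace o_def)
 have \<delta>c: "continuous_map (subtopology b2.T O2) euclidean \<delta>"
  using b2.class_fun_continuous[OF adm op2 q[OF s(1)]] b2.class_fun_continuous[OF adm op2 q[OF s(2)]] continuous_map_from_subtopology[OF up]
  unfolding \<delta>_def[abs_def] by (simp add: continuous_map_atin tendsto_diff tendsto_scaleR)
 define N0 where "N0 = {w \<in> O2. \<delta> w ~= 0} \<inter> {w \<in> b2.X. phi w \<in> P}"
 from b2.openin_preimage[OF op2 \<delta>c, of "- {0}"] have "openin b2.T {w \<in> O2. \<delta> w ~= 0}" by (simp add: open_Compl)
 hence N0: "openin b2.T N0" unfolding N0_def using phi_preimage_open[OF e(5)] by (rule openin_Int)
 have "q su w0 ~= 0" using nz b2.coord_eq_zero[OF at2 f_carrier[OF s(1) w0]] by (simp add: q_def su_def)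
 hence w0N: "w0 \<in> N0" using at2(2) w0 e(6) v0 by (simp add: N0_def \<delta>_def)
 \<comment> \<open>The section t confines the new point w to N0, while
   \<open>interior_support\<close> places phi w in the interior of a chart.\<close>
 obtain t C where t: "sect2 t" "t w0 = \<one>\<^bsub>F2 w0\<^esub>" "C \<subseteq> N0" "!!u. u \<in> b2.X ==> u \<notin> C ==> t u = zero2 u"
  using b2.bump_section[OF w0 b2.fibre_simps(1)[OF w0] N0 w0N adm] by metis
 have "t w0 ~= zero2 w0" using t(2) b2.fibre_one_nonzero[OF w0] by simp
 from interior_support[OF n t(1) w0 this] obtain w U c where
  w: "w \<in> b2.X" "t w ~= zero2 w" and c: "(U, c) \<in> charts V" "phi w \<in> U" "c (phi w) \<in> interior (c ` U)" by metis
 have wN: "w \<in> N0" using w t(3,4) by blast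
 define v where "v = phi w"
 have vP: "v \<in> P" "v \<in> U" "v \<in> b1.X" using wN c(2) phi_in[OF w(1)] by (auto simp: N0_def v_def)
 have UP: "openin b1.T (U \<inter> P)" using b1.chart(1)[OF c(1)] e(5) by (rule openin_Int)
 define Q where "Q = N0 \<inter> {w \<in> b2.X. phi w \<in> U \<inter> P}"
 have Q: "openin b2.T Q" "w \<in> Q" unfolding Q_def
  using openin_Int[OF N0 phi_preimage_open[OF UP]] wN w(1) vP by (auto simp: v_def)
 obtain ws where ws: "limitin b2.T ws w sequentially" "!!j. ws j \<in> Q" "!!j. phi (ws j) ~= v"
  using approaching_sequence[OF w(1) c Q] unfolding v_def by metis
 have vs: "limitin b1.T (%j. phi (ws j)) v sequentially"
  using continuous_map_limit[OF phi_continuous ws(1)] by (simp add: o_def v_def)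
 have wsQ: "ws j \<in> O2" "phi (ws j) \<in> U" "phi (ws j) \<in> P" "ws j \<in> b2.X" "phi (ws j) \<in> b1.X" for j
  using ws(2)[of j] phi_in O2X by (auto simp: Q_def N0_def)
 have cinv: "inv_into U c (c x) = x" if "x \<in> U" for x using b1.chart_inverse[OF c(1) that] .
 define u' where "u' = (%y. u (inv_into U c y))"
 have UX: "U \<inter> b1.X = U" using b1.chart(5)[OF c(1)] by blast
 have ho: "half_open (c ` U)" using b1.chart(2)[OF c(1)] n by (simp add: model_open_cases)
 have "loc_sobolev k p (c ` U) u'" using b1.class_funD[OF u c(1)] by (simp add: F UX u'_def)
 hence u'c: "continuous_on (c ` U) u'" and "\<exists>N. open N & c v \<in> N & sob k p (N \<inter> interior (c ` U)) u'"
  using loc_sobolev_alt[OF _ ho, of p k u'] p vP(2) by auto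
 then obtain N where N: "open N" "c v \<in> N" "sob k p (N \<inter> interior (c ` U)) u'" by blast
 define Om where "Om = N \<inter> (c ` (U \<inter> P) \<inter> interior (c ` U))"
 have Om: "open Om" unfolding Om_def using N(1) b1.chart_image_open[OF c(1) e(5)] by (rule open_Int)
 have vOm: "c v \<in> Om" using N(2) vP c(3) by (auto simp: Om_def v_def)
 have OmU: "Om \<subseteq> c ` (U \<inter> P)" by (auto simp: Om_def)
 obtain R where R: "R > 0" "cball (c v) R \<subseteq> Om" using Om vOm open_contains_cball by blast
 have sob: "sob k p Om u'" by (rule sob_mono[OF N(3) _ Om]) (auto simp: Om_def)
 have uc: "continuous_on Om u'" by (rule continuous_on_subset[OF u'c]) (use OmU in blast)
 have xs: "(%j. c (phi (ws j))) \<longlonglongrightarrow> c v" by (rule b1.chart_limit[OF c(1) vs vP(2)])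
 have xs': "c (phi (ws j)) ~= c v" for j
  using ws(3) inj_onD[OF b1.chart(4)[OF c(1)]] wsQ(2) vP(2) by blast
 \<comment> \<open>The hump is built along the chart images of phi (ws j), which converge to
   \<open>c v\<close> without meeting it.\<close>
 obtain r h l z M where g: "strict_mono r" "smooth_on (- {c v}) h" "smooth_on (- {c v}) l" "continuous_on UNIV z" "z (c v) = 0"
  "small k p (cball (c v) R) M z" "!!x. x \<in> Om ==> z x = h x * u' x - l x" "!!x. x \<notin> cball (c v) R ==> h x = 0 & l x = 0"
  "!!j. h (c (phi (ws (r j)))) = real j"
  by (rule gliding_hump[OF p sob uc Om R xs xs'], rule that) assumption+
 \<comment> \<open>Transport from the chart to V by zero off U. The compact set K contains the
   supports of the three transported functions.\<close>
 define ext where "ext g x = (if x \<in> U then g (c x) else 0)" for g :: "'e => real" and x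
 define K where "K = inv_into U c ` cball (c v) R"
 have ballU: "cball (c v) R \<subseteq> c ` U" using R(2) OmU by blast
 have KP: "K \<subseteq> U \<inter> P"
 proof
  fix x assume "x \<in> K"
  then obtain y where y: "y \<in> cball (c v) R" "x = inv_into U c y" by (auto simp: K_def)
  then obtain x' where "x' \<in> U" "x' \<in> P" "y = c x'" using R(2) OmU by blast
  with y cinv show "x \<in> U \<inter> P" by simp
 qed
 have "compactin (top_of_set (c ` U)) (cball (c v) R)" using ballU by (simp add: compactin_subtopology)
 from image_compactin[OF this b1.chart_inverse_continuous[OF c(1)]] have Kc: "compactin b1.T K"
  by (simp add: K_def compactin_subtopology)
 have Kcl: "openin b1.T (b1.X - K)"
  using compactin_imp_closedin[OF b1.hausdorff Kc] by (rule openin_diff[OF openin_topspace])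
 have ext0: "ext g x = 0" if "!!y. y \<notin> cball (c v) R ==> g y = 0" "x \<notin> K" for g x
 proof (cases "x \<in> U")
  case True
  hence "c x \<notin> cball (c v) R" using that(2) cinv[OF True] unfolding K_def by (metis imageI)
  with that(1) show ?thesis by (simp add: ext_def)
 qed (simp add: ext_def)
 have "closedin b1.T {v}" by (rule closedin_Hausdorff_singleton[OF b1.hausdorff vP(3)])
 hence offv: "openin b1.T (b1.X - {v})" by (rule openin_diff[OF openin_topspace])
 have admS: "admissible_class smooth" by simp
 have ext_smooth: "class_fun smooth V (b1.X - {v}) (ext g)"
  if g: "smooth_on (- {c v}) g" "!!y. y \<notin> cball (c v) R ==> g y = 0" for g
 proof (rule b1.class_fun_glue[OF admS offv])
  fix x assume x: "x \<in> b1.X - {v}"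
  show "\<exists>O'. openin b1.T O' & x \<in> O' & class_fun smooth V ((b1.X - {v}) \<inter> O') (ext g)"
  proof (cases "x \<in> U")
   case True
   have eq: "(b1.X - {v}) \<inter> U = U - {v}" using UX by blast
   have opU: "openin b1.T (U - {v})" using openin_Int[OF offv b1.chart(1)[OF c(1)]] unfolding eq .
   have "smooth_on (c ` (U - {v})) g"
    by (rule smooth_on_subset[OF g(1)]) (use inj_onD[OF b1.chart(4)[OF c(1)]] vP(2) in blast)
   from b1.class_fun_chart_open[OF c(1) opU _ this]
   have "class_fun smooth V (U - {v}) (%x. g (c x))" by blast
   hence "class_fun smooth V (U - {v}) (ext g)" by (rule b1.class_fun_cong[OF admS opU]) (simp add: ext_def)
   with True b1.chart(1)[OF c(1)] show ?thesis by (intro exI[of _ U]) (simp add: eq)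
  next
   case False
   have opK: "openin b1.T ((b1.X - {v}) \<inter> (b1.X - K))" by (rule openin_Int[OF offv Kcl])
   have "class_fun smooth V ((b1.X - {v}) \<inter> (b1.X - K)) (ext g)"
    by (rule b1.class_fun_cong[OF admS opK b1.class_fun_const[OF admS opK, of 0]]) (use ext0[of g] g(2) in force)
   with Kcl False KP x show ?thesis by (intro exI[of _ "b1.X - K"]) auto
  qed
 qed
 define H where "H = ext h"
 define L where "L = ext l"
 define Z where "Z = ext z"
 have H: "class_fun smooth V (b1.X - {v}) H" unfolding H_def by (rule ext_smooth[OF g(2)]) (use g(8) in blast)
 have L: "class_fun smooth V (b1.X - {v}) L" unfolding L_def by (rule ext_smooth[OF g(3)]) (use g(8) in blast)
 have Zeq: "Z x = H x * u x - L x" for x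
 proof (cases "x \<in> U")
  case True
  show ?thesis
  proof (cases "c x \<in> Om")
   case inOm: True
   thus ?thesis using g(7)[OF inOm] True cinv[OF True] by (simp add: Z_def H_def L_def ext_def u'_def)
  next
   case False
   hence "c x \<notin> cball (c v) R" using R(2) by blast
   thus ?thesis using smallD(5)[OF g(6)] g(8) True by (simp add: Z_def H_def L_def ext_def)
  qed
 qed (simp add: Z_def H_def L_def ext_def)
 have "class_fun \<F> V (b1.X - {v}) Z"
 proof (rule b1.class_fun_cong[OF adm offv])
  have uo: "class_fun \<F> V (b1.X - {v}) u" by (rule b1.class_fun_subset[OF adm opX u offv]) blast
  have Lo: "class_fun \<F> V (b1.X - {v}) (%x. - L x)"
   by (rule b1.class_fun_linear[OF adm offv b1.class_fun_smooth_imp[OF adm offv L] bounded_linear_minus[OF bounded_linear_ident]])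
  show "class_fun \<F> V (b1.X - {v}) (%x. H x *\<^sub>R u x + - L x)"
   by (rule b1.class_fun_add[OF adm offv b1.class_fun_scaleR[OF adm offv _ uo] Lo]) (use H in \<open>simp add: sF\<close>)
 qed (simp add: Zeq)
 \<comment> \<open>Off v the class of Z comes from H u - L with H and L smooth; across v it comes
   from the Sobolev bound on z in the chart c.\<close>
 hence ZF: "class_fun \<F> V b1.X Z" unfolding F
  by (intro b1.class_fun_across_point[OF p c(1) vP(2) _ g(6,4)]) (use c(3) in \<open>simp_all add: v_def Z_def ext_def\<close>)
 define sz where "sz = b1.vsec O' \<tau> (%v. Z v *\<^sub>R i)"
 have Z0: "Z x = 0" if "x \<notin> K" for x unfolding Z_def by (rule ext0[OF _ that]) (rule smallD(5)[OF g(6)])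
 have sz: "sect1 sz" unfolding sz_def
  by (rule sect_vsec_scalar[OF at ZF Kc]) (use KP e(3,7) Z0 in blast)+
 have Qv: "openin b1.T ((b1.X - {v}) \<inter> P)" by (rule openin_Int[OF offv e(5)])
 \<comment> \<open>Substituting L = H u - Z isolates the excess: H, which takes the value j along
   the subsequence, multiplies \<open>\<delta>\<close>, while the remaining term contains Z and
   tends to 0.\<close>
 have qz: "q sz (ws j) = H (phi (ws j)) *\<^sub>R \<delta> (ws j) + Z (phi (ws j)) *\<^sub>R q se (ws j)" for j
 proof -
  note wj = wsQ[of j]
  have cl: "class_fun (scalar_class \<F>) V ((b1.X - {v}) \<inter> P) G" if "class_fun smooth V (b1.X - {v}) G" for G :: "'v => real"
   unfolding sF by (rule b1.class_fun_subset[OF admS offv that Qv]) blast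
  have "phi (ws j) \<in> (b1.X - {v}) \<inter> P" using wj ws(3)[of j] by blast
  from f_vsec_split[OF at s[unfolded su_def se_def] sz[unfolded sz_def] wj(4) Qv this _ cl[OF H] cl[OF L] Zeq] e(8)
  have "f sz (ws j) = complex_of_real (H (phi (ws j))) \<odot>\<^bsub>F2 (ws j)\<^esub> f su (ws j)
   \<oplus>\<^bsub>F2 (ws j)\<^esub> complex_of_real (- L (phi (ws j))) \<odot>\<^bsub>F2 (ws j)\<^esub> f se (ws j)"
   unfolding sz_def su_def se_def by blast
  hence "q sz (ws j) = H (phi (ws j)) *\<^sub>R q su (ws j) + (- L (phi (ws j))) *\<^sub>R q se (ws j)"
   using b2.coord_add[OF at2(1) wj(1)] b2.coord_scale[OF at2(1) wj(1)] b2.fibre_simps(11)[OF wj(4)] f_carrier[OF s(1) wj(4)] f_carrier[OF s(2) wj(4)]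
   by (simp add: q_def del: of_real_minus)
  moreover have "L (phi (ws j)) = H (phi (ws j)) * u (phi (ws j)) - Z (phi (ws j))" using Zeq[of "phi (ws j)"] by simp
  ultimately show ?thesis by (simp add: \<delta>_def algebra_simps)
 qed
 have wO: "w \<in> O2" "\<delta> w ~= 0" using wN by (auto simp: N0_def)
 have lim: "(%j. q s (ws (r j))) \<longlonglongrightarrow> q s w" if "sect1 s" for s
  using LIMSEQ_subseq_LIMSEQ[OF b2.class_fun_limit[OF adm op2 q[OF that] ws(1) wO(1)] g(1)] by (simp add: o_def)
 have ulim: "(%j. u (phi (ws (r j)))) \<longlonglongrightarrow> u v"
  using LIMSEQ_subseq_LIMSEQ[OF b1.class_fun_limit[OF adm opX u vs vP(3)] g(1)] by (simp add: o_def)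
 have \<delta>lim: "(%j. \<delta> (ws (r j))) \<longlonglongrightarrow> \<delta> w" unfolding \<delta>_def v_def[symmetric] by (intro tendsto_intros lim s ulim)
 have zlim: "(%j. Z (phi (ws (r j)))) \<longlonglongrightarrow> 0"
 proof -
  have "isCont z (c v)" using g(4) by (simp add: continuous_on_eq_continuous_at)
  from isCont_tendsto_compose[OF this xs] have "(%j. z (c (phi (ws j)))) \<longlonglongrightarrow> 0" by (simp add: g(5))
  from LIMSEQ_subseq_LIMSEQ[OF this g(1)] show ?thesis using wsQ(2) by (simp add: o_def Z_def ext_def)
 qed
 \<comment> \<open>The right side converges because f of the hump section is continuous at w.
   Dividing by j makes \<open>\<delta>\<close> tend to 0, although its limit is nonzero.\<close>
 have "real j *\<^sub>R \<delta> (ws (r j)) = q sz (ws (r j)) - Z (phi (ws (r j))) *\<^sub>R q se (ws (r j))" for j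
  using qz[of "r j"] g(9)[of j] wsQ(2)[of "r j"] by (simp add: H_def ext_def)
 moreover have "(%j. q sz (ws (r j)) - Z (phi (ws (r j))) *\<^sub>R q se (ws (r j))) \<longlonglongrightarrow> q sz w - 0 *\<^sub>R q se w"
  by (intro tendsto_intros lim s sz zlim)
 ultimately have "(%j. real j *\<^sub>R \<delta> (ws (r j))) \<longlonglongrightarrow> q sz w" by simp
 from tendsto_scaleR[OF lim_inverse_n this] have "(%j. inverse (real j) *\<^sub>R real j *\<^sub>R \<delta> (ws (r j))) \<longlonglongrightarrow> 0" by simp
 moreover have "\<forall>\<^sub>F j in sequentially. inverse (real j) *\<^sub>R real j *\<^sub>R \<delta> (ws (r j)) = \<delta> (ws (r j))"
  using eventually_gt_at_top[of 0] by eventually_elim simp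
 ultimately have "(%j. \<delta> (ws (r j))) \<longlonglongrightarrow> 0" by (rule Lim_transform_eventually)
 with \<delta>lim wO(2) show False using LIMSEQ_unique by blast
qed

lemma scalar_eval: scalar_eval
proof (cases "scalar_class \<F> = \<F> \<or> n = 0")
 case True
 thus ?thesis by (rule scalar_eval_scalar)
next
 case False
 then obtain k p where "\<F> = Sobolev k p" by (cases \<F>) auto
 with False show ?thesis by (intro scalar_eval_sobolev) auto
qed

end

section \<open>The isomorphisms of fibres\<close>

context section_iso
begin

lemma f_eval_eq:
 assumes s: "sect1 s" and t: "sect1 t" and w: "w \<in> b2.X" and eq: "s (phi w) = t (phi w)"
 shows "f s w = f t w"
proof -
 note v = phi_in[OF w]
 have cf: "class_fun (scalar_class \<F>) V b1.X (%_. -1::real)" by (rule b1.class_fun_const[OF sadm]) simp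
 let ?d = "b1.sadd s (b1.smul (%_. -1) t)"
 have st: "sect1 (b1.smul (%_. -1) t)" by (rule b1.sect_smul[OF adm cf t])
 have sd: "sect1 ?d" by (rule b1.sect_sadd[OF adm s st])
 from b1.ex_atriv[OF v] obtain O' \<tau> where at: "b1.atriv O' \<tau>" "phi w \<in> O'" by blast
 have "b1.coord \<tau> (phi w) (?d (phi w)) = 0"
  using v eq b1.coord_add[OF at carrier1[OF s v] carrier1[OF st v]] b1.coord_scale[OF at carrier1[OF t v], of "-1"]
  by (simp add: b1.sadd_def b1.smul_def)
 hence "?d (phi w) = zero1 (phi w)" using b1.coord_eq_zero[OF at carrier1[OF sd v]] by blast
 from point_eval[OF scalar_eval sd w this] have z: "f s w \<oplus>\<^bsub>F2 w\<^esub> (complex_of_real (-1) \<odot>\<^bsub>F2 w\<^esub> f t w) = zero2 w"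
  using f_add_at[OF s st w] f_scale[OF t w, of "-1"] by simp
 from b2.ex_atriv[OF w] obtain O2 \<sigma> where at2: "b2.atriv O2 \<sigma>" "w \<in> O2" by blast
 note fc = f_carrier[OF s w] f_carrier[OF t w]
 have "b2.coord \<sigma> w (f s w) + - b2.coord \<sigma> w (f t w) = 0"
  using arg_cong[OF z, of "b2.coord \<sigma> w"] b2.coord_add[OF at2 fc(1) b2.fibre_simps(11)[OF w fc(2), of "-1"]]
   b2.coord_scale[OF at2 fc(2), of "-1"] b2.coord_zero[OF at2] by simp
 thus ?thesis using b2.coord_carrier_eq[OF at2 fc] by simp
qed

text \<open>By \<open>f_eval_eq\<close> the value does not depend on the chosen section, and
  \<open>bump_section\<close> provides one through every element of a fibre.\<close>

definition gam :: "'w \<times> 'x => 'y" where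
 "gam p = f (SOME s. sect1 s & s (phi (fst p)) = snd p) (fst p)"

lemma gam_eq:
 assumes "sect1 s" "w \<in> b2.X"
 shows "gam (w, s (phi w)) = f s w"
proof -
 have "\<exists>t. sect1 t & t (phi w) = s (phi w)" using assms(1) by blast
 from someI_ex[OF this] show ?thesis unfolding gam_def using f_eval_eq[OF _ assms] by simp
qed

context
 fixes w O' \<tau> e C P
 assumes w: "w \<in> b2.X" and at: "b1.atriv O' \<tau>" and b: "b1.is_bump O' (phi w) e C P"
begin

lemma bump_point: "phi w \<in> O'" "phi w \<in> b1.X" "e (phi w) = 1"
 using b1.is_bumpD[OF b] phi_in[OF w] by auto

lemma E_sect: "sect1 (b1.vsec O' \<tau> (%u. e u *\<^sub>R a))"
 by (rule bump_vsec[OF at b order_refl])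

lemma E_phi: "b1.vsec O' \<tau> (%u. e u *\<^sub>R a) (phi w) = \<tau> (phi w) a"
 using bump_point by (simp add: b1.vsec_def)

lemma gam_tau: "gam (w, \<tau> (phi w) a) = f (b1.vsec O' \<tau> (%u. e u *\<^sub>R a)) w"
 using gam_eq[OF E_sect w, of a] by (simp add: E_phi)

lemma gam_tau_carrier: "gam (w, \<tau> (phi w) a) \<in> carrier (F2 w)"
 unfolding gam_tau by (rule f_carrier[OF E_sect w])

lemma gam_tau_add: "gam (w, \<tau> (phi w) (a + a')) = gam (w, \<tau> (phi w) a) \<oplus>\<^bsub>F2 w\<^esub> gam (w, \<tau> (phi w) a')"
 using b1.vsec_add[OF at, of "%u. e u *\<^sub>R a" "%u. e u *\<^sub>R a'"] f_add_at[OF E_sect E_sect w, of a a']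
 by (simp add: gam_tau scaleR_add_right)

text \<open>The product of two bump sections carries the square of e; the additional factor e is 1
  near phi w and disappears by \<open>f_cutoff\<close>.\<close>

lemma gam_tau_mult: "gam (w, \<tau> (phi w) (a \<otimes>\<^bsub>A1\<^esub> a')) = gam (w, \<tau> (phi w) a) \<otimes>\<^bsub>F2 w\<^esub> gam (w, \<tau> (phi w) a')"
proof -
 let ?E = "%a. b1.vsec O' \<tau> (%u. e u *\<^sub>R a)"
 have eq: "b1.smult2 (?E a) (?E a') = b1.smul e (?E (a \<otimes>\<^bsub>A1\<^esub> a'))"
 proof
  fix u
  show "b1.smult2 (?E a) (?E a') u = b1.smul e (?E (a \<otimes>\<^bsub>A1\<^esub> a')) u"
  proof (cases "u \<in> b1.X")
   case True
   show ?thesis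
   proof (cases "u \<in> O'")
    case uO: True
    have "\<tau> u (e u *\<^sub>R a) \<otimes>\<^bsub>F1 u\<^esub> \<tau> u (e u *\<^sub>R a') = \<tau> u (e u *\<^sub>R (e u *\<^sub>R (a \<otimes>\<^bsub>A1\<^esub> a')))"
     by (simp add: b1.A_smult_mult flip: b1.tau_mult[OF at uO])
    thus ?thesis using True uO unfolding b1.smul_vsec[OF at] by (simp add: b1.smult2_def b1.vsec_def)
   next
    case False
    thus ?thesis using True b1.fibre_simps(2,9)[OF True] unfolding b1.smul_vsec[OF at] by (simp add: b1.smult2_def b1.vsec_def)
   qed
  qed (simp add: b1.smult2_def b1.smul_def)
 qed
 have "f (b1.smult2 (?E a) (?E a')) w = f (?E (a \<otimes>\<^bsub>A1\<^esub> a')) w"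
  unfolding eq by (rule f_cutoff[OF w E_sect sc_bump[OF b]]) (use b1.is_bumpD[OF b] in auto)
 moreover have "sect1 (b1.smult2 (?E a) (?E a'))" unfolding eq by (rule sc_smul[OF sc_bump[OF b] E_sect])
 ultimately show ?thesis unfolding gam_tau using f_mult[OF E_sect E_sect, of a a'] w by (simp add: b2.smult2_def)
qed

lemma gam_surj:
 assumes "x \<in> carrier (F2 w)"
 shows "\<exists>a. gam (w, \<tau> (phi w) a) = x"
proof -
 from surj_at[OF w assms] obtain s where s: "sect1 s" "f s w = x" by blast
 have "gam (w, s (phi w)) = x" using gam_eq[OF s(1) w] s(2) by simp
 thus ?thesis using b1.tau_coord[OF at bump_point(1) carrier1[OF s(1) bump_point(2)]] by metis
qed

text \<open>The vectors sent to zero form a two-sided ideal of A1. It is proper because the unit of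
  the fibre over w is attained, so simplicity leaves only 0.\<close>

lemma gam_kernel: "gam (w, \<tau> (phi w) a) = zero2 w ==> a = 0"
proof -
 let ?I = "{a. gam (w, \<tau> (phi w) a) = zero2 w}"
 note fs = b2.fibre_simps[OF w]
 have z: "gam (w, \<tau> (phi w) 0) = zero2 w"
  unfolding gam_tau
  by (rule f_zero_at[OF E_sect _ w]) (use b1.tau_zero[OF at] in \<open>simp add: b1.vsec_def\<close>)
 have "?I = {0} \<or> ?I = UNIV"
 proof (rule b1.A_ideal)
  show "?I ~= {}" using z by blast
  show "x + y \<in> ?I" if "x \<in> ?I" "y \<in> ?I" for x y using that fs(2,5) by (simp add: gam_tau_add)
  show "a \<otimes>\<^bsub>A1\<^esub> x \<in> ?I" if "x \<in> ?I" for x a using that fs(10)[OF gam_tau_carrier] by (simp add: gam_tau_mult)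
  show "x \<otimes>\<^bsub>A1\<^esub> a \<in> ?I" if "x \<in> ?I" for x a using that fs(9)[OF gam_tau_carrier] by (simp add: gam_tau_mult)
 qed
 moreover have "?I ~= UNIV"
 proof
  assume "?I = UNIV"
  moreover from gam_surj[OF fs(1)] obtain a where "gam (w, \<tau> (phi w) a) = \<one>\<^bsub>F2 w\<^esub>" by blast
  moreover have "a \<in> UNIV" by simp
  ultimately have "gam (w, \<tau> (phi w) a) = zero2 w" by (metis (mono_tags, lifting) mem_Collect_eq)
  with \<open>gam (w, \<tau> (phi w) a) = \<one>\<^bsub>F2 w\<^esub>\<close> show False using b2.fibre_one_nonzero[OF w] by simp
 qed
 ultimately show "gam (w, \<tau> (phi w) a) = zero2 w ==> a = 0" by blast
qed

lemma gam_inj: "gam (w, \<tau> (phi w) a) = gam (w, \<tau> (phi w) a') ==> a = a'"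
proof -
 assume eq: "gam (w, \<tau> (phi w) a) = gam (w, \<tau> (phi w) a')"
 have z: "gam (w, \<tau> (phi w) 0) = zero2 w"
  unfolding gam_tau
  by (rule f_zero_at[OF E_sect _ w]) (use b1.tau_zero[OF at] in \<open>simp add: b1.vsec_def\<close>)
 have "gam (w, \<tau> (phi w) (a + - a')) = gam (w, \<tau> (phi w) (a' + - a'))"
  unfolding gam_tau_add eq by (rule refl)
 hence "gam (w, \<tau> (phi w) (a + - a')) = zero2 w" using z by simp
 thus ?thesis using gam_kernel by fastforce
qed

lemma gam_tau_smult: 
 assumes c: "c \<in> K" and f_smult: "!!s. sect1 s ==> f (\<lambda>v\<in>b1.X. c \<odot>\<^bsub>F1 v\<^esub> s v) = (\<lambda>w\<in>b2.X. c \<odot>\<^bsub>F2 w\<^esub> f s w)"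
 shows "gam (w, \<tau> (phi w) (c \<odot>\<^bsub>A1\<^esub> a)) = c \<odot>\<^bsub>F2 w\<^esub> gam (w, \<tau> (phi w) a)"
proof -
 let ?E = "%a. b1.vsec O' \<tau> (%u. e u *\<^sub>R a)"
 have "(\<lambda>u\<in>b1.X. c \<odot>\<^bsub>F1 u\<^esub> ?E a u) = ?E (c \<odot>\<^bsub>A1\<^esub> a)"
 proof
  fix u
  show "(\<lambda>u\<in>b1.X. c \<odot>\<^bsub>F1 u\<^esub> ?E a u) u = ?E (c \<odot>\<^bsub>A1\<^esub> a) u"
  proof (cases "u \<in> b1.X")
   case True
   show ?thesis
   proof (cases "u \<in> O'")
    case uO: True
    \<comment> \<open>The scalar c may be complex; it commutes with the real factor e u by
      associativity of the scalar action.\<close>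
    have "c \<odot>\<^bsub>A1\<^esub> (e u *\<^sub>R a) = e u *\<^sub>R (c \<odot>\<^bsub>A1\<^esub> a)"
     using c module.smult_assoc1[of "scalar_ring K" A1 c "complex_of_real (e u)" a]
      module.smult_assoc1[of "scalar_ring K" A1 "complex_of_real (e u)" c a] b1.A_alg
     by (simp add: unital_algebra_def scalar_ring_def b1.A_simps mult.commute flip: b1.A_simps(4))
    thus ?thesis using True uO b1.tau_smult[OF at uO c, of "e u *\<^sub>R a"] by (simp add: b1.vsec_def)
   next
    case False
    have "c \<odot>\<^bsub>F1 u\<^esub> zero1 u = zero1 u"
     using module.smult_r_null[OF b1.fibre_module[OF True], of c] c by (simp add: scalar_ring_def)
    thus ?thesis using True False by (simp add: b1.vsec_def)
   qed
  qed (simp add: b1.vsec_def)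
 qed
 with f_smult[OF E_sect, of a] w show ?thesis by (simp add: gam_tau)
qed

lemma gam_iso:
 assumes f_smult: "!!c s. c \<in> K ==> sect1 s ==> f (\<lambda>v\<in>b1.X. c \<odot>\<^bsub>F1 v\<^esub> s v) = (\<lambda>w\<in>b2.X. c \<odot>\<^bsub>F2 w\<^esub> f s w)"
 shows "algebra_iso K (pullback_fibre w (F1 (phi w))) (F2 w) gam"
proof -
 note tc = b1.tau_coord[OF at bump_point(1)]
 have rep: "\<exists>a. p = (w, \<tau> (phi w) a)" if "p \<in> {w} \<times> carrier (F1 (phi w))" for p
 proof -
  from that obtain x where x: "p = (w, x)" "x \<in> carrier (F1 (phi w))" by auto
  with tc[OF x(2)] show ?thesis by metis
 qed
 have "bij_betw gam ({w} \<times> carrier (F1 (phi w))) (carrier (F2 w))"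
  unfolding bij_betw_def
 proof (intro conjI inj_onI equalityI subsetI)
  fix p q assume "p \<in> {w} \<times> carrier (F1 (phi w))" "q \<in> {w} \<times> carrier (F1 (phi w))" "gam p = gam q"
  with rep[of p] rep[of q] gam_inj show "p = q" by auto
 next
  fix x assume "x \<in> gam ` ({w} \<times> carrier (F1 (phi w)))"
  with rep gam_tau_carrier show "x \<in> carrier (F2 w)" by blast
 next
  fix x assume "x \<in> carrier (F2 w)"
  with gam_surj obtain a where "gam (w, \<tau> (phi w) a) = x" by blast
  moreover have "(w, \<tau> (phi w) a) \<in> {w} \<times> carrier (F1 (phi w))" using b1.tau_carrier[OF at bump_point(1)] by simp
  ultimately show "x \<in> gam ` ({w} \<times> carrier (F1 (phi w)))" by blast
 qed
 moreover have "gam (w, snd p \<oplus>\<^bsub>F1 (phi w)\<^esub> snd q) = gam p \<oplus>\<^bsub>F2 w\<^esub> gam q &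
   gam (w, snd p \<otimes>\<^bsub>F1 (phi w)\<^esub> snd q) = gam p \<otimes>\<^bsub>F2 w\<^esub> gam q"
  if "p \<in> {w} \<times> carrier (F1 (phi w))" "q \<in> {w} \<times> carrier (F1 (phi w))" for p q
 proof -
  from rep[OF that(1)] rep[OF that(2)] obtain a a' where [simp]: "p = (w, \<tau> (phi w) a)" "q = (w, \<tau> (phi w) a')" by blast
  show ?thesis by (simp add: gam_tau_add gam_tau_mult flip: b1.tau_add[OF at bump_point(1)] b1.tau_mult[OF at bump_point(1)])
 qed
 moreover have "gam (w, c \<odot>\<^bsub>F1 (phi w)\<^esub> snd p) = c \<odot>\<^bsub>F2 w\<^esub> gam p"
  if "c \<in> K" "p \<in> {w} \<times> carrier (F1 (phi w))" for c p
 proof -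
  from rep[OF that(2)] obtain a where [simp]: "p = (w, \<tau> (phi w) a)" by blast
  show ?thesis using that(1) by (simp add: gam_tau_smult[OF _ f_smult] flip: b1.tau_smult[OF at bump_point(1)])
 qed
 ultimately show ?thesis unfolding algebra_iso_def pullback_fibre_def by simp
qed

end

lemma gam_algebra_iso:
 assumes w: "w \<in> b2.X"
  and f_smult: "!!c s. c \<in> K ==> sect1 s ==> f (\<lambda>v\<in>b1.X. c \<odot>\<^bsub>F1 v\<^esub> s v) = (\<lambda>w\<in>b2.X. c \<odot>\<^bsub>F2 w\<^esub> f s w)"
 shows "algebra_iso K (pullback_fibre w (F1 (phi w))) (F2 w) gam"
proof -
 from b1.ex_atriv[OF phi_in[OF w]] obtain O' \<tau> where at: "b1.atriv O' \<tau>" "phi w \<in> O'" by blast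
 from b1.ex_bump[OF b1.atriv_open[OF at(1)] at(2)] obtain e C P where "b1.is_bump O' (phi w) e C P" by blast
 from gam_iso[OF w at(1) this f_smult] show ?thesis .
qed

text \<open>This equivalence is symmetric in f and its inverse, and it ties together the point maps
  of the two.\<close>

lemma point_eval_iff: "w \<in> b2.X ==> sect1 s ==> f s w = zero2 w \<longleftrightarrow> s (phi w) = zero1 (phi w)"
proof
 assume w: "w \<in> b2.X" and s: "sect1 s" and z: "f s w = zero2 w"
 note v = phi_in[OF w]
 from b1.ex_atriv[OF v] obtain O' \<tau> where at: "b1.atriv O' \<tau>" "phi w \<in> O'" by blast
 from b1.ex_bump[OF b1.atriv_open[OF at(1)] at(2)] obtain e C P where b: "b1.is_bump O' (phi w) e C P" by blast
 have "gam (w, \<tau> (phi w) (b1.coord \<tau> (phi w) (s (phi w)))) = zero2 w"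
  using gam_eq[OF s w] z by (simp add: b1.tau_coord[OF at carrier1[OF s v]])
 from gam_kernel[OF w at(1) b this] show "s (phi w) = zero1 (phi w)" using b1.coord_eq_zero[OF at carrier1[OF s v]] by blast
qed (rule point_eval[OF scalar_eval])

section \<open>The inverse isomorphism and regularity\<close>

text \<open>If the points differed, a bump section at v supported away from phi w would contradict
  the hypothesis.\<close>

lemma phi_eqI:
 assumes w: "w \<in> b2.X" and v: "v \<in> b1.X" and z: "!!s. sect1 s ==> f s w = zero2 w ==> s v = zero1 v"
 shows "phi w = v"
proof (rule ccontr)
 assume "phi w ~= v"
 with b1.hausdorff phi_in[OF w] v obtain N1 N2 where N: "openin b1.T N1" "openin b1.T N2" "phi w \<in> N1" "v \<in> N2" "disjnt N1 N2"
  unfolding Hausdorff_space_def by metis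
 obtain s C where s: "sect1 s" "s v = \<one>\<^bsub>F1 v\<^esub>" "C \<subseteq> N2" "!!u. u \<in> b1.X ==> u \<notin> C ==> s u = zero1 u"
  using b1.bump_section[OF v b1.fibre_simps(1)[OF v] N(2,4) adm] by metis
 have "phi w \<notin> C" using N s(3) by (auto simp: disjnt_def)
 hence "f s w = zero2 w" using point_eval_iff[OF w s(1)] s(4) phi_in[OF w] by simp
 from z[OF s(1) this] s(2) show False using b1.fibre_one_nonzero[OF v] by simp
qed

text \<open>A preimage c of the product of f s and f t agrees with s t at every phi w, because the
  fibre maps are injective and multiplicative. The set where c and s t differ is open, so by density
  of the image of phi it is empty.\<close>

lemma f_mult_closed:
 assumes s: "sect1 s" "sect1 t" and m: "sect2 (b2.smult2 (f s) (f t))"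
 shows "sect1 (b1.smult2 s t)"
proof -
 obtain c where c: "sect1 c" "f c = b2.smult2 (f s) (f t)" by (rule f_surj[OF m])
 have "c v = b1.smult2 s t v" if v: "v \<in> b1.X" for v
 proof -
  from b1.ex_atriv[OF v] obtain O' \<tau> where at: "b1.atriv O' \<tau>" "v \<in> O'" by blast
  note op = b1.atriv_open[OF at(1)] and sub = b1.atriv_sub[OF at(1)]
  let ?q = "%x u. b1.coord \<tau> u (x u)" and ?Y = "subtopology b1.T O'"
  have cont: "continuous_map ?Y euclidean (?q x)" if "sect1 x" for x
   by (rule b1.class_fun_continuous[OF adm op b1.sect_coord[OF adm that at(1)]])
  have "bilinear (%x y. x \<otimes>\<^bsub>A1\<^esub> y)" unfolding bilinear_def by (intro conjI allI linearI) (simp_all add: b1.A_distrib b1.A_smult_mult)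
  hence bb: "bounded_bilinear (%x y. x \<otimes>\<^bsub>A1\<^esub> y)" by (simp add: bilinear_conv_bounded_bilinear)
  have "continuous_map ?Y (prod_topology euclidean (prod_topology euclidean euclidean)) (%u. (?q c u, ?q s u, ?q t u))"
   by (intro continuous_map_pairedI cont c(1) s)
  hence "continuous_map ?Y euclidean (%u. (?q c u, ?q s u, ?q t u))" by simp
  moreover have "continuous_map euclidean euclidean (%(x, y, z). x - y \<otimes>\<^bsub>A1\<^esub> z)"
   by (auto simp: case_prod_beta intro!: continuous_intros bounded_bilinear.continuous_on[OF bb])
  \<comment> \<open>Coordinates of the difference c - s t are continuous even if s t is not known to
    be a section, since the product of A1 is bilinear on a finite dimensional space.\<close>
  ultimately have "continuous_map ?Y euclidean ((%(x, y, z). x - y \<otimes>\<^bsub>A1\<^esub> z) \<circ> (%u. (?q c u, ?q s u, ?q t u)))"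
   by (rule continuous_map_compose)
  from b1.openin_preimage[OF op this, of "- {0}"] have o: "openin b1.T {u \<in> O'. ?q c u - ?q s u \<otimes>\<^bsub>A1\<^esub> ?q t u \<in> - {0}}"
   by (simp add: open_Compl)
  have "?q c v = ?q s v \<otimes>\<^bsub>A1\<^esub> ?q t v"
  proof (rule ccontr)
   assume "\<not> ?thesis"
   with at(2) have "v \<in> {u \<in> O'. ?q c u - ?q s u \<otimes>\<^bsub>A1\<^esub> ?q t u \<in> - {0}}" by simp
   from phi_dense[OF o this] obtain w where w: "w \<in> b2.X" "phi w \<in> O'" and ne: "?q c (phi w) ~= ?q s (phi w) \<otimes>\<^bsub>A1\<^esub> ?q t (phi w)" by auto
   from b1.ex_bump[OF op w(2)] obtain e C P where b: "b1.is_bump O' (phi w) e C P" by blast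
   have g: "gam (w, \<tau> (phi w) (?q x (phi w))) = f x w" if "sect1 x" for x
    using gam_eq[OF that w(1)] b1.tau_coord[OF at(1) w(2) carrier1[OF that phi_in[OF w(1)]]] by simp
   have "f c w = f s w \<otimes>\<^bsub>F2 w\<^esub> f t w" using c(2) w(1) by (simp add: b2.smult2_def)
   hence "gam (w, \<tau> (phi w) (?q c (phi w))) = gam (w, \<tau> (phi w) (?q s (phi w) \<otimes>\<^bsub>A1\<^esub> ?q t (phi w)))"
    using gam_tau_mult[OF w(1) at(1) b, of "?q s (phi w)" "?q t (phi w)"] g[OF c(1)] g[OF s(1)] g[OF s(2)] by simp
   from gam_inj[OF w(1) at(1) b this] ne show False by simp
  qed
  hence "?q c v = b1.coord \<tau> v (s v \<otimes>\<^bsub>F1 v\<^esub> t v)" using b1.coord_mult[OF at carrier1[OF s(1) v] carrier1[OF s(2) v]] by simp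
  hence "c v = s v \<otimes>\<^bsub>F1 v\<^esub> t v"
   using b1.coord_carrier_eq[OF at carrier1[OF c(1) v] b1.fibre_simps(8)[OF v carrier1[OF s(1) v] carrier1[OF s(2) v]]] by simp
  thus ?thesis using v by (simp add: b1.smult2_def)
 qed
 moreover have "c \<in> extensional b1.X" using c(1) by (simp add: b1.sect_iff)
 ultimately have "c = b1.smult2 s t" by (auto simp: b1.smult2_def extensional_def)
 with c(1) show ?thesis by simp
qed

lemma inverse_iso: "section_iso m n W V K A2 A1 B2 B1 \<F> cpt (inv_into {s. sect1 s} f)"
proof unfold_locales
 let ?g = "inv_into {s. sect1 s} f"
 show "bij_betw ?g {t. sect2 t} {s. sect1 s}" by (rule bij_betw_inv_into[OF f_bij])
 have gf: "?g (f s) = s" if "sect1 s" for s using bij_betw_inv_into_left[OF f_bij] that by simp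
 have fg: "f (?g t) = t" "sect1 (?g t)" if "sect2 t" for t
  using bij_betw_inv_into_right[OF f_bij] bij_betwE[OF bij_betw_inv_into[OF f_bij]] that by auto
 fix s t assume s: "sect2 s"
 show "?g (b2.smul (%_. r) s) = b1.smul (%_. r) (?g s)" for r
  using f_scaleR[OF fg(2)[OF s], of r] gf[OF b1.sect_smul[OF adm b1.class_fun_const[OF sadm] fg(2)[OF s]], of r] fg(1)[OF s] by simp
 assume t: "sect2 t"
 note st = fg(2)[OF s] fg(2)[OF t]
 show "?g (b2.sadd s t) = b1.sadd (?g s) (?g t)"
  using f_add[OF st] gf[OF b1.sect_sadd[OF adm st]] fg(1)[OF s] fg(1)[OF t] by simp
 assume "sect2 (b2.smult2 s t)"
 hence m: "sect1 (b1.smult2 (?g s) (?g t))" using f_mult_closed[OF st] fg(1)[OF s] fg(1)[OF t] by simp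
 show "?g (b2.smult2 s t) = b1.smult2 (?g s) (?g t)"
  using f_mult[OF st m] gf[OF m] fg(1)[OF s] fg(1)[OF t] by simp
qed (rule adm)

text \<open>A bump turns g into a global scalar without changing it near the point considered, and
  \<open>class_fun_phi\<close> applies to that scalar.\<close>

lemma class_fun_phi_local:
 assumes O': "openin b1.T O'" and g: "class_fun smooth V O' g"
 shows "class_fun \<F> W {w \<in> b2.X. phi w \<in> O'} (%w. g (phi w) :: real)"
proof (rule b2.class_fun_glue[OF adm])
 show op: "openin b2.T {w \<in> b2.X. phi w \<in> O'}" by (rule phi_preimage_open[OF O'])
 fix w assume "w \<in> {w \<in> b2.X. phi w \<in> O'}"
 hence w: "w \<in> b2.X" "phi w \<in> O'" by auto
 from b1.ex_bump[OF O' w(2)] obtain e C P where b: "b1.is_bump O' (phi w) e C P" by blast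
 note e = b1.is_bumpD[OF b]
 have "sc (%u. if u \<in> O' then e u * g u else 0)" (is "sc ?k")
  by (rule sc_extend[OF O' b b1.class_fun_smooth_imp[OF sadm O' g]])
 from class_fun_phi[OF this] have k: "class_fun \<F> W b2.X (%w. ?k (phi w))" .
 define Q where "Q = {w \<in> b2.X. phi w \<in> P}"
 have Q: "openin b2.T Q" unfolding Q_def by (rule phi_preimage_open[OF e(5)])
 have sub: "{w \<in> b2.X. phi w \<in> O'} \<inter> Q = Q" using e(3,7) by (auto simp: Q_def)
 have "class_fun \<F> W Q (%w. ?k (phi w))" by (rule b2.class_fun_subset[OF adm _ k Q]) (auto simp: Q_def)
 hence "class_fun \<F> W Q (%w. g (phi w))"
 proof (rule b2.class_fun_cong[OF adm Q])
  fix w' assume "w' \<in> Q"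
  hence "phi w' \<in> P" "phi w' \<in> O'" using e(3,7) by (auto simp: Q_def)
  thus "?k (phi w') = g (phi w')" using e(8) by simp
 qed
 with Q sub w e(6) show "\<exists>Q. openin b2.T Q & w \<in> Q & class_fun \<F> W ({w \<in> b2.X. phi w \<in> O'} \<inter> Q) (%w. g (phi w))"
  by (intro exI[of _ Q]) (simp add: Q_def)
qed

lemma class_map_phi: "class_map \<F> W V phi"
 unfolding class_map_def
proof (intro conjI phi_continuous ballI)
 fix p assume "p \<in> charts V"
 then obtain U c where [simp]: "p = (U, c)" and c: "(U, c) \<in> charts V" by (cases p) auto
 note U = b1.chart(1)[OF c]
 have "class_fun \<F> W {w \<in> b2.X. phi w \<in> U} (%w. c (phi w) \<bullet> j)" for j
  by (rule class_fun_phi_local[OF U b1.class_fun_chart[OF c c smooth_on_linear[OF bounded_linear_inner_left smooth_on_ident]]])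
 thus "case p of (U, c) => class_fun \<F> W {w \<in> b2.X. phi w \<in> U} (%w. c (phi w))"
  by (simp add: b2.class_fun_componentwise[OF adm phi_preimage_open[OF U]])
qed

text \<open>By \<open>point_eval_iff\<close> for f and for its inverse, vanishing at a point
  corresponds to vanishing at its image; \<open>phi_eqI\<close> then shows that the two point maps
  are inverse to each other.\<close>

lemma bi_class_map_phi: "bi_class_map \<F> W V phi"
proof -
 let ?g = "inv_into {s. sect1 s} f"
 interpret inv: section_iso m n W V K A2 A1 B2 B1 \<F> cpt ?g by (rule inverse_iso)
 have gf: "?g (f s) = s" if "sect1 s" for s using bij_betw_inv_into_left[OF f_bij] that by simp
 have fg: "f (?g t) = t" "sect1 (?g t)" if "sect2 t" for t
  using bij_betw_inv_into_right[OF f_bij] bij_betwE[OF bij_betw_inv_into[OF f_bij]] that by auto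
 have 1: "phi (inv.phi v) = v" if v: "v \<in> b1.X" for v
 proof (rule phi_eqI[OF inv.phi_in[OF v] v])
  fix s assume s: "sect1 s" "f s (inv.phi v) = zero2 (inv.phi v)"
  with inv.point_eval_iff[OF v f_sect[OF s(1)]] gf[OF s(1)] show "s v = zero1 v" by simp
 qed
 have 2: "inv.phi (phi w) = w" if w: "w \<in> b2.X" for w
 proof (rule inv.phi_eqI[OF phi_in[OF w] w])
  fix t assume t: "sect2 t" "?g t (phi w) = zero1 (phi w)"
  with point_eval_iff[OF w fg(2)[OF t(1)]] fg(1)[OF t(1)] show "t w = zero2 w" by simp
 qed
 have bij: "bij_betw phi b2.X b1.X"
  by (rule bij_betw_byWitness[where f' = inv.phi]) (use 1 2 phi_in inv.phi_in in auto)
 have eq: "inv.phi v = inv_into b2.X phi v" if "v \<in> b1.X" for v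
  using inv_into_f_f[OF _ inv.phi_in[OF that], of phi] 1[OF that] bij by (simp add: bij_betw_def)
 have "class_map \<F> V W (inv_into b2.X phi)" unfolding class_map_def
 proof (intro conjI ballI)
  show "continuous_map b1.T b2.T (inv_into b2.X phi)" by (rule continuous_map_eq[OF inv.phi_continuous eq])
  fix p assume p: "p \<in> charts W"
  have set: "{v \<in> b1.X. inv_into b2.X phi v \<in> U} = {v \<in> b1.X. inv.phi v \<in> U}" for U using eq by auto
  obtain U c where [simp]: "p = (U, c)" by (cases p)
  have f: "class_fun \<F> V {v \<in> b1.X. inv.phi v \<in> U} (%v. c (inv.phi v))" "openin b1.T {v \<in> b1.X. inv.phi v \<in> U}"
   using inv.class_map_phi p inv.phi_preimage_open[OF b2.chart(1), of U c] unfolding class_map_def by auto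
  have "class_fun \<F> V {v \<in> b1.X. inv.phi v \<in> U} (%v. c (inv_into b2.X phi v))"
   by (rule b1.class_fun_cong[OF adm f(2,1)]) (simp add: eq)
  thus "case p of (U, c) => class_fun \<F> V {v \<in> b1.X. inv_into b2.X phi v \<in> U} (%v. c (inv_into b2.X phi v))"
   by (simp add: set)
 qed
 with bij class_map_phi show ?thesis by (simp add: bi_class_map_def)
qed

text \<open>Column i of the matrix is the image under f of a section that equals
  \<open>\<tau>1 u i\<close> near phi w, and images of sections have coordinates of class F. To
  obtain that section globally, \<open>\<tau>1 u i\<close> is written in an algebra trivialization
  and cut off by a bump.\<close>

lemma gam_bundle_iso:
 assumes f_smult: "!!c s. c \<in> K ==> sect1 s ==> f (\<lambda>v\<in>b1.X. c \<odot>\<^bsub>F1 v\<^esub> s v) = (\<lambda>w\<in>b2.X. c \<odot>\<^bsub>F2 w\<^esub> f s w)"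
 shows "algebra_bundle_iso \<F> K W (pullback_bundle W phi B1) B2 gam"
 unfolding algebra_bundle_iso_def
proof (intro conjI ballI)
 fix w assume "w \<in> b2.X"
 thus "algebra_iso K (fibre (pullback_bundle W phi B1) w) (F2 w) gam"
  using gam_algebra_iso[OF _ f_smult] by (simp add: pullback_bundle_def)
next
 fix p assume p: "p \<in> trivs (pullback_bundle W phi B1)"
 from p obtain O1 \<tau>1 where t1: "(O1, \<tau>1) \<in> trivs B1" and p_eq: "p = ({w \<in> b2.X. phi w \<in> O1}, %w a. (w, \<tau>1 (phi w) a))"
  by (auto simp: pullback_bundle_def)
 have "class_matrix \<F> W ({w \<in> b2.X. phi w \<in> O1} \<inter> O2) (%w. inv_into UNIV (\<sigma> w) \<circ> gam \<circ> (%a. (w, \<tau>1 (phi w) a)))"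
  if t2: "(O2, \<sigma>) \<in> trivs B2" for O2 \<sigma>
 proof -
 note f1 = b1.trivs_facts[OF t1] and f2 = b2.trivs_facts[OF t2]
 have op: "openin b2.T ({w \<in> b2.X. phi w \<in> O1} \<inter> O2)" using phi_preimage_open[OF f1(1)] f2(1) by blast
 have "class_fun \<F> W ({w \<in> b2.X. phi w \<in> O1} \<inter> O2) (%w. (inv_into UNIV (\<sigma> w) \<circ> gam \<circ> (%a. (w, \<tau>1 (phi w) a))) i \<bullet> j)"
  if ij: "i \<in> Basis" "j \<in> Basis" for i j
 proof (rule b2.class_fun_glue[OF adm op])
  fix w assume "w \<in> {w \<in> b2.X. phi w \<in> O1} \<inter> O2"
  hence w: "w \<in> b2.X" "phi w \<in> O1" "w \<in> O2" by auto
  from b1.ex_atriv[OF phi_in[OF w(1)]] obtain O' \<tau> where at: "b1.atriv O' \<tau>" "phi w \<in> O'" by blast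
  have opO: "openin b1.T (O' \<inter> O1)" "phi w \<in> O' \<inter> O1" using b1.atriv_open[OF at(1)] f1(1) at(2) w by auto
  from b1.ex_bump[OF opO] obtain e C P where b: "b1.is_bump (O' \<inter> O1) (phi w) e C P" by blast
  note e = b1.is_bumpD[OF b]
  have sm: "admissible_class smooth" by simp
  have sub: "O' \<inter> O1 \<subseteq> b1.X" using opO(1) openin_subset by blast
  define g where "g u = (if u \<in> O' \<inter> O1 then e u *\<^sub>R b1.coord \<tau> u (\<tau>1 u i) else 0)" for u
  have "class_fun smooth V (O' \<inter> O1) (%u. b1.coord \<tau> u (\<tau>1 u i))"
  proof (rule b1.class_fun_componentwise[OF sm opO(1)])
   fix l :: 'a assume "l \<in> Basis"
   with b1.atriv_transition(2)[OF at(1) t1] ij(1) show "class_fun smooth V (O' \<inter> O1) (%u. b1.coord \<tau> u (\<tau>1 u i) \<bullet> l)"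
    unfolding class_matrix_def by auto
  qed
  moreover have "class_fun (scalar_class smooth) V (O' \<inter> O1) e" using b1.class_fun_subset[OF sm _ e(1) opO(1) sub] by simp
  ultimately have "class_fun smooth V (O' \<inter> O1) (%u. e u *\<^sub>R b1.coord \<tau> u (\<tau>1 u i))" by (intro b1.class_fun_scaleR[OF sm opO(1)])
  hence "class_fun smooth V (O' \<inter> O1) g" by (rule b1.class_fun_cong[OF sm opO(1)]) (simp add: g_def)
  hence "class_fun smooth V b1.X g" by (rule b1.class_fun_extend_zero[OF sm e(2,3) opO(1)]) (use e(4) in \<open>simp add: g_def\<close>)
  hence "class_fun \<F> V b1.X g" by (rule b1.class_fun_smooth_imp[OF adm, rotated]) simp
  hence s: "sect1 (b1.vsec O' \<tau> g)"
   by (rule b1.sect_vsec[OF adm at(1) _ e(2)]) (use e(3,4) in \<open>auto simp: g_def\<close>)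
  define Q where "Q = {w \<in> b2.X. phi w \<in> P} \<inter> O2"
  have Q: "openin b2.T Q" unfolding Q_def using phi_preimage_open[OF e(5)] f2(1) by blast
  have fs: "f (b1.vsec O' \<tau> g) w' = gam (w', \<tau>1 (phi w') i)" if "w' \<in> Q" for w'
  proof -
   have w': "w' \<in> b2.X" "phi w' \<in> P" "phi w' \<in> O'" "phi w' \<in> O1" using that e(3,7) by (auto simp: Q_def)
   have "b1.vsec O' \<tau> g (phi w') = \<tau>1 (phi w') i"
    using w' e(8)[OF w'(2)] phi_in[OF w'(1)] b1.tau_coord[OF at(1) w'(3) b1.linear_isoD(1)[OF f1(2)[OF w'(4)]]]
    by (simp add: b1.vsec_def g_def)
   with gam_eq[OF s w'(1)] show ?thesis by simp
  qed
  have "class_fun \<F> W O2 (%w. inv_into UNIV (\<sigma> w) (f (b1.vsec O' \<tau> g) w))"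
  proof -
   have "class_fun \<F> W (b2.X \<inter> O2) (%w. inv_into UNIV (\<sigma> w) (f (b1.vsec O' \<tau> g) w))"
    using f_sect[OF s] t2 unfolding b2.sect_iff b2.lsec_def by blast
   moreover have "b2.X \<inter> O2 = O2" using openin_subset[OF f2(1)] by blast
   ultimately show ?thesis by simp
  qed
  hence "class_fun \<F> W Q (%w. inv_into UNIV (\<sigma> w) (f (b1.vsec O' \<tau> g) w))"
   by (rule b2.class_fun_subset[OF adm f2(1) _ Q]) (simp add: Q_def)
  hence "class_fun \<F> W Q (%w. inv_into UNIV (\<sigma> w) (f (b1.vsec O' \<tau> g) w) \<bullet> j)"
   by (rule b2.class_fun_linear[OF adm Q _ bounded_linear_inner_left])
  hence "class_fun \<F> W Q (%w. (inv_into UNIV (\<sigma> w) \<circ> gam \<circ> (%a. (w, \<tau>1 (phi w) a))) i \<bullet> j)"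
   by (rule b2.class_fun_cong[OF adm Q]) (simp add: fs)
  moreover have "{w \<in> b2.X. phi w \<in> O1} \<inter> O2 \<inter> Q = Q" using e(3,7) by (auto simp: Q_def)
  ultimately show "\<exists>Q. openin b2.T Q & w \<in> Q & class_fun \<F> W ({w \<in> b2.X. phi w \<in> O1} \<inter> O2 \<inter> Q)
    (%w. (inv_into UNIV (\<sigma> w) \<circ> gam \<circ> (%a. (w, \<tau>1 (phi w) a))) i \<bullet> j)"
   using Q w e(6) by (intro exI[of _ Q]) (simp add: Q_def)
 qed
 thus ?thesis unfolding class_matrix_def by blast
 qed
 thus "case p of (O', \<tau>) => \<forall>(O'', \<sigma>)\<in>trivs B2.
   class_matrix \<F> W (O' \<inter> O'') (%w. inv_into UNIV (\<sigma> w) \<circ> gam \<circ> \<tau> w)"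
  unfolding p_eq by auto
qed

lemma f_eq_gam:
 assumes "sect1 x"
 shows "f x = (\<lambda>w\<in>b2.X. gam (pullback_section W phi x w))"
proof
 fix w
 have "f x \<in> extensional b2.X" using f_sect[OF assms] by (simp add: b2.sect_iff)
 thus "f x w = (\<lambda>w\<in>b2.X. gam (pullback_section W phi x w)) w"
  using gam_eq[OF assms] by (cases "w \<in> b2.X") (auto simp: pullback_section_def extensional_def)
qed

lemma conclusion:
 assumes "!!c s. c \<in> K ==> sect1 s ==> f (\<lambda>v\<in>b1.X. c \<odot>\<^bsub>F1 v\<^esub> s v) = (\<lambda>w\<in>b2.X. c \<odot>\<^bsub>F2 w\<^esub> f s w)"
 shows "\<exists>\<phi> \<gamma>. bi_class_map \<F> W V \<phi> & algebra_bundle_iso \<F> K W (pullback_bundle W \<phi> B1) B2 \<gamma> &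
   (\<forall>x. sect1 x --> f x = (\<lambda>w\<in>topspace (mtop W). \<gamma> (pullback_section W \<phi> x w)))"
proof (intro exI conjI allI impI)
 show "bi_class_map \<F> W V phi" by (rule bi_class_map_phi)
 show "algebra_bundle_iso \<F> K W (pullback_bundle W phi B1) B2 gam" by (rule gam_bundle_iso[OF assms])
qed (rule f_eq_gam)

end

section \<open>The theorem, for both algebras of sections\<close>

theorem corollary12p2:
  fixes K :: "complex set"
    and \<F> :: regularity
    and n m :: nat
    and V :: "('v, 'e::euclidean_space) manifold"
    and W :: "('w, 'd::euclidean_space) manifold"
    and A1 :: "(complex, 'a::euclidean_space) module"
    and A2 :: "(complex, 'b::euclidean_space) module"
    and B1 :: "('v, 'x, 'a) fibre_bundle"
    and B2 :: "('w, 'y, 'b) fibre_bundle"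
  assumes K: "K = \<real> \<or> K = UNIV"
    and V: "smooth_manifold n V"
    and W: "smooth_manifold m W"
    and \<F>: "admissible \<F> n" "admissible \<F> m"
    and A1: "on_euclidean_space A1" "simple_algebra K A1"
    and A2: "on_euclidean_space A2" "simple_algebra K A2"
    and B1: "algebra_bundle K V A1 B1"
    and B2: "algebra_bundle K W A2 B2"
  shows
    "(\<forall>f. algebra_iso K (section_algebra_c \<F> V B1) (section_algebra_c \<F> W B2) f \<longrightarrow>
        (\<exists>\<phi> \<gamma>. bi_class_map \<F> W V \<phi> \<and>
               algebra_bundle_iso \<F> K W (pullback_bundle W \<phi> B1) B2 \<gamma> \<and>
               (\<forall>x\<in>sections_c \<F> V B1.
                  f x = (\<lambda>w\<in>topspace (mtop W). \<gamma> (pullback_section W \<phi> x w)))))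
     \<and>
     (\<forall>f. algebra_iso K (section_algebra \<F> V B1) (section_algebra \<F> W B2) f \<longrightarrow>
        (\<exists>\<phi> \<gamma>. bi_class_map \<F> W V \<phi> \<and>
               algebra_bundle_iso \<F> K W (pullback_bundle W \<phi> B1) B2 \<gamma> \<and>
               (\<forall>x\<in>sections \<F> V B1.
                  f x = (\<lambda>w\<in>topspace (mtop W). \<gamma> (pullback_section W \<phi> x w)))))"
proof -
 interpret b1: alg_bundle n V K A1 B1 by unfold_locales (fact V K A1 B1)+
 interpret b2: alg_bundle m W K A2 B2 by unfold_locales (fact W K A2 B2)+
 have adm: "admissible_class \<F>" using \<F>(1) by (rule admissible_imp_class)
 have "\<exists>\<phi> \<gamma>. bi_class_map \<F> W V \<phi> & algebra_bundle_iso \<F> K W (pullback_bundle W \<phi> B1) B2 \<gamma> &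
   (\<forall>x. b1.sect \<F> cpt x --> f x = (\<lambda>w\<in>topspace (mtop W). \<gamma> (pullback_section W \<phi> x w)))"
  if f: "algebra_iso K (pointwise_algebra V B1 {s. b1.sect \<F> cpt s}) (pointwise_algebra W B2 {s. b2.sect \<F> cpt s}) f" for f cpt
 proof -
  note f' = f[unfolded algebra_iso_def b1.pointwise_simps b2.pointwise_simps]
  have sm: "f (\<lambda>v\<in>b1.X. c \<odot>\<^bsub>fibre B1 v\<^esub> s v) = (\<lambda>w\<in>b2.X. c \<odot>\<^bsub>fibre B2 w\<^esub> f s w)" if "c \<in> K" "b1.sect \<F> cpt s" for c s
   using f' that by simp
  interpret section_iso n m V W K A1 A2 B1 B2 \<F> cpt f
   by unfold_locales (use adm f' sm[OF b1.real_in_K] in \<open>simp_all add: b1.smul_def b2.smul_def\<close>)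
  show ?thesis by (rule conclusion[OF sm])
 qed
 from this[of True] this[of False] show ?thesis
  unfolding section_algebra_c_def section_algebra_def by (simp add: b1.sect_def b2.sect_def Ball_def)
qed

end
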